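(* Let $p$ be an odd prime and let $r\in\mathbb{Z}_p^\times$, $r\neq 1$, be a root of unity, of order $\mathrm{ord}(r)$. Then there are isomorphisms of C$^*$-algebras $$I_r'\cong M_{\mathrm{ord}(r)}(\mathbb{C})\otimes c_0(\mathbb{Z}_{\geq 0})\otimes C(\mathbb{Z}_p)\quad\text{and}\quad I_r\cong I_r'\otimes C(S^1).$$
   Context: $\mathbb{Z}_p$ is the ring of $p$-adic integers and $\mathbb{Z}_p^\times$ its group of units. For $r\in\mathbb{Z}_p^\times$, let $(\alpha_rf)(x)=f(x/r)$ for $f\in C(\mathbb{Z}_p)$. The algebra $A_r=C(\mathbb{Z}_p)\rtimes_{\alpha_r}\mathbb{N}\cong C(\mathbb{Z}_p)\rtimes_{\alpha_r}\mathbb{Z}$ is the universal unital C$^*$-algebra generated by a (unital) copy $\{M_f:f\in C(\mathbb{Z}_p)\}$ of $C(\mathbb{Z}_p)$ and an element $V_r$ satisfying $V_r^*V_r=I$ and $V_rM_fV_r^*=M_{\alpha_r(f)}$. When $r$ is a root of unity, $\mathrm{ord}(r)$ is the smallest positive integer $n$ with $r^n=1$, and $A_r'=C(\mathbb{Z}_p)\rtimes_{\alpha_r}\mathbb{Z}/\mathrm{ord}(r)\mathbb{Z}$ is the crossed product by the induced action of the finite cyclic group, i.e. generated by $\{M_f\}$ and a unitary $V_r$ with $V_r^{\mathrm{ord}(r)}=I$ and $V_rM_fV_r^*=M_{\alpha_r(f)}$. $I_r=\mathrm{Ker}\,\pi_0$, where $\pi_0:A_r\to B(\ell^2(\mathbb{Z}))$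 is given on the canonical basis by $V_r\mapsto v$, $vE_k=E_{k+1}$, and $M_f\mapsto m_f$, $m_fE_k=f(0)E_k$. Similarly $I_r'=\mathrm{Ker}\,\pi_0'$, where $\pi_0':A_r'\to B(\ell^2(\mathbb{Z}/\mathrm{ord}(r)\mathbb{Z}))$ is given by $V_r\mapsto v'$, $v'E_k=E_{k+1\bmod \mathrm{ord}(r)}$, and $M_f\mapsto m_f'$, $m_f'E_k=f(0)E_k$. $c_0(\mathbb{Z}_{\geq 0})$ is the C$^*$-algebra of complex sequences converging to $0$. *)

theory Defs
  imports
    "HOL-Analysis.Analysis"
    "HOL-Algebra.Ring"
    "Jordan_Normal_Form.Schur_Decomposition"
begin

unbundle no vec_syntax

section \<open>C*-algebras\<close>

text \<open>Algebras are given by a carrier set and need not be unital, so the rings of HOL-Algebra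
  (which carry a unit) are not used for them.\<close>

record 'a star_alg = "'a partial_object" +
  alg_zero :: 'a
  alg_add :: "'a \<Rightarrow> 'a \<Rightarrow> 'a"
  alg_scale :: "complex \<Rightarrow> 'a \<Rightarrow> 'a"
  alg_mult :: "'a \<Rightarrow> 'a \<Rightarrow> 'a"
  alg_star :: "'a \<Rightarrow> 'a"

record 'a cstar_alg = "'a star_alg" +
  alg_norm :: "'a \<Rightarrow> real"

definition alg_diff :: "('a, 'm) star_alg_scheme \<Rightarrow> 'a \<Rightarrow> 'a \<Rightarrow> 'a" where
  "alg_diff A x y = alg_add A x (alg_scale A (-1) y)"

locale star_algebra =
  fixes A :: "('a, 'm) star_alg_scheme"
  assumes zero_closed: "alg_zero A \<in> carrier A"
    and add_closed: "\<lbrakk>x \<in> carrier A; y \<in> carrier A\<rbrakk> \<Longrightarrow> alg_add A x y \<in> carrier A"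
    and scale_closed: "x \<in> carrier A \<Longrightarrow> alg_scale A c x \<in> carrier A"
    and mult_closed: "\<lbrakk>x \<in> carrier A; y \<in> carrier A\<rbrakk> \<Longrightarrow> alg_mult A x y \<in> carrier A"
    and star_closed: "x \<in> carrier A \<Longrightarrow> alg_star A x \<in> carrier A"
    and add_assoc: "\<lbrakk>x \<in> carrier A; y \<in> carrier A; z \<in> carrier A\<rbrakk>
      \<Longrightarrow> alg_add A (alg_add A x y) z = alg_add A x (alg_add A y z)"
    and add_commute: "\<lbrakk>x \<in> carrier A; y \<in> carrier A\<rbrakk> \<Longrightarrow> alg_add A x y = alg_add A y x"
    and add_zero: "x \<in> carrier A \<Longrightarrow> alg_add A x (alg_zero A) = x"
    and diff_self: "x \<in> carrier A \<Longrightarrow> alg_diff A x x = alg_zero A"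
    and scale_one: "x \<in> carrier A \<Longrightarrow> alg_scale A 1 x = x"
    and scale_scale: "x \<in> carrier A \<Longrightarrow> alg_scale A c (alg_scale A d x) = alg_scale A (c * d) x"
    and scale_add_left: "x \<in> carrier A
      \<Longrightarrow> alg_scale A (c + d) x = alg_add A (alg_scale A c x) (alg_scale A d x)"
    and scale_add_right: "\<lbrakk>x \<in> carrier A; y \<in> carrier A\<rbrakk>
      \<Longrightarrow> alg_scale A c (alg_add A x y) = alg_add A (alg_scale A c x) (alg_scale A c y)"
    and mult_assoc: "\<lbrakk>x \<in> carrier A; y \<in> carrier A; z \<in> carrier A\<rbrakk>
      \<Longrightarrow> alg_mult A (alg_mult A x y) z = alg_mult A x (alg_mult A y z)"
    and mult_add_left: "\<lbrakk>x \<in> carrier A; y \<in> carrier A; z \<in> carrier A\<rbrakk>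
      \<Longrightarrow> alg_mult A (alg_add A x y) z = alg_add A (alg_mult A x z) (alg_mult A y z)"
    and mult_add_right: "\<lbrakk>x \<in> carrier A; y \<in> carrier A; z \<in> carrier A\<rbrakk>
      \<Longrightarrow> alg_mult A x (alg_add A y z) = alg_add A (alg_mult A x y) (alg_mult A x z)"
    and mult_scale_left: "\<lbrakk>x \<in> carrier A; y \<in> carrier A\<rbrakk>
      \<Longrightarrow> alg_mult A (alg_scale A c x) y = alg_scale A c (alg_mult A x y)"
    and mult_scale_right: "\<lbrakk>x \<in> carrier A; y \<in> carrier A\<rbrakk>
      \<Longrightarrow> alg_mult A x (alg_scale A c y) = alg_scale A c (alg_mult A x y)"
    and star_star: "x \<in> carrier A \<Longrightarrow> alg_star A (alg_star A x) = x"
    and star_add: "\<lbrakk>x \<in> carrier A; y \<in> carrier A\<rbrakk>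
      \<Longrightarrow> alg_star A (alg_add A x y) = alg_add A (alg_star A x) (alg_star A y)"
    and star_scale: "x \<in> carrier A \<Longrightarrow> alg_star A (alg_scale A c x) = alg_scale A (cnj c) (alg_star A x)"
    and star_mult: "\<lbrakk>x \<in> carrier A; y \<in> carrier A\<rbrakk>
      \<Longrightarrow> alg_star A (alg_mult A x y) = alg_mult A (alg_star A y) (alg_star A x)"

text \<open>The equality \<open>q (x\<^sup>*) = q x\<close> follows from the last two conditions.\<close>

definition cstar_seminorm :: "('a, 'm) star_alg_scheme \<Rightarrow> ('a \<Rightarrow> real) \<Rightarrow> bool" where
  "cstar_seminorm A q \<longleftrightarrow>
     (\<forall>x\<in>carrier A. 0 \<le> q x) \<and>
     (\<forall>x\<in>carrier A. \<forall>c. q (alg_scale A c x) = cmod c * q x) \<and>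
     (\<forall>x\<in>carrier A. \<forall>y\<in>carrier A. q (alg_add A x y) \<le> q x + q y) \<and>
     (\<forall>x\<in>carrier A. \<forall>y\<in>carrier A. q (alg_mult A x y) \<le> q x * q y) \<and>
     (\<forall>x\<in>carrier A. q (alg_mult A (alg_star A x) x) = (q x)\<^sup>2)"

definition cauchy_seqs :: "('a, 'm) star_alg_scheme \<Rightarrow> ('a \<Rightarrow> real) \<Rightarrow> (nat \<Rightarrow> 'a) set" where
  "cauchy_seqs A q = {s. (\<forall>n. s n \<in> carrier A) \<and>
     (\<forall>e>0. \<exists>N. \<forall>m\<ge>N. \<forall>n\<ge>N. q (alg_diff A (s m) (s n)) < e)}"

locale cstar_algebra = star_algebra A
  for A :: "('a, 'm) cstar_alg_scheme" +
  assumes norm_seminorm: "cstar_seminorm A (alg_norm A)"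
    and norm_definite: "\<lbrakk>x \<in> carrier A; alg_norm A x = 0\<rbrakk> \<Longrightarrow> x = alg_zero A"
    and complete: "s \<in> cauchy_seqs A (alg_norm A)
      \<Longrightarrow> \<exists>x\<in>carrier A. (\<lambda>n. alg_norm A (alg_diff A (s n) x)) \<longlonglongrightarrow> 0"

definition star_hom ::
  "('a, 'm) star_alg_scheme \<Rightarrow> ('b, 'n) star_alg_scheme \<Rightarrow> ('a \<Rightarrow> 'b) \<Rightarrow> bool" where
  "star_hom A B \<phi> \<longleftrightarrow>
     \<phi> \<in> carrier A \<rightarrow> carrier B \<and>
     (\<forall>x\<in>carrier A. \<forall>y\<in>carrier A. \<phi> (alg_add A x y) = alg_add B (\<phi> x) (\<phi> y)) \<and>
     (\<forall>x\<in>carrier A. \<forall>c. \<phi> (alg_scale A c x) = alg_scale B c (\<phi> x)) \<and>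
     (\<forall>x\<in>carrier A. \<forall>y\<in>carrier A. \<phi> (alg_mult A x y) = alg_mult B (\<phi> x) (\<phi> y)) \<and>
     (\<forall>x\<in>carrier A. \<phi> (alg_star A x) = alg_star B (\<phi> x))"

text \<open>Isomorphisms of C*-algebras are bijective \<open>*\<close>-homomorphisms; these are automatically isometric.\<close>

definition cstar_isomorphic ::
  "('a, 'm) cstar_alg_scheme \<Rightarrow> ('b, 'n) cstar_alg_scheme \<Rightarrow> bool" (infix \<open>\<cong>\<^sub>C\<close> 50) where
  "A \<cong>\<^sub>C B \<longleftrightarrow> cstar_algebra A \<and> cstar_algebra B \<and>
     (\<exists>\<phi>. star_hom A B \<phi> \<and> bij_betw \<phi> (carrier A) (carrier B))"

section \<open>Enveloping C*-algebras\<close>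

definition null_rel :: "('a, 'm) star_alg_scheme \<Rightarrow> ('a \<Rightarrow> real) \<Rightarrow> ((nat \<Rightarrow> 'a) \<times> (nat \<Rightarrow> 'a)) set" where
  "null_rel A q = {(s, t). s \<in> cauchy_seqs A q \<and> t \<in> cauchy_seqs A q \<and>
     (\<lambda>n. q (alg_diff A (s n) (t n))) \<longlonglongrightarrow> 0}"

definition seq_class :: "('a, 'm) star_alg_scheme \<Rightarrow> ('a \<Rightarrow> real) \<Rightarrow> (nat \<Rightarrow> 'a) \<Rightarrow> (nat \<Rightarrow> 'a) set" where
  "seq_class A q s = null_rel A q `` {s}"

definition seq_rep :: "(nat \<Rightarrow> 'a) set \<Rightarrow> nat \<Rightarrow> 'a" where
  "seq_rep X = (SOME s. s \<in> X)"

text \<open>The separated completion of a \<open>*\<close>-algebra with respect to a C*-seminorm: Cauchy sequences modulo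
  null sequences, with the operations computed on representatives.\<close>

definition completion :: "('a, 'm) star_alg_scheme \<Rightarrow> ('a \<Rightarrow> real) \<Rightarrow> (nat \<Rightarrow> 'a) set cstar_alg" where
  "completion A q = \<lparr>
     carrier = cauchy_seqs A q // null_rel A q,
     alg_zero = seq_class A q (\<lambda>n. alg_zero A),
     alg_add = (\<lambda>X Y. seq_class A q (\<lambda>n. alg_add A (seq_rep X n) (seq_rep Y n))),
     alg_scale = (\<lambda>c X. seq_class A q (\<lambda>n. alg_scale A c (seq_rep X n))),
     alg_mult = (\<lambda>X Y. seq_class A q (\<lambda>n. alg_mult A (seq_rep X n) (seq_rep Y n))),
     alg_star = (\<lambda>X. seq_class A q (\<lambda>n. alg_star A (seq_rep X n))),
     alg_norm = (\<lambda>X. lim (\<lambda>n. q (seq_rep X n)))\<rparr>"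

text \<open>The largest C*-seminorm for which the equations \<open>R\<close> hold. It is only meaningful
  if \<open>R\<close> bounds all C*-seminorms at each element, as is the case in all uses below.\<close>

definition max_seminorm :: "('a, 'm) star_alg_scheme \<Rightarrow> ('a \<times> 'a) set \<Rightarrow> 'a \<Rightarrow> real" where
  "max_seminorm A R x =
     Sup {q x |q. cstar_seminorm A q \<and> (\<forall>(y, z)\<in>R. q (alg_diff A y z) = 0)}"

definition envelope :: "('a, 'm) star_alg_scheme \<Rightarrow> ('a \<times> 'a) set \<Rightarrow> (nat \<Rightarrow> 'a) set cstar_alg" where
  "envelope A R = completion A (max_seminorm A R)"

definition to_envelope :: "('a, 'm) star_alg_scheme \<Rightarrow> ('a \<times> 'a) set \<Rightarrow> 'a \<Rightarrow> (nat \<Rightarrow> 'a) set" where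
  "to_envelope A R x = seq_class A (max_seminorm A R) (\<lambda>n. x)"

text \<open>The \<open>*\<close>-algebra \<open>\<complex>[S]\<close> of a semigroup \<open>S\<close> with product \<open>m\<close> and involution \<open>i\<close>.\<close>

definition semigroup_alg ::
  "'s set \<Rightarrow> ('s \<Rightarrow> 's \<Rightarrow> 's) \<Rightarrow> ('s \<Rightarrow> 's) \<Rightarrow> ('s \<Rightarrow> complex) star_alg" where
  "semigroup_alg S m i = \<lparr>
     carrier = {x. finite {s. x s \<noteq> 0} \<and> {s. x s \<noteq> 0} \<subseteq> S},
     alg_zero = (\<lambda>u. 0),
     alg_add = (\<lambda>x y u. x u + y u),
     alg_scale = (\<lambda>c x u. c * x u),
     alg_mult = (\<lambda>x y u. \<Sum>(s, t)\<in>{(s, t). x s \<noteq> 0 \<and> y t \<noteq> 0 \<and> m s t = u}. x s * y t),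
     alg_star = (\<lambda>x u. \<Sum>s\<in>{s. x s \<noteq> 0 \<and> i s = u}. cnj (x s))\<rparr>"

definition delta :: "'s \<Rightarrow> 's \<Rightarrow> complex" where
  "delta s = (\<lambda>u. if u = s then 1 else 0)"

subsection \<open>Generators and relations\<close>

text \<open>The free unital \<open>*\<close>-algebra on \<open>G\<close> has as basis the words in the letters \<open>(g, False)\<close>, which stand
  for \<open>g\<close>, and \<open>(g, True)\<close>, which stand for \<open>g\<^sup>*\<close>. The unit is the empty word.\<close>

definition free_star_alg :: "'g set \<Rightarrow> (('g \<times> bool) list \<Rightarrow> complex) star_alg" where
  "free_star_alg G =
     semigroup_alg (lists (G \<times> UNIV)) (@) (\<lambda>w. rev (map (\<lambda>(g, b). (g, \<not> b)) w))"

definition free_one :: "('g \<times> bool) list \<Rightarrow> complex" where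
  "free_one = delta []"

definition free_gen :: "'g \<Rightarrow> ('g \<times> bool) list \<Rightarrow> complex" where
  "free_gen g = delta [(g, False)]"

definition universal_cstar ::
  "'g set \<Rightarrow> ((('g \<times> bool) list \<Rightarrow> complex) \<times> (('g \<times> bool) list \<Rightarrow> complex)) set
    \<Rightarrow> (nat \<Rightarrow> ('g \<times> bool) list \<Rightarrow> complex) set cstar_alg" where
  "universal_cstar G R = envelope (free_star_alg G) R"

definition universal_gen ::
  "'g set \<Rightarrow> ((('g \<times> bool) list \<Rightarrow> complex) \<times> (('g \<times> bool) list \<Rightarrow> complex)) set
    \<Rightarrow> 'g \<Rightarrow> (nat \<Rightarrow> ('g \<times> bool) list \<Rightarrow> complex) set" where
  "universal_gen G R g = to_envelope (free_star_alg G) R (free_gen g)"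

subsection \<open>Tensor products\<close>

text \<open>The algebraic tensor product is \<open>\<complex>[A \<times> B]\<close> modulo bilinearity, and the C*-tensor product is its
  completion in the maximal C*-norm. If one factor is nuclear (for instance commutative or
  finite-dimensional), this is the only C*-norm on the algebraic tensor product.\<close>

definition pair_alg ::
  "('a, 'm) star_alg_scheme \<Rightarrow> ('b, 'n) star_alg_scheme \<Rightarrow> ('a \<times> 'b \<Rightarrow> complex) star_alg" where
  "pair_alg A B = semigroup_alg (carrier A \<times> carrier B)
     (\<lambda>(a, b) (a', b'). (alg_mult A a a', alg_mult B b b'))
     (\<lambda>(a, b). (alg_star A a, alg_star B b))"

definition bilinear_rels ::
  "('a, 'm) star_alg_scheme \<Rightarrow> ('b, 'n) star_alg_scheme
    \<Rightarrow> (('a \<times> 'b \<Rightarrow> complex) \<times> ('a \<times> 'b \<Rightarrow> complex)) set" where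
  "bilinear_rels A B =
     (let P = pair_alg A B in
      {(delta (alg_add A a a', b), alg_add P (delta (a, b)) (delta (a', b))) |a a' b.
         a \<in> carrier A \<and> a' \<in> carrier A \<and> b \<in> carrier B} \<union>
      {(delta (a, alg_add B b b'), alg_add P (delta (a, b)) (delta (a, b'))) |a b b'.
         a \<in> carrier A \<and> b \<in> carrier B \<and> b' \<in> carrier B} \<union>
      {(delta (alg_scale A c a, b), alg_scale P c (delta (a, b))) |a b c.
         a \<in> carrier A \<and> b \<in> carrier B} \<union>
      {(delta (a, alg_scale B c b), alg_scale P c (delta (a, b))) |a b c.
         a \<in> carrier A \<and> b \<in> carrier B})"

definition cstar_tensor ::
  "('a, 'm) cstar_alg_scheme \<Rightarrow> ('b, 'n) cstar_alg_scheme
    \<Rightarrow> (nat \<Rightarrow> 'a \<times> 'b \<Rightarrow> complex) set cstar_alg" (infixl \<open>\<otimes>\<^sub>C\<close> 70) where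
  "A \<otimes>\<^sub>C B = envelope (pair_alg A B) (bilinear_rels A B)"

section \<open>Concrete C*-algebras\<close>

text \<open>Functions on \<open>X\<close> are represented by their extension by \<open>0\<close>; continuity refers to \<open>X\<close> only.\<close>

definition cont_alg :: "'x::topological_space set \<Rightarrow> ('x \<Rightarrow> complex) cstar_alg" where
  "cont_alg X = \<lparr>
     carrier = {f. continuous_on X f \<and> (\<forall>x. x \<notin> X \<longrightarrow> f x = 0)},
     alg_zero = (\<lambda>x. 0),
     alg_add = (\<lambda>f g x. f x + g x),
     alg_scale = (\<lambda>c f x. c * f x),
     alg_mult = (\<lambda>f g x. f x * g x),
     alg_star = (\<lambda>f x. cnj (f x)),
     alg_norm = (\<lambda>f. SUP x\<in>X. cmod (f x))\<rparr>"

definition c0_alg :: "(nat \<Rightarrow> complex) cstar_alg" where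
  "c0_alg = \<lparr>
     carrier = {f. f \<longlonglongrightarrow> 0},
     alg_zero = (\<lambda>k. 0),
     alg_add = (\<lambda>f g k. f k + g k),
     alg_scale = (\<lambda>c f k. c * f k),
     alg_mult = (\<lambda>f g k. f k * g k),
     alg_star = (\<lambda>f k. cnj (f k)),
     alg_norm = (\<lambda>f. SUP k. cmod (f k))\<rparr>"

definition vec_norm2 :: "complex Matrix.vec \<Rightarrow> real" where
  "vec_norm2 v = sqrt (\<Sum>i<dim_vec v. (cmod (v $ i))\<^sup>2)"

definition matrix_alg :: "nat \<Rightarrow> complex Matrix.mat cstar_alg" where
  "matrix_alg n = \<lparr>
     carrier = carrier_mat n n,
     alg_zero = 0\<^sub>m n n,
     alg_add = (+),
     alg_scale = (\<cdot>\<^sub>m),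
     alg_mult = (*),
     alg_star = mat_adjoint,
     alg_norm = (\<lambda>M. SUP v\<in>{v \<in> carrier_vec n. vec_norm2 v \<le> 1}. vec_norm2 (M *\<^sub>v v))\<rparr>"

text \<open>\<open>\<ell>\<^sup>2(I)\<close> for an index set \<open>I\<close>, again with functions extended by \<open>0\<close>, and \<open>B(\<ell>\<^sup>2(I))\<close>, where operators
  are extended by \<open>0\<close> outside \<open>\<ell>\<^sup>2(I)\<close>.\<close>

definition ell2 :: "'i set \<Rightarrow> ('i \<Rightarrow> complex) set" where
  "ell2 I = {x. (\<forall>i. i \<notin> I \<longrightarrow> x i = 0) \<and> (\<lambda>i. (cmod (x i))\<^sup>2) summable_on I}"

definition ell2_inner :: "'i set \<Rightarrow> ('i \<Rightarrow> complex) \<Rightarrow> ('i \<Rightarrow> complex) \<Rightarrow> complex" where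
  "ell2_inner I x y = (\<Sum>\<^sub>\<infinity>i\<in>I. x i * cnj (y i))"

definition ell2_norm :: "'i set \<Rightarrow> ('i \<Rightarrow> complex) \<Rightarrow> real" where
  "ell2_norm I x = sqrt (\<Sum>\<^sub>\<infinity>i\<in>I. (cmod (x i))\<^sup>2)"

definition bounded_ops :: "'i set \<Rightarrow> (('i \<Rightarrow> complex) \<Rightarrow> 'i \<Rightarrow> complex) set" where
  "bounded_ops I = {T.
     (\<forall>x\<in>ell2 I. T x \<in> ell2 I) \<and>
     (\<forall>x\<in>ell2 I. \<forall>y\<in>ell2 I. T (\<lambda>i. x i + y i) = (\<lambda>i. T x i + T y i)) \<and>
     (\<forall>x\<in>ell2 I. \<forall>c. T (\<lambda>i. c * x i) = (\<lambda>i. c * T x i)) \<and>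
     (\<exists>K. \<forall>x\<in>ell2 I. ell2_norm I (T x) \<le> K * ell2_norm I x) \<and>
     (\<forall>x. x \<notin> ell2 I \<longrightarrow> T x = (\<lambda>i. 0))}"

definition op_alg :: "'i set \<Rightarrow> (('i \<Rightarrow> complex) \<Rightarrow> 'i \<Rightarrow> complex) cstar_alg" where
  "op_alg I = \<lparr>
     carrier = bounded_ops I,
     alg_zero = (\<lambda>x i. 0),
     alg_add = (\<lambda>S T x i. S x i + T x i),
     alg_scale = (\<lambda>c T x i. c * T x i),
     alg_mult = (\<lambda>S T x. S (T x)),
     alg_star = (\<lambda>T. THE S. S \<in> bounded_ops I \<and>
       (\<forall>x\<in>ell2 I. \<forall>y\<in>ell2 I. ell2_inner I (T x) y = ell2_inner I x (S y))),
     alg_norm = (\<lambda>T. SUP x\<in>{x \<in> ell2 I. ell2_norm I x \<le> 1}. ell2_norm I (T x))\<rparr>"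

definition basis_vec :: "'i \<Rightarrow> 'i \<Rightarrow> complex" where
  "basis_vec k = (\<lambda>i. if i = k then 1 else 0)"

section \<open>The p-adic integers\<close>

text \<open>\<open>\<int>\<^sub>p\<close> as the inverse limit of the rings \<open>\<int>/p\<^sup>n\<close>, represented by least non-negative residues. Its
  topology is the one induced by the product topology of \<open>nat \<Rightarrow> int\<close> with \<open>int\<close> discrete.\<close>

definition Zp :: "nat \<Rightarrow> (nat \<Rightarrow> int) ring" where
  "Zp p = \<lparr>
     carrier = {x. \<forall>n. 0 \<le> x n \<and> x n < int p ^ n \<and> x (Suc n) mod int p ^ n = x n},
     mult = (\<lambda>x y n. (x n * y n) mod int p ^ n),
     one = (\<lambda>n. 1 mod int p ^ n),
     zero = (\<lambda>n. 0),
     add = (\<lambda>x y n. (x n + y n) mod int p ^ n)\<rparr>"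

definition root_of_unity :: "nat \<Rightarrow> (nat \<Rightarrow> int) \<Rightarrow> bool" where
  "root_of_unity p r \<longleftrightarrow> (\<exists>n>0. r [^]\<^bsub>Zp p\<^esub> (n::nat) = \<one>\<^bsub>Zp p\<^esub>)"

definition ord_Zp :: "nat \<Rightarrow> (nat \<Rightarrow> int) \<Rightarrow> nat" where
  "ord_Zp p r = (LEAST n. 0 < n \<and> r [^]\<^bsub>Zp p\<^esub> n = \<one>\<^bsub>Zp p\<^esub>)"

abbreviation C_Zp :: "nat \<Rightarrow> ((nat \<Rightarrow> int) \<Rightarrow> complex) cstar_alg" where
  "C_Zp p \<equiv> cont_alg (carrier (Zp p))"

abbreviation C_S1 :: "(complex \<Rightarrow> complex) cstar_alg" where
  "C_S1 \<equiv> cont_alg (sphere 0 1)"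

definition one_Zp :: "nat \<Rightarrow> (nat \<Rightarrow> int) \<Rightarrow> complex" where
  "one_Zp p = (\<lambda>x. if x \<in> carrier (Zp p) then 1 else 0)"

definition alpha ::
  "nat \<Rightarrow> (nat \<Rightarrow> int) \<Rightarrow> ((nat \<Rightarrow> int) \<Rightarrow> complex) \<Rightarrow> (nat \<Rightarrow> int) \<Rightarrow> complex" where
  "alpha p r f = (\<lambda>x. if x \<in> carrier (Zp p) then f (x \<otimes>\<^bsub>Zp p\<^esub> inv\<^bsub>Zp p\<^esub> r) else 0)"

section \<open>The crossed products and their ideals\<close>

datatype 'f generator = M_gen 'f | V_gen

type_synonym gen = "((nat \<Rightarrow> int) \<Rightarrow> complex) generator"
type_synonym free_elem = "(gen \<times> bool) list \<Rightarrow> complex"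

definition gens :: "nat \<Rightarrow> gen set" where
  "gens p = insert V_gen (M_gen ` carrier (C_Zp p))"

text \<open>\<open>f \<mapsto> M\<^sub>f\<close> is a unital \<open>*\<close>-homomorphism on \<open>C(\<int>\<^sub>p)\<close>.\<close>

definition M_rels :: "nat \<Rightarrow> (free_elem \<times> free_elem) set" where
  "M_rels p =
     (let F = free_star_alg (gens p); C = C_Zp p; M = (\<lambda>f. free_gen (M_gen f)) in
      {(M (alg_add C f g), alg_add F (M f) (M g)) |f g. f \<in> carrier C \<and> g \<in> carrier C} \<union>
      {(M (alg_scale C c f), alg_scale F c (M f)) |c f. f \<in> carrier C} \<union>
      {(M (alg_mult C f g), alg_mult F (M f) (M g)) |f g. f \<in> carrier C \<and> g \<in> carrier C} \<union>
      {(M (alg_star C f), alg_star F (M f)) |f. f \<in> carrier C} \<union>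
      {(M (one_Zp p), free_one)})"

definition covariance_rels :: "nat \<Rightarrow> (nat \<Rightarrow> int) \<Rightarrow> (free_elem \<times> free_elem) set" where
  "covariance_rels p r =
     (let F = free_star_alg (gens p); V = free_gen V_gen; M = (\<lambda>f. free_gen (M_gen f)) in
      {(alg_mult F (alg_mult F V (M f)) (alg_star F V), M (alpha p r f)) |f. f \<in> carrier (C_Zp p)})"

text \<open>\<open>V V\<^sup>* = 1\<close> is the covariance relation for \<open>f = 1\<close>.\<close>

definition A_rels :: "nat \<Rightarrow> (nat \<Rightarrow> int) \<Rightarrow> (free_elem \<times> free_elem) set" where
  "A_rels p r =
     (let F = free_star_alg (gens p); V = free_gen V_gen in
      M_rels p \<union> covariance_rels p r \<union> {(alg_mult F (alg_star F V) V, free_one)})"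

definition A'_rels :: "nat \<Rightarrow> (nat \<Rightarrow> int) \<Rightarrow> (free_elem \<times> free_elem) set" where
  "A'_rels p r =
     (let F = free_star_alg (gens p); V = free_gen V_gen in
      M_rels p \<union> covariance_rels p r \<union>
      {(alg_mult F (alg_star F V) V, free_one), (alg_mult F V (alg_star F V), free_one),
       ((alg_mult F V ^^ ord_Zp p r) free_one, free_one)})"

definition A_alg :: "nat \<Rightarrow> (nat \<Rightarrow> int) \<Rightarrow> (nat \<Rightarrow> free_elem) set cstar_alg" where
  "A_alg p r = universal_cstar (gens p) (A_rels p r)"

definition A'_alg :: "nat \<Rightarrow> (nat \<Rightarrow> int) \<Rightarrow> (nat \<Rightarrow> free_elem) set cstar_alg" where
  "A'_alg p r = universal_cstar (gens p) (A'_rels p r)"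

text \<open>Representations are normalised to be extensional so that they are determined as HOL functions.
  Contractivity is automatic for \<open>*\<close>-homomorphisms of C*-algebras; with it, uniqueness is immediate
  from the density of the \<open>*\<close>-algebra generated by the generators.\<close>

definition representation ::
  "('a, 'm) cstar_alg_scheme \<Rightarrow> 'i set \<Rightarrow> ('a \<Rightarrow> ('i \<Rightarrow> complex) \<Rightarrow> 'i \<Rightarrow> complex) \<Rightarrow> bool" where
  "representation A I \<pi> \<longleftrightarrow>
     star_hom A (op_alg I) \<pi> \<and> \<pi> \<in> extensional (carrier A) \<and>
     (\<forall>a\<in>carrier A. alg_norm (op_alg I) (\<pi> a) \<le> alg_norm A a)"

definition pi0 ::
  "nat \<Rightarrow> (nat \<Rightarrow> int) \<Rightarrow> (nat \<Rightarrow> free_elem) set \<Rightarrow> (int \<Rightarrow> complex) \<Rightarrow> int \<Rightarrow> complex" where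
  "pi0 p r = (THE \<pi>. representation (A_alg p r) UNIV \<pi> \<and>
     (let gen = universal_gen (gens p) (A_rels p r) in
      (\<forall>k. \<pi> (gen V_gen) (basis_vec k) = basis_vec (k + 1)) \<and>
      (\<forall>f\<in>carrier (C_Zp p). \<forall>k.
         \<pi> (gen (M_gen f)) (basis_vec k) = (\<lambda>i. f \<zero>\<^bsub>Zp p\<^esub> * basis_vec k i))))"

text \<open>\<open>\<int>/n\<int>\<close> is represented by \<open>{0..<n}\<close>.\<close>

definition pi0' ::
  "nat \<Rightarrow> (nat \<Rightarrow> int) \<Rightarrow> (nat \<Rightarrow> free_elem) set \<Rightarrow> (int \<Rightarrow> complex) \<Rightarrow> int \<Rightarrow> complex" where
  "pi0' p r = (THE \<pi>.
     let n = int (ord_Zp p r); gen = universal_gen (gens p) (A'_rels p r) in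
     representation (A'_alg p r) {0..<n} \<pi> \<and>
     (\<forall>k\<in>{0..<n}. \<pi> (gen V_gen) (basis_vec k) = basis_vec ((k + 1) mod n)) \<and>
     (\<forall>f\<in>carrier (C_Zp p). \<forall>k\<in>{0..<n}.
        \<pi> (gen (M_gen f)) (basis_vec k) = (\<lambda>i. f \<zero>\<^bsub>Zp p\<^esub> * basis_vec k i)))"

definition kernel_alg ::
  "('a, 'm) cstar_alg_scheme \<Rightarrow> ('b, 'n) star_alg_scheme \<Rightarrow> ('a \<Rightarrow> 'b) \<Rightarrow> ('a, 'm) cstar_alg_scheme" where
  "kernel_alg A B \<phi> = A\<lparr>carrier := {a \<in> carrier A. \<phi> a = alg_zero B}\<rparr>"

definition I_alg :: "nat \<Rightarrow> (nat \<Rightarrow> int) \<Rightarrow> (nat \<Rightarrow> free_elem) set cstar_alg" where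
  "I_alg p r = kernel_alg (A_alg p r) (op_alg (UNIV :: int set)) (pi0 p r)"

definition I'_alg :: "nat \<Rightarrow> (nat \<Rightarrow> int) \<Rightarrow> (nat \<Rightarrow> free_elem) set cstar_alg" where
  "I'_alg p r = kernel_alg (A'_alg p r) (op_alg {0..<int (ord_Zp p r)}) (pi0' p r)"

end

theory Submission
 imports Defs
begin

text \<open>Every algebra in the statement is identified with an algebra of matrix-valued functions. A free
 \<open>*\<close>-algebra element is, modulo the relations, a combination of normal forms \<open>M\<^sub>f V\<^sup>j\<close>; a word of length \<open>d\<close>
 needs only \<open>O(d)\<close> of them. The coefficients \<open>f\<close> are bounded by the norm of the image in \<open>M\<^sub>n(C(\<int>\<^sub>p \<times> S\<^sup>1))\<close>
 (they are its Fourier coefficients), so every C*-seminorm \<open>q\<close> compatible with the relations satisfies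
 \<open>q \<le> C d N\<close> on words of length \<open>d\<close>, where \<open>N\<close> is the norm in the model. Applying this to
 \<open>(x\<^sup>* x)\<^bsup>2^k\<^esup>\<close> and taking roots gives \<open>q \<le> N\<close>. Hence the universal norms are computed in the
 models; tensor products are treated in the same way. The action of \<open>r\<close> on \<open>\<int>\<^sub>p\<close> without \<open>0\<close> is free and has
 a fundamental domain consisting of a sequence of balls shrinking to \<open>0\<close>. Restricting a covariant
 matrix-valued function that vanishes at \<open>0\<close> to these balls gives an arbitrary null sequence of
 matrix-valued functions on \<open>\<int>\<^sub>p\<close>, which yields both isomorphisms.\<close>

section \<open>Star algebras and C*-seminorms\<close>

text \<open>The universal norms are suprema over all C*-seminorms, so every upper bound must hold
  for a seminorm \<open>q\<close> of which only the C*-identity is known. On a copy of a function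
  algebra the bound comes from multiplying by functions of modulus one, which the C*-identity cannot
  see. A combination of normal forms is then bounded term by term; the number of terms grows with
  the degree as soon as integer powers of V or of z are involved, which is why growth in the degree,
  and not just a constant, has to be absorbed. An element equals its normal form only modulo the
  null space of \<open>q\<close>, while its coefficients are read off in the model, so
  \<open>q\<close> is replaced by the maximum of \<open>q\<close> and the model norm. The model
  collects representations induced from the points x of the p-adic integers: V shifts n basis
  vectors, and the central unitary V^n acts as a scalar z, which runs over the circle for A_r and is
  1 for A_r'. The fibre over x = 0 and pi_0 have the same norm, though one is a family of matrices
  and the other a shift on a sequence space; this makes the kernel the ideal of functions vanishing
  at 0.\<close>

context star_algebra
begin

lemma diff_closed: "[|x : carrier A; y : carrier A|] ==> alg_diff A x y : carrier A"
 by (simp add: alg_diff_def add_closed scale_closed)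

lemmas closed = zero_closed add_closed scale_closed mult_closed star_closed diff_closed

lemma add_left_commute:
 "[|x : carrier A; y : carrier A; z : carrier A|]
  ==> alg_add A x (alg_add A y z) = alg_add A y (alg_add A x z)"
 by (metis add_assoc add_commute)

lemmas add_ac = add_assoc add_commute add_left_commute

lemma zero_add: "x : carrier A ==> alg_add A (alg_zero A) x = x"
 by (metis add_commute add_zero zero_closed)

lemma scale_zero_left: "x : carrier A ==> alg_scale A 0 x = alg_zero A"
 using scale_add_left[of x 1 "-1"] diff_self[of x] scale_one[of x] by (simp add: alg_diff_def)

lemma scale_zero_right: "alg_scale A c (alg_zero A) = alg_zero A"
 by (metis mult_zero_right scale_scale scale_zero_left zero_closed)

lemma mult_zero_left: "x : carrier A ==> alg_mult A (alg_zero A) x = alg_zero A"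
 by (metis mult_scale_left scale_zero_left zero_closed mult_closed)

lemma mult_zero_right: "x : carrier A ==> alg_mult A x (alg_zero A) = alg_zero A"
 by (metis mult_scale_right scale_zero_left zero_closed mult_closed)

lemma star_zero: "alg_star A (alg_zero A) = alg_zero A"
 by (metis complex_cnj_zero scale_zero_left star_closed star_scale zero_closed)

lemma diff_add_cancel: "[|x : carrier A; y : carrier A|] ==> alg_add A (alg_diff A x y) y = x"
 using diff_self[of y] add_commute[of y "alg_scale A (-1) y"]
 by (simp add: alg_diff_def add_assoc closed add_zero)

lemma diff_eq_zero_iff: "[|x : carrier A; y : carrier A|] ==> alg_diff A x y = alg_zero A \<longleftrightarrow> x = y"
 by (metis diff_add_cancel diff_self zero_add)

lemma diff_add_diff:
 assumes "x : carrier A" "y : carrier A" "z : carrier A"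
 shows "alg_add A (alg_diff A x y) (alg_diff A y z) = alg_diff A x z"
 using assms diff_add_cancel[of x y]
 by (simp add: alg_diff_def[of A y z] add_assoc[symmetric] closed) (simp add: alg_diff_def)

lemma diff_swap:
 "[|x : carrier A; y : carrier A|] ==> alg_diff A y x = alg_scale A (-1) (alg_diff A x y)"
 by (simp add: alg_diff_def scale_add_right scale_scale closed scale_one add_commute)

lemma diff_add:
 assumes "x : carrier A" "y : carrier A" "x' : carrier A" "y' : carrier A"
 shows "alg_diff A (alg_add A x y) (alg_add A x' y') = alg_add A (alg_diff A x x') (alg_diff A y y')"
 using assms by (simp add: alg_diff_def scale_add_right closed add_ac)

lemma diff_scale:
 "[|x : carrier A; y : carrier A|]
  ==> alg_diff A (alg_scale A c x) (alg_scale A c y) = alg_scale A c (alg_diff A x y)"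
 by (simp add: alg_diff_def scale_add_right closed scale_scale mult.commute)

lemma diff_star:
 "[|x : carrier A; y : carrier A|]
  ==> alg_diff A (alg_star A x) (alg_star A y) = alg_star A (alg_diff A x y)"
 by (simp add: alg_diff_def star_add star_scale closed)

lemma mult_diff_left:
 "[|x : carrier A; y : carrier A; z : carrier A|]
  ==> alg_mult A (alg_diff A x y) z = alg_diff A (alg_mult A x z) (alg_mult A y z)"
 by (simp add: alg_diff_def mult_add_left mult_scale_left closed)

lemma mult_diff_right:
 "[|x : carrier A; y : carrier A; z : carrier A|]
  ==> alg_mult A z (alg_diff A x y) = alg_diff A (alg_mult A z x) (alg_mult A z y)"
 by (simp add: alg_diff_def mult_add_right mult_scale_right closed)

lemma diff_mult:
 assumes "x : carrier A" "y : carrier A" "x' : carrier A" "y' : carrier A"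
 shows "alg_diff A (alg_mult A x y) (alg_mult A x' y')
  = alg_add A (alg_mult A (alg_diff A x x') y) (alg_mult A x' (alg_diff A y y'))"
 using assms by (simp add: mult_diff_left mult_diff_right diff_add_diff closed)

end

locale seminormed_algebra = star_algebra A for A :: "('a, 'm) star_alg_scheme" +
 fixes q :: "'a => real"
 assumes seminorm: "cstar_seminorm A q"
begin

lemma q_nonneg: "x : carrier A ==> 0 <= q x"
 and q_scale: "x : carrier A ==> q (alg_scale A c x) = cmod c * q x"
 and q_add: "[|x : carrier A; y : carrier A|] ==> q (alg_add A x y) <= q x + q y"
 and q_mult: "[|x : carrier A; y : carrier A|] ==> q (alg_mult A x y) <= q x * q y"
 and q_cstar: "x : carrier A ==> q (alg_mult A (alg_star A x) x) = (q x)\<^sup>2"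
 using seminorm by (auto simp: cstar_seminorm_def)

lemma q_zero: "q (alg_zero A) = 0"
 using q_scale[OF zero_closed, of 0] by (simp add: scale_zero_right)

lemma q_star: 
 assumes x: "x : carrier A" shows "q (alg_star A x) = q x"
proof -
 have le: "q y <= q (alg_star A y)" if y: "y : carrier A" for y
 proof (cases "q y = 0")
  case True then show ?thesis using q_nonneg[OF star_closed[OF y]] by simp
 next
  case False
  have "(q y)\<^sup>2 <= q (alg_star A y) * q y"
   using q_mult[OF star_closed[OF y] y] q_cstar[OF y] by simp
  then show ?thesis using False q_nonneg[OF y] by (simp add: power2_eq_square)
 qed
 show ?thesis using le[OF x] le[OF star_closed[OF x]] star_star[OF x] by simp
qed

lemma q_diff_commute: "[|x : carrier A; y : carrier A|] ==> q (alg_diff A x y) = q (alg_diff A y x)"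
 by (subst diff_swap) (auto simp: q_scale closed)

lemma q_diff_triangle:
 "[|x : carrier A; y : carrier A; z : carrier A|]
  ==> q (alg_diff A x z) <= q (alg_diff A x y) + q (alg_diff A y z)"
 by (metis diff_add_diff q_add diff_closed)

lemma q_le_diff: "[|x : carrier A; y : carrier A|] ==> q x <= q y + q (alg_diff A x y)"
 by (metis diff_add_cancel q_add diff_closed add.commute)

lemma q_abs_diff: "[|x : carrier A; y : carrier A|] ==> \<bar>q x - q y\<bar> <= q (alg_diff A x y)"
 using q_le_diff[of x y] q_le_diff[of y x] q_diff_commute[of x y] by auto

lemma q_add_diff_le:
 assumes "x : carrier A" "y : carrier A" "x' : carrier A" "y' : carrier A"
 shows "q (alg_diff A (alg_add A x y) (alg_add A x' y')) <= q (alg_diff A x x') + q (alg_diff A y y')"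
 using assms by (simp add: diff_add q_add closed)

lemma q_mult_diff_le:
 assumes "x : carrier A" "y : carrier A" "x' : carrier A" "y' : carrier A"
 shows "q (alg_diff A (alg_mult A x y) (alg_mult A x' y'))
  <= q (alg_diff A x x') * q y + q x' * q (alg_diff A y y')"
 using assms q_add[of "alg_mult A (alg_diff A x x') y" "alg_mult A x' (alg_diff A y y')"]
  q_mult[of "alg_diff A x x'" y] q_mult[of x' "alg_diff A y y'"]
 by (simp add: diff_mult closed)

lemma q_star_diff:
 "[|x : carrier A; y : carrier A|] ==> q (alg_diff A (alg_star A x) (alg_star A y)) = q (alg_diff A x y)"
 by (simp add: diff_star q_star closed)

lemma q_scale_diff:
 "[|x : carrier A; y : carrier A|]
  ==> q (alg_diff A (alg_scale A c x) (alg_scale A c y)) = cmod c * q (alg_diff A x y)"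
 by (simp add: diff_scale q_scale closed)

text \<open>Equality modulo the null space of \<open>q\<close>. Membership in the carrier is part of
  the relation, so chains of \<open>qeq\<close> steps carry their own closure facts.\<close>

definition qeq :: "'a => 'a => bool" where
 "qeq x y \<longleftrightarrow> x : carrier A & y : carrier A & q (alg_diff A x y) = 0"

lemma qeq_closed: "qeq x y ==> x : carrier A" "qeq x y ==> y : carrier A"
 by (auto simp: qeq_def)

lemma qeq_refl: "x : carrier A ==> qeq x x"
 by (simp add: qeq_def diff_self q_zero)

lemma qeq_sym: "qeq x y ==> qeq y x"
 by (auto simp: qeq_def q_diff_commute)

lemma qeq_trans [trans]: "[|qeq x y; qeq y z|] ==> qeq x z"
 unfolding qeq_def using q_diff_triangle[of x y z] q_nonneg[OF diff_closed, of x z] by fastforce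

lemma qeq_q: "qeq x y ==> q x = q y"
 unfolding qeq_def using q_abs_diff[of x y] by auto

lemma qeq_add: "[|qeq x x'; qeq y y'|] ==> qeq (alg_add A x y) (alg_add A x' y')"
 unfolding qeq_def using q_add_diff_le[of x y x' y'] q_nonneg[OF diff_closed[OF add_closed add_closed], of x y x' y']
 by (auto simp: closed)

lemma qeq_mult: "[|qeq x x'; qeq y y'|] ==> qeq (alg_mult A x y) (alg_mult A x' y')"
 unfolding qeq_def using q_mult_diff_le[of x y x' y'] q_nonneg[OF diff_closed[OF mult_closed mult_closed], of x y x' y']
 by (auto simp: closed)

lemma qeq_scale: "qeq x x' ==> qeq (alg_scale A c x) (alg_scale A c x')"
 unfolding qeq_def by (auto simp: q_scale_diff closed)

end

fun square_iter :: "('a, 'm) star_alg_scheme => 'a => nat => 'a" where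
 "square_iter A x 0 = alg_mult A (alg_star A x) x"
| "square_iter A x (Suc k) = alg_mult A (square_iter A x k) (square_iter A x k)"

lemma (in star_algebra) square_iter_closed: "x : carrier A ==> square_iter A x k : carrier A"
 by (induction k) (auto simp: closed)

lemma (in star_algebra) square_iter_star:
 "x : carrier A ==> alg_star A (square_iter A x k) = square_iter A x k"
 by (induction k) (auto simp: closed square_iter_closed star_mult star_star)

text \<open>Starting from x* x makes every iterate selfadjoint, so the C*-identity reads q (y y) =
  (q y)^2 and the exponent doubles at each squaring.\<close>

lemma (in seminormed_algebra) square_iter_q:
 assumes "x : carrier A"
 shows "q (square_iter A x k) = q x ^ (2 ^ Suc k)"
proof (induction k)
 case 0 then show ?case using assms by (simp add: q_cstar)
next
 case (Suc k)
 have "q (square_iter A x (Suc k)) = (q (square_iter A x k))\<^sup>2"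
  using q_cstar[OF square_iter_closed[OF assms, of k]] square_iter_star[OF assms, of k] by simp
 then show ?case using Suc by (simp add: power_mult[symmetric] mult.commute)
qed

text \<open>If t = a / b were larger than 1, then t^M would outgrow every bound linear in M; the
  exponents M = 2^(k+1) are unbounded, which is enough. The case b = 0 is read off at k = 0.\<close>

lemma power_growth_bound:
 fixes a b C :: real
 assumes "0 <= a" "0 <= b"
  and le: "!!k. a ^ (2 ^ Suc k) <= C * (1 + real (2 ^ Suc k * d)) * b ^ (2 ^ Suc k)"
 shows "a <= b"
proof (rule ccontr)
 assume "~ a <= b"
 then have ab: "b < a" by simp
 show False
 proof (cases "b = 0")
  case True
  then have "a ^ 2 <= 0" using le[of 0] by simp
  then show False using ab True by simp
 next
  case False
  then have b: "b > 0" using assms by simp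
  define t where "t = a / b"
  have t: "t > 1" using ab b by (simp add: t_def)
  \<comment> \<open>Bernoulli is linear in M. Applied to sqrt t and then squared, it gives the
    quadratic lower bound (M s)^2 \<le> t^M, which beats the linear upper bound.\<close>
  define s where "s = sqrt t - 1"
  have s: "s > 0" using t by (simp add: s_def)
  have *: "real (2 ^ Suc k) * s\<^sup>2 <= \<bar>C\<bar> * (1 + real d)" for k
  proof -
   define M :: nat where "M = 2 ^ Suc k"
   have M: "real M >= 1" unfolding M_def by (metis one_le_numeral one_le_power of_nat_1 of_nat_le_iff)
   have "t ^ M = a ^ M / b ^ M" by (simp add: t_def power_divide)
   also have "... <= C * (1 + real (M * d))"
    using le[of k] b by (simp add: M_def divide_le_eq)
   also have "... <= \<bar>C\<bar> * (real M * (1 + real d))"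
   proof (rule mult_mono)
    show "1 + real (M * d) <= real M * (1 + real d)" using M by (simp add: algebra_simps)
   qed auto
   finally have 1: "t ^ M <= \<bar>C\<bar> * (real M * (1 + real d))" .
   have "1 + real M * s <= (1 + s) ^ M" using s by (intro Bernoulli_inequality) simp
   then have "(real M * s)\<^sup>2 <= ((1 + s) ^ M)\<^sup>2" using s by (intro power_mono) auto
   also have "((1 + s) ^ M)\<^sup>2 = ((1 + s)\<^sup>2) ^ M" by (simp add: power_mult[symmetric] mult.commute)
   also have "... = t ^ M" using t by (simp add: s_def)
   finally have "real M * (real M * s\<^sup>2) <= real M * (\<bar>C\<bar> * (1 + real d))"
    using 1 by (simp add: power2_eq_square algebra_simps)
   then have "real M * s\<^sup>2 <= \<bar>C\<bar> * (1 + real d)" using M by simp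
   then show ?thesis unfolding M_def .
  qed
  obtain k :: nat where k: "\<bar>C\<bar> * (1 + real d) / s\<^sup>2 < real k" using reals_Archimedean2 by blast
  have "real k < 2 ^ k" by simp
  also have "... <= real (2 ^ Suc k)" by simp
  finally have "\<bar>C\<bar> * (1 + real d) / s\<^sup>2 < real (2 ^ Suc k)" using k by simp
  then show False using *[of k] s by (simp add: divide_less_eq)
 qed
qed

text \<open>Iterated squaring of \<open>x\<^sup>* x\<close> multiplies the exponent of both C*-seminorms by two and the degree at
 most by two, so a bound that grows polynomially with the degree has constant \<open>1\<close>.\<close>

lemma cstar_seminorm_le_if_growth:
 assumes A: "star_algebra A" and q: "cstar_seminorm A q" and N: "cstar_seminorm A N"
  and W: "!!d. W d \<subseteq> carrier A"
  and W_star: "!!d x. x : W d ==> alg_star A x : W d"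
  and W_mult: "!!d e x y. [|x : W d; y : W e|] ==> alg_mult A x y : W (d + e)"
  and bound: "!!d x. x : W d ==> q x <= C * (1 + real d) * N x"
  and x: "x : W d"
 shows "q x <= N x"
proof -
 interpret q: seminormed_algebra A q by (intro seminormed_algebra.intro A seminormed_algebra_axioms.intro q)
 interpret N: seminormed_algebra A N by (intro seminormed_algebra.intro A seminormed_algebra_axioms.intro N)
 have xA: "x : carrier A" using W x by blast
 have WY: "square_iter A x k : W (2 ^ Suc k * d)" for k
 proof (induction k)
  case 0 then show ?case using W_mult[OF W_star[OF x] x] by (simp add: mult_2)
 next
  case (Suc k) then show ?case using W_mult[OF Suc Suc] by (simp add: mult_2 algebra_simps)
 qed
 show ?thesis
 proof (rule power_growth_bound)
  fix k show "q x ^ (2 ^ Suc k) <= C * (1 + real (2 ^ Suc k * d)) * N x ^ (2 ^ Suc k)"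
   using bound[OF WY[of k]] unfolding q.square_iter_q[OF xA] N.square_iter_q[OF xA] .
 qed (use q.q_nonneg N.q_nonneg xA in auto)
qed

text \<open>The growth criterion with the trivial filtration: any constant factor between two
  C*-seminorms can be lowered to 1.\<close>

lemma cstar_seminorm_le_if_bounded:
 assumes A: "star_algebra A" and q: "cstar_seminorm A q" and N: "cstar_seminorm A N"
  and bound: "!!x. x : carrier A ==> q x <= C * N x"
  and x: "x : carrier A"
 shows "q x <= N x"
proof (rule cstar_seminorm_le_if_growth[OF A q N, where W = "%_. carrier A" and C = "\<bar>C\<bar>"])
 interpret N: seminormed_algebra A N by (intro seminormed_algebra.intro A seminormed_algebra_axioms.intro N)
 fix d :: nat and x assume x: "x : carrier A"
 have "q x <= \<bar>C\<bar> * N x" 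
  using bound[OF x] N.q_nonneg[OF x] by (meson abs_ge_self mult_right_mono order_trans)
 also have "... <= \<bar>C\<bar> * (1 + real d) * N x"
  using N.q_nonneg[OF x] by (intro mult_right_mono) (auto simp: algebra_simps)
 finally show "q x <= \<bar>C\<bar> * (1 + real d) * N x" .
qed (use x star_algebra.closed[OF A] in auto)

section \<open>Homomorphisms\<close>

lemma star_homD:
 assumes "star_hom A B \<phi>"
 shows "x : carrier A ==> \<phi> x : carrier B"
  and "[|x : carrier A; y : carrier A|] ==> \<phi> (alg_add A x y) = alg_add B (\<phi> x) (\<phi> y)"
  and "x : carrier A ==> \<phi> (alg_scale A c x) = alg_scale B c (\<phi> x)"
  and "[|x : carrier A; y : carrier A|] ==> \<phi> (alg_mult A x y) = alg_mult B (\<phi> x) (\<phi> y)"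
  and "x : carrier A ==> \<phi> (alg_star A x) = alg_star B (\<phi> x)"
 using assms by (auto simp: star_hom_def)

lemma star_hom_diff:
 assumes "star_hom A B \<phi>" "star_algebra A" "x : carrier A" "y : carrier A"
 shows "\<phi> (alg_diff A x y) = alg_diff B (\<phi> x) (\<phi> y)"
 using assms(3,4) by (simp add: alg_diff_def star_homD[OF assms(1)] star_algebra.closed[OF assms(2)])

lemma star_hom_zero:
 assumes "star_hom A B \<phi>" "star_algebra A" "star_algebra B"
 shows "\<phi> (alg_zero A) = alg_zero B"
proof -
 have z: "alg_zero A : carrier A" by (rule star_algebra.zero_closed[OF assms(2)])
 have "\<phi> (alg_zero A) = \<phi> (alg_scale A 0 (alg_zero A))"
  by (simp add: star_algebra.scale_zero_right[OF assms(2)])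
 also have "... = alg_zero B"
  by (simp add: star_homD[OF assms(1)] z star_algebra.scale_zero_left[OF assms(3)])
 finally show ?thesis .
qed

lemma star_hom_comp:
 assumes "star_hom A B \<phi>" "star_hom B C \<psi>"
 shows "star_hom A C (\<psi> \<circ> \<phi>)"
 unfolding star_hom_def using star_homD[OF assms(1)] star_homD[OF assms(2)] by simp

lemma star_hom_inv:
 assumes h: "star_hom A B \<phi>" and b: "bij_betw \<phi> (carrier A) (carrier B)" and A: "star_algebra A"
 shows "star_hom B A (inv_into (carrier A) \<phi>)" (is "star_hom B A ?g")
proof -
 have inj: "inj_on \<phi> (carrier A)" and im: "\<phi> ` carrier A = carrier B"
  using b by (auto simp: bij_betw_def)
 have c: "?g y : carrier A" "\<phi> (?g y) = y" if "y : carrier B" for y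
  using that im by (auto simp: inv_into_into f_inv_into_f)
 have e: "?g y = x" if "x : carrier A" "y = \<phi> x" for x y
  using that inj by (simp add: inv_into_f_f)
 show ?thesis
  unfolding star_hom_def
 proof (intro conjI ballI allI funcsetI)
  fix x y assume x: "x : carrier B" and y: "y : carrier B"
  show "?g (alg_add B x y) = alg_add A (?g x) (?g y)"
   by (rule e) (use x y c in "auto simp: star_homD[OF h] star_algebra.add_closed[OF A]")
  show "?g (alg_mult B x y) = alg_mult A (?g x) (?g y)"
   by (rule e) (use x y c in "auto simp: star_homD[OF h] star_algebra.mult_closed[OF A]")
 next
  fix x k assume x: "x : carrier B"
  show "?g x : carrier A" using c x by blast
  show "?g (alg_scale B k x) = alg_scale A k (?g x)"
   by (rule e) (use x c in "auto simp: star_homD[OF h] star_algebra.scale_closed[OF A]")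
  show "?g (alg_star B x) = alg_star A (?g x)"
   by (rule e) (use x c in "auto simp: star_homD[OF h] star_algebra.star_closed[OF A]")
 qed
qed

lemma cstar_seminorm_hom:
 assumes h: "star_hom A B \<phi>" and A: "star_algebra A" and q: "cstar_seminorm B q"
 shows "cstar_seminorm A (%x. q (\<phi> x))"
 using q by (auto simp: cstar_seminorm_def star_homD[OF h] star_algebra.closed[OF A])

text \<open>The isomorphism runs through a common model. Only \<open>A\<close> and \<open>B\<close>
  must be complete; \<open>D\<close> enters merely as a *-algebra.\<close>

lemma cstar_isomorphic_via:
 assumes "cstar_algebra A" "cstar_algebra B" "star_algebra D"
  and "star_hom A D \<phi>" "bij_betw \<phi> (carrier A) (carrier D)"
  and "star_hom B D \<psi>" "bij_betw \<psi> (carrier B) (carrier D)"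
 shows "A \<cong>\<^sub>C B"
proof -
 have "star_algebra B" using assms(2) by (simp add: cstar_algebra_def)
 note h = star_hom_comp[OF assms(4) star_hom_inv[OF assms(6,7) this]]
 have "bij_betw (inv_into (carrier B) \<psi> \<circ> \<phi>) (carrier A) (carrier B)"
  using assms(5) bij_betw_inv_into[OF assms(7)] by (rule bij_betw_trans)
 then show ?thesis using h assms(1,2) unfolding cstar_isomorphic_def by blast
qed

text \<open>All algebra axioms are equations, so an injective map reflects them from
  \<open>D\<close>; only closure under the operations and the value of zero remain to be checked. It
  serves completions, matrix algebras and kernels alike.\<close>

lemma star_algebra_pullback:
 assumes D: "star_algebra D" and h: "star_hom B D \<phi>" and inj: "inj_on \<phi> (carrier B)"
  and zero: "alg_zero B : carrier B" "\<phi> (alg_zero B) = alg_zero D"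
  and add: "!!x y. [|x : carrier B; y : carrier B|] ==> alg_add B x y : carrier B"
  and scale: "!!c x. x : carrier B ==> alg_scale B c x : carrier B"
  and mult: "!!x y. [|x : carrier B; y : carrier B|] ==> alg_mult B x y : carrier B"
  and star: "!!x. x : carrier B ==> alg_star B x : carrier B"
 shows "star_algebra B"
proof -
 interpret D: star_algebra D by (rule D)
 have diff: "\<phi> (alg_diff B x y) = alg_diff D (\<phi> x) (\<phi> y)" "alg_diff B x y : carrier B"
  if "x : carrier B" "y : carrier B" for x y
  using that by (simp_all add: alg_diff_def star_homD[OF h] add scale)
 note H = zero add scale mult star diff star_homD[OF h]
 have eq: "x = y" if "x : carrier B" "y : carrier B" "\<phi> x = \<phi> y" for x y
  using inj_onD[OF inj] that by blast
 show ?thesis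
 proof unfold_locales
  fix x y assume "x : carrier B" "y : carrier B"
  then show "alg_add B x y = alg_add B y x" by (intro eq) (simp_all add: H D.add_commute)
 next
  fix x y z assume "x : carrier B" "y : carrier B" "z : carrier B"
  then show "alg_add B (alg_add B x y) z = alg_add B x (alg_add B y z)"
   by (intro eq) (simp_all add: H D.add_assoc)
 next
  fix x y z assume "x : carrier B" "y : carrier B" "z : carrier B"
  then show "alg_mult B (alg_mult B x y) z = alg_mult B x (alg_mult B y z)"
   by (intro eq) (simp_all add: H D.mult_assoc)
 qed ((simp add: H; fail) | (rule eq; simp add: H D.closed D.diff_self D.add_zero D.scale_one
   D.scale_scale D.scale_add_left D.scale_add_right D.mult_add_left D.mult_add_right
   D.mult_scale_left D.mult_scale_right D.star_star D.star_add D.star_scale D.star_mult; fail))+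
qed

section \<open>Completions and enveloping C*-algebras\<close>

lemma eventually_halves:
 fixes f g :: "nat => nat => real"
 assumes f: "ALL m>=N. ALL n>=N. f m n < e / 2" and g: "ALL m>=M. ALL n>=M. g m n < e / 2"
 shows "EX N. ALL m>=N. ALL n>=N. f m n + g m n < e"
proof (intro exI allI impI)
 fix m n assume m: "max N M <= m" and n: "max N M <= n"
 then have "f m n < e / 2" "g m n < e / 2" using f g by simp_all
 then show "f m n + g m n < e" by linarith
qed

section \<open>Limits and Cauchy sequences with respect to a C*-seminorm\<close>

context seminormed_algebra
begin

definition tends :: "(nat => 'a) => 'a => bool" where
 "tends s y \<longleftrightarrow> (ALL n. s n : carrier A) & y : carrier A & (%n. q (alg_diff A (s n) y)) \<longlonglongrightarrow> 0"

lemma null_comparison: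
 assumes "!!n. x n : carrier A" "!!n. q (x n) <= b n" "b \<longlonglongrightarrow> 0"
 shows "(%n. q (x n)) \<longlonglongrightarrow> 0"
 by (rule Lim_null_comparison[OF _ assms(3)]) (use assms(1,2) q_nonneg in auto)

lemma tends_q: "tends s y ==> (%n. q (s n)) \<longlonglongrightarrow> q y"
 unfolding tends_def
 by (rule LIM_zero_cancel, rule Lim_null_comparison[where g = "%n. q (alg_diff A (s n) y)"]) (use q_abs_diff in auto)

lemma tends_const: "x : carrier A ==> tends (%n. x) x"
 by (simp add: tends_def diff_self q_zero)

lemma tends_add:
 assumes "tends s x" "tends t y" shows "tends (%n. alg_add A (s n) (t n)) (alg_add A x y)"
proof -
 have "(%n. q (alg_diff A (alg_add A (s n) (t n)) (alg_add A x y))) \<longlonglongrightarrow> 0"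
 proof (rule null_comparison)
  show "(%n. q (alg_diff A (s n) x) + q (alg_diff A (t n) y)) \<longlonglongrightarrow> 0"
   using assms by (auto simp: tends_def intro: tendsto_add_zero)
 qed (use assms in "auto simp: tends_def closed intro: q_add_diff_le")
 then show ?thesis using assms by (auto simp: tends_def closed)
qed

lemma tends_scale:
 assumes "tends s x" shows "tends (%n. alg_scale A c (s n)) (alg_scale A c x)"
proof -
 have "(%n. cmod c * q (alg_diff A (s n) x)) \<longlonglongrightarrow> 0"
  using assms by (auto simp: tends_def intro: tendsto_mult_right_zero)
 then show ?thesis using assms by (auto simp: tends_def closed q_scale_diff)
qed

lemma tends_star:
 assumes "tends s x" shows "tends (%n. alg_star A (s n)) (alg_star A x)"
 using assms by (auto simp: tends_def closed q_star_diff)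

lemma tends_mult:
 assumes "tends s x" "tends t y" shows "tends (%n. alg_mult A (s n) (t n)) (alg_mult A x y)"
proof -
 have "(%n. q (alg_diff A (alg_mult A (s n) (t n)) (alg_mult A x y))) \<longlonglongrightarrow> 0"
 proof (rule null_comparison)
  have "(%n. q (alg_diff A (s n) x) * q (t n) + q x * q (alg_diff A (t n) y)) \<longlonglongrightarrow> 0 * q y + q x * 0"
   using assms tends_q[OF assms(2)] by (intro tendsto_intros) (auto simp: tends_def)
  then show "(%n. q (alg_diff A (s n) x) * q (t n) + q x * q (alg_diff A (t n) y)) \<longlonglongrightarrow> 0"
   by simp
 qed (use assms in "auto simp: tends_def closed intro: q_mult_diff_le")
 then show ?thesis using assms by (auto simp: tends_def closed)
qed

lemma tends_null:
 assumes "tends s x" "!!n. t n : carrier A" "(%n. q (alg_diff A (s n) (t n))) \<longlonglongrightarrow> 0"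
 shows "tends t x"
proof -
 have "(%n. q (alg_diff A (t n) x)) \<longlonglongrightarrow> 0"
 proof (rule null_comparison)
  show "(%n. q (alg_diff A (s n) (t n)) + q (alg_diff A (s n) x)) \<longlonglongrightarrow> 0"
   using assms by (auto simp: tends_def intro: tendsto_add_zero)
  fix n show "q (alg_diff A (t n) x) <= q (alg_diff A (s n) (t n)) + q (alg_diff A (s n) x)"
   using q_diff_triangle[of "t n" "s n" x] q_diff_commute[of "t n" "s n"] assms by (auto simp: tends_def)
 qed (use assms in "auto simp: tends_def closed")
 then show ?thesis using assms by (auto simp: tends_def)
qed

lemma tends_qeq: "[|tends s x; tends s y|] ==> qeq x y"
proof -
 assume a: "tends s x" "tends s y"
 have "(%n. q (alg_diff A (s n) x) + q (alg_diff A (s n) y)) \<longlonglongrightarrow> 0"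
  using a by (auto simp: tends_def intro: tendsto_add_zero)
 moreover have "q (alg_diff A x y) <= q (alg_diff A (s n) x) + q (alg_diff A (s n) y)" for n
  using q_diff_triangle[of x "s n" y] q_diff_commute[of x "s n"] a by (auto simp: tends_def)
 ultimately have "q (alg_diff A x y) <= 0"
  by (intro tendsto_lowerbound) (auto intro: always_eventually)
 then show ?thesis using q_nonneg[OF diff_closed, of x y] a by (auto simp: tends_def qeq_def)
qed

lemma cauchyD: "s : cauchy_seqs A q ==> s n : carrier A"
 by (simp add: cauchy_seqs_def)

lemma cauchy_q: 
 assumes s: "s : cauchy_seqs A q" shows "Cauchy (%n. q (s n))"
proof (rule CauchyI)
 fix e :: real assume "e > 0"
 with s obtain N where N: "ALL m>=N. ALL n>=N. q (alg_diff A (s m) (s n)) < e" 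
  unfolding cauchy_seqs_def by blast
 have "norm (q (s m) - q (s n)) < e" if "m >= N" "n >= N" for m n
  using q_abs_diff[OF cauchyD[OF s, of m] cauchyD[OF s, of n]] N that by fastforce
 then show "EX N. ALL m>=N. ALL n>=N. norm (q (s m) - q (s n)) < e" by blast
qed

lemma cauchy_convergent: "s : cauchy_seqs A q ==> convergent (%n. q (s n))"
 by (rule Cauchy_convergent[OF cauchy_q])

lemma cauchy_bound: 
 assumes s: "s : cauchy_seqs A q" shows "EX K>0. ALL n. q (s n) <= K"
proof -
 obtain K where K: "K > 0" "!!n. norm (q (s n)) <= K" 
  using Cauchy_Bseq[OF cauchy_q[OF s]] by (rule BseqE) blast
 have "q (s n) <= K" for n using K(2)[of n] by simp
 then show ?thesis using K(1) by blast
qed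

lemma cauchy_seqsI:
 assumes "!!n. s n : carrier A" 
  "!!m n. q (alg_diff A (s m) (s n)) <= f m n"
  "!!e. 0 < e ==> EX N. ALL m>=N. ALL n>=N. f m n < e"
 shows "s : cauchy_seqs A q"
 unfolding cauchy_seqs_def
proof (intro CollectI conjI allI impI)
 fix e :: real assume "0 < e"
 then obtain N where N: "ALL m>=N. ALL n>=N. f m n < e" using assms(3) by blast
 show "EX N. ALL m>=N. ALL n>=N. q (alg_diff A (s m) (s n)) < e"
 proof (intro exI allI impI)
  fix m n assume "N <= m" "N <= n"
  then have "f m n < e" using N by blast
  then show "q (alg_diff A (s m) (s n)) < e" using assms(2)[of m n] by linarith
 qed
qed (rule assms(1))

lemma cauchy_const: "x : carrier A ==> (%n. x) : cauchy_seqs A q"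
 by (simp add: cauchy_seqs_def diff_self q_zero)

lemma cauchy_add:
 assumes "s : cauchy_seqs A q" "t : cauchy_seqs A q"
 shows "(%n. alg_add A (s n) (t n)) : cauchy_seqs A q"
proof (rule cauchy_seqsI)
 fix e :: real assume "e > 0"
 then have "e / 2 > 0" by simp
 with assms obtain N M where "ALL m>=N. ALL n>=N. q (alg_diff A (s m) (s n)) < e / 2"
  "ALL m>=M. ALL n>=M. q (alg_diff A (t m) (t n)) < e / 2"
  unfolding cauchy_seqs_def by blast
 then show "EX N. ALL m>=N. ALL n>=N. q (alg_diff A (s m) (s n)) + q (alg_diff A (t m) (t n)) < e"
  by (rule eventually_halves)
qed (use assms in "simp_all add: closed cauchyD q_add_diff_le")

lemma cauchy_scale:
 assumes "s : cauchy_seqs A q"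
 shows "(%n. alg_scale A c (s n)) : cauchy_seqs A q"
proof (rule cauchy_seqsI)
 fix e :: real assume "e > 0"
 then have "e / (cmod c + 1) > 0" by (simp add: add_nonneg_pos)
 with assms obtain N where N: "ALL m>=N. ALL n>=N. q (alg_diff A (s m) (s n)) < e / (cmod c + 1)"
  unfolding cauchy_seqs_def by blast
 show "EX N. ALL m>=N. ALL n>=N. (cmod c + 1) * q (alg_diff A (s m) (s n)) < e"
  using N by (intro exI[of _ N]) (auto simp: pos_less_divide_eq add_nonneg_pos mult.commute)
next
 fix m n
 show "q (alg_diff A (alg_scale A c (s m)) (alg_scale A c (s n))) <= (cmod c + 1) * q (alg_diff A (s m) (s n))"
  using assms cauchyD by (auto simp: q_scale_diff algebra_simps intro: q_nonneg closed)
qed (use assms in "simp_all add: closed cauchyD")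

lemma cauchy_star:
 assumes "s : cauchy_seqs A q"
 shows "(%n. alg_star A (s n)) : cauchy_seqs A q"
 using assms by (auto simp: cauchy_seqs_def closed q_star_diff)

lemma cauchy_mult:
 assumes s: "s : cauchy_seqs A q" and t: "t : cauchy_seqs A q"
 shows "(%n. alg_mult A (s n) (t n)) : cauchy_seqs A q"
proof -
 obtain K L where K: "K > 0" "!!n. q (s n) <= K" and L: "L > 0" "!!n. q (t n) <= L"
  using cauchy_bound[OF s] cauchy_bound[OF t] by blast
 show ?thesis
 proof (rule cauchy_seqsI)
  fix e :: real assume "e > 0"
  then have "e / (2 * L) > 0" "e / (2 * K) > 0" using K L by auto
  with s t obtain N M where "ALL m>=N. ALL n>=N. q (alg_diff A (s m) (s n)) < e / (2 * L)"
   "ALL m>=M. ALL n>=M. q (alg_diff A (t m) (t n)) < e / (2 * K)"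
   unfolding cauchy_seqs_def by blast
  then have "ALL m>=N. ALL n>=N. q (alg_diff A (s m) (s n)) * L < e / 2"
   "ALL m>=M. ALL n>=M. K * q (alg_diff A (t m) (t n)) < e / 2"
   using K(1) L(1) by (simp_all add: pos_less_divide_eq mult_ac)
  then show "EX N. ALL m>=N. ALL n>=N. q (alg_diff A (s m) (s n)) * L + K * q (alg_diff A (t m) (t n)) < e"
   by (rule eventually_halves)
 next
  fix m n
  have "q (alg_diff A (alg_mult A (s m) (t m)) (alg_mult A (s n) (t n)))
    <= q (alg_diff A (s m) (s n)) * q (t m) + q (s n) * q (alg_diff A (t m) (t n))"
   using s t cauchyD by (intro q_mult_diff_le) auto
  also have "... <= q (alg_diff A (s m) (s n)) * L + K * q (alg_diff A (t m) (t n))"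
   using s t cauchyD by (intro add_mono mult_mono K L) (auto intro!: q_nonneg closed less_imp_le[OF K(1)])
  finally show "q (alg_diff A (alg_mult A (s m) (t m)) (alg_mult A (s n) (t n)))
   <= q (alg_diff A (s m) (s n)) * L + K * q (alg_diff A (t m) (t n))" .
 qed (use s t in "simp_all add: closed cauchyD")
qed

lemma null_rel_iff:
 "(s, t) : null_rel A q \<longleftrightarrow> s : cauchy_seqs A q & t : cauchy_seqs A q &
   (%n. q (alg_diff A (s n) (t n))) \<longlonglongrightarrow> 0"
 by (simp add: null_rel_def)

lemma equiv_null_rel: "equiv (cauchy_seqs A q) (null_rel A q)"
proof (rule equivI)
 show "null_rel A q \<subseteq> cauchy_seqs A q \<times> cauchy_seqs A q" by (auto simp: null_rel_iff)
 show "refl_on (cauchy_seqs A q) (null_rel A q)"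
  by (auto simp: refl_on_def null_rel_iff diff_self q_zero cauchyD)
 show "sym (null_rel A q)"
  by (auto simp: sym_def null_rel_iff q_diff_commute cauchyD)
 show "trans (null_rel A q)"
 proof (rule transI)
  fix s t u assume a: "(s, t) : null_rel A q" "(t, u) : null_rel A q"
  then have c: "!!n. s n : carrier A" "!!n. t n : carrier A" "!!n. u n : carrier A"
   by (auto simp: null_rel_iff cauchyD)
  have "(%n. q (alg_diff A (s n) (u n))) \<longlonglongrightarrow> 0"
  proof (rule null_comparison)
   show "(%n. q (alg_diff A (s n) (t n)) + q (alg_diff A (t n) (u n))) \<longlonglongrightarrow> 0"
    using a by (auto simp: null_rel_iff intro: tendsto_add_zero)
  qed (use c in "auto simp: closed intro: q_diff_triangle")
  then show "(s, u) : null_rel A q" using a by (auto simp: null_rel_iff)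
 qed
qed

lemma class_closed: "s : cauchy_seqs A q ==> seq_class A q s : carrier (completion A q)"
 by (simp add: seq_class_def completion_def quotientI)

text \<open>The operations of \<open>completion\<close> are computed on representatives picked by
  choice. The pick is harmless because it differs from the given sequence by a null
  sequence.\<close>

lemma rep_null:
 assumes "s : cauchy_seqs A q" shows "(s, seq_rep (seq_class A q s)) : null_rel A q"
proof -
 have "s : seq_class A q s"
  using equiv_class_self[OF equiv_null_rel assms] by (simp add: seq_class_def)
 then have "seq_rep (seq_class A q s) : seq_class A q s" unfolding seq_rep_def by (rule someI[where P = "%s'. s' : seq_class A q s"])
 then show ?thesis by (simp add: seq_class_def)
qed

lemma class_eqI: "(s, t) : null_rel A q ==> seq_class A q s = seq_class A q t"
 unfolding seq_class_def by (rule equiv_class_eq[OF equiv_null_rel])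

lemma rep_class:
 assumes "X : carrier (completion A q)"
 shows "seq_rep X : cauchy_seqs A q" "seq_class A q (seq_rep X) = X"
proof -
 from assms obtain s where s: "s : cauchy_seqs A q" "X = seq_class A q s"
  by (auto simp: completion_def seq_class_def elim: quotientE)
 show "seq_rep X : cauchy_seqs A q" using rep_null[OF s(1)] by (simp add: null_rel_iff s(2))
 show "seq_class A q (seq_rep X) = X" using class_eqI[OF rep_null[OF s(1)], symmetric] unfolding s(2) .
qed

lemma completion_closed:
 shows "alg_zero (completion A q) : carrier (completion A q)"
  and "[|X : carrier (completion A q); Y : carrier (completion A q)|]
   ==> alg_add (completion A q) X Y : carrier (completion A q)"
  and "X : carrier (completion A q) ==> alg_scale (completion A q) c X : carrier (completion A q)"
  and "[|X : carrier (completion A q); Y : carrier (completion A q)|]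
   ==> alg_mult (completion A q) X Y : carrier (completion A q)"
  and "X : carrier (completion A q) ==> alg_star (completion A q) X : carrier (completion A q)"
proof -
 show "alg_zero (completion A q) : carrier (completion A q)"
  using class_closed[OF cauchy_const[OF zero_closed]] by (simp add: completion_def)
 show "alg_scale (completion A q) c X : carrier (completion A q)"
  "alg_star (completion A q) X : carrier (completion A q)" if X: "X : carrier (completion A q)"
  using class_closed[OF cauchy_scale[OF rep_class(1)[OF X]]] class_closed[OF cauchy_star[OF rep_class(1)[OF X]]]
  by (simp_all add: completion_def)
 show "alg_add (completion A q) X Y : carrier (completion A q)"
  "alg_mult (completion A q) X Y : carrier (completion A q)" 
  if X: "X : carrier (completion A q)" and Y: "Y : carrier (completion A q)"
  using class_closed[OF cauchy_add[OF rep_class(1)[OF X] rep_class(1)[OF Y]]]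
   class_closed[OF cauchy_mult[OF rep_class(1)[OF X] rep_class(1)[OF Y]]]
  by (simp_all add: completion_def)
qed

lemma completion_norm:
 "X : carrier (completion A q) ==> (%n. q (seq_rep X n)) \<longlonglongrightarrow> alg_norm (completion A q) X"
 using cauchy_convergent[OF rep_class(1)] by (simp add: completion_def convergent_LIMSEQ_iff)

end

section \<open>C*-algebras obtained from isometric embeddings with closed image\<close>

lemma cstar_algebra_seminormed: "cstar_algebra D ==> seminormed_algebra D (alg_norm D)"
 by (simp add: cstar_algebra_def cstar_algebra_axioms_def seminormed_algebra_def seminormed_algebra_axioms_def)

lemma cstar_seminorm_cong:
 assumes "star_algebra A" "!!x. x : carrier A ==> q x = q' x"
 shows "cstar_seminorm A q \<longleftrightarrow> cstar_seminorm A q'"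
 using assms(2) by (simp add: cstar_seminorm_def star_algebra.closed[OF assms(1)])

text \<open>Completeness passes to closed subspaces: a Cauchy sequence converges in
  \<open>D\<close>, and the assumption on approximable points, which says that the image is closed,
  puts the limit back into it.\<close>

lemma cstar_algebra_pullback:
 assumes D: "cstar_algebra D" and B: "star_algebra B" and h: "star_hom B D \<phi>" 
  and inj: "inj_on \<phi> (carrier B)"
  and norm: "!!x. x : carrier B ==> alg_norm B x = alg_norm D (\<phi> x)"
  and range: "!!y. [|y : carrier D; !!e. 0 < e ==> EX x:carrier B. alg_norm D (alg_diff D y (\<phi> x)) < e|]
   ==> y : \<phi> ` carrier B"
 shows "cstar_algebra B"
proof -
 interpret D: cstar_algebra D by (rule D)
 interpret DN: seminormed_algebra D "alg_norm D" by (rule cstar_algebra_seminormed[OF D])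
 interpret B: star_algebra B by (rule B)
 have Dsa: "star_algebra D" by unfold_locales
 have nd: "alg_norm B (alg_diff B x y) = alg_norm D (alg_diff D (\<phi> x) (\<phi> y))"
  if "x : carrier B" "y : carrier B" for x y
  using that by (simp add: norm B.closed star_hom_diff[OF h B])
 show ?thesis
 proof (intro cstar_algebra.intro B cstar_algebra_axioms.intro)
  show "cstar_seminorm B (alg_norm B)"
   by (subst cstar_seminorm_cong[OF B norm]) (auto intro: cstar_seminorm_hom[OF h B] D.norm_seminorm)
 next
  fix x assume x: "x : carrier B" "alg_norm B x = 0"
  then have "\<phi> x = alg_zero D" using D.norm_definite[of "\<phi> x"] by (simp add: norm star_homD[OF h])
  then show "x = alg_zero B" using inj x star_hom_zero[OF h B Dsa] by (auto simp: inj_on_def B.closed)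
 next
  fix s assume s: "s : cauchy_seqs B (alg_norm B)"
  have sB: "s n : carrier B" for n using s by (simp add: cauchy_seqs_def)
  have "(%n. \<phi> (s n)) : cauchy_seqs D (alg_norm D)"
   using s by (auto simp: cauchy_seqs_def nd star_homD[OF h])
  from D.complete[OF this] obtain y where y: "y : carrier D" 
   "(%n. alg_norm D (alg_diff D (\<phi> (s n)) y)) \<longlonglongrightarrow> 0" by auto
  have "y : \<phi> ` carrier B"
  proof (rule range[OF y(1)])
   fix e :: real assume "e > 0"
   from order_tendstoD(2)[OF y(2) this] obtain n where "alg_norm D (alg_diff D (\<phi> (s n)) y) < e"
    by (auto simp: eventually_sequentially)
   then show "EX x:carrier B. alg_norm D (alg_diff D y (\<phi> x)) < e"
    using sB y(1) by (intro bexI[of _ "s n"]) (simp_all add: DN.q_diff_commute star_homD[OF h])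
  qed
  then obtain x where "x : carrier B" "y = \<phi> x" by auto
  then show "EX x:carrier B. (%n. alg_norm B (alg_diff B (s n) x)) \<longlonglongrightarrow> 0"
   using y sB by (intro bexI[of _ x]) (simp_all add: nd)
 qed
qed

text \<open>The universal property of the completion: a contractive homomorphism into a complete
  algebra extends by continuity.\<close>

locale completion_hom = seminormed_algebra A q + D: cstar_algebra D
 for A :: "('a, 'm) star_alg_scheme" and q and D :: "('d, 'k) cstar_alg_scheme" +
 fixes \<phi> :: "'a => 'd"
 assumes hom: "star_hom A D \<phi>"
  and contractive: "x : carrier A ==> alg_norm D (\<phi> x) <= q x"
begin

sublocale DN: seminormed_algebra D "alg_norm D"
 by (rule cstar_algebra_seminormed) unfold_locales

lemma A_star_algebra: "star_algebra A" and D_star_algebra: "star_algebra D"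
 by unfold_locales

definition ext :: "(nat => 'a) set => 'd" where
 "ext X = (SOME y. DN.tends (%n. \<phi> (seq_rep X n)) y)"

lemma diff_contractive:
 "[|x : carrier A; y : carrier A|] ==> alg_norm D (alg_diff D (\<phi> x) (\<phi> y)) <= q (alg_diff A x y)"
 using contractive[OF diff_closed, of x y] by (simp add: star_hom_diff[OF hom A_star_algebra])

lemma ext_tends_rep:
 assumes "X : carrier (completion A q)"
 shows "DN.tends (%n. \<phi> (seq_rep X n)) (ext X)"
proof -
 have c: "seq_rep X : cauchy_seqs A q" by (rule rep_class[OF assms])
 then have "(%n. \<phi> (seq_rep X n)) : cauchy_seqs D (alg_norm D)"
  by (intro DN.cauchy_seqsI[where f = "%m n. q (alg_diff A (seq_rep X m) (seq_rep X n))"])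
   (auto simp: cauchy_seqs_def star_homD[OF hom] diff_contractive)
 then have "EX y. DN.tends (%n. \<phi> (seq_rep X n)) y"
  using D.complete[of "%n. \<phi> (seq_rep X n)"] cauchyD[OF c]
  by (auto simp: DN.tends_def star_homD[OF hom])
 then show ?thesis unfolding ext_def by (rule someI_ex)
qed

text \<open>\<open>ext\<close> is defined through the chosen representative, but may be computed
  along any Cauchy sequence of the class. The algebraic laws of \<open>ext\<close> then follow by
  taking limits of those of \<open>\<phi>\<close>.\<close>

lemma ext_tends:
 assumes "s : cauchy_seqs A q"
 shows "DN.tends (%n. \<phi> (s n)) (ext (seq_class A q s))"
proof (rule DN.tends_null[OF ext_tends_rep[OF class_closed[OF assms]]])
 let ?t = "seq_rep (seq_class A q s)"
 have n: "(s, ?t) : null_rel A q" by (rule rep_null[OF assms])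
 have c: "s n : carrier A" "?t n : carrier A" for n
  using n by (auto simp: null_rel_iff cauchyD)
 show "(%n. alg_norm D (alg_diff D (\<phi> (?t n)) (\<phi> (s n)))) \<longlonglongrightarrow> 0"
 proof (rule DN.null_comparison)
  show "(%n. q (alg_diff A (s n) (?t n))) \<longlonglongrightarrow> 0" using n by (simp add: null_rel_iff)
  show "alg_norm D (alg_diff D (\<phi> (?t n)) (\<phi> (s n))) <= q (alg_diff A (s n) (?t n))" for n
   using diff_contractive[of "?t n" "s n"] c q_diff_commute by simp
 qed (use c in "auto simp: D.closed star_homD[OF hom]")
 show "\<phi> (s n) : carrier D" for n using c star_homD[OF hom] by auto
qed

lemma tends_unique: "[|DN.tends s x; DN.tends s y|] ==> x = y"
 using DN.tends_qeq[of s x y] D.norm_definite[of "alg_diff D x y"]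
 by (auto simp: DN.qeq_def D.closed D.diff_eq_zero_iff)

lemma ext_hom: "star_hom (completion A q) D ext"
proof -
 note r = rep_class(1)
 have "ext X : carrier D" if "X : carrier (completion A q)" for X
  using ext_tends_rep[OF that] by (simp add: DN.tends_def)
 moreover have "ext (alg_add (completion A q) X Y) = alg_add D (ext X) (ext Y)"
  if "X : carrier (completion A q)" "Y : carrier (completion A q)" for X Y
  using ext_tends[OF cauchy_add[OF r r], OF that] DN.tends_add[OF ext_tends_rep ext_tends_rep, OF that]
   cauchyD[OF r] that
  by (intro tends_unique[of "%n. \<phi> (alg_add A (seq_rep X n) (seq_rep Y n))"])
   (simp_all add: completion_def star_homD[OF hom])
 moreover have "ext (alg_mult (completion A q) X Y) = alg_mult D (ext X) (ext Y)"
  if "X : carrier (completion A q)" "Y : carrier (completion A q)" for X Y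
  using ext_tends[OF cauchy_mult[OF r r], OF that] DN.tends_mult[OF ext_tends_rep ext_tends_rep, OF that]
   cauchyD[OF r] that
  by (intro tends_unique[of "%n. \<phi> (alg_mult A (seq_rep X n) (seq_rep Y n))"])
   (simp_all add: completion_def star_homD[OF hom])
 moreover have "ext (alg_scale (completion A q) c X) = alg_scale D c (ext X)"
  if "X : carrier (completion A q)" for c X
  using ext_tends[OF cauchy_scale[OF r], OF that] DN.tends_scale[OF ext_tends_rep, OF that]
   cauchyD[OF r] that
  by (intro tends_unique[of "%n. \<phi> (alg_scale A c (seq_rep X n))"])
   (simp_all add: completion_def star_homD[OF hom])
 moreover have "ext (alg_star (completion A q) X) = alg_star D (ext X)"
  if "X : carrier (completion A q)" for X
  using ext_tends[OF cauchy_star[OF r], OF that] DN.tends_star[OF ext_tends_rep, OF that]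
   cauchyD[OF r] that
  by (intro tends_unique[of "%n. \<phi> (alg_star A (seq_rep X n))"])
   (simp_all add: completion_def star_homD[OF hom])
 ultimately show ?thesis by (simp add: star_hom_def)
qed

lemma ext_const: "x : carrier A ==> ext (seq_class A q (%n. x)) = \<phi> x"
 using ext_tends[OF cauchy_const, of x] DN.tends_const[of "\<phi> x"] star_homD(1)[OF hom]
 by (auto intro: tends_unique)

lemma ext_contractive:
 assumes "X : carrier (completion A q)" shows "alg_norm D (ext X) <= alg_norm (completion A q) X"
 using DN.tends_q[OF ext_tends_rep[OF assms]] completion_norm[OF assms]
 by (rule LIMSEQ_le) (use contractive cauchyD[OF rep_class(1)[OF assms]] in auto)

end

locale isometric_completion_hom = completion_hom +
 assumes isometric: "x : carrier A ==> alg_norm D (\<phi> x) = q x"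
begin

lemma ext_isometric:
 assumes "X : carrier (completion A q)" shows "alg_norm (completion A q) X = alg_norm D (ext X)"
 using DN.tends_q[OF ext_tends_rep[OF assms]] completion_norm[OF assms]
  cauchyD[OF rep_class(1)[OF assms]] by (simp add: isometric LIMSEQ_unique)

lemma ext_inj: "inj_on ext (carrier (completion A q))"
proof (rule inj_onI)
 fix X Y assume XY: "X : carrier (completion A q)" "Y : carrier (completion A q)" and e: "ext X = ext Y"
 let ?s = "seq_rep X" and ?t = "seq_rep Y"
 have c: "?s n : carrier A" "?t n : carrier A" for n
  using XY cauchyD[OF rep_class(1)] by auto
 have "DN.tends (%n. alg_diff D (\<phi> (?s n)) (\<phi> (?t n))) (alg_diff D (ext X) (ext X))"
  unfolding alg_diff_def
  using ext_tends_rep[OF XY(1)] ext_tends_rep[OF XY(2)] e by (intro DN.tends_add DN.tends_scale) auto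
 from DN.tends_q[OF this] have "(%n. q (alg_diff A (?s n) (?t n))) \<longlonglongrightarrow> 0"
  using XY c D.diff_self[OF star_homD(1)[OF ext_hom]] DN.q_zero
  by (simp add: isometric[symmetric] closed star_hom_diff[OF hom A_star_algebra])
 then show "X = Y" using class_eqI[of ?s ?t] rep_class XY by (simp add: null_rel_iff)
qed

text \<open>An approximable point is the limit of approximants with errors below 1/(n+1); since
  \<open>\<phi>\<close> is isometric for \<open>q\<close>, their preimages form a Cauchy sequence
  already in \<open>A\<close>.\<close>

lemma ext_range:
 "ext ` carrier (completion A q) = 
  {y : carrier D. ALL e>0. EX x:carrier A. alg_norm D (alg_diff D y (\<phi> x)) < e}" (is "_ = ?R")
proof
 show "ext ` carrier (completion A q) \<subseteq> ?R"
 proof (intro subsetI; elim imageE; safe)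
  fix X assume X: "X : carrier (completion A q)"
  then show "ext X : carrier D" by (rule star_homD[OF ext_hom])
  fix e :: real assume "e > 0"
  moreover have "(%n. alg_norm D (alg_diff D (\<phi> (seq_rep X n)) (ext X))) \<longlonglongrightarrow> 0"
   using ext_tends_rep[OF X] by (simp add: DN.tends_def)
  ultimately obtain n where "alg_norm D (alg_diff D (\<phi> (seq_rep X n)) (ext X)) < e"
   using order_tendstoD(2)[of _ 0 sequentially e] eventually_happens'[OF sequentially_bot] by blast
  then show "EX x:carrier A. alg_norm D (alg_diff D (ext X) (\<phi> x)) < e"
   using X cauchyD[OF rep_class(1)[OF X]] 
   using DN.q_diff_commute[of "ext X" "\<phi> (seq_rep X n)"] star_homD(1)[OF ext_hom X] star_homD(1)[OF hom]
   by (intro bexI[of _ "seq_rep X n"]) simp_all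
 qed
 show "?R \<subseteq> ext ` carrier (completion A q)"
 proof
  fix y assume y: "y : ?R"
  have "EX x:carrier A. alg_norm D (alg_diff D y (\<phi> x)) < inverse (real (Suc n))" for n using y by simp
  then obtain s where s: "!!n. s n : carrier A" "!!n. alg_norm D (alg_diff D y (\<phi> (s n))) < inverse (real (Suc n))"
   by metis
  have le: "q (alg_diff A (s m) (s n)) <= inverse (real (Suc m)) + inverse (real (Suc n))" for m n
  proof -
   have "q (alg_diff A (s m) (s n)) = alg_norm D (alg_diff D (\<phi> (s m)) (\<phi> (s n)))"
    by (simp add: isometric[symmetric] s closed star_hom_diff[OF hom A_star_algebra])
   also have "... <= alg_norm D (alg_diff D y (\<phi> (s m))) + alg_norm D (alg_diff D y (\<phi> (s n)))"
    using DN.q_diff_triangle[of "\<phi> (s m)" y "\<phi> (s n)"] y s(1) DN.q_diff_commute[of y "\<phi> (s m)"]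
    by (simp add: star_homD[OF hom])
   finally show ?thesis using s(2)[of m] s(2)[of n] by linarith
  qed
  have c: "s : cauchy_seqs A q"
  proof (rule cauchy_seqsI[OF s(1) le])
   fix e :: real assume "e > 0"
   then obtain N where N: "inverse (real (Suc N)) < e / 2" using reals_Archimedean[of "e/2"] by auto
   have "inverse (real (Suc m)) < e / 2" if "m >= N" for m
    using that le_imp_inverse_le[of "real (Suc N)" "real (Suc m)"]
    by (intro le_less_trans[OF _ N]) simp
   then show "EX N. ALL m>=N. ALL n>=N. inverse (real (Suc m)) + inverse (real (Suc n)) < e"
    by (intro eventually_halves[where N = N and M = N]) auto
  qed
  have "DN.tends (%n. \<phi> (s n)) y"
   unfolding DN.tends_def
  proof (intro conjI allI)
   show "(%n. alg_norm D (alg_diff D (\<phi> (s n)) y)) \<longlonglongrightarrow> 0"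
   proof (rule DN.null_comparison[OF _ _ LIMSEQ_inverse_real_of_nat])
    fix n
    have c: "\<phi> (s n) : carrier D" "y : carrier D" using star_homD(1)[OF hom s(1)] y by auto
    show "alg_diff D (\<phi> (s n)) y : carrier D" by (rule D.diff_closed[OF c])
    show "alg_norm D (alg_diff D (\<phi> (s n)) y) <= inverse (real (Suc n))"
     using s(2)[of n] DN.q_diff_commute[OF c] by simp
   qed
  qed (use s y in "auto simp: star_homD[OF hom]")
  then have "y = ext (seq_class A q s)" using ext_tends[OF c] tends_unique by blast
  then show "y : ext ` carrier (completion A q)" using class_closed[OF c] by blast
 qed
qed

text \<open>The C*-axioms are not verified on classes of Cauchy sequences: the isometric embedding
  \<open>ext\<close> has closed image in the C*-algebra \<open>D\<close>, and everything is pulled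
  back along it.\<close>

lemma completion_cstar: "cstar_algebra (completion A q)"
proof (rule cstar_algebra_pullback[OF _ _ ext_hom ext_inj ext_isometric])
 show "cstar_algebra D" by unfold_locales
 show "star_algebra (completion A q)"
 proof (rule star_algebra_pullback[OF D_star_algebra ext_hom ext_inj])
  show "ext (alg_zero (completion A q)) = alg_zero D"
   using ext_const[OF zero_closed] star_hom_zero[OF hom A_star_algebra D_star_algebra]
   by (simp add: completion_def)
 qed (fact completion_closed)+
 fix y assume y: "y : carrier D"
  and ap: "!!e. 0 < e ==> EX x:carrier (completion A q). alg_norm D (alg_diff D y (ext x)) < e"
 have "EX x:carrier A. alg_norm D (alg_diff D y (\<phi> x)) < e" if e: "e > 0" for e
 proof -
  have e2: "e / 2 > 0" using e by simp
  obtain X where X: "X : carrier (completion A q)" "alg_norm D (alg_diff D y (ext X)) < e / 2"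
   using ap[OF e2] by blast
  then have "ext X : ext ` carrier (completion A q)" by simp
  then obtain x where x: "x : carrier A" "alg_norm D (alg_diff D (ext X) (\<phi> x)) < e / 2"
   unfolding ext_range using e2 by blast
  have "alg_norm D (alg_diff D y (\<phi> x)) < e"
   using DN.q_diff_triangle[of y "ext X" "\<phi> x"] y star_homD(1)[OF hom x(1)] star_homD(1)[OF ext_hom X(1)]
    X(2) x(2) by linarith
  then show ?thesis using x(1) by blast
 qed
 then show "y : ext ` carrier (completion A q)" using y ext_range by blast
qed

end

text \<open>\<open>D\<close> with \<open>\<phi>\<close> is a faithful model of the presentation: its
  norm is one admissible C*-seminorm and, by \<open>dominates\<close>, the largest. The envelope is
  then isomorphic to the closure of the image of \<open>\<phi>\<close>.\<close>

locale envelope_model = star_algebra P + D: cstar_algebra D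
 for P :: "('a, 'm) star_alg_scheme" and R and D :: "('d, 'k) cstar_alg_scheme" +
 fixes \<phi> :: "'a => 'd"
 assumes hom: "star_hom P D \<phi>"
  and rels: "(y, z) : R ==> y : carrier P & z : carrier P & \<phi> y = \<phi> z"
  and dominates: "[|cstar_seminorm P q; !!y z. (y, z) : R ==> q (alg_diff P y z) = 0; x : carrier P|]
   ==> q x <= alg_norm D (\<phi> x)"
begin

lemma P_star_algebra: "star_algebra P" and D_cstar_algebra: "cstar_algebra D"
 by unfold_locales

text \<open>The supremum is a maximum, attained at the model norm; in particular the set in
  \<open>max_seminorm\<close> is bounded.\<close>

lemma max_seminorm_eq: 
 assumes "x : carrier P" shows "max_seminorm P R x = alg_norm D (\<phi> x)"
proof -
 interpret DN: seminormed_algebra D "alg_norm D"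
  by (rule cstar_algebra_seminormed) unfold_locales
 have "alg_norm D (\<phi> (alg_diff P y z)) = 0" if "(y, z) : R" for y z
  using rels[OF that] star_hom_diff[OF hom P_star_algebra, of y z] D.diff_self[OF star_homD(1)[OF hom], of z]
  by (simp add: DN.q_zero)
 then have "alg_norm D (\<phi> x) : {q x |q. cstar_seminorm P q & (ALL (y, z):R. q (alg_diff P y z) = 0)}"
  using cstar_seminorm_hom[OF hom P_star_algebra D.norm_seminorm]
  by (intro CollectI exI[of _ "%x. alg_norm D (\<phi> x)"]) auto
 then show ?thesis
  unfolding max_seminorm_def
 proof (rule cSup_eq_maximum)
  fix c assume "c : {q x |q. cstar_seminorm P q & (ALL (y, z):R. q (alg_diff P y z) = 0)}"
  then obtain q where q: "c = q x" "cstar_seminorm P q" "ALL (y, z):R. q (alg_diff P y z) = 0"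
   by (elim CollectE exE conjE)
  show "c <= alg_norm D (\<phi> x)"
   unfolding q(1) by (rule dominates[OF q(2) _ assms]) (use q(3) in blast)
 qed
qed

sublocale env: isometric_completion_hom P "max_seminorm P R" D \<phi>
proof unfold_locales
 show "cstar_seminorm P (max_seminorm P R)"
  using cstar_seminorm_hom[OF hom P_star_algebra D.norm_seminorm]
  by (simp only: cstar_seminorm_cong[OF P_star_algebra max_seminorm_eq])
qed (simp_all add: hom max_seminorm_eq)

lemma envelope_cstar: "cstar_algebra (envelope P R)"
 using env.completion_cstar by (simp add: envelope_def)

lemma envelope_ext_bij:
 assumes "!!y e. [|y : carrier D; 0 < e|] ==> EX x:carrier P. alg_norm D (alg_diff D y (\<phi> x)) < e"
 shows "star_hom (envelope P R) D env.ext" "bij_betw env.ext (carrier (envelope P R)) (carrier D)"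
 using env.ext_hom env.ext_inj env.ext_range assms by (auto simp: envelope_def bij_betw_def)

end

section \<open>Semigroup algebras\<close>

locale star_semigroup =
 fixes S :: "'s set" and m :: "'s => 's => 's" and i :: "'s => 's"
 assumes m_closed: "[|s : S; t : S|] ==> m s t : S"
  and m_assoc: "[|s : S; t : S; u : S|] ==> m (m s t) u = m s (m t u)"
  and i_closed: "s : S ==> i s : S"
  and i_i: "s : S ==> i (i s) = s"
  and i_m: "[|s : S; t : S|] ==> i (m s t) = m (i t) (i s)"
begin

abbreviation "P \<equiv> semigroup_alg S m i"

lemma carrier_iff: "x : carrier P \<longleftrightarrow> finite {s. x s ~= 0} & {s. x s ~= 0} \<subseteq> S"
 by (simp add: semigroup_alg_def)

lemma add_app: "alg_add P x y = (%u. x u + y u)"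
 and scale_app: "alg_scale P c x = (%u. c * x u)"
 and zero_app: "alg_zero P = (%u. 0)"
 by (simp_all add: semigroup_alg_def)

text \<open>The sums run over arbitrary finite sets containing the supports, so that elements with
  different supports can be compared over one common index set.\<close>

lemma mult_app:
 assumes "finite X" "{s. x s ~= 0} \<subseteq> X" "finite Y" "{t. y t ~= 0} \<subseteq> Y"
 shows "alg_mult P x y u = (SUM s:X. SUM t:Y. if m s t = u then x s * y t else 0)"
proof -
 have "alg_mult P x y u = (SUM (s, t):{(s, t). x s ~= 0 & y t ~= 0 & m s t = u}. x s * y t)"
  by (simp add: semigroup_alg_def)
 also have "... = (SUM (s, t):X \<times> Y. if m s t = u then x s * y t else 0)"
  using assms by (intro sum.mono_neutral_cong_left) (auto split: if_splits)
 also have "... = (SUM s:X. SUM t:Y. if m s t = u then x s * y t else 0)"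
  by (simp add: sum.cartesian_product)
 finally show ?thesis .
qed

lemma star_app:
 assumes "finite X" "{s. x s ~= 0} \<subseteq> X"
 shows "alg_star P x u = (SUM s:X. if i s = u then cnj (x s) else 0)"
proof -
 have "alg_star P x u = (SUM s:{s. x s ~= 0 & i s = u}. cnj (x s))"
  by (simp add: semigroup_alg_def)
 also have "... = (SUM s:X. if i s = u then cnj (x s) else 0)"
  using assms by (intro sum.mono_neutral_cong_left) (auto split: if_splits)
 finally show ?thesis .
qed

lemma mult_support: "{u. alg_mult P x y u ~= 0} \<subseteq> (%(s, t). m s t) ` ({s. x s ~= 0} \<times> {t. y t ~= 0})"
proof
 fix u assume u: "u : {u. alg_mult P x y u ~= 0}"
 have "alg_mult P x y u = (SUM (s, t):{(s, t). x s ~= 0 & y t ~= 0 & m s t = u}. x s * y t)"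
  by (simp add: semigroup_alg_def)
 with u have "{(s, t). x s ~= 0 & y t ~= 0 & m s t = u} ~= {}" by (intro notI) simp
 then show "u : (%(s, t). m s t) ` ({s. x s ~= 0} \<times> {t. y t ~= 0})" by auto
qed

lemma star_support: "{u. alg_star P x u ~= 0} \<subseteq> i ` {s. x s ~= 0}"
proof
 fix u assume u: "u : {u. alg_star P x u ~= 0}"
 have "alg_star P x u = (SUM s:{s. x s ~= 0 & i s = u}. cnj (x s))"
  by (simp add: semigroup_alg_def)
 with u have "{s. x s ~= 0 & i s = u} ~= {}" by (intro notI) simp
 then show "u : i ` {s. x s ~= 0}" by auto
qed

lemma add_cl: "[|x : carrier P; y : carrier P|] ==> alg_add P x y : carrier P"
proof -
 assume a: "x : carrier P" "y : carrier P"
 have "{u. x u + y u ~= 0} \<subseteq> {u. x u ~= 0} \<union> {u. y u ~= 0}" by auto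
 with a show ?thesis unfolding carrier_iff add_app by (meson finite_UnI finite_subset le_sup_iff order_trans)
qed

lemma scale_cl: "x : carrier P ==> alg_scale P c x : carrier P"
proof -
 assume a: "x : carrier P"
 have "{u. c * x u ~= 0} \<subseteq> {u. x u ~= 0}" by auto
 with a show ?thesis unfolding carrier_iff scale_app by (meson finite_subset order_trans)
qed

lemma mult_cl: "[|x : carrier P; y : carrier P|] ==> alg_mult P x y : carrier P"
proof -
 assume a: "x : carrier P" "y : carrier P"
 then have "finite ((%(s, t). m s t) ` ({s. x s ~= 0} \<times> {t. y t ~= 0}))" 
  and "(%(s, t). m s t) ` ({s. x s ~= 0} \<times> {t. y t ~= 0}) \<subseteq> S"
  using m_closed unfolding carrier_iff by auto
 with mult_support[of x y] show ?thesis unfolding carrier_iff by (meson finite_subset order_trans)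
qed

lemma star_cl: "x : carrier P ==> alg_star P x : carrier P"
proof -
 assume a: "x : carrier P"
 then have "finite (i ` {s. x s ~= 0})" and "i ` {s. x s ~= 0} \<subseteq> S"
  using i_closed unfolding carrier_iff by auto
 with star_support[of x] show ?thesis unfolding carrier_iff by (meson finite_subset order_trans)
qed

lemma zero_cl: "alg_zero P : carrier P"
 by (simp add: carrier_iff zero_app)

lemma delta_cl: "s : S ==> delta s : carrier P"
 by (simp add: carrier_iff delta_def)

lemmas cl = add_cl scale_cl mult_cl star_cl zero_cl delta_cl m_closed i_closed

lemma mult_add_l:
 assumes "x : carrier P" "x' : carrier P" "y : carrier P"
 shows "alg_mult P (alg_add P x x') y = alg_add P (alg_mult P x y) (alg_mult P x' y)"
proof
 fix u
 let ?X = "{s. x s ~= 0} \<union> {s. x' s ~= 0}" and ?Y = "{t. y t ~= 0}"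
 have f: "finite ?X" "finite ?Y" using assms by (auto simp: carrier_iff)
 have 1: "alg_mult P (alg_add P x x') y u = (SUM s:?X. SUM t:?Y. if m s t = u then alg_add P x x' s * y t else 0)"
  by (rule mult_app) (use f in "auto simp: add_app")
 have 2: "alg_mult P x y u = (SUM s:?X. SUM t:?Y. if m s t = u then x s * y t else 0)"
  by (rule mult_app) (use f in auto)
 have 3: "alg_mult P x' y u = (SUM s:?X. SUM t:?Y. if m s t = u then x' s * y t else 0)"
  by (rule mult_app) (use f in auto)
 show "alg_mult P (alg_add P x x') y u = alg_add P (alg_mult P x y) (alg_mult P x' y) u"
  unfolding add_app[of "alg_mult P x y"] 1 2 3 sum.distrib[symmetric]
  by (intro sum.cong refl) (simp add: add_app algebra_simps)
qed

lemma mult_add_r: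
 assumes "x : carrier P" "y : carrier P" "y' : carrier P"
 shows "alg_mult P x (alg_add P y y') = alg_add P (alg_mult P x y) (alg_mult P x y')"
proof
 fix u
 let ?X = "{s. x s ~= 0}" and ?Y = "{t. y t ~= 0} \<union> {s. y' s ~= 0}"
 have f: "finite ?X" "finite ?Y" using assms by (auto simp: carrier_iff)
 have 1: "alg_mult P x (alg_add P y y') u = (SUM s:?X. SUM t:?Y. if m s t = u then x s * alg_add P y y' t else 0)"
  by (rule mult_app) (use f in "auto simp: add_app")
 have 2: "alg_mult P x y u = (SUM s:?X. SUM t:?Y. if m s t = u then x s * y t else 0)"
  by (rule mult_app) (use f in auto)
 have 3: "alg_mult P x y' u = (SUM s:?X. SUM t:?Y. if m s t = u then x s * y' t else 0)"
  by (rule mult_app) (use f in auto)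
 show "alg_mult P x (alg_add P y y') u = alg_add P (alg_mult P x y) (alg_mult P x y') u"
  unfolding add_app[of "alg_mult P x y"] 1 2 3 sum.distrib[symmetric]
  by (intro sum.cong refl) (simp add: add_app algebra_simps)
qed

lemma mult_scale_l:
 assumes "x : carrier P" "y : carrier P"
 shows "alg_mult P (alg_scale P c x) y = alg_scale P c (alg_mult P x y)"
proof
 fix u
 let ?X = "{s. x s ~= 0}" and ?Y = "{t. y t ~= 0}"
 have f: "finite ?X" "finite ?Y" using assms by (auto simp: carrier_iff)
 have 1: "alg_mult P (alg_scale P c x) y u = (SUM s:?X. SUM t:?Y. if m s t = u then alg_scale P c x s * y t else 0)"
  by (rule mult_app) (use f in "auto simp: scale_app")
 have 2: "alg_mult P x y u = (SUM s:?X. SUM t:?Y. if m s t = u then x s * y t else 0)"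
  by (rule mult_app) (use f in auto)
 show "alg_mult P (alg_scale P c x) y u = alg_scale P c (alg_mult P x y) u"
  unfolding scale_app[of _ "alg_mult P x y"] 1 2 sum_distrib_left
  by (intro sum.cong refl) (simp add: scale_app)
qed

lemma mult_scale_r:
 assumes "x : carrier P" "y : carrier P"
 shows "alg_mult P x (alg_scale P c y) = alg_scale P c (alg_mult P x y)"
proof
 fix u
 let ?X = "{s. x s ~= 0}" and ?Y = "{t. y t ~= 0}"
 have f: "finite ?X" "finite ?Y" using assms by (auto simp: carrier_iff)
 have 1: "alg_mult P x (alg_scale P c y) u = (SUM s:?X. SUM t:?Y. if m s t = u then x s * alg_scale P c y t else 0)"
  by (rule mult_app) (use f in "auto simp: scale_app")
 have 2: "alg_mult P x y u = (SUM s:?X. SUM t:?Y. if m s t = u then x s * y t else 0)"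
  by (rule mult_app) (use f in auto)
 show "alg_mult P x (alg_scale P c y) u = alg_scale P c (alg_mult P x y) u"
  unfolding scale_app[of _ "alg_mult P x y"] 1 2 sum_distrib_left
  by (intro sum.cong refl) (simp add: scale_app)
qed

lemma star_add':
 assumes "x : carrier P" "x' : carrier P"
 shows "alg_star P (alg_add P x x') = alg_add P (alg_star P x) (alg_star P x')"
proof
 fix u
 let ?X = "{s. x s ~= 0} \<union> {s. x' s ~= 0}"
 have f: "finite ?X" using assms by (auto simp: carrier_iff)
 have 1: "alg_star P (alg_add P x x') u = (SUM s:?X. if i s = u then cnj (alg_add P x x' s) else 0)"
  by (rule star_app) (use f in "auto simp: add_app")
 have 2: "alg_star P x u = (SUM s:?X. if i s = u then cnj (x s) else 0)"
  by (rule star_app) (use f in auto)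
 have 3: "alg_star P x' u = (SUM s:?X. if i s = u then cnj (x' s) else 0)"
  by (rule star_app) (use f in auto)
 show "alg_star P (alg_add P x x') u = alg_add P (alg_star P x) (alg_star P x') u"
  unfolding add_app[of "alg_star P x"] 1 2 3 sum.distrib[symmetric]
  by (intro sum.cong refl) (simp add: add_app)
qed

lemma star_scale':
 assumes "x : carrier P"
 shows "alg_star P (alg_scale P c x) = alg_scale P (cnj c) (alg_star P x)"
proof
 fix u
 let ?X = "{s. x s ~= 0}"
 have f: "finite ?X" using assms by (auto simp: carrier_iff)
 have 1: "alg_star P (alg_scale P c x) u = (SUM s:?X. if i s = u then cnj (alg_scale P c x s) else 0)"
  by (rule star_app) (use f in "auto simp: scale_app")
 have 2: "alg_star P x u = (SUM s:?X. if i s = u then cnj (x s) else 0)"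
  by (rule star_app) (use f in auto)
 show "alg_star P (alg_scale P c x) u = alg_scale P (cnj c) (alg_star P x) u"
  unfolding scale_app[of _ "alg_star P x"] 1 2 sum_distrib_left
  by (intro sum.cong refl) (simp add: scale_app)
qed

lemma zero_mult': "y : carrier P ==> alg_mult P (alg_zero P) y = alg_zero P"
 using mult_scale_l[OF zero_cl, of y 0] by (simp add: scale_app zero_app)

lemma mult_zero': "y : carrier P ==> alg_mult P y (alg_zero P) = alg_zero P"
 using mult_scale_r[OF _ zero_cl, of y 0] by (simp add: scale_app zero_app)

lemma star_zero': "alg_star P (alg_zero P) = alg_zero P"
 using star_scale'[OF zero_cl, of 0] by (simp add: scale_app zero_app)

lemma scale_zero': "alg_scale P c (alg_zero P) = alg_zero P"
 by (simp add: scale_app zero_app)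

lemma delta_mult: "alg_mult P (delta s) (delta t) = delta (m s t)"
proof
 fix u
 have "alg_mult P (delta s) (delta t) u
   = (SUM s':{s}. SUM t':{t}. if m s' t' = u then delta s s' * delta t t' else 0)"
  by (rule mult_app) (auto simp: delta_def)
 then show "alg_mult P (delta s) (delta t) u = delta (m s t) u" by (auto simp: delta_def)
qed

lemma delta_star: "alg_star P (delta s) = delta (i s)"
proof
 fix u
 have "alg_star P (delta s) u = (SUM s':{s}. if i s' = u then cnj (delta s s') else 0)"
  by (rule star_app) (auto simp: delta_def)
 then show "alg_star P (delta s) u = delta (i s) u" by (auto simp: delta_def)
qed

text \<open>Induction over the support of \<open>x\<close>. The step keeps the information that the
  added basis element occurs in \<open>x\<close>, which later bounds its degree.\<close>

lemma alg_induct_support [consumes 1, case_names zero step]: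
 assumes x: "x : carrier P" and zero: "Q (alg_zero P)"
  and step: "!!y c s. [|y : carrier P; s : S; x s ~= 0; Q y|] ==> Q (alg_add P y (alg_scale P c (delta s)))"
 shows "Q x"
proof -
 have "Q (%u. if u : F then x u else 0) & (%u. if u : F then x u else 0) : carrier P"
  if "finite F" "F \<subseteq> {s. x s ~= 0}" for F
  using that
 proof (induction F rule: finite_induct)
  case empty then show ?case using zero by (simp add: zero_app carrier_iff)
 next
  case (insert s F)
  let ?y = "%u. if u : F then x u else 0"
  have e: "(%u. if u : insert s F then x u else 0) = alg_add P ?y (alg_scale P (x s) (delta s))"
   using insert by (auto simp: fun_eq_iff add_app scale_app delta_def)
  have s: "s : S" "x s ~= 0" using x insert unfolding carrier_iff by auto
  show ?case unfolding e using step[of ?y s] s insert by (auto intro: cl)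
 qed
 from this[of "{s. x s ~= 0}"] x have "Q (%u. if u : {s. x s ~= 0} then x u else 0)" by (simp add: carrier_iff)
 moreover have "(%u. if u : {s. x s ~= 0} then x u else 0) = x" by auto
 ultimately show ?thesis by simp
qed


lemma mult_assoc':
 assumes x: "x : carrier P" and y: "y : carrier P" and z: "z : carrier P"
 shows "alg_mult P (alg_mult P x y) z = alg_mult P x (alg_mult P y z)"
proof -
 have 1: "alg_mult P (alg_mult P (delta s) (delta t)) z = alg_mult P (delta s) (alg_mult P (delta t) z)"
  if st: "s : S" "t : S" for s t
  using z
 proof (induction rule: alg_induct_support)
  case zero then show ?case using st by (simp add: mult_zero' cl)
 next
  case (step z c u) then show ?case using st 
   by (simp add: mult_add_r mult_scale_r cl delta_mult m_assoc)
 qed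
 have 2: "alg_mult P (alg_mult P (delta s) y) z = alg_mult P (delta s) (alg_mult P y z)" if s: "s : S" for s
  using y
 proof (induction rule: alg_induct_support)
  case zero then show ?case using s z by (simp add: mult_zero' zero_mult' cl)
 next
  case (step y c u) then show ?case using s z 
   by (simp add: mult_add_r mult_scale_r mult_add_l mult_scale_l cl 1)
 qed
 show ?thesis
  using x
 proof (induction rule: alg_induct_support)
  case zero then show ?case using y z by (simp add: mult_zero' zero_mult' cl)
 next
  case (step x c u) then show ?case using y z 
   by (simp add: mult_add_l mult_scale_l cl 2)
 qed
qed

lemma star_mult':
 assumes x: "x : carrier P" and y: "y : carrier P"
 shows "alg_star P (alg_mult P x y) = alg_mult P (alg_star P y) (alg_star P x)"
proof -
 have 1: "alg_star P (alg_mult P (delta s) y) = alg_mult P (alg_star P y) (alg_star P (delta s))" if s: "s : S" for s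
  using y
 proof (induction rule: alg_induct_support)
  case zero then show ?case using s by (simp add: mult_zero' zero_mult' star_zero' cl)
 next
  case (step y c u) then show ?case using s
   by (simp add: mult_add_r mult_scale_r mult_add_l mult_scale_l star_add' star_scale' cl delta_mult delta_star i_m i_closed)
 qed
 show ?thesis
  using x
 proof (induction rule: alg_induct_support)
  case zero then show ?case using y by (simp add: mult_zero' zero_mult' star_zero' cl)
 next
  case (step x c u) then show ?case using y
   by (simp add: mult_add_l mult_add_r mult_scale_l mult_scale_r star_add' star_scale' cl 1)
 qed
qed

lemma star_star':
 assumes "x : carrier P" shows "alg_star P (alg_star P x) = x"
 using assms
proof (induction rule: alg_induct_support)
 case zero then show ?case by (simp add: star_zero')
next
 case (step x c u) then show ?case by (simp add: star_add' star_scale' cl delta_star i_i)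
qed

lemma star_algebra_P: "star_algebra P"
proof unfold_locales
 show "alg_diff P x x = alg_zero P" for x by (simp add: alg_diff_def add_app scale_app zero_app)
qed (simp_all add: cl mult_add_l mult_add_r mult_scale_l mult_scale_r star_add' star_scale' star_mult' star_star' mult_assoc',
 simp_all add: add_app scale_app zero_app algebra_simps)

sublocale star_algebra P
 by (rule star_algebra_P)

text \<open>A multiplicative and *-preserving map of the basis extends linearly. Homomorphisms out
  of free algebras and out of algebraic tensor products are both built this way.\<close>

lemma hom_extension:
 assumes D: "star_algebra D" and T: "!!s. s : S ==> T s : carrier D"
  and T_mult: "!!s t. [|s : S; t : S|] ==> T (m s t) = alg_mult D (T s) (T t)"
  and T_star: "!!s. s : S ==> T (i s) = alg_star D (T s)"
 shows "EX \<phi>. star_hom P D \<phi> & (ALL s:S. \<phi> (delta s) = T s)"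
proof -
 interpret D: star_algebra D by (rule D)
 \<comment> \<open>Addition is presented as a commutative monoid, so that finite sums in the carrier
   of \<open>D\<close> become products \<open>finprod\<close>.\<close>
 let ?G = "\<lparr>carrier = carrier D, monoid.mult = alg_add D, one = alg_zero D\<rparr>"
 interpret G: comm_monoid ?G
  by (rule comm_monoidI) (simp_all add: D.closed D.add_ac D.zero_add D.add_zero)
 define \<phi> where "\<phi> x = finprod ?G (%s. alg_scale D (x s) (T s)) {s. x s ~= 0}" for x
 have sup: "\<phi> x = finprod ?G (%s. alg_scale D (x s) (T s)) X"
  if "finite X" "{s. x s ~= 0} \<subseteq> X" "X \<subseteq> S" for x X
  unfolding \<phi>_def using that T
  by (intro G.finprod_mono_neutral_cong_left) (auto simp: D.scale_zero_left D.closed)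
 have \<phi>_closed: "\<phi> x : carrier D" if "x : carrier P" for x
  using G.finprod_closed[of "%s. alg_scale D (x s) (T s)" "{s. x s ~= 0}"] that T
  unfolding \<phi>_def carrier_iff by (auto simp: D.closed Pi_iff subset_iff)
 have \<phi>_add: "\<phi> (alg_add P x y) = alg_add D (\<phi> x) (\<phi> y)" if "x : carrier P" "y : carrier P" for x y
 proof -
  let ?X = "{s. x s ~= 0} \<union> {s. y s ~= 0}"
  have X: "finite ?X" "?X \<subseteq> S" using that unfolding carrier_iff by auto
  have TX: "T s : carrier D" if "s : ?X" for s using X(2) T that by blast
  have "\<phi> (alg_add P x y) = finprod ?G (%s. alg_scale D (alg_add P x y s) (T s)) ?X"
   by (rule sup) (use X in "auto simp: add_app")
  also have "... = finprod ?G (%s. alg_add D (alg_scale D (x s) (T s)) (alg_scale D (y s) (T s))) ?X"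
   by (intro G.finprod_cong') (auto simp: TX add_app D.scale_add_left D.closed)
  also have "... = alg_add D (finprod ?G (%s. alg_scale D (x s) (T s)) ?X) (finprod ?G (%s. alg_scale D (y s) (T s)) ?X)"
   using G.finprod_multf[of "%s. alg_scale D (x s) (T s)" ?X "%s. alg_scale D (y s) (T s)"]
   by (auto simp: TX D.closed)
  also have "... = alg_add D (\<phi> x) (\<phi> y)"
   using sup[of ?X x] sup[of ?X y] X by simp
  finally show ?thesis .
 qed
 have \<phi>_delta: "\<phi> (alg_scale P c (delta s)) = alg_scale D c (T s)" if "s : S" for c s
 proof -
  have "{u. alg_scale P c (delta s) u ~= 0} \<subseteq> {s}" by (auto simp: scale_app delta_def split: if_splits)
  from sup[OF _ this] that T[OF that] show ?thesis
   by (simp add: scale_app delta_def D.closed D.add_zero)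
 qed
 have \<phi>_delta1: "\<phi> (delta s) = T s" if "s : S" for s
  using \<phi>_delta[OF that, of 1] T[OF that] by (simp add: scale_one delta_cl that D.scale_one)
 have \<phi>_zero: "\<phi> (alg_zero P) = alg_zero D" by (simp add: \<phi>_def zero_app)
 note rules = mult_add_left mult_add_right mult_scale_left mult_scale_right star_add star_scale
  scale_add_right scale_scale cl
  D.mult_add_left D.mult_add_right D.mult_scale_left D.mult_scale_right D.star_add D.star_scale D.closed
  D.scale_add_right D.scale_scale \<phi>_closed \<phi>_add \<phi>_delta \<phi>_delta1 T
 have \<phi>_scale: "\<phi> (alg_scale P c x) = alg_scale D c (\<phi> x)" if "x : carrier P" for c x
  using that
 proof (induction rule: alg_induct_support)
  case zero then show ?case by (simp add: scale_zero' \<phi>_zero D.scale_zero_right)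
 qed (simp add: rules)
 have \<phi>_mult1: "\<phi> (alg_mult P (delta s) y) = alg_mult D (T s) (\<phi> y)" if y: "y : carrier P" and s: "s : S" for s y
  using y
 proof (induction rule: alg_induct_support)
  case zero then show ?case by (simp add: mult_zero' \<phi>_zero D.mult_zero_right T s cl)
 next
  case (step y c t) then show ?case by (simp add: rules s delta_mult \<phi>_delta[OF m_closed] T_mult)
 qed
 have \<phi>_mult: "\<phi> (alg_mult P x y) = alg_mult D (\<phi> x) (\<phi> y)" if x: "x : carrier P" and y: "y : carrier P" for x y
  using x
 proof (induction rule: alg_induct_support)
  case zero then show ?case by (simp add: zero_mult' \<phi>_zero D.mult_zero_left y \<phi>_closed)
 next
  case (step x c t) then show ?case by (simp add: rules y \<phi>_scale \<phi>_mult1)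
 qed
 have \<phi>_star: "\<phi> (alg_star P x) = alg_star D (\<phi> x)" if x: "x : carrier P" for x
  using x
 proof (induction rule: alg_induct_support)
  case zero then show ?case by (simp add: star_zero' \<phi>_zero D.star_zero)
 next
  case (step x c t) then show ?case by (simp add: rules \<phi>_delta[OF i_closed] delta_star T_star)
 qed
 have "star_hom P D \<phi>"
  unfolding star_hom_def using \<phi>_closed \<phi>_add \<phi>_scale \<phi>_mult \<phi>_star by simp
 then show ?thesis using \<phi>_delta1 by blast
qed

lemma alg_sum_closed:
 assumes "finite J" "!!j. j : J ==> y j : carrier P"
 shows "(%u. SUM j:J. y j u) : carrier P"
 using assms
proof (induction J rule: finite_induct)
 case empty then show ?case using zero_cl by (simp add: zero_app)
next
 case (insert j J)
 then show ?case using add_cl[of "y j" "%u. SUM j:J. y j u"] by (simp add: add_app)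
qed

lemma seminorm_sum:
 assumes q: "cstar_seminorm P q" and "finite J" "!!j. j : J ==> y j : carrier P"
 shows "q (%u. SUM j:J. y j u) <= (SUM j:J. q (y j))"
 using assms(2,3)
proof (induction J rule: finite_induct)
 case empty
 interpret q: seminormed_algebra P q by unfold_locales (rule q)
 show ?case using q.q_zero by (simp add: zero_app)
next
 case (insert j J)
 interpret q: seminormed_algebra P q by unfold_locales (rule q)
 show ?case using q.q_add[of "y j" "%u. SUM j:J. y j u"] insert alg_sum_closed[of J y] by (simp add: add_app)
qed

end

subsection \<open>Free algebras\<close>

abbreviation flip :: "('g \<times> bool) list => ('g \<times> bool) list" where
 "flip w \<equiv> rev (map (%(g, b). (g, ~ b)) w)"

lemma star_semigroup_words: "star_semigroup (lists (G \<times> UNIV)) (@) flip"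
proof unfold_locales
 fix s :: "('a \<times> bool) list" show "s : lists (G \<times> UNIV) ==> flip s : lists (G \<times> UNIV)"
  by (auto simp: in_lists_conv_set)
 show "flip (flip s) = s" by (simp add: rev_map[symmetric] comp_def case_prod_unfold)
qed auto

text \<open>The universal property of the free unital *-algebra. The unit \<open>e\<close> is
  selfadjoint because the star of a unit is again a unit; this makes the empty word consistent with
  the involution.\<close>

lemma free_hom:
 assumes D: "star_algebra D" and e: "e : carrier D"
  and unit: "!!x. x : carrier D ==> alg_mult D e x = x" "!!x. x : carrier D ==> alg_mult D x e = x"
  and \<tau>: "!!g. g : G ==> \<tau> g : carrier D"
 shows "EX \<phi>. star_hom (free_star_alg G) D \<phi> & \<phi> free_one = e & (ALL g:G. \<phi> (free_gen g) = \<tau> g)"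
proof -
 interpret D: star_algebra D by (rule D)
 interpret W: star_semigroup "lists (G \<times> UNIV)" "(@)" flip by (rule star_semigroup_words)
 define L where "L = (%(g, b). if b then alg_star D (\<tau> g) else \<tau> g)"
 define T where "T w = foldr (%l. alg_mult D (L l)) w e" for w
 have L: "L l : carrier D" if "l : G \<times> UNIV" for l
  using that \<tau> by (auto simp: L_def D.closed)
 have T: "T w : carrier D" if "w : lists (G \<times> UNIV)" for w
  using that by (induction w) (auto simp: T_def e L D.closed)
 have star_e: "alg_star D e = e"
  using unit(2)[of "alg_star D e"] D.star_mult[of "alg_star D e" e] unit(1)[of e] e
  by (metis D.star_closed D.star_star unit(2))
 have app: "T (v @ w) = alg_mult D (T v) (T w)" if "v : lists (G \<times> UNIV)" "w : lists (G \<times> UNIV)" for v w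
  using that
 proof (induction v)
  case Nil then show ?case using T by (simp add: T_def unit)
 next
  case (Cons l v)
  then have "alg_mult D (L l) (alg_mult D (T v) (T w)) = alg_mult D (alg_mult D (L l) (T v)) (T w)"
   using T L by (simp add: D.mult_assoc)
  then show ?case using Cons by (simp add: T_def)
 qed
 have star: "T (flip w) = alg_star D (T w)" if "w : lists (G \<times> UNIV)" for w
  using that
 proof (induction w)
  case Nil then show ?case by (simp add: T_def star_e)
 next
  case (Cons l w)
  obtain g b where l: "l = (g, b)" by force
  have fl: "flip w : lists (G \<times> UNIV)" using Cons W.i_closed by blast
  have g: "g : G" using Cons l by auto
  have "T (flip (l # w)) = alg_mult D (T (flip w)) (T [(g, ~ b)])"
   using app[OF fl, of "[(g, ~ b)]"] g l by simp
  also have "T [(g, ~ b)] = alg_star D (L l)"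
   using \<tau>[OF g] by (auto simp: T_def L_def l unit D.closed D.star_star)
  also have "T (flip w) = alg_star D (T w)" using Cons by simp
  finally show ?case using Cons T[of w] L[of l] by (simp add: D.star_mult T_def)
 qed
 obtain \<phi> where \<phi>: "star_hom (free_star_alg G) D \<phi>" "!!w. w : lists (G \<times> UNIV) ==> \<phi> (delta w) = T w"
  using W.hom_extension[OF D T app star] unfolding free_star_alg_def by blast
 have "\<phi> free_one = e" using \<phi>(2)[of "[]"] by (simp add: free_one_def T_def)
 moreover have "\<phi> (free_gen g) = \<tau> g" if "g : G" for g
  using \<phi>(2)[of "[(g, False)]"] that \<tau>[OF that] by (simp add: free_gen_def T_def L_def unit)
 ultimately show ?thesis using \<phi>(1) by blast
qed

subsection \<open>Tensor products\<close>

lemma star_semigroup_pairs: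
 assumes "star_algebra A" "star_algebra B"
 shows "star_semigroup (carrier A \<times> carrier B)
   (%(a, b) (a', b'). (alg_mult A a a', alg_mult B b b')) (%(a, b). (alg_star A a, alg_star B b))"
proof -
 interpret A: star_algebra A by (rule assms)
 interpret B: star_algebra B by (rule assms)
 show ?thesis
  by unfold_locales
   (auto simp: A.closed B.closed A.mult_assoc B.mult_assoc A.star_star B.star_star A.star_mult B.star_mult)
qed

section \<open>Bounded operators on sequence spaces\<close>

abbreviation l2 :: "('i => complex) => 'i set => real" where
 "l2 x F \<equiv> L2_set (%i. cmod (x i)) F"

lemma l2_power2: "(l2 x F)\<^sup>2 = (SUM i:F. (cmod (x i))\<^sup>2)"
 by (simp add: L2_set_def sum_nonneg)

text \<open>Membership and norm bound both come from uniform bounds on finite sections, the form in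
  which shifts, adjoints and limits are estimated later.\<close>

lemma ell2I:
 assumes "!!i. i ~: I ==> x i = 0" "0 <= K" "!!F. [|finite F; F \<subseteq> I|] ==> l2 x F <= K"
 shows "x : ell2 I" "ell2_norm I x <= K"
proof -
 have le: "(SUM i:F. (cmod (x i))\<^sup>2) <= K\<^sup>2" if "finite F" "F \<subseteq> I" for F
  using power_mono[OF assms(3)[OF that], of 2] by (simp add: l2_power2)
 have s: "(%i. (cmod (x i))\<^sup>2) summable_on I"
 proof (rule nonneg_bdd_above_summable_on)
  show "bdd_above (sum (%i. (cmod (x i))\<^sup>2) ` {F. F \<subseteq> I & finite F})"
   by (rule bdd_aboveI[of _ "K\<^sup>2"]) (use le in blast)
 qed simp
 then show "x : ell2 I" using assms(1) by (simp add: ell2_def)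
 have "(\<Sum>\<^sub>\<infinity>i\<in>I. (cmod (x i))\<^sup>2) <= K\<^sup>2" by (rule infsum_le_finite_sums[OF s le])
 then show "ell2_norm I x <= K" using assms(2) by (simp add: ell2_norm_def real_le_lsqrt)
qed

lemma ell2_vanish: "[|x : ell2 I; i ~: I|] ==> x i = 0"
 by (simp add: ell2_def)

lemma ell2_summable: "x : ell2 I ==> (%i. (cmod (x i))\<^sup>2) summable_on I"
 by (simp add: ell2_def)

lemma ell2_norm_nonneg: "0 <= ell2_norm I x"
 by (simp add: ell2_norm_def infsum_nonneg)

lemma l2_le_norm:
 assumes "x : ell2 I" "finite F" "F \<subseteq> I" shows "l2 x F <= ell2_norm I x"
 unfolding L2_set_def ell2_norm_def
 by (intro real_sqrt_le_mono finite_sum_le_infsum ell2_summable assms) simp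

lemma cmod_le_ell2_norm:
 assumes "x : ell2 I" shows "cmod (x i) <= ell2_norm I x"
proof (cases "i : I")
 case True then show ?thesis using l2_le_norm[OF assms, of "{i}"] by simp
next
 case False then show ?thesis using ell2_vanish[OF assms] ell2_norm_nonneg by simp
qed

lemma l2_triangle: "l2 (%i. x i + y i) F <= l2 x F + l2 y F"
proof -
 have "l2 (%i. x i + y i) F <= L2_set (%i. cmod (x i) + cmod (y i)) F"
  by (intro L2_set_mono norm_triangle_ineq) simp
 also have "... <= l2 x F + l2 y F" by (rule L2_set_triangle_ineq)
 finally show ?thesis .
qed

lemma ell2_add:
 assumes "x : ell2 I" "y : ell2 I"
 shows "(%i. x i + y i) : ell2 I" "ell2_norm I (%i. x i + y i) <= ell2_norm I x + ell2_norm I y"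
proof -
 have le: "l2 (%i. x i + y i) F <= ell2_norm I x + ell2_norm I y" if "finite F" "F \<subseteq> I" for F
  using l2_triangle[of x y F] l2_le_norm[OF assms(1) that] l2_le_norm[OF assms(2) that] by linarith
 show "(%i. x i + y i) : ell2 I" "ell2_norm I (%i. x i + y i) <= ell2_norm I x + ell2_norm I y"
  by (rule ell2I[OF _ _ le], (simp add: ell2_vanish[OF assms(1)] ell2_vanish[OF assms(2)] ell2_norm_nonneg)+)+
qed

lemma ell2_scale: "x : ell2 I ==> (%i. c * x i) : ell2 I"
 by (simp add: ell2_def norm_mult power_mult_distrib summable_on_cmult_right)

lemma ell2_norm_scale: "ell2_norm I (%i. c * x i) = cmod c * ell2_norm I x"
 by (simp add: ell2_norm_def norm_mult power_mult_distrib infsum_cmult_right' real_sqrt_mult)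

lemma ell2_zero: "(%i. 0) : ell2 I"
 by (simp add: ell2_def)

lemma ell2_norm_zero: "ell2_norm I (%i. 0) = 0"
 by (simp add: ell2_norm_def)

lemma ell2_norm_eq_0: "[|x : ell2 I; ell2_norm I x <= 0|] ==> x = (%i. 0)"
 using cmod_le_ell2_norm[of x I] by (metis ext norm_le_zero_iff order_trans)

lemma ell2_diff: "[|x : ell2 I; y : ell2 I|] ==> (%i. x i - y i) : ell2 I"
 using ell2_add(1)[OF _ ell2_scale[of y I "-1"], of x] by simp

lemma basis_ell2: "k : I ==> basis_vec k : ell2 I"
proof (rule ell2I(1)[where K = 1])
 fix F assume "finite F" "F \<subseteq> I"
 have "(SUM i:F. (cmod (basis_vec k i))\<^sup>2) = (SUM i:F. if i = k then 1 else 0)"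
  by (intro sum.cong) (auto simp: basis_vec_def)
 also have "... <= 1" using \<open>finite F\<close> by simp
 finally show "l2 (basis_vec k) F <= 1" by (simp add: L2_set_def)
qed (auto simp: basis_vec_def)

lemma inner_abs_summable:
 assumes "x : ell2 I" "y : ell2 I"
 shows "(%i. cmod (x i * cnj (y i))) summable_on I"
  and "cmod (ell2_inner I x y) <= ell2_norm I x * ell2_norm I y"
proof -
 have le: "(SUM i:F. cmod (x i * cnj (y i))) <= ell2_norm I x * ell2_norm I y" if "finite F" "F \<subseteq> I" for F
 proof -
  have "(SUM i:F. cmod (x i * cnj (y i))) = (SUM i:F. \<bar>cmod (x i)\<bar> * \<bar>cmod (y i)\<bar>)" by (simp add: norm_mult)
  also have "... <= l2 x F * l2 y F" by (rule L2_set_mult_ineq)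
  also have "... <= ell2_norm I x * ell2_norm I y"
   by (intro mult_mono l2_le_norm assms that ell2_norm_nonneg L2_set_nonneg)
  finally show ?thesis .
 qed
 show s: "(%i. cmod (x i * cnj (y i))) summable_on I"
 proof (rule nonneg_bdd_above_summable_on)
  show "bdd_above (sum (%i. cmod (x i * cnj (y i))) ` {F. F \<subseteq> I & finite F})"
   by (rule bdd_aboveI[of _ "ell2_norm I x * ell2_norm I y"]) (use le in blast)
 qed simp
 have "cmod (ell2_inner I x y) <= (\<Sum>\<^sub>\<infinity>i\<in>I. cmod (x i * cnj (y i)))"
  unfolding ell2_inner_def by (rule norm_infsum_bound[OF s])
 also have "... <= ell2_norm I x * ell2_norm I y" by (rule infsum_le_finite_sums[OF s le])
 finally show "cmod (ell2_inner I x y) <= ell2_norm I x * ell2_norm I y" .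
qed

lemma inner_summable: "[|x : ell2 I; y : ell2 I|] ==> (%i. x i * cnj (y i)) summable_on I"
 by (rule abs_summable_summable[OF inner_abs_summable(1)])

lemma inner_cnj: "ell2_inner I y x = cnj (ell2_inner I x y)"
 unfolding ell2_inner_def infsum_cnj[symmetric] by (simp add: mult.commute)

lemma inner_add_left:
 "[|x : ell2 I; y : ell2 I; z : ell2 I|]
  ==> ell2_inner I (%i. x i + y i) z = ell2_inner I x z + ell2_inner I y z"
 unfolding ell2_inner_def by (simp add: infsum_add[symmetric] inner_summable algebra_simps)

lemma inner_scale_left: "ell2_inner I (%i. c * x i) z = c * ell2_inner I x z"
 unfolding ell2_inner_def by (simp add: infsum_cmult_right'[symmetric] algebra_simps)

lemma inner_add_right:
 "[|x : ell2 I; y : ell2 I; z : ell2 I|]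
  ==> ell2_inner I z (%i. x i + y i) = ell2_inner I z x + ell2_inner I z y"
 by (simp add: inner_cnj[of I z] inner_add_left)

lemma inner_scale_right: "ell2_inner I z (%i. c * x i) = cnj c * ell2_inner I z x"
 by (simp add: inner_cnj[of I z] inner_scale_left)

lemma inner_basis: 
 assumes "k : I" shows "ell2_inner I x (basis_vec k) = x k"
proof -
 have "ell2_inner I x (basis_vec k) = infsum (%i. x i) {k}"
  unfolding ell2_inner_def by (rule infsum_cong_neutral) (use assms in "auto simp: basis_vec_def")
 then show ?thesis by simp
qed

lemma inner_self: 
 assumes "x : ell2 I" shows "cmod (ell2_inner I x x) = (ell2_norm I x)\<^sup>2"
proof -
 have "((%i. (cmod (x i))\<^sup>2) has_sum (\<Sum>\<^sub>\<infinity>i\<in>I. (cmod (x i))\<^sup>2)) I"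
  by (rule has_sum_infsum[OF ell2_summable[OF assms]])
 then have "((%F. complex_of_real (SUM i:F. (cmod (x i))\<^sup>2)) \<longlongrightarrow> complex_of_real (\<Sum>\<^sub>\<infinity>i\<in>I. (cmod (x i))\<^sup>2)) (finite_subsets_at_top I)"
  unfolding has_sum_def by (rule tendsto_of_real)
 then have "((%i. x i * cnj (x i)) has_sum complex_of_real (\<Sum>\<^sub>\<infinity>i\<in>I. (cmod (x i))\<^sup>2)) I"
  unfolding has_sum_def by (simp add: complex_norm_square[symmetric])
 then have "ell2_inner I x x = complex_of_real (\<Sum>\<^sub>\<infinity>i\<in>I. (cmod (x i))\<^sup>2)"
  unfolding ell2_inner_def by (rule infsumI)
 then show ?thesis by (simp add: ell2_norm_def infsum_nonneg)
qed

section \<open>The operator norm, adjoints and completeness of bounded operators\<close>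

abbreviation opnorm :: "'i set => (('i => complex) => 'i => complex) => real" where
 "opnorm I T \<equiv> alg_norm (op_alg I) T"

lemma bounded_opsD:
 assumes "T : bounded_ops I"
 shows "x : ell2 I ==> T x : ell2 I"
  and "[|x : ell2 I; y : ell2 I|] ==> T (%i. x i + y i) = (%i. T x i + T y i)"
  and "x : ell2 I ==> T (%i. c * x i) = (%i. c * T x i)"
  and "x ~: ell2 I ==> T x = (%i. 0)"
  and "EX K. ALL x:ell2 I. ell2_norm I (T x) <= K * ell2_norm I x"
 using assms by (simp_all add: bounded_ops_def)

lemma bounded_opsI:
 assumes "!!x. x : ell2 I ==> T x : ell2 I"
  and "!!x y. [|x : ell2 I; y : ell2 I|] ==> T (%i. x i + y i) = (%i. T x i + T y i)"
  and "!!x c. x : ell2 I ==> T (%i. c * x i) = (%i. c * T x i)"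
  and "!!x. x ~: ell2 I ==> T x = (%i. 0)"
  and "!!x. x : ell2 I ==> ell2_norm I (T x) <= K * ell2_norm I x"
 shows "T : bounded_ops I"
 unfolding bounded_ops_def using assms by blast

lemma bounded_op_zero: "T : bounded_ops I ==> T (%i. 0) = (%i. 0)"
 using bounded_opsD(3)[OF _ ell2_zero, of T I 0] by simp

lemma bounded_op_ell2: "T : bounded_ops I ==> T x : ell2 I"
 using bounded_opsD(1)[of T I x] bounded_opsD(4)[of T I x] ell2_zero[of I] by (cases "x : ell2 I") simp_all

lemma opnorm_eq: "opnorm I T = (SUP x\<in>{x : ell2 I. ell2_norm I x <= 1}. ell2_norm I (T x))"
 by (simp add: op_alg_def)

lemma opnorm_bdd: 
 assumes "T : bounded_ops I"
 shows "bdd_above ((%x. ell2_norm I (T x)) ` {x : ell2 I. ell2_norm I x <= 1})"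
proof -
 obtain K where K: "!!x. x : ell2 I ==> ell2_norm I (T x) <= K * ell2_norm I x"
  using bounded_opsD(5)[OF assms] by blast
 show ?thesis
 proof (rule bdd_aboveI2[of _ _ "\<bar>K\<bar>"])
  fix x assume x: "x : {x : ell2 I. ell2_norm I x <= 1}"
  have "ell2_norm I (T x) <= K * ell2_norm I x" using K x by simp
  also have "... <= \<bar>K\<bar> * 1" using x ell2_norm_nonneg[of I x] by (intro mult_mono) auto
  finally show "ell2_norm I (T x) <= \<bar>K\<bar>" by simp
 qed
qed

lemma opnorm_nonneg:
 assumes "T : bounded_ops I" shows "0 <= opnorm I T"
proof -
 have "ell2_norm I (T (%i. 0)) <= opnorm I T"
  unfolding opnorm_eq by (rule cSUP_upper[OF _ opnorm_bdd[OF assms]]) (simp add: ell2_zero ell2_norm_zero)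
 then show ?thesis using ell2_norm_nonneg[of I "T (%i. 0)"] by simp
qed

lemma opnorm_bound:
 assumes T: "T : bounded_ops I" and x: "x : ell2 I"
 shows "ell2_norm I (T x) <= opnorm I T * ell2_norm I x"
proof (cases "ell2_norm I x = 0")
 case True
 then have "x = (%i. 0)" using ell2_norm_eq_0[OF x] by simp
 then show ?thesis using bounded_op_zero[OF T] by (simp add: ell2_norm_zero)
next
 case False
 then have n: "ell2_norm I x > 0" using ell2_norm_nonneg[of I x] by simp
 let ?c = "complex_of_real (inverse (ell2_norm I x))"
 have "ell2_norm I (%i. ?c * x i) = 1"
  using n unfolding ell2_norm_scale norm_of_real by (simp add: abs_of_pos)
 then have "ell2_norm I (T (%i. ?c * x i)) <= opnorm I T"
  unfolding opnorm_eq using ell2_scale[OF x, of ?c]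
  by (intro cSUP_upper[OF _ opnorm_bdd[OF T]]) simp
 then have "inverse (ell2_norm I x) * ell2_norm I (T x) <= opnorm I T"
  unfolding bounded_opsD(3)[OF T x] ell2_norm_scale norm_of_real using n by (simp add: abs_of_pos)
 then show ?thesis using n by (simp add: field_simps)
qed

lemma opnorm_le:
 assumes "0 <= K" "!!x. x : ell2 I ==> ell2_norm I (T x) <= K * ell2_norm I x"
 shows "opnorm I T <= K"
 unfolding opnorm_eq
proof (rule cSUP_least)
 show "{x : ell2 I. ell2_norm I x <= 1} ~= {}" using ell2_zero ell2_norm_zero[of I] by (auto intro!: exI[of _ "%i. 0"])
 fix x assume x: "x : {x : ell2 I. ell2_norm I x <= 1}"
 have "ell2_norm I (T x) <= K * ell2_norm I x" using assms(2) x by simp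
 also have "... <= K * 1" using x assms(1) by (intro mult_left_mono) auto
 finally show "ell2_norm I (T x) <= K" by simp
qed

lemma op_alg_simps:
 "carrier (op_alg I) = bounded_ops I" "alg_zero (op_alg I) = (%x i. 0)"
 "alg_add (op_alg I) S T = (%x i. S x i + T x i)" "alg_scale (op_alg I) c T = (%x i. c * T x i)"
 "alg_mult (op_alg I) S T = (%x. S (T x))"
 by (simp_all add: op_alg_def)

lemma op_add_closed:
 assumes S: "S : bounded_ops I" and T: "T : bounded_ops I"
 shows "(%x i. S x i + T x i) : bounded_ops I"
  and "opnorm I (%x i. S x i + T x i) <= opnorm I S + opnorm I T"
proof -
 have le: "ell2_norm I (%i. S x i + T x i) <= (opnorm I S + opnorm I T) * ell2_norm I x" if "x : ell2 I" for x
  using ell2_add(2)[OF bounded_op_ell2[OF S] bounded_op_ell2[OF T], of x x] opnorm_bound[OF S that] opnorm_bound[OF T that]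
  by (simp add: distrib_right)
 show "(%x i. S x i + T x i) : bounded_ops I"
  by (rule bounded_opsI[OF _ _ _ _ le])
   (simp_all add: ell2_add bounded_op_ell2[OF S] bounded_op_ell2[OF T] bounded_opsD(2,3,4)[OF S] bounded_opsD(2,3,4)[OF T] algebra_simps)
 show "opnorm I (%x i. S x i + T x i) <= opnorm I S + opnorm I T"
  by (rule opnorm_le[OF _ le]) (simp_all add: opnorm_nonneg S T)
qed

lemma op_scale_closed:
 assumes T: "T : bounded_ops I"
 shows "(%x i. c * T x i) : bounded_ops I"
  and "opnorm I (%x i. c * T x i) <= cmod c * opnorm I T"
proof -
 have le: "ell2_norm I (%i. c * T x i) <= (cmod c * opnorm I T) * ell2_norm I x" if "x : ell2 I" for x
  using mult_left_mono[OF opnorm_bound[OF T that], of "cmod c"] by (simp add: ell2_norm_scale mult.assoc)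
 show "(%x i. c * T x i) : bounded_ops I"
  by (rule bounded_opsI[OF _ _ _ _ le])
   (simp_all add: ell2_scale bounded_op_ell2[OF T] bounded_opsD(2,3,4)[OF T] algebra_simps)
 show "opnorm I (%x i. c * T x i) <= cmod c * opnorm I T"
  by (rule opnorm_le[OF _ le]) (simp_all add: opnorm_nonneg T)
qed

lemma op_scale_norm:
 assumes T: "T : bounded_ops I"
 shows "opnorm I (%x i. c * T x i) = cmod c * opnorm I T"
proof (cases "c = 0")
 case True
 then show ?thesis using op_scale_closed[OF T, of c] opnorm_nonneg[OF op_scale_closed(1)[OF T, of c]] by simp
next
 case False
 have "opnorm I (%x i. inverse c * (c * T x i)) <= cmod (inverse c) * opnorm I (%x i. c * T x i)"
  by (rule op_scale_closed(2)[OF op_scale_closed(1)[OF T]])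
 moreover have "(%x i. inverse c * (c * T x i)) = T" using False by (simp add: mult.assoc[symmetric])
 ultimately have "opnorm I T <= inverse (cmod c) * opnorm I (%x i. c * T x i)" by (simp only: norm_inverse)
 then have "cmod c * opnorm I T <= opnorm I (%x i. c * T x i)"
  using False by (simp add: field_simps)
 then show ?thesis using op_scale_closed(2)[OF T, of c] by simp
qed

lemma op_mult_closed:
 assumes S: "S : bounded_ops I" and T: "T : bounded_ops I"
 shows "(%x. S (T x)) : bounded_ops I"
  and "opnorm I (%x. S (T x)) <= opnorm I S * opnorm I T"
proof -
 have le: "ell2_norm I (S (T x)) <= (opnorm I S * opnorm I T) * ell2_norm I x" if "x : ell2 I" for x
  using opnorm_bound[OF S bounded_op_ell2[OF T], of x] mult_left_mono[OF opnorm_bound[OF T that] opnorm_nonneg[OF S]]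
  by (simp add: mult.assoc)
 show "(%x. S (T x)) : bounded_ops I"
  by (rule bounded_opsI[OF _ _ _ _ le])
   (simp_all add: bounded_op_ell2[OF S] bounded_op_ell2[OF T] bounded_opsD(2,3,4)[OF S] bounded_opsD(2,3,4)[OF T] bounded_op_zero[OF S])
 show "opnorm I (%x. S (T x)) <= opnorm I S * opnorm I T"
  by (rule opnorm_le[OF _ le]) (simp_all add: opnorm_nonneg S T)
qed

lemma op_zero_closed: "(%x i. 0) : bounded_ops I"
 by (rule bounded_opsI[where K = 0]) (simp_all add: ell2_zero ell2_norm_zero)

lemma op_inner_zero:
 assumes "x : ell2 I" "!!y. y : ell2 I ==> ell2_inner I y x = 0" shows "x = (%i. 0)"
 using assms(2)[OF assms(1)] inner_self[OF assms(1)] ell2_norm_eq_0[OF assms(1)] by simp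

definition is_adjoint :: "'i set => (('i => complex) => 'i => complex) => (('i => complex) => 'i => complex) => bool" where
 "is_adjoint I T S \<longleftrightarrow> S : bounded_ops I &
   (ALL x:ell2 I. ALL y:ell2 I. ell2_inner I (T x) y = ell2_inner I x (S y))"

lemma is_adjoint_unique:
 assumes "is_adjoint I T S" "is_adjoint I T S'" shows "S = S'"
proof
 fix y
 show "S y = S' y"
 proof (cases "y : ell2 I")
  case True
  have "(%i. S y i - S' y i) = (%i. 0)"
  proof (rule op_inner_zero)
   show d: "(%i. S y i - S' y i) : ell2 I"
    using assms by (intro ell2_diff bounded_op_ell2) (auto simp: is_adjoint_def)
   fix x assume x: "x : ell2 I"
   have "ell2_inner I x (%i. S y i + (-1) * S' y i) = ell2_inner I x (S y) + cnj (-1) * ell2_inner I x (S' y)"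
    using assms x by (subst inner_add_right) (auto simp: is_adjoint_def inner_scale_right[of _ _ "-1", simplified] intro: bounded_op_ell2 ell2_scale[where c = "-1", simplified])
   also have "... = 0" using assms x True by (simp add: is_adjoint_def)
   finally show "ell2_inner I x (%i. S y i - S' y i) = 0" by simp
  qed
  then show ?thesis by (metis eq_iff_diff_eq_0 ext)
 next
  case False then show ?thesis using assms bounded_opsD(4)[OF _ False] unfolding is_adjoint_def by metis
 qed
qed

lemma op_star_eq:
 assumes "is_adjoint I T S" shows "alg_star (op_alg I) T = S"
proof -
 have "(THE S. is_adjoint I T S) = S"
  using assms is_adjoint_unique by (intro the_equality) blast+
 then show ?thesis by (simp add: op_alg_def is_adjoint_def)
qed

lemma op_finite_sum:
 assumes T: "T : bounded_ops I" and F: "finite F" "F \<subseteq> I"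
 shows "(%i. SUM k:F. c k * basis_vec k i) : ell2 I"
  and "T (%i. SUM k:F. c k * basis_vec k i) = (%i. SUM k:F. c k * T (basis_vec k) i)"
proof -
 have "(%i. SUM k:F. c k * basis_vec k i) : ell2 I &
  T (%i. SUM k:F. c k * basis_vec k i) = (%i. SUM k:F. c k * T (basis_vec k) i)"
  using F
 proof (induction F rule: finite_induct)
  case empty then show ?case using bounded_op_zero[OF T] by (simp add: ell2_zero)
 next
  case (insert k F)
  then have b: "basis_vec k : ell2 I" "(%i. c k * basis_vec k i) : ell2 I" by (simp_all add: basis_ell2 ell2_scale)
  then show ?case using insert ell2_add(1)[OF b(2), of "%i. SUM k:F. c k * basis_vec k i"]
   by (simp add: bounded_opsD(2,3)[OF T])
 qed
 then show "(%i. SUM k:F. c k * basis_vec k i) : ell2 I"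
  "T (%i. SUM k:F. c k * basis_vec k i) = (%i. SUM k:F. c k * T (basis_vec k) i)" by auto
qed

lemma basis_sum:
 assumes "finite F" shows "(SUM k:F. c k * basis_vec k i) = (if i : F then c i else 0)"
proof -
 have "(SUM k:F. c k * basis_vec k i) = (SUM k:F. if k = i then c i else 0)"
  by (intro sum.cong) (auto simp: basis_vec_def)
 then show ?thesis using assms by simp
qed

lemma inner_sum_left:
 assumes "finite F" "!!k. k : F ==> x k : ell2 I" "y : ell2 I"
 shows "(%i. SUM k:F. c k * x k i) : ell2 I & ell2_inner I (%i. SUM k:F. c k * x k i) y = (SUM k:F. c k * ell2_inner I (x k) y)"
 using assms
proof (induction F rule: finite_induct)
 case empty then show ?case by (simp add: ell2_inner_def ell2_zero)
next
 case (insert k F)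
 then show ?case using ell2_add(1)[of "%i. c k * x k i" I "%i. SUM k:F. c k * x k i"]
  by (simp add: inner_add_left inner_scale_left ell2_scale)
qed

lemma truncation_tendsto:
 assumes x: "x : ell2 I"
 shows "((%F. ell2_norm I (%i. x i - (SUM k:F. x k * basis_vec k i))) \<longlongrightarrow> 0) (finite_subsets_at_top I)"
proof -
 let ?s = "\<Sum>\<^sub>\<infinity>i\<in>I. (cmod (x i))\<^sup>2"
 have e: "ell2_norm I (%i. x i - (SUM k:F. x k * basis_vec k i)) = sqrt (?s - (SUM i:F. (cmod (x i))\<^sup>2))"
  if F: "finite F" "F \<subseteq> I" for F
 proof -
  have "(\<Sum>\<^sub>\<infinity>i\<in>I. (cmod (x i - (SUM k:F. x k * basis_vec k i)))\<^sup>2) = (\<Sum>\<^sub>\<infinity>i\<in>I - F. (cmod (x i))\<^sup>2)"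
   by (rule infsum_cong_neutral) (use F in "auto simp: basis_sum")
  also have "... = ?s - (SUM i:F. (cmod (x i))\<^sup>2)"
   using F by (subst infsum_Diff) (auto intro: ell2_summable[OF x])
  finally show ?thesis by (simp add: ell2_norm_def)
 qed
 have "((%F. sqrt (?s - (SUM i:F. (cmod (x i))\<^sup>2))) \<longlongrightarrow> sqrt (?s - ?s)) (finite_subsets_at_top I)"
  by (intro tendsto_intros has_sum_infsum[OF ell2_summable[OF x], unfolded has_sum_def])
 moreover have "\<forall>\<^sub>F F in finite_subsets_at_top I. 
   sqrt (?s - (SUM i:F. (cmod (x i))\<^sup>2)) = ell2_norm I (%i. x i - (SUM k:F. x k * basis_vec k i))"
  by (rule eventually_finite_subsets_at_top_weakI) (simp add: e)
 ultimately show ?thesis using tendsto_cong by force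
qed

text \<open>The adjoint of \<open>T\<close> is given by the matrix coefficients \<open>(S y)\<^sub>i = cnj \<langle>T E\<^sub>i, y\<rangle>\<close>, so the Riesz
 representation theorem is not needed.\<close>

lemma adjoint_exists:
 assumes T: "T : bounded_ops I"
 shows "EX S. is_adjoint I T S & opnorm I S <= opnorm I T"
proof -
 define S where "S y i = (if y : ell2 I & i : I then cnj (ell2_inner I (T (basis_vec i)) y) else 0)" for y i
 have Tb: "T x : ell2 I" for x by (rule bounded_op_ell2[OF T])
 have *: "S y : ell2 I & ell2_norm I (S y) <= opnorm I T * ell2_norm I y" if y: "y : ell2 I" for y
 proof -
  have le: "l2 (S y) F <= opnorm I T * ell2_norm I y" if F: "finite F" "F \<subseteq> I" for F
  proof -
   let ?v = "%i. SUM k:F. S y k * basis_vec k i"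
   have v: "?v : ell2 I" by (rule op_finite_sum(1)[OF T F])
   \<comment> \<open>Pairing y with the image of the truncation of \<open>S y\<close> to
     \<open>F\<close> yields the square of the norm of that truncation; one factor cancels against
     the boundedness of \<open>T\<close>, leaving a bound uniform in \<open>F\<close>.\<close>
   have "complex_of_real ((l2 (S y) F)\<^sup>2) = (SUM k:F. S y k * ell2_inner I (T (basis_vec k)) y)"
    unfolding l2_power2 of_real_sum
   proof (rule sum.cong)
    fix k assume "k : F"
    then have i: "ell2_inner I (T (basis_vec k)) y = cnj (S y k)" using F y by (auto simp: S_def)
    show "complex_of_real ((cmod (S y k))\<^sup>2) = S y k * ell2_inner I (T (basis_vec k)) y"
     unfolding i by (rule complex_norm_square)
   qed simp
   also have "... = ell2_inner I (T ?v) y"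
    using inner_sum_left[of F "%k. T (basis_vec k)" I y "S y"] F Tb y op_finite_sum(2)[OF T F] by simp
   finally have "(l2 (S y) F)\<^sup>2 = cmod (ell2_inner I (T ?v) y)"
    by (metis abs_of_nonneg norm_of_real zero_le_power2)
   also have "... <= ell2_norm I (T ?v) * ell2_norm I y" by (rule inner_abs_summable(2)[OF Tb y])
   also have "... <= (opnorm I T * ell2_norm I ?v) * ell2_norm I y"
    by (intro mult_right_mono opnorm_bound[OF T v] ell2_norm_nonneg)
   finally have 1: "(l2 (S y) F)\<^sup>2 <= (opnorm I T * ell2_norm I ?v) * ell2_norm I y" .
   have "ell2_norm I ?v <= l2 (S y) F"
   proof (rule ell2I(2))
    fix F' assume F': "finite F'" "F' \<subseteq> I"
    have "(SUM i:F'. (cmod (?v i))\<^sup>2) = (SUM i:F' \<inter> F. (cmod (S y i))\<^sup>2)"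
     using F F' by (intro sum.mono_neutral_cong_right) (auto simp: basis_sum)
    also have "... <= (SUM i:F. (cmod (S y i))\<^sup>2)" using F by (intro sum_mono2) auto
    finally show "l2 ?v F' <= l2 (S y) F" by (simp add: L2_set_def)
   qed (use F in "auto simp: basis_sum")
   then have "(opnorm I T * ell2_norm I ?v) * ell2_norm I y <= (opnorm I T * l2 (S y) F) * ell2_norm I y"
    by (intro mult_right_mono mult_left_mono opnorm_nonneg[OF T] ell2_norm_nonneg)
   with 1 have "l2 (S y) F * l2 (S y) F <= l2 (S y) F * (opnorm I T * ell2_norm I y)"
    by (simp add: power2_eq_square mult_ac)
   then show ?thesis
    using opnorm_nonneg[OF T] ell2_norm_nonneg[of I y] by (cases "l2 (S y) F = 0") (auto simp: less_le)
  qed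
  have "S y i = 0" if "i ~: I" for i by (simp add: S_def that)
  from ell2I[OF this mult_nonneg_nonneg[OF opnorm_nonneg[OF T] ell2_norm_nonneg] le]
  show ?thesis by blast
 qed
 have Sb: "S : bounded_ops I"
 proof (rule bounded_opsI[where K = "opnorm I T"])
  fix x y assume x: "x : ell2 I" and y: "y : ell2 I"
  show "S (%i. x i + y i) = (%i. S x i + S y i)"
   using x y by (intro ext) (simp add: S_def ell2_add inner_add_right Tb)
 next
  fix x c assume x: "x : ell2 I"
  show "S (%i. c * x i) = (%i. c * S x i)"
   using x by (intro ext) (simp add: S_def ell2_scale inner_scale_right)
 qed (use * in "auto simp: S_def")
 have "ell2_inner I (T x) y = ell2_inner I x (S y)" if x: "x : ell2 I" and y: "y : ell2 I" for x y
 proof -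
  let ?d = "%F i. x i - (SUM k:F. x k * basis_vec k i)"
  have "((%F. SUM k:F. x k * cnj (S y k)) \<longlongrightarrow> ell2_inner I x (S y)) (finite_subsets_at_top I)"
   using has_sum_infsum[OF inner_summable[OF x conjunct1[OF *[OF y]]]] by (simp add: has_sum_def ell2_inner_def)
  \<comment> \<open>\<open>T\<close> is bounded, so the inner product is the limit along truncations
    of x; the error is at most the norm of \<open>T\<close> times the norm of the tail times the
    norm of y.\<close>
  moreover have "((%F. SUM k:F. x k * cnj (S y k)) \<longlongrightarrow> ell2_inner I (T x) y) (finite_subsets_at_top I)"
  proof (rule LIM_zero_cancel, rule Lim_null_comparison)
   show "((%F. (opnorm I T * ell2_norm I (?d F)) * ell2_norm I y) \<longlongrightarrow> 0) (finite_subsets_at_top I)"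
    by (intro tendsto_mult_left_zero tendsto_mult_right_zero truncation_tendsto[OF x])
   show "\<forall>\<^sub>F F in finite_subsets_at_top I. norm ((SUM k:F. x k * cnj (S y k)) - ell2_inner I (T x) y)
     <= (opnorm I T * ell2_norm I (?d F)) * ell2_norm I y"
   proof (rule eventually_finite_subsets_at_top_weakI)
    fix F assume F: "finite F" "F \<subseteq> I"
    let ?v = "%i. SUM k:F. x k * basis_vec k i"
    have v: "?v : ell2 I" by (rule op_finite_sum(1)[OF T F])
    have d: "?d F : ell2 I" by (rule ell2_diff[OF x v])
    have "(SUM k:F. x k * cnj (S y k)) = (SUM k:F. x k * ell2_inner I (T (basis_vec k)) y)"
     using F y by (intro sum.cong) (auto simp: S_def)
    also have "... = ell2_inner I (T ?v) y"
     using inner_sum_left[of F "%k. T (basis_vec k)" I y x] F Tb y op_finite_sum(2)[OF T F] by simp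
    finally have 1: "(SUM k:F. x k * cnj (S y k)) = ell2_inner I (T ?v) y" .
    have "T x = T (%i. ?v i + ?d F i)" by simp
    also have "... = (%i. T ?v i + T (?d F) i)" by (rule bounded_opsD(2)[OF T v d])
    finally have "ell2_inner I (T x) y = ell2_inner I (T ?v) y + ell2_inner I (T (?d F)) y"
     using inner_add_left[OF Tb Tb y] by simp
    then have "norm ((SUM k:F. x k * cnj (S y k)) - ell2_inner I (T x) y) = cmod (ell2_inner I (T (?d F)) y)"
     using 1 by (simp add: norm_minus_commute)
    also have "... <= ell2_norm I (T (?d F)) * ell2_norm I y" by (rule inner_abs_summable(2)[OF Tb y])
    also have "... <= (opnorm I T * ell2_norm I (?d F)) * ell2_norm I y"
     by (intro mult_right_mono opnorm_bound[OF T d] ell2_norm_nonneg)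
    finally show "norm ((SUM k:F. x k * cnj (S y k)) - ell2_inner I (T x) y)
     <= (opnorm I T * ell2_norm I (?d F)) * ell2_norm I y" .
   qed
  qed
  ultimately show ?thesis using tendsto_unique[OF finite_subsets_at_top_neq_bot] by blast
 qed
 then have "is_adjoint I T S" using Sb by (simp add: is_adjoint_def)
 moreover have "opnorm I S <= opnorm I T" by (rule opnorm_le[OF opnorm_nonneg[OF T]]) (use * in blast)
 ultimately show ?thesis by blast
qed

lemma op_star:
 assumes "T : bounded_ops I"
 shows "is_adjoint I T (alg_star (op_alg I) T)" "opnorm I (alg_star (op_alg I) T) <= opnorm I T"
 using adjoint_exists[OF assms] op_star_eq by auto

lemma is_adjoint_sym:
 assumes "is_adjoint I T S" "T : bounded_ops I" shows "is_adjoint I S T"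
 unfolding is_adjoint_def
proof (intro conjI ballI assms(2))
 fix x y assume "x : ell2 I" "y : ell2 I"
 then have "ell2_inner I (T y) x = ell2_inner I y (S x)" using assms(1) by (simp add: is_adjoint_def)
 then show "ell2_inner I (S x) y = ell2_inner I x (T y)"
  using inner_cnj[of I "S x" y] inner_cnj[of I x "T y"] by simp
qed

text \<open>Values on basis vectors determine all coefficients of the adjoints, so the adjoints
  coincide, and then so do the operators.\<close>

lemma op_eqI:
 assumes S: "S : bounded_ops I" and T: "T : bounded_ops I"
  and eq: "!!k. k : I ==> S (basis_vec k) = T (basis_vec k)"
 shows "S = T"
proof -
 let ?S = "alg_star (op_alg I) S" and ?T = "alg_star (op_alg I) T"
 note adj = op_star(1)[OF S] op_star(1)[OF T]
 have "?S y = ?T y" for y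
 proof (cases "y : ell2 I")
  case True
  show ?thesis
  proof
   fix k
   show "?S y k = ?T y k"
   proof (cases "k : I")
    case k: True
    have "cnj (?S y k) = cnj (?T y k)"
     using adj True basis_ell2[OF k] eq[OF k] inner_basis[OF k, of "?S y"] inner_basis[OF k, of "?T y"]
      inner_cnj[of I "basis_vec k" "?S y"] inner_cnj[of I "basis_vec k" "?T y"]
     unfolding is_adjoint_def by metis
    then show ?thesis by simp
   next
    case False then show ?thesis using adj bounded_op_ell2 ell2_vanish unfolding is_adjoint_def by metis
   qed
  qed
 next
  case False then show ?thesis using adj bounded_opsD(4)[OF _ False] unfolding is_adjoint_def by metis
 qed
 then have "?S = ?T" by auto
 then show ?thesis
  using is_adjoint_unique[OF is_adjoint_sym[OF adj(1) S]] is_adjoint_sym[OF adj(2) T] by simp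
qed

lemma op_cstar_le:
 assumes T: "T : bounded_ops I" and a: "is_adjoint I T S"
 shows "(opnorm I T)\<^sup>2 <= opnorm I (%x. S (T x))"
proof -
 have S: "S : bounded_ops I" using a by (simp add: is_adjoint_def)
 note ST = op_mult_closed(1)[OF S T]
 have "ell2_norm I (T x) <= sqrt (opnorm I (%x. S (T x))) * ell2_norm I x" if x: "x : ell2 I" for x
 proof -
  have "(ell2_norm I (T x))\<^sup>2 = cmod (ell2_inner I (T x) (T x))" by (rule inner_self[OF bounded_op_ell2[OF T], symmetric])
  also have "... = cmod (ell2_inner I x (S (T x)))" using a x bounded_op_ell2[OF T] by (simp add: is_adjoint_def)
  also have "... <= ell2_norm I x * ell2_norm I (S (T x))" by (rule inner_abs_summable(2)[OF x bounded_op_ell2[OF S]])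
  also have "... <= ell2_norm I x * (opnorm I (%x. S (T x)) * ell2_norm I x)"
   by (intro mult_left_mono opnorm_bound[OF ST x] ell2_norm_nonneg)
  also have "... = opnorm I (%x. S (T x)) * (ell2_norm I x)\<^sup>2" by (simp add: power2_eq_square)
  finally have "sqrt ((ell2_norm I (T x))\<^sup>2) <= sqrt (opnorm I (%x. S (T x)) * (ell2_norm I x)\<^sup>2)"
   by (rule real_sqrt_le_mono)
  then show ?thesis using ell2_norm_nonneg[of I x] ell2_norm_nonneg[of I "T x"] by (simp add: real_sqrt_mult)
 qed
 then have "opnorm I T <= sqrt (opnorm I (%x. S (T x)))"
  by (intro opnorm_le) (simp_all add: opnorm_nonneg[OF ST])
 then have "(opnorm I T)\<^sup>2 <= (sqrt (opnorm I (%x. S (T x))))\<^sup>2" by (intro power_mono opnorm_nonneg[OF T])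
 then show ?thesis using opnorm_nonneg[OF ST] by simp
qed

lemma op_diff: "alg_diff (op_alg I) S T = (%x i. S x i - T x i)"
 by (simp add: alg_diff_def op_alg_simps)

lemma op_star_algebra: "star_algebra (op_alg I)"
proof -
 note adj = op_star(1)
 have adjD: "alg_star (op_alg I) T : bounded_ops I" if "T : bounded_ops I" for T
  using adj[OF that] by (simp add: is_adjoint_def)
 have adjE: "ell2_inner I (T x) y = ell2_inner I x (alg_star (op_alg I) T y)" 
  if "T : bounded_ops I" "x : ell2 I" "y : ell2 I" for T x y
  using adj[OF that(1)] that by (simp add: is_adjoint_def)
 show ?thesis
 proof unfold_locales
  fix S T :: "('a => complex) => 'a => complex" and c
  assume "S : carrier (op_alg I)" "T : carrier (op_alg I)"
  then have S: "S : bounded_ops I" and T: "T : bounded_ops I" by (simp_all add: op_alg_simps)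
  note b = bounded_op_ell2[OF S] bounded_op_ell2[OF T] bounded_op_ell2[OF adjD[OF S]] bounded_op_ell2[OF adjD[OF T]]
  show "alg_star (op_alg I) (alg_add (op_alg I) S T) = alg_add (op_alg I) (alg_star (op_alg I) S) (alg_star (op_alg I) T)"
   unfolding op_alg_simps
   by (rule op_star_eq) (simp add: is_adjoint_def op_add_closed adjD S T inner_add_left inner_add_right b adjE)
  show "alg_star (op_alg I) (alg_mult (op_alg I) S T) = alg_mult (op_alg I) (alg_star (op_alg I) T) (alg_star (op_alg I) S)"
   unfolding op_alg_simps
   by (rule op_star_eq) (simp add: is_adjoint_def op_mult_closed adjD S T b adjE)
 next
  fix T :: "('a => complex) => 'a => complex" and c
  assume "T : carrier (op_alg I)"
  then have T: "T : bounded_ops I" by (simp add: op_alg_simps)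
  show "alg_star (op_alg I) (alg_star (op_alg I) T) = T"
   by (rule op_star_eq[OF is_adjoint_sym[OF adj[OF T] T]])
  show "alg_star (op_alg I) (alg_scale (op_alg I) c T) = alg_scale (op_alg I) (cnj c) (alg_star (op_alg I) T)"
   unfolding op_alg_simps
   by (rule op_star_eq) (simp add: is_adjoint_def op_scale_closed adjD T inner_scale_left inner_scale_right adjE)
  show "alg_diff (op_alg I) T T = alg_zero (op_alg I)" by (simp add: op_diff op_alg_simps)
 next
  fix S T U :: "('a => complex) => 'a => complex"
  assume "S : carrier (op_alg I)" "T : carrier (op_alg I)" "U : carrier (op_alg I)"
  then show "alg_mult (op_alg I) S (alg_add (op_alg I) T U) = alg_add (op_alg I) (alg_mult (op_alg I) S T) (alg_mult (op_alg I) S U)"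
   by (simp add: op_alg_simps bounded_opsD(2) bounded_op_ell2)
 next
  fix S T :: "('a => complex) => 'a => complex" and c
  assume "S : carrier (op_alg I)" "T : carrier (op_alg I)"
  then show "alg_mult (op_alg I) S (alg_scale (op_alg I) c T) = alg_scale (op_alg I) c (alg_mult (op_alg I) S T)"
   by (simp add: op_alg_simps bounded_opsD(3) bounded_op_ell2)
 qed (simp_all add: op_alg_simps op_add_closed op_scale_closed op_mult_closed op_zero_closed adjD algebra_simps)
qed

lemma op_norm_seminorm: "cstar_seminorm (op_alg I) (opnorm I)"
 unfolding cstar_seminorm_def
proof (intro conjI ballI allI; unfold op_alg_simps(1,3,4,5))
 fix T assume T: "T : bounded_ops I"
 let ?S = "alg_star (op_alg I) T"
 have S: "?S : bounded_ops I" using op_star(1)[OF T] by (simp add: is_adjoint_def)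
 have "opnorm I (%x. ?S (T x)) <= opnorm I ?S * opnorm I T" by (rule op_mult_closed(2)[OF S T])
 also have "... <= opnorm I T * opnorm I T" by (intro mult_right_mono op_star(2)[OF T] opnorm_nonneg[OF T])
 finally show "opnorm I (%x. ?S (T x)) = (opnorm I T)\<^sup>2"
  using op_cstar_le[OF T op_star(1)[OF T]] by (simp add: power2_eq_square)
qed (simp_all add: opnorm_nonneg op_scale_norm op_add_closed op_mult_closed)

lemma op_norm_definite:
 assumes T: "T : bounded_ops I" and z: "opnorm I T = 0" shows "T = (%x i. 0)"
proof
 fix x show "T x = (%i. 0)"
 proof (cases "x : ell2 I")
  case True
  then show ?thesis using opnorm_bound[OF T True] z by (intro ell2_norm_eq_0[OF bounded_op_ell2[OF T]]) simp
 qed (simp add: bounded_opsD(4)[OF T])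
qed

lemma op_complete:
 assumes s: "s : cauchy_seqs (op_alg I) (opnorm I)"
 shows "EX T:bounded_ops I. (%n. opnorm I (alg_diff (op_alg I) (s n) T)) \<longlonglongrightarrow> 0"
proof -
 interpret star_algebra "op_alg I" by (rule op_star_algebra)
 have sb: "s n : bounded_ops I" for n using s by (simp add: cauchy_seqs_def op_alg_simps)
 have db: "(%x i. s m x i - s n x i) : bounded_ops I" for m n
  using diff_closed[of "s m" "s n"] sb by (simp add: op_diff op_alg_simps)
 have C: "EX N. ALL m>=N. ALL n>=N. opnorm I (%x i. s m x i - s n x i) < e" if "e > 0" for e
  using s that unfolding cauchy_seqs_def op_diff by simp
 have conv: "EX l. (%n. s n x i) \<longlonglongrightarrow> l" for x i
 proof (cases "x : ell2 I")
  case True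
  have "Cauchy (%n. s n x i)"
  proof (rule CauchyI)
   fix e :: real assume e: "e > 0"
   have "e / (ell2_norm I x + 1) > 0" using e ell2_norm_nonneg[of I x] by simp
   then obtain N where N: "ALL m>=N. ALL n>=N. opnorm I (%x i. s m x i - s n x i) < e / (ell2_norm I x + 1)"
    using C by blast
   have "norm (s m x i - s n x i) < e" if "m >= N" "n >= N" for m n
   proof -
    have "norm (s m x i - s n x i) <= ell2_norm I (%i. s m x i - s n x i)"
     using cmod_le_ell2_norm[OF bounded_op_ell2[OF db], of m x i n] by simp
    also have "... <= opnorm I (%x i. s m x i - s n x i) * ell2_norm I x"
     by (rule opnorm_bound[OF db True])
    also have "... <= opnorm I (%x i. s m x i - s n x i) * (ell2_norm I x + 1)"
     by (intro mult_left_mono opnorm_nonneg[OF db]) simp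
    also have "... < e"
     using N that ell2_norm_nonneg[of I x] by (simp add: pos_less_divide_eq[symmetric])
    finally show ?thesis .
   qed
   then show "EX N. ALL m>=N. ALL n>=N. norm (s m x i - s n x i) < e" by blast
  qed
  then show ?thesis using Cauchy_convergent convergent_def by blast
 next
  case False then show ?thesis using bounded_opsD(4)[OF sb False] by auto
 qed
 define T where "T x i = lim (%n. s n x i)" for x i
 have T: "(%n. s n x i) \<longlonglongrightarrow> T x i" for x i
  using conv[of x i] limI unfolding T_def by blast
 have Tdiff: "(%i. s m x i - T x i) : ell2 I & ell2_norm I (%i. s m x i - T x i) <= e * ell2_norm I x"
  if x: "x : ell2 I" and e: "e > 0" and N: "ALL n>=N. opnorm I (%x i. s m x i - s n x i) < e" for x m e N
 proof -
  have le: "l2 (%i. s m x i - T x i) F <= e * ell2_norm I x" if F: "finite F" "F \<subseteq> I" for F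
  proof (rule tendsto_upperbound)
   show "(%n. l2 (%i. s m x i - s n x i) F) \<longlonglongrightarrow> l2 (%i. s m x i - T x i) F"
    unfolding L2_set_def by (intro tendsto_intros T)
   have "l2 (%i. s m x i - s n x i) F <= e * ell2_norm I x" if "n >= N" for n
   proof -
    have "l2 (%i. s m x i - s n x i) F <= ell2_norm I (%i. s m x i - s n x i)"
     using l2_le_norm[OF bounded_op_ell2[OF db] F, of m x n] by simp
    also have "... <= opnorm I (%x i. s m x i - s n x i) * ell2_norm I x"
     by (rule opnorm_bound[OF db x])
    also have "... <= e * ell2_norm I x"
     using N that by (intro mult_right_mono ell2_norm_nonneg) (auto intro: less_imp_le)
    finally show ?thesis .
   qed
   then show "\<forall>\<^sub>F n in sequentially. l2 (%i. s m x i - s n x i) F <= e * ell2_norm I x"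
    by (auto simp: eventually_sequentially)
  qed simp
  have out: "s m x i - T x i = 0" if "i ~: I" for i
  proof -
   have z: "s n x i = 0" for n using ell2_vanish[OF bounded_op_ell2[OF sb] that] .
   then have "T x i = 0" using LIMSEQ_unique[OF T[of x i], of 0] by simp
   then show ?thesis using z by simp
  qed
  show ?thesis using ell2I[OF out _ le] e ell2_norm_nonneg[of I x] by simp
 qed
 obtain N where N: "ALL m>=N. ALL n>=N. opnorm I (%x i. s m x i - s n x i) < 1" using C[of 1] by auto
 have Tx: "T x : ell2 I & ell2_norm I (T x) <= (opnorm I (s N) + 1) * ell2_norm I x" if x: "x : ell2 I" for x
 proof -
  have d: "(%i. s N x i - T x i) : ell2 I" "ell2_norm I (%i. s N x i - T x i) <= 1 * ell2_norm I x"
   using Tdiff[OF x, of 1 N N] N by auto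
  have d': "(%i. -1 * (s N x i - T x i)) : ell2 I" by (rule ell2_scale[OF d(1)])
  have e: "T x = (%i. s N x i + -1 * (s N x i - T x i))" by auto
  have "ell2_norm I (T x) <= ell2_norm I (s N x) + ell2_norm I (%i. -1 * (s N x i - T x i))"
   by (subst e) (rule ell2_add(2)[OF bounded_op_ell2[OF sb] d'])
  then have "ell2_norm I (T x) <= (opnorm I (s N) + 1) * ell2_norm I x"
   unfolding ell2_norm_scale using d(2) opnorm_bound[OF sb x, of N] by (simp add: distrib_right)
  moreover have "T x : ell2 I" by (subst e) (rule ell2_add(1)[OF bounded_op_ell2[OF sb] d'])
  ultimately show ?thesis by blast
 qed
 have Tb: "T : bounded_ops I"
 proof (rule bounded_opsI[where K = "opnorm I (s N) + 1"])
  fix x y assume x: "x : ell2 I" and y: "y : ell2 I"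
  show "T (%i. x i + y i) = (%i. T x i + T y i)"
  proof
   fix i
   have "(%n. s n (%i. x i + y i) i) \<longlonglongrightarrow> T x i + T y i"
    unfolding bounded_opsD(2)[OF sb x y] by (intro tendsto_intros T)
   then show "T (%i. x i + y i) i = T x i + T y i" using T LIMSEQ_unique by blast
  qed
 next
  fix x c assume x: "x : ell2 I"
  show "T (%i. c * x i) = (%i. c * T x i)"
  proof
   fix i
   have "(%n. s n (%i. c * x i) i) \<longlonglongrightarrow> c * T x i"
    unfolding bounded_opsD(3)[OF sb x] by (intro tendsto_intros T)
   then show "T (%i. c * x i) i = c * T x i" using T LIMSEQ_unique by blast
  qed
 next
  fix x assume x: "x ~: ell2 I"
  show "T x = (%i. 0)" unfolding T_def bounded_opsD(4)[OF sb x] by simp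
 qed (use Tx in auto)
 have "(%n. opnorm I (alg_diff (op_alg I) (s n) T)) \<longlonglongrightarrow> 0"
 proof (rule LIMSEQ_I)
  fix e :: real assume e: "e > 0"
  then obtain N where N: "ALL m>=N. ALL n>=N. opnorm I (%x i. s m x i - s n x i) < e / 2" using C[of "e/2"] by auto
  have "norm (opnorm I (alg_diff (op_alg I) (s m) T) - 0) < e" if m: "m >= N" for m
  proof -
   have "opnorm I (%x i. s m x i - T x i) <= e / 2"
    by (rule opnorm_le) (use Tdiff[of _ "e/2" N m] N m e in auto)
   moreover have "0 <= opnorm I (%x i. s m x i - T x i)"
    using opnorm_nonneg[of "%x i. s m x i - T x i" I] diff_closed[of "s m" T] sb Tb by (simp add: op_diff op_alg_simps)
   ultimately show ?thesis using e by (simp add: op_diff)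
  qed
  then show "EX N. ALL n>=N. norm (opnorm I (alg_diff (op_alg I) (s n) T) - 0) < e" by blast
 qed
 then show ?thesis using Tb by blast
qed

lemma op_cstar_algebra: "cstar_algebra (op_alg I)"
proof (intro cstar_algebra.intro op_star_algebra cstar_algebra_axioms.intro op_norm_seminorm)
 fix T assume "T : carrier (op_alg I)" "opnorm I T = 0"
 then show "T = alg_zero (op_alg I)" using op_norm_definite by (simp add: op_alg_simps(1,2))
next
 fix s assume "s : cauchy_seqs (op_alg I) (opnorm I)"
 from op_complete[OF this] 
 show "EX x:carrier (op_alg I). (%n. opnorm I (alg_diff (op_alg I) (s n) x)) \<longlonglongrightarrow> 0"
  by (simp only: op_alg_simps(1))
qed

definition id_op :: "'i set => ('i => complex) => 'i => complex" where
 "id_op I x = (if x : ell2 I then x else (%i. 0))"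

lemma id_op: 
 shows "id_op I : bounded_ops I"
  and "T : bounded_ops I ==> alg_mult (op_alg I) (id_op I) T = T"
  and "T : bounded_ops I ==> alg_mult (op_alg I) T (id_op I) = T"
proof -
 show "id_op I : bounded_ops I"
  by (rule bounded_opsI[where K = 1]) (simp_all add: id_op_def ell2_add ell2_scale)
 show "alg_mult (op_alg I) (id_op I) T = T" if "T : bounded_ops I"
  using bounded_op_ell2[OF that] by (simp add: op_alg_simps id_op_def)
 show "alg_mult (op_alg I) T (id_op I) = T" if "T : bounded_ops I"
 proof
  fix x show "alg_mult (op_alg I) T (id_op I) x = T x"
   using bounded_opsD(4)[OF that, of x] bounded_op_zero[OF that] by (simp add: op_alg_simps id_op_def)
 qed
qed

section \<open>Matrix-valued functions\<close>

text \<open>Matrices are plain functions of two indices, of which only the entries below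
  \<open>n\<close> matter. The norm is inherited from bounded operators on a finite sequence space,
  and with it the C*-identity.\<close>

definition mat_op :: "nat => (nat => nat => complex) => (nat => complex) => nat => complex" where
 "mat_op n M = (%x i. if x : ell2 {..<n} & i < n then \<Sum>j<n. M i j * x j else 0)"

definition opn :: "nat => (nat => nat => complex) => real" where
 "opn n M = opnorm {..<n} (mat_op n M)"

lemma ell2_finite: "finite I ==> x : ell2 I \<longleftrightarrow> (ALL i. i ~: I --> x i = 0)"
 by (simp add: ell2_def summable_on_finite)

lemma mat_op_ell2: "mat_op n M x : ell2 {..<n}"
 by (simp add: ell2_finite mat_op_def)

lemma mat_op_bound:
 assumes x: "x : ell2 {..<n}"
 shows "ell2_norm {..<n} (mat_op n M x) <= (\<Sum>i<n. \<Sum>j<n. cmod (M i j)) * ell2_norm {..<n} x"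
proof (rule ell2I(2))
 fix F :: "nat set" assume F: "finite F" "F \<subseteq> {..<n}"
 have "l2 (mat_op n M x) F <= (SUM i:F. \<bar>cmod (mat_op n M x i)\<bar>)" by (rule L2_set_le_sum_abs)
 also have "... <= (\<Sum>i<n. cmod (mat_op n M x i))" using F by (simp add: sum_mono2)
 also have "... <= (\<Sum>i<n. \<Sum>j<n. cmod (M i j) * ell2_norm {..<n} x)"
 proof (rule sum_mono)
  fix i assume "i : {..<n}"
  then have "cmod (mat_op n M x i) = cmod (\<Sum>j<n. M i j * x j)" using x by (simp add: mat_op_def)
  also have "... <= (\<Sum>j<n. cmod (M i j * x j))" by (rule norm_sum)
  also have "... <= (\<Sum>j<n. cmod (M i j) * ell2_norm {..<n} x)"
   unfolding norm_mult by (intro sum_mono mult_left_mono cmod_le_ell2_norm x) simp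
  finally show "cmod (mat_op n M x i) <= (\<Sum>j<n. cmod (M i j) * ell2_norm {..<n} x)" .
 qed
 finally show "l2 (mat_op n M x) F <= (\<Sum>i<n. \<Sum>j<n. cmod (M i j)) * ell2_norm {..<n} x"
  by (simp add: sum_distrib_right)
qed (auto simp: mat_op_def intro!: mult_nonneg_nonneg sum_nonneg ell2_norm_nonneg)

lemma mat_op_bounded: "mat_op n M : bounded_ops {..<n}"
proof (rule bounded_opsI[OF mat_op_ell2 _ _ _ mat_op_bound])
 fix x y :: "nat => complex" assume "x : ell2 {..<n}" "y : ell2 {..<n}"
 then show "mat_op n M (%i. x i + y i) = (%i. mat_op n M x i + mat_op n M y i)"
  by (intro HOL.ext) (simp add: mat_op_def ell2_add sum.distrib algebra_simps)
next
 fix x :: "nat => complex" and c assume "x : ell2 {..<n}"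
 then show "mat_op n M (%i. c * x i) = (%i. c * mat_op n M x i)"
  by (intro HOL.ext) (simp add: mat_op_def ell2_scale sum_distrib_left mult_ac)
qed (auto simp: mat_op_def)

lemma opn_nonneg: "0 <= opn n M"
 unfolding opn_def by (rule opnorm_nonneg[OF mat_op_bounded])

lemma opn_le_sum: "opn n M <= (\<Sum>i<n. \<Sum>j<n. cmod (M i j))"
 unfolding opn_def by (rule opnorm_le) (simp_all add: mat_op_bound sum_nonneg)

lemma basis_norm_le: "k : I ==> ell2_norm I (basis_vec k) <= 1"
proof (rule ell2I(2))
 fix F assume "finite F" "F \<subseteq> I"
 have "(SUM i:F. (cmod (basis_vec k i))\<^sup>2) = (SUM i:F. if i = k then 1 else 0)"
  by (intro sum.cong) (auto simp: basis_vec_def)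
 also have "... <= 1" using \<open>finite F\<close> by simp
 finally show "l2 (basis_vec k) F <= 1" by (simp add: L2_set_def)
qed (auto simp: basis_vec_def)

lemma coeff_le_opnorm:
 assumes T: "T : bounded_ops I" and k: "k : I" shows "cmod (T (basis_vec k) i) <= opnorm I T"
proof -
 have "cmod (T (basis_vec k) i) <= ell2_norm I (T (basis_vec k))" by (rule cmod_le_ell2_norm[OF bounded_op_ell2[OF T]])
 also have "... <= opnorm I T * ell2_norm I (basis_vec k)" by (rule opnorm_bound[OF T basis_ell2[OF k]])
 also have "... <= opnorm I T * 1" by (intro mult_left_mono basis_norm_le k opnorm_nonneg T)
 finally show ?thesis by simp
qed

lemma mat_op_basis:
 assumes "i < n" "j < n" shows "mat_op n M (basis_vec j) i = M i j"
proof -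
 have "(\<Sum>k<n. M i k * basis_vec j k) = (\<Sum>k<n. if k = j then M i j else 0)"
  by (intro sum.cong) (auto simp: basis_vec_def)
 then show ?thesis using assms basis_ell2[of j "{..<n}"] by (simp add: mat_op_def)
qed

lemma opn_entry: "[|i < n; j < n|] ==> cmod (M i j) <= opn n M"
 using coeff_le_opnorm[OF mat_op_bounded, of j n M i] by (simp add: mat_op_basis opn_def)

lemma opn_add: "opn n (%i j. M i j + N i j) <= opn n M + opn n N"
proof -
 have "mat_op n (%i j. M i j + N i j) = (%x i. mat_op n M x i + mat_op n N x i)"
  by (intro HOL.ext) (simp add: mat_op_def sum.distrib algebra_simps)
 then show ?thesis using op_add_closed(2)[OF mat_op_bounded mat_op_bounded, of n M N] by (simp add: opn_def)
qed

lemma opn_scale: "opn n (%i j. c * M i j) = cmod c * opn n M"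
proof -
 have "mat_op n (%i j. c * M i j) = (%x i. c * mat_op n M x i)"
  by (intro HOL.ext) (simp add: mat_op_def sum_distrib_left mult_ac)
 then show ?thesis using op_scale_norm[OF mat_op_bounded, of n c M] by (simp add: opn_def)
qed

lemma mat_op_mult: "mat_op n (%i j. \<Sum>l<n. M i l * N l j) = (%x. mat_op n M (mat_op n N x))"
proof (intro HOL.ext)
 fix x i
 show "mat_op n (%i j. \<Sum>l<n. M i l * N l j) x i = mat_op n M (mat_op n N x) i"
 proof (cases "x : ell2 {..<n} & i < n")
  case True
  have "(\<Sum>j<n. (\<Sum>l<n. M i l * N l j) * x j) = (\<Sum>l<n. \<Sum>j<n. M i l * (N l j * x j))"
   unfolding sum_distrib_right by (subst sum.swap) (simp add: mult.assoc)
  also have "... = (\<Sum>l<n. M i l * mat_op n N x l)"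
   using True by (simp add: mat_op_def sum_distrib_left)
  finally show ?thesis using True mat_op_ell2[of n N x] by (simp add: mat_op_def[of n M] mat_op_def[of n "%i j. \<Sum>l<n. M i l * N l j"])
 next
  case False
  have "mat_op n N x = (%i. 0)" if "x ~: ell2 {..<n}" using that by (simp add: mat_op_def)
  then show ?thesis using False by (auto simp: mat_op_def)
 qed
qed

lemma opn_mult: "opn n (%i j. \<Sum>l<n. M i l * N l j) <= opn n M * opn n N"
 unfolding opn_def mat_op_mult by (rule op_mult_closed(2)[OF mat_op_bounded mat_op_bounded])

lemma mat_op_adjoint: "is_adjoint {..<n} (mat_op n M) (mat_op n (%i j. cnj (M j i)))"
 unfolding is_adjoint_def
proof (intro conjI ballI mat_op_bounded)
 fix x y :: "nat => complex" assume x: "x : ell2 {..<n}" and y: "y : ell2 {..<n}"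
 have "ell2_inner {..<n} (mat_op n M x) y = (\<Sum>i<n. \<Sum>j<n. M i j * x j * cnj (y i))"
  using x by (simp add: ell2_inner_def mat_op_def sum_distrib_right)
 also have "... = (\<Sum>j<n. \<Sum>i<n. M i j * x j * cnj (y i))" by (rule sum.swap)
 also have "... = ell2_inner {..<n} x (mat_op n (%i j. cnj (M j i)) y)"
  using y by (simp add: ell2_inner_def mat_op_def sum_distrib_left mult_ac)
 finally show "ell2_inner {..<n} (mat_op n M x) y = ell2_inner {..<n} x (mat_op n (%i j. cnj (M j i)) y)" .
qed

lemma opn_cstar: "opn n (%i j. \<Sum>l<n. cnj (M l i) * M l j) = (opn n M)\<^sup>2"
proof -
 have "opn n (%i j. \<Sum>l<n. cnj (M l i) * M l j)
   = opnorm {..<n} (alg_mult (op_alg {..<n}) (alg_star (op_alg {..<n}) (mat_op n M)) (mat_op n M))"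
  unfolding op_star_eq[OF mat_op_adjoint] opn_def
  using mat_op_mult[of n "%i j. cnj (M j i)" M] by (simp add: op_alg_simps)
 then show ?thesis
  using op_norm_seminorm[of "{..<n}"] mat_op_bounded[of n M]
  by (simp add: cstar_seminorm_def op_alg_simps(1) opn_def)
qed

text \<open>The n by n matrices over a function algebra \<open>C\<close>. Entries outside the square
  vanish, so that elements are equal as functions; the supremum may run over the whole type because
  the functions used later are extended by zero.\<close>

definition mat_fun :: "nat => ('y => complex) set => ('y => nat => nat => complex) cstar_alg" where
 "mat_fun n C = \<lparr>
   carrier = {F. (ALL i j. (%y. F y i j) : C) & (ALL y i j. n <= i \<or> n <= j --> F y i j = 0)},
   alg_zero = (%y i j. 0),
   alg_add = (%F G y i j. F y i j + G y i j),
   alg_scale = (%c F y i j. c * F y i j),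
   alg_mult = (%F G y i j. \<Sum>l<n. F y i l * G y l j),
   alg_star = (%F y i j. cnj (F y j i)),
   alg_norm = (%F. SUP y. opn n (F y))\<rparr>"

lemma mat_fun_simps:
 "alg_zero (mat_fun n C) = (%y i j. 0)"
 "alg_add (mat_fun n C) F G = (%y i j. F y i j + G y i j)"
 "alg_scale (mat_fun n C) c F = (%y i j. c * F y i j)"
 "alg_mult (mat_fun n C) F G = (%y i j. \<Sum>l<n. F y i l * G y l j)"
 "alg_star (mat_fun n C) F = (%y i j. cnj (F y j i))"
 by (simp_all add: mat_fun_def)

lemma mat_fun_carrier:
 "F : carrier (mat_fun n C) \<longleftrightarrow> (ALL i j. (%y. F y i j) : C) & (ALL y i j. n <= i \<or> n <= j --> F y i j = 0)"
 by (simp add: mat_fun_def)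

lemma mat_fun_norm: "alg_norm (mat_fun n C) F = (SUP y. opn n (F y))"
 by (simp add: mat_fun_def)

lemma mat_fun_diff: "alg_diff (mat_fun n C) F G = (%y i j. F y i j - G y i j)"
 by (simp add: alg_diff_def mat_fun_simps)

text \<open>A uniformly closed *-algebra of bounded functions. One argument then covers C(X), null
  sequences in C(X) and the one-point case.\<close>

locale fun_alg =
 fixes C :: "('y => complex) set"
 assumes f_zero: "(%y. 0) : C"
  and f_add: "[|f : C; g : C|] ==> (%y. f y + g y) : C"
  and f_scale: "f : C ==> (%y. c * f y) : C"
  and f_mult: "[|f : C; g : C|] ==> (%y. f y * g y) : C"
  and f_cnj: "f : C ==> (%y. cnj (f y)) : C"
  and f_bounded: "f : C ==> EX K. ALL y. cmod (f y) <= K"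
  and f_closed: "(!!e. 0 < e ==> EX g:C. ALL y. cmod (f y - g y) <= e) ==> f : C"
begin

lemma f_sum: "[|finite J; !!j. j : J ==> f j : C|] ==> (%y. SUM j:J. f j y) : C"
 by (induction J rule: finite_induct) (simp_all add: f_zero f_add)

lemma mf_entry: "F : carrier (mat_fun n C) ==> (%y. F y i j) : C"
 by (simp add: mat_fun_carrier)

lemma mf_closed:
 shows "alg_zero (mat_fun n C) : carrier (mat_fun n C)"
  and "[|F : carrier (mat_fun n C); G : carrier (mat_fun n C)|] ==> alg_add (mat_fun n C) F G : carrier (mat_fun n C)"
  and "F : carrier (mat_fun n C) ==> alg_scale (mat_fun n C) c F : carrier (mat_fun n C)"
  and "[|F : carrier (mat_fun n C); G : carrier (mat_fun n C)|] ==> alg_mult (mat_fun n C) F G : carrier (mat_fun n C)"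
  and "F : carrier (mat_fun n C) ==> alg_star (mat_fun n C) F : carrier (mat_fun n C)"
proof -
 show "alg_mult (mat_fun n C) F G : carrier (mat_fun n C)" 
  if F: "F : carrier (mat_fun n C)" and G: "G : carrier (mat_fun n C)"
 proof -
  have "(%y. \<Sum>l<n. F y i l * G y l j) : C" for i j
   by (rule f_sum) (simp_all add: f_mult mf_entry[OF F] mf_entry[OF G])
  then show ?thesis using F G by (auto simp: mat_fun_carrier mat_fun_simps)
 qed
qed (auto simp: mat_fun_carrier mat_fun_simps f_zero f_add f_scale f_cnj)

lemma mf_bound:
 assumes F: "F : carrier (mat_fun n C)"
 shows "bdd_above (range (%y. opn n (F y)))"
proof -
 have "EX K. ALL y. cmod (F y i j) <= K" for i j using f_bounded[OF mf_entry[OF F]] .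
 then obtain K where K: "!!i j y. cmod (F y i j) <= K i j" by metis
 show ?thesis
 proof (rule bdd_aboveI2)
  fix y
  show "opn n (F y) <= (\<Sum>i<n. \<Sum>j<n. K i j)"
   by (rule order_trans[OF opn_le_sum]) (intro sum_mono K)
 qed
qed

lemma mf_norm_ge: "F : carrier (mat_fun n C) ==> opn n (F y) <= alg_norm (mat_fun n C) F"
 unfolding mat_fun_norm by (intro cSUP_upper mf_bound) simp_all

lemma mf_norm_le: "(!!y. opn n (F y) <= K) ==> alg_norm (mat_fun n C) F <= K"
 unfolding mat_fun_norm by (intro cSUP_least) simp_all

lemma mf_norm_nonneg: "F : carrier (mat_fun n C) ==> 0 <= alg_norm (mat_fun n C) F"
 using mf_norm_ge opn_nonneg order_trans by blast

lemma mf_norm_entry: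
 assumes "F : carrier (mat_fun n C)" shows "cmod (F y i j) <= alg_norm (mat_fun n C) F"
proof (cases "i < n & j < n")
 case True then show ?thesis using opn_entry[of i n j "F y"] mf_norm_ge[OF assms, of y] by linarith
next
 case False
 then have "F y i j = 0" using assms unfolding mat_fun_carrier by (meson not_le)
 then show ?thesis using mf_norm_nonneg[OF assms] by simp
qed

lemma mf_norm_le_entries:
 assumes "!!y i j. [|i < n; j < n|] ==> cmod (F y i j) <= B"
 shows "alg_norm (mat_fun n C) F <= real n * real n * B"
proof (rule mf_norm_le)
 fix y
 have "(\<Sum>i<n. \<Sum>j<n. cmod (F y i j)) <= (\<Sum>i<n. \<Sum>j<n. B)" by (intro sum_mono assms) simp_all
 then show "opn n (F y) <= real n * real n * B" using opn_le_sum[of n "F y"] by simp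
qed

lemma mf_star_algebra: "star_algebra (mat_fun n C)"
proof unfold_locales
 fix F :: "'y => nat => nat => complex"
 show "alg_diff (mat_fun n C) F F = alg_zero (mat_fun n C)" by (simp add: mat_fun_diff mat_fun_simps)
next
 fix F G H :: "'y => nat => nat => complex"
 show "alg_mult (mat_fun n C) (alg_mult (mat_fun n C) F G) H = alg_mult (mat_fun n C) F (alg_mult (mat_fun n C) G H)"
  unfolding mat_fun_simps
 proof (intro HOL.ext)
  fix y i j
  have "(\<Sum>l<n. (\<Sum>m<n. F y i m * G y m l) * H y l j) = (\<Sum>l<n. \<Sum>m<n. F y i m * (G y m l * H y l j))"
   by (simp add: sum_distrib_right mult.assoc)
  also have "... = (\<Sum>m<n. \<Sum>l<n. F y i m * (G y m l * H y l j))" by (rule sum.swap)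
  finally show "(\<Sum>l<n. (\<Sum>m<n. F y i m * G y m l) * H y l j) = (\<Sum>m<n. F y i m * (\<Sum>l<n. G y m l * H y l j))"
   by (simp add: sum_distrib_left)
 qed
qed (simp add: mf_closed; fail | intro HOL.ext; simp add: mat_fun_simps sum.distrib sum_distrib_left algebra_simps; fail)+

lemma mf_seminorm: "cstar_seminorm (mat_fun n C) (alg_norm (mat_fun n C))"
proof -
 interpret star_algebra "mat_fun n C" by (rule mf_star_algebra)
 let ?N = "alg_norm (mat_fun n C)"
 show ?thesis
  unfolding cstar_seminorm_def
 proof (intro conjI ballI allI)
  fix F assume F: "F : carrier (mat_fun n C)"
  show "0 <= ?N F" by (rule mf_norm_nonneg[OF F])
  have sc: "?N (alg_scale (mat_fun n C) c F) <= cmod c * ?N F" if "F : carrier (mat_fun n C)" for F c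
   by (rule mf_norm_le) (simp add: mat_fun_simps opn_scale mult_left_mono mf_norm_ge that)
  show "?N (alg_scale (mat_fun n C) c F) = cmod c * ?N F" for c
  proof (cases "c = 0")
   case True
   then show ?thesis using sc[OF F, of c] mf_norm_nonneg[OF scale_closed[OF F, of c]] by simp
  next
   case False
   have "?N F = ?N (alg_scale (mat_fun n C) (inverse c) (alg_scale (mat_fun n C) c F))"
    using F False by (simp add: scale_scale scale_one)
   also have "... <= inverse (cmod c) * ?N (alg_scale (mat_fun n C) c F)"
    using sc[OF scale_closed[OF F, of c], of "inverse c"] by (simp only: norm_inverse)
   finally show ?thesis using False sc[OF F, of c] by (simp add: field_simps)
  qed
  let ?S = "alg_mult (mat_fun n C) (alg_star (mat_fun n C) F) F"
  have S: "?S : carrier (mat_fun n C)" using F by (intro closed)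
  have o: "opn n (?S y) = (opn n (F y))\<^sup>2" for y
   by (simp add: mat_fun_simps opn_cstar)
  have "?N ?S <= (?N F)\<^sup>2"
   by (rule mf_norm_le) (simp add: o power_mono mf_norm_ge[OF F] opn_nonneg)
  moreover have "?N F <= sqrt (?N ?S)"
   using mf_norm_ge[OF S] by (intro mf_norm_le) (simp add: o real_le_rsqrt)
  then have "(?N F)\<^sup>2 <= ?N ?S"
   using power_mono[of "?N F" "sqrt (?N ?S)" 2] mf_norm_nonneg[OF F] mf_norm_nonneg[OF S] by simp
  ultimately show "?N ?S = (?N F)\<^sup>2" by simp
  fix G assume G: "G : carrier (mat_fun n C)"
  show "?N (alg_add (mat_fun n C) F G) <= ?N F + ?N G"
   unfolding mat_fun_simps by (rule mf_norm_le, rule order_trans[OF opn_add]) (intro add_mono mf_norm_ge F G)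
  show "?N (alg_mult (mat_fun n C) F G) <= ?N F * ?N G"
   unfolding mat_fun_simps by (rule mf_norm_le, rule order_trans[OF opn_mult]) 
    (intro mult_mono mf_norm_ge F G opn_nonneg mf_norm_nonneg)
 qed
qed

lemma mf_complete:
 assumes s: "s : cauchy_seqs (mat_fun n C) (alg_norm (mat_fun n C))"
 shows "EX F:carrier (mat_fun n C). (%m. alg_norm (mat_fun n C) (alg_diff (mat_fun n C) (s m) F)) \<longlonglongrightarrow> 0"
proof -
 interpret star_algebra "mat_fun n C" by (rule mf_star_algebra)
 let ?N = "alg_norm (mat_fun n C)"
 have sc: "s m : carrier (mat_fun n C)" for m using s by (simp add: cauchy_seqs_def)
 have C: "EX N. ALL m>=N. ALL l>=N. ALL y i j. cmod (s m y i j - s l y i j) < e" if e: "e > 0" for e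
 proof -
  obtain N where N: "ALL m>=N. ALL l>=N. ?N (alg_diff (mat_fun n C) (s m) (s l)) < e"
   using s e unfolding cauchy_seqs_def by blast
  have "cmod (s m y i j - s l y i j) < e" if "m >= N" "l >= N" for m l y i j
  proof -
   have "cmod (s m y i j - s l y i j) <= ?N (alg_diff (mat_fun n C) (s m) (s l))"
    using mf_norm_entry[OF diff_closed[OF sc sc], of m l y i j] by (simp add: mat_fun_diff)
   then show ?thesis using N that by fastforce
  qed
  then show ?thesis by blast
 qed
 have "EX l. (%m. s m y i j) \<longlonglongrightarrow> l" for y i j
 proof -
  have "Cauchy (%m. s m y i j)"
  proof (rule CauchyI)
   fix e :: real assume "0 < e"
   from C[OF this] show "EX N. ALL m>=N. ALL l>=N. norm (s m y i j - s l y i j) < e" by blast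
  qed
  then show ?thesis using Cauchy_convergent convergent_def by blast
 qed
 then have "ALL y i j. EX l. (%m. s m y i j) \<longlonglongrightarrow> l" by blast
 then obtain F where F: "!!y i j. (%m. s m y i j) \<longlonglongrightarrow> F y i j" by metis
 have lim: "EX N. ALL m>=N. ALL y i j. cmod (s m y i j - F y i j) <= e" if e: "e > 0" for e
 proof -
  obtain N where N: "ALL m>=N. ALL l>=N. ALL y i j. cmod (s m y i j - s l y i j) < e" using C[OF e] by blast
  have "cmod (s m y i j - F y i j) <= e" if "m >= N" for m y i j
  proof (rule tendsto_upperbound)
   show "(%l. cmod (s m y i j - s l y i j)) \<longlonglongrightarrow> cmod (s m y i j - F y i j)" by (intro tendsto_intros F)
   show "\<forall>\<^sub>F l in sequentially. cmod (s m y i j - s l y i j) <= e"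
    using N that by (auto simp: eventually_sequentially intro!: exI[of _ N] less_imp_le)
  qed simp
  then show ?thesis by blast
 qed
 have Fc: "F : carrier (mat_fun n C)"
  unfolding mat_fun_carrier
 proof (intro conjI allI impI)
  fix i j show "(%y. F y i j) : C"
  proof (rule f_closed)
   fix e :: real assume "e > 0"
   then obtain N where "ALL m>=N. ALL y i j. cmod (s m y i j - F y i j) <= e" using lim by blast
   then show "EX g:C. ALL y. cmod (F y i j - g y) <= e"
    using mf_entry[OF sc[of N], of i j] by (intro bexI[of _ "%y. s N y i j"]) (auto simp: norm_minus_commute)
  qed
 next
  fix y i j assume "n <= i \<or> n <= j"
  then have "s m y i j = 0" for m using sc[of m] unfolding mat_fun_carrier by blast
  then show "F y i j = 0" using LIMSEQ_unique[OF F[of y i j], of 0] by simp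
 qed
 have "(%m. ?N (alg_diff (mat_fun n C) (s m) F)) \<longlonglongrightarrow> 0"
 proof (rule LIMSEQ_I)
  fix e :: real assume e: "e > 0"
  \<comment> \<open>Passing from the entries to the operator norm costs a factor
    \<open>n * n\<close>; the added 1 keeps the denominator positive.\<close>
  define d where "d = e / (real n * real n + 1)"
  have p: "real n * real n + 1 > 0" by (simp add: add_nonneg_pos)
  have d: "d > 0" using e p by (simp add: d_def)
  have "(real n * real n + 1) * d = e" using p by (simp add: d_def)
  then have d2: "real n * real n * d < e" using d by (simp add: distrib_right)
  obtain N where N: "ALL m>=N. ALL y i j. cmod (s m y i j - F y i j) <= d" using lim[OF d] by blast
  have "norm (?N (alg_diff (mat_fun n C) (s m) F) - 0) < e" if m: "m >= N" for m
  proof -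
   have "?N (alg_diff (mat_fun n C) (s m) F) <= real n * real n * d"
    by (rule mf_norm_le_entries) (use N m in "simp add: mat_fun_diff")
   then show ?thesis using mf_norm_nonneg[OF diff_closed[OF sc Fc], of m] d2 by simp
  qed
  then show "EX N. ALL m>=N. norm (?N (alg_diff (mat_fun n C) (s m) F) - 0) < e" by blast
 qed
 then show ?thesis using Fc by blast
qed

lemma mf_cstar_algebra: "cstar_algebra (mat_fun n C)"
proof (intro cstar_algebra.intro mf_star_algebra cstar_algebra_axioms.intro mf_seminorm mf_complete)
 fix F assume F: "F : carrier (mat_fun n C)" "alg_norm (mat_fun n C) F = 0"
 then have "F y i j = 0" for y i j using mf_norm_entry[OF F(1), of y i j] by simp
 then show "F = alg_zero (mat_fun n C)" by (intro HOL.ext) (simp add: mat_fun_simps)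
qed

end

section \<open>Continuous functions on a compact space and null sequences of them\<close>

abbreviation cfun :: "'x::topological_space set => ('x => complex) set" where
 "cfun X \<equiv> carrier (cont_alg X)"

lemma cfun_iff: "f : cfun X \<longleftrightarrow> continuous_on X f & (ALL x. x ~: X --> f x = 0)"
 by (simp add: cont_alg_def)

lemma cont_alg_simps:
 "alg_zero (cont_alg X) = (%x. 0)" "alg_add (cont_alg X) f g = (%x. f x + g x)"
 "alg_scale (cont_alg X) c f = (%x. c * f x)" "alg_mult (cont_alg X) f g = (%x. f x * g x)"
 "alg_star (cont_alg X) f = (%x. cnj (f x))"
 by (simp_all add: cont_alg_def)

lemma continuous_on_if_uniformly_approx:
 fixes f :: "'x::topological_space => complex"
 assumes "!!e. 0 < e ==> EX g. continuous_on X g & (ALL x:X. cmod (f x - g x) <= e)"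
 shows "continuous_on X f"
proof -
 have "ALL m. EX g. continuous_on X g & (ALL x:X. cmod (f x - g x) <= inverse (real (Suc m)))"
  using assms by simp
 then obtain g where g: "!!m. continuous_on X (g m)" 
  "!!m x. x : X ==> cmod (f x - g m x) <= inverse (real (Suc m))" by metis
 have "uniform_limit X g f sequentially"
 proof (rule uniform_limitI)
  fix e :: real assume "e > 0"
  then obtain N where N: "inverse (real (Suc N)) < e" using reals_Archimedean by blast
  have "dist (g m x) (f x) < e" if "m >= N" "x : X" for m x
  proof -
   have "dist (g m x) (f x) <= inverse (real (Suc m))" using g(2)[OF that(2)] by (simp add: dist_norm norm_minus_commute)
   also have "... <= inverse (real (Suc N))" using that(1) by (intro le_imp_inverse_le) auto
   finally show ?thesis using N by linarith
  qed
  then show "\<forall>\<^sub>F m in sequentially. ALL x:X. dist (g m x) (f x) < e" by (auto simp: eventually_sequentially)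
 qed
 then show ?thesis by (rule uniform_limit_theorem[rotated]) (simp_all add: g)
qed

lemma cfun_bounded:
 assumes X: "compact X" and f: "f : cfun X" shows "EX K>0. ALL x. cmod (f x) <= K"
proof -
 have "bounded (f ` X)"
  using f by (intro compact_imp_bounded compact_continuous_image X) (simp add: cfun_iff)
 then obtain K where "K > 0" "ALL y:f ` X. cmod y <= K" unfolding bounded_pos by blast
 moreover have "cmod (f x) <= K" for x
  using calculation f by (cases "x : X") (simp_all add: cfun_iff)
 ultimately show ?thesis by blast
qed

lemma cfun_closed:
 assumes "!!e. 0 < e ==> EX g:cfun X. ALL y. cmod (f y - g y) <= e" shows "f : cfun X"
 unfolding cfun_iff
proof (intro conjI allI impI)
 show "continuous_on X f"
 proof (rule continuous_on_if_uniformly_approx)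
  fix e :: real assume "0 < e"
  from assms[OF this] show "EX g. continuous_on X g & (ALL x:X. cmod (f x - g x) <= e)"
   by (auto simp: cfun_iff)
 qed
 fix x assume x: "x ~: X"
 have "cmod (f x) <= 0 + e" if e: "0 < e" for e 
 proof -
  obtain g where g: "g : cfun X" "ALL y. cmod (f y - g y) <= e" using assms[OF e] by blast
  then have "g x = 0" using x by (simp add: cfun_iff)
  then show ?thesis using spec[OF g(2), of x] by simp
 qed
 then have "cmod (f x) <= 0" by (rule field_le_epsilon)
 then show "f x = 0" by simp
qed

lemma cfun_fun_alg: "compact X ==> fun_alg (cfun X)"
proof unfold_locales
 fix f :: "'a => complex" assume "!!e. 0 < e ==> EX g:cfun X. ALL y. cmod (f y - g y) <= e"
 then show "f : cfun X" by (rule cfun_closed)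
next
 fix f assume "compact X" "f : cfun X"
 then show "EX K. ALL y. cmod (f y) <= K" using cfun_bounded by blast
qed (auto simp: cfun_iff intro!: continuous_intros)

text \<open>C_0(N x X) for compact X, that is, c_0 tensored with C(X). The decay in the layer k is
  uniform over the points of X.\<close>

definition C0X :: "'x::topological_space set => (nat \<times> 'x => complex) set" where
 "C0X X = {g. (ALL k. (%x. g (k, x)) : cfun X) & (ALL e>0. EX K. ALL k>=K. ALL x. cmod (g (k, x)) < e)}"

lemma C0X_decay: "[|f : C0X X; 0 < e|] ==> EX K. ALL k>=K. ALL x. cmod (f (k, x)) < e"
 by (simp add: C0X_def)

lemma C0X_fun_alg:
 assumes X: "compact X" shows "fun_alg (C0X X)"
proof -
 interpret X: fun_alg "cfun X" by (rule cfun_fun_alg[OF X])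
 have bd: "EX K>0. ALL y. cmod (f y) <= K" if f: "f : C0X X" for f :: "nat \<times> 'a => complex"
 proof -
  obtain N where N: "!!k x. k >= N ==> cmod (f (k, x)) < 1" using C0X_decay[OF f, of 1] by auto
  have "ALL k. EX B>0. ALL x. cmod (f (k, x)) <= B" using f cfun_bounded[OF X] by (simp add: C0X_def)
  then obtain B where B: "!!k. B k > 0" "!!k x. cmod (f (k, x)) <= B k" by metis
  have "cmod (f (k, x)) <= 1 + (\<Sum>k<N. B k)" for k x
  proof (cases "k < N")
   case True
   have "B k <= (\<Sum>k<N. B k)" using True B(1) by (intro member_le_sum) (auto intro: less_imp_le)
   then show ?thesis using B(2)[of k x] by linarith
  next
   case False
   have "0 <= (\<Sum>k<N. B k)" using B(1) by (intro sum_nonneg) (auto intro: less_imp_le)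
   then show ?thesis using N[of k x] False by simp
  qed
  moreover have "0 <= (\<Sum>k<N. B k)" using B(1) by (intro sum_nonneg) (auto intro: less_imp_le)
  ultimately show ?thesis by (intro exI[of _ "1 + (\<Sum>k<N. B k)"]) auto
 qed
 show ?thesis
 proof unfold_locales
  show "(%y. 0) : C0X X" by (simp add: C0X_def X.f_zero)
 next
  fix f g :: "nat \<times> 'a => complex" assume f: "f : C0X X" and g: "g : C0X X"
  show "(%y. f y + g y) : C0X X"
   unfolding C0X_def
  proof (intro CollectI conjI allI impI)
   show "(%x. f (k, x) + g (k, x)) : cfun X" for k using f g by (simp add: C0X_def X.f_add)
   fix e :: real assume "e > 0"
   then have e: "e / 2 > 0" by simp
   obtain K L where KL: "ALL k>=K. ALL x. cmod (f (k, x)) < e / 2" "ALL k>=L. ALL x. cmod (g (k, x)) < e / 2"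
    using C0X_decay[OF f e] C0X_decay[OF g e] by blast
   have "cmod (f (k, x) + g (k, x)) < e" if k: "k >= max K L" for k x
   proof -
    have "cmod (f (k, x)) < e / 2" "cmod (g (k, x)) < e / 2" using KL k by simp_all
    then show ?thesis using norm_triangle_ineq[of "f (k, x)" "g (k, x)"] by linarith
   qed
   then show "EX K. ALL k>=K. ALL x. cmod (f (k, x) + g (k, x)) < e" by blast
  qed
  obtain B where B: "B > 0" "!!y. cmod (g y) <= B" using bd[OF g] by blast
  show "(%y. f y * g y) : C0X X"
   unfolding C0X_def
  proof (intro CollectI conjI allI impI)
   show "(%x. f (k, x) * g (k, x)) : cfun X" for k using f g by (simp add: C0X_def X.f_mult)
   fix e :: real assume "e > 0"
   then have e: "e / B > 0" using B by simp
   obtain K where K: "ALL k>=K. ALL x. cmod (f (k, x)) < e / B" using C0X_decay[OF f e] by blast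
   have "cmod (f (k, x) * g (k, x)) < e" if "k >= K" for k x
   proof -
    have "cmod (f (k, x) * g (k, x)) <= cmod (f (k, x)) * B" unfolding norm_mult by (intro mult_left_mono B) simp
    also have "... < e" using K that B by (simp add: pos_less_divide_eq[symmetric])
    finally show ?thesis .
   qed
   then show "EX K. ALL k>=K. ALL x. cmod (f (k, x) * g (k, x)) < e" by blast
  qed
 next
  fix f :: "nat \<times> 'a => complex" assume f: "f : C0X X"
  show "(%y. cnj (f y)) : C0X X" using f by (simp add: C0X_def X.f_cnj)
  show "EX K. ALL y. cmod (f y) <= K" using bd[OF f] by blast
  fix c
  show "(%y. c * f y) : C0X X"
   unfolding C0X_def
  proof (intro CollectI conjI allI impI)
   show "(%x. c * f (k, x)) : cfun X" for k using f by (simp add: C0X_def X.f_scale)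
   fix e :: real assume "e > 0"
   then have e: "e / (cmod c + 1) > 0" by (simp add: add_nonneg_pos)
   obtain K where K: "ALL k>=K. ALL x. cmod (f (k, x)) < e / (cmod c + 1)" using C0X_decay[OF f e] by blast
   have "cmod (c * f (k, x)) < e" if "k >= K" for k x
   proof -
    have "cmod (c * f (k, x)) <= (cmod c + 1) * cmod (f (k, x))" unfolding norm_mult by (intro mult_right_mono) auto
    also have "... < e"
    proof -
     have "cmod (f (k, x)) < e / (cmod c + 1)" using K that by blast
     then show ?thesis by (simp add: pos_less_divide_eq add_nonneg_pos mult.commute)
    qed
    finally show ?thesis .
   qed
   then show "EX K. ALL k>=K. ALL x. cmod (c * f (k, x)) < e" by blast
  qed
 next
  fix f :: "nat \<times> 'a => complex" assume ap: "!!e. 0 < e ==> EX g:C0X X. ALL y. cmod (f y - g y) <= e"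
  show "f : C0X X"
   unfolding C0X_def
  proof (intro CollectI conjI allI impI)
   fix k show "(%x. f (k, x)) : cfun X"
   proof (rule cfun_closed)
    fix e :: real assume "e > 0"
    then obtain g where "g : C0X X" "ALL y. cmod (f y - g y) <= e" using ap by blast
    then show "EX g:cfun X. ALL x. cmod (f (k, x) - g x) <= e"
     by (intro bexI[of _ "%x. g (k, x)"]) (auto simp: C0X_def)
   qed
  next
   fix e :: real assume "e > 0"
   then have e: "e / 2 > 0" by simp
   then obtain g where g: "g : C0X X" "ALL y. cmod (f y - g y) <= e / 2" using ap by blast
   obtain K where K: "ALL k>=K. ALL x. cmod (g (k, x)) < e / 2" using C0X_decay[OF g(1) e] by blast
   have "cmod (f (k, x)) < e" if "k >= K" for k x
   proof -
    have "cmod (f (k, x)) <= cmod (g (k, x)) + cmod (f (k, x) - g (k, x))"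
     using norm_triangle_ineq[of "g (k, x)" "f (k, x) - g (k, x)"] by simp
    moreover have "cmod (g (k, x)) < e / 2" "cmod (f (k, x) - g (k, x)) <= e / 2" using K g that by auto
    ultimately show ?thesis by linarith
   qed
   then show "EX K. ALL k>=K. ALL x. cmod (f (k, x)) < e" by blast
  qed
 qed
qed

section \<open>Seminorms on algebras of functions\<close>

text \<open>The functionals \<open>h \<mapsto> q (\<Theta> h)\<close>, where \<open>\<Theta>\<close> embeds a commutative algebra of functions as a corner, a
 slice or a subalgebra. Multiplying \<open>h\<close> by a function \<open>u\<close> of modulus one does not change \<open>\<bar>h\<bar>\<^sup>2\<close>, and a
 real function \<open>f\<close> with \<open>\<bar>f\<bar> \<le> 1\<close> is the mean of \<open>f \<plusminus> i \<surd>(1 - f\<^sup>2)\<close>.\<close>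

locale multiplier_family =
 fixes \<N> :: "(('y => complex) => real) set" and B :: "('y => complex) set" and MB :: "('y => complex) set"
 assumes N_nonneg: "[|N : \<N>; h : B|] ==> 0 <= N h"
  and N_add: "[|N : \<N>; g : B; h : B|] ==> N (%y. g y + h y) <= N g + N h"
  and N_scale: "[|N : \<N>; h : B|] ==> N (%y. c * h y) = cmod c * N h"
  and N_square: "N : \<N> ==> EX N':\<N>. ALL h:B. (N h)\<^sup>2 = N' (%y. cnj (h y) * h y)"
  and B_scale: "h : B ==> (%y. c * h y) : B"
  and B_square: "h : B ==> (%y. cnj (h y) * h y) : B"
  and B_mult: "[|h : B; f : MB|] ==> (%y. h y * f y) : B"
  and MB_comp: "[|f : MB; continuous_on UNIV \<phi>|] ==> (%y. \<phi> (f y)) : MB"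
begin

lemma N_unitary:
 assumes N: "N : \<N>" and h: "h : B" and u: "u : MB" and 1: "!!y. h y ~= 0 ==> cmod (u y) = 1"
 shows "N (%y. h y * u y) = N h"
proof -
 obtain N' where N': "!!h. h : B ==> (N h)\<^sup>2 = N' (%y. cnj (h y) * h y)" using N_square[OF N] by blast
 have "cnj (h y * u y) * (h y * u y) = cnj (h y) * h y" for y
 proof (cases "h y = 0")
  case False
  then have "u y * cnj (u y) = 1" using 1[of y] complex_norm_square[of "u y"] by simp
  then have "cnj (h y) * h y * (u y * cnj (u y)) = cnj (h y) * h y" by simp
  then show ?thesis by (simp add: mult_ac)
 qed simp
 then have "(%y. cnj (h y * u y) * (h y * u y)) = (%y. cnj (h y) * h y)" by (intro HOL.ext)
 then have "(N (%y. h y * u y))\<^sup>2 = (N h)\<^sup>2" using N'[OF h] N'[OF B_mult[OF h u]] by (simp only:)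
 then show ?thesis using N_nonneg[OF N h] N_nonneg[OF N B_mult[OF h u]] by (simp add: power2_eq_iff_nonneg)
qed

lemma N_real_mult:
 assumes N: "N : \<N>" and h: "h : B" and f: "f : MB" 
  and real: "!!y. f y = complex_of_real (Re (f y))" and 1: "!!y. h y ~= 0 ==> cmod (f y) <= 1"
 shows "N (%y. h y * f y) <= N h"
proof -
 define \<phi> where "\<phi> s w = complex_of_real (Re w) + s * complex_of_real (sqrt (1 - (Re w)\<^sup>2))" for s w
 have cont: "continuous_on UNIV (\<phi> s)" for s unfolding \<phi>_def by (intro continuous_intros)
 have mb: "(%y. \<phi> s (f y)) : MB" for s by (rule MB_comp[OF f cont])
 have n: "cmod (\<phi> s (f y)) = 1" if "s = \<i> \<or> s = - \<i>" "h y ~= 0" for s y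
 proof -
  have "\<bar>Re (f y)\<bar> <= 1" using 1[OF that(2)] abs_Re_le_cmod[of "f y"] by linarith
  then have "(Re (f y))\<^sup>2 <= 1" by (simp add: abs_square_le_1)
  then show ?thesis using that(1) by (auto simp: \<phi>_def cmod_def)
 qed
 have e: "(%y. h y * f y) = (%y. (1/2) * (h y * \<phi> \<i> (f y)) + (1/2) * (h y * \<phi> (-\<i>) (f y)))"
 proof
  fix y
  have "\<phi> \<i> (f y) + \<phi> (-\<i>) (f y) = 2 * f y" using real[of y] by (simp add: \<phi>_def)
  then have "f y = (1/2) * \<phi> \<i> (f y) + (1/2) * \<phi> (-\<i>) (f y)" by (simp add: field_simps)
  then have "h y * f y = h y * ((1/2) * \<phi> \<i> (f y) + (1/2) * \<phi> (-\<i>) (f y))" by simp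
  then show "h y * f y = (1/2) * (h y * \<phi> \<i> (f y)) + (1/2) * (h y * \<phi> (-\<i>) (f y))"
   by (simp add: algebra_simps)
 qed
 note B2 = B_scale[OF B_mult[OF h mb], of "1/2"]
 have "N (%y. h y * f y) <= N (%y. (1/2) * (h y * \<phi> \<i> (f y))) + N (%y. (1/2) * (h y * \<phi> (-\<i>) (f y)))"
  unfolding e by (rule N_add[OF N B2 B2])
 also have "... = (1/2) * N h + (1/2) * N h"
  unfolding N_scale[OF N B_mult[OF h mb]] using N_unitary[OF N h mb] n by simp
 finally show ?thesis by simp
qed

text \<open>The C*-identity replaces the complex multiplier f by the real one |f|^2, for which
  averaging is available. The functional changes from \<open>N\<close> to \<open>N'\<close> on the
  way, which is why a family closed under squaring is considered instead of a single
  functional.\<close>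

lemma N_mult_le1:
 assumes N: "N : \<N>" and h: "h : B" and f: "f : MB" and 1: "!!y. h y ~= 0 ==> cmod (f y) <= 1"
 shows "N (%y. h y * f y) <= N h"
proof -
 obtain N' where N': "N' : \<N>" "!!h. h : B ==> (N h)\<^sup>2 = N' (%y. cnj (h y) * h y)" using N_square[OF N] by blast
 have mb: "(%y. complex_of_real ((cmod (f y))\<^sup>2)) : MB"
  by (rule MB_comp[OF f, where \<phi> = "%w. complex_of_real ((cmod w)\<^sup>2)"]) (intro continuous_intros)
 have e: "(%y. cnj (h y * f y) * (h y * f y)) = (%y. cnj (h y) * h y * complex_of_real ((cmod (f y))\<^sup>2))"
  by (intro HOL.ext) (simp add: complex_norm_square mult_ac del: of_real_power)
 have "(N (%y. h y * f y))\<^sup>2 = N' (%y. cnj (h y) * h y * complex_of_real ((cmod (f y))\<^sup>2))"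
  using N'(2)[OF B_mult[OF h f]] unfolding e .
 also have "... <= N' (%y. cnj (h y) * h y)"
 proof (rule N_real_mult[OF N'(1) B_square[OF h] mb])
  fix y assume "cnj (h y) * h y ~= 0"
  then have "cmod (f y) <= 1" using 1[of y] by auto
  then have "(cmod (f y))\<^sup>2 <= 1\<^sup>2" by (intro power_mono) auto
  then show "cmod (complex_of_real ((cmod (f y))\<^sup>2)) <= 1" by (simp add: norm_power del: of_real_power)
 qed simp
 also have "... = (N h)\<^sup>2" using N'(2)[OF h] by simp
 finally show ?thesis using power2_le_imp_le N_nonneg[OF N h] by blast
qed

lemma N_mult_le:
 assumes N: "N : \<N>" and h: "h : B" and f: "f : MB" and c: "c > 0" "!!y. h y ~= 0 ==> cmod (f y) <= c"
 shows "N (%y. h y * f y) <= c * N h"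
proof -
 have mb: "(%y. inverse (complex_of_real c) * f y) : MB"
  by (rule MB_comp[OF f, where \<phi> = "%w. inverse (complex_of_real c) * w"]) (intro continuous_intros)
 have e: "(%y. h y * f y) = (%y. complex_of_real c * (h y * (inverse (complex_of_real c) * f y)))"
  using c(1) by (intro HOL.ext) simp
 have "N (%y. h y * f y) = c * N (%y. h y * (inverse (complex_of_real c) * f y))"
  by (subst e, subst N_scale[OF N B_mult[OF h mb]]) (use c(1) in simp)
 also have "... <= c * N h"
 proof (intro mult_left_mono N_mult_le1[OF N h mb])
  fix y assume "h y ~= 0"
  then have "cmod (f y) <= c" by (rule c(2))
  then show "cmod (inverse (complex_of_real c) * f y) <= 1" using c(1) by (simp add: norm_mult norm_inverse norm_divide field_simps)
 qed (use c(1) in simp)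
 finally show ?thesis .
qed

end

section \<open>Bounds for functionals on null sequences of functions\<close>

definition trunc :: "'x set => nat => nat \<times> 'x => complex" where
 "trunc X K = (%(k, x). if k < K & x : X then 1 else 0)"

text \<open>Multipliers need no decay in k, only continuity on every layer; a bound is added where
  they are used.\<close>

definition layer_mult :: "'x::topological_space set => (nat \<times> 'x => complex) set" where
 "layer_mult X = {f. ALL k. continuous_on X (%x. f (k, x))}"

lemma trunc_C0X: "trunc X K : C0X X"
 unfolding C0X_def
proof (intro CollectI conjI allI impI)
 fix k
 have "continuous_on X (%x. trunc X K (k, x)) \<longleftrightarrow> continuous_on X (%x. if k < K then 1 else 0 :: complex)"
  by (intro continuous_on_cong) (auto simp: trunc_def)
 then show "(%x. trunc X K (k, x)) : cfun X" by (auto simp: cfun_iff trunc_def)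
next
 fix e :: real assume "e > 0"
 then show "EX L. ALL k>=L. ALL x. cmod (trunc X K (k, x)) < e" by (intro exI[of _ K]) (simp add: trunc_def)
qed

lemma C0X_mult_layer:
 assumes X: "compact X" and h: "h : C0X X" and f: "f : layer_mult X" and b: "!!y. h y ~= 0 ==> cmod (f y) <= c"
 shows "(%y. h y * f y) : C0X X"
 unfolding C0X_def
proof (intro CollectI conjI allI impI)
 fix k show "(%x. h (k, x) * f (k, x)) : cfun X"
  using h f by (auto simp: C0X_def layer_mult_def cfun_iff intro!: continuous_intros)
next
 fix e :: real assume "e > 0"
 then have e: "e / (\<bar>c\<bar> + 1) > 0" by (simp add: add_nonneg_pos)
 obtain K where K: "ALL k>=K. ALL x. cmod (h (k, x)) < e / (\<bar>c\<bar> + 1)" using C0X_decay[OF h e] by blast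
 have "cmod (h (k, x) * f (k, x)) < e" if "k >= K" for k x
 proof (cases "h (k, x) = 0")
  case False
  have "cmod (h (k, x) * f (k, x)) <= cmod (h (k, x)) * (\<bar>c\<bar> + 1)"
   unfolding norm_mult using b[OF False] by (intro mult_left_mono) auto
  also have "... < e"
  proof -
   have "cmod (h (k, x)) < e / (\<bar>c\<bar> + 1)" using K that by blast
   then show ?thesis by (simp add: pos_less_divide_eq add_nonneg_pos)
  qed
  finally show ?thesis .
 qed (use \<open>e > 0\<close> in simp)
 then show "EX K. ALL k>=K. ALL x. cmod (h (k, x) * f (k, x)) < e" by blast
qed

text \<open>The square root of the modulus times the phase. Division by zero gives the value 0 at w
  = 0, which is the continuous one.\<close>

definition sqrt_phase :: "complex => complex" where
 "sqrt_phase w = w / complex_of_real (sqrt (cmod w))"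

lemma cmod_sqrt_phase: "cmod (sqrt_phase w) = sqrt (cmod w)"
 by (simp add: sqrt_phase_def norm_divide real_div_sqrt)

lemma sqrt_phase_mult: "complex_of_real (sqrt (cmod w)) * sqrt_phase w = w"
 by (simp add: sqrt_phase_def)

lemma continuous_sqrt_phase: "continuous_on UNIV sqrt_phase"
proof -
 have "isCont sqrt_phase w" for w
 proof (cases "w = 0")
  case True
  have "(sqrt_phase \<longlongrightarrow> 0) (at 0)"
  proof (rule Lim_null_comparison)
   show "\<forall>\<^sub>F w in at 0. norm (sqrt_phase w) <= sqrt (cmod w)" by (simp add: cmod_sqrt_phase)
   have "((%w. sqrt (cmod w)) \<longlongrightarrow> sqrt (cmod (0::complex))) (at 0)" by (intro tendsto_intros)
   then show "((%w::complex. sqrt (cmod w)) \<longlongrightarrow> 0) (at 0)" by simp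
  qed
  then show ?thesis using True by (simp add: isCont_def sqrt_phase_def)
 next
  case False then show ?thesis unfolding sqrt_phase_def by (intro continuous_intros) auto
 qed
 then show ?thesis by (simp add: continuous_on_eq_continuous_at)
qed

text \<open>The tail of \<open>g\<close> is controlled by writing \<open>g\<close> as \<open>\<surd>\<bar>g\<bar>\<close> times a function that tends to zero.\<close>

lemma C0X_functional_bound:
 assumes X: "compact X"
  and fam: "!!MB. [|!!f. f : MB ==> f : layer_mult X & bounded (range f); 
   !!f \<phi>. [|f : MB; continuous_on UNIV \<phi>|] ==> (%y. \<phi> (f y)) : MB|] ==> multiplier_family \<N> (C0X X) MB"
  and N: "N : \<N>" and N1: "!!K. N (trunc X K) <= 1"
  and g: "g : C0X X" and c: "c > 0" "!!y. cmod (g y) <= c"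
 shows "N g <= c"
proof -
 \<comment> \<open>The assumption on the family is stated for every \<open>MB\<close> so that the
   multipliers can be fixed here: bounded and layerwise continuous, stable under continuous
   functions, but not necessarily decaying.\<close>
 let ?MB = "{f. f : layer_mult X & bounded (range f)}"
 interpret C: fun_alg "C0X X" by (rule C0X_fun_alg[OF X])
 interpret F: multiplier_family \<N> "C0X X" ?MB
 proof (rule fam)
  fix f :: "nat \<times> 'a => complex" and \<phi> :: "complex => complex" 
  assume f: "f : ?MB" and \<phi>: "continuous_on UNIV \<phi>"
  have "continuous_on X (%x. \<phi> (f (k, x)))" for k
   using f by (intro continuous_on_compose2[OF \<phi>]) (auto simp: layer_mult_def)
  moreover have "bounded (range (%y. \<phi> (f y)))"
  proof -
   have "compact (closure (range f))" using f by simp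
   then have "bounded (\<phi> ` closure (range f))"
    by (intro compact_imp_bounded compact_continuous_image continuous_on_subset[OF \<phi>]) auto
   moreover have "range (%y. \<phi> (f y)) \<subseteq> \<phi> ` closure (range f)" using closure_subset by fastforce
   ultimately show ?thesis by (rule bounded_subset)
  qed
  ultimately show "(%y. \<phi> (f y)) : ?MB" by (simp add: layer_mult_def)
 qed simp
 obtain Bg where Bg: "!!y. cmod (g y) <= Bg" using C.f_bounded[OF g] by blast
 define h where "h y = complex_of_real (sqrt (cmod (g y)))" for y
 have hC: "h : C0X X"
  unfolding C0X_def
 proof (intro CollectI conjI allI impI)
  fix k show "(%x. h (k, x)) : cfun X"
   using g unfolding h_def by (auto simp: C0X_def cfun_iff intro!: continuous_intros)
 next
  fix e :: real assume e: "e > 0"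
  obtain K where K: "ALL k>=K. ALL x. cmod (g (k, x)) < e\<^sup>2" using C0X_decay[OF g, of "e\<^sup>2"] e by auto
  have "cmod (h (k, x)) < e" if "k >= K" for k x
  proof -
   have "cmod (g (k, x)) < e\<^sup>2" using K that by blast
   then have "sqrt (cmod (g (k, x))) < e" using e by (simp add: real_less_lsqrt)
   then show ?thesis by (simp add: h_def)
  qed
  then show "EX K. ALL k>=K. ALL x. cmod (h (k, x)) < e" by blast
 qed
 have gM: "g : ?MB"
  using g Bg by (auto simp: C0X_def layer_mult_def cfun_iff bounded_iff)
 have "N g <= c + e" if e: "e > 0" for e
 proof -
  have nh: "0 <= N h" by (rule F.N_nonneg[OF N hC])
  \<comment> \<open>Chosen with \<open>d * N h <= e\<close>. The tail multiplier \<open>f\<close>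
    below is bounded by \<open>d\<close> because |g| < d^2 from layer \<open>K\<close> on.\<close>
  define d where "d = e / (N h + 1)"
  have d: "d > 0" using e nh by (simp add: d_def add_nonneg_pos)
  have dn: "d * N h <= e"
  proof -
   have "d * N h <= d * (N h + 1)" using d by simp
   also have "... = e" using nh by (simp add: d_def add_nonneg_eq_0_iff)
   finally show ?thesis .
  qed
  obtain K where K: "ALL k>=K. ALL x. cmod (g (k, x)) < d\<^sup>2" using C0X_decay[OF g, of "d\<^sup>2"] d by auto
  define f where "f = (%(k, x). if k < K then 0 else sqrt_phase (g (k, x)))"
  have fM: "f : ?MB"
  proof -
   have "continuous_on X (%x. f (k, x))" for k
    using gM by (cases "k < K") (auto simp: f_def layer_mult_def intro!: continuous_on_compose2[OF continuous_sqrt_phase])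
   moreover have "cmod (f y) <= sqrt Bg" for y
    using Bg[of y] order_trans[OF norm_ge_zero Bg[of y]] by (cases y) (auto simp: f_def cmod_sqrt_phase)
   then have "bounded (range f)" by (auto simp: bounded_iff)
   ultimately show ?thesis by (simp add: layer_mult_def)
  qed
  have fd: "cmod (f y) <= d" for y
  proof (cases y)
   case (Pair k x)
   show ?thesis
   proof (cases "k < K")
    case False
    then have "cmod (g (k, x)) <= d\<^sup>2" using K by (simp add: less_imp_le)
    then show ?thesis using d False Pair by (simp add: f_def cmod_sqrt_phase real_le_lsqrt)
   qed (use d Pair in "simp add: f_def")
  qed
  have e: "g = (%y. trunc X K y * g y + h y * f y)"
  proof
   fix y show "g y = trunc X K y * g y + h y * f y"
   proof (cases y)
    case (Pair k x)
    show ?thesis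
    proof (cases "x : X")
     case True
     then show ?thesis using Pair sqrt_phase_mult[of "g (k, x)"] by (auto simp: trunc_def f_def h_def)
    next
     case False
     then have "g (k, x) = 0" using g by (auto simp: C0X_def cfun_iff)
     then show ?thesis using Pair by (simp add: h_def)
    qed
   qed
  qed
  have "N g <= N (%y. trunc X K y * g y) + N (%y. h y * f y)"
   by (subst e) (rule F.N_add[OF N F.B_mult[OF trunc_C0X gM] F.B_mult[OF hC fM]])
  also have "N (%y. trunc X K y * g y) <= c * N (trunc X K)"
   by (rule F.N_mult_le[OF N trunc_C0X gM c])
  also have "c * N (trunc X K) <= c" using N1[of K] c(1) by (simp add: mult_left_le)
  also have "N (%y. h y * f y) <= d * N h" by (rule F.N_mult_le[OF N hC fM d fd])
  finally show ?thesis using dn by simp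
 qed
 then show ?thesis by (rule field_le_epsilon)
qed

lemma layer_mult_bounded_B_mult:
 assumes "compact X" "h : C0X X" "f : layer_mult X & bounded (range f)"
 shows "(%y. h y * f y) : C0X X"
proof -
 obtain c where "!!y. cmod (f y) <= c" using assms(3) unfolding bounded_iff by auto
 then show ?thesis using C0X_mult_layer assms by blast
qed

definition unit_fun :: "nat => nat => ('y => complex) => 'y => nat => nat => complex" where
 "unit_fun i j g = (%y i' j'. if i' = i & j' = j then g y else 0)"

lemma (in fun_alg) unit_fun_closed: "[|i < n; j < n; g : C|] ==> unit_fun i j g : carrier (mat_fun n C)"
proof -
 assume a: "i < n" "j < n" "g : C"
 have "(%y. if P then g y else 0) : C" for P using a(3) f_zero by (cases P) simp_all
 then show ?thesis using a by (auto simp: mat_fun_carrier unit_fun_def)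
qed

text \<open>Squaring moves the matrix corner (i, j) to the diagonal corner (j, j); hence the
  functionals for all corners together form a family closed under squaring.\<close>

lemma unit_fun_star_mult:
 assumes "i < n"
 shows "alg_mult (mat_fun n C) (alg_star (mat_fun n C) (unit_fun i j g)) (unit_fun i j g)
  = unit_fun j j (%y. cnj (g y) * g y)"
proof (intro HOL.ext)
 fix y i' j'
 have "(\<Sum>l<n. cnj (unit_fun i j g y l i') * unit_fun i j g y l j')
   = (\<Sum>l<n. if l = i then cnj (if i' = j then g y else 0) * (if j' = j then g y else 0) else 0)"
  by (intro sum.cong) (auto simp: unit_fun_def)
 also have "... = unit_fun j j (%y. cnj (g y) * g y) y i' j'" using assms by (simp add: unit_fun_def)
 finally show "alg_mult (mat_fun n C) (alg_star (mat_fun n C) (unit_fun i j g)) (unit_fun i j g) y i' j'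
  = unit_fun j j (%y. cnj (g y) * g y) y i' j'" by (simp add: mat_fun_simps)
qed

lemma (in fun_alg) mf_sum:
 assumes q: "cstar_seminorm (mat_fun n C) q" and "finite J" "!!a. a : J ==> F a : carrier (mat_fun n C)"
 shows "(%y i j. SUM a:J. F a y i j) : carrier (mat_fun n C) & q (%y i j. SUM a:J. F a y i j) <= (SUM a:J. q (F a))"
 using assms(2,3)
proof (induction J rule: finite_induct)
 interpret q: seminormed_algebra "mat_fun n C" q
  by (intro seminormed_algebra.intro mf_star_algebra seminormed_algebra_axioms.intro q)
 case empty
 show ?case using q.q_zero q.zero_closed by (simp add: mat_fun_simps)
next
 interpret q: seminormed_algebra "mat_fun n C" q
  by (intro seminormed_algebra.intro mf_star_algebra seminormed_algebra_axioms.intro q)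
 case (insert a J)
 then show ?case
  using q.q_add[of "F a" "%y i j. SUM a:J. F a y i j"] q.add_closed[of "F a" "%y i j. SUM a:J. F a y i j"]
  by (simp add: mat_fun_simps)
qed

lemma unit_fun_decomp:
 assumes "F : carrier (mat_fun n C)"
 shows "F = (%y i j. SUM a:{..<n} \<times> {..<n}. unit_fun (fst a) (snd a) (%y. F y (fst a) (snd a)) y i j)"
proof (intro HOL.ext)
 fix y i j
 have "(SUM a:{..<n} \<times> {..<n}. unit_fun (fst a) (snd a) (%y. F y (fst a) (snd a)) y i j)
   = (SUM a:{..<n} \<times> {..<n}. if a = (i, j) then F y i j else 0)"
  by (intro sum.cong) (auto simp: unit_fun_def)
 also have "... = F y i j" using assms unfolding mat_fun_carrier by (simp add: not_less)
 finally show "F y i j = (SUM a:{..<n} \<times> {..<n}. unit_fun (fst a) (snd a) (%y. F y (fst a) (snd a)) y i j)" by simp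
qed

theorem mat_C0X_seminorm_le:
 assumes X: "compact X" and q: "cstar_seminorm (mat_fun n (C0X X)) q" and F: "F : carrier (mat_fun n (C0X X))"
 shows "q F <= alg_norm (mat_fun n (C0X X)) F"
proof -
 let ?D = "mat_fun n (C0X X)"
 interpret C: fun_alg "C0X X" by (rule C0X_fun_alg[OF X])
 interpret q: seminormed_algebra ?D q
  by (intro seminormed_algebra.intro C.mf_star_algebra seminormed_algebra_axioms.intro q)
 define \<N> where "\<N> = {%g. q (unit_fun i j g) |i j. i < n & j < n}"
 have sq: "(q (unit_fun i j h))\<^sup>2 = q (unit_fun j j (%y. cnj (h y) * h y))" if "i < n" "j < n" "h : C0X X" for i j h
  using q.q_cstar[OF C.unit_fun_closed[OF that]] unit_fun_star_mult[OF that(1), of "C0X X" j h] by simp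
 have fam: "multiplier_family \<N> (C0X X) MB"
  if MB: "!!f. f : MB ==> f : layer_mult X & bounded (range f)" 
   "!!f \<phi>. [|f : MB; continuous_on UNIV \<phi>|] ==> (%y. \<phi> (f y)) : MB" for MB
 proof unfold_locales
  fix N assume "N : \<N>"
  then obtain i j where ij: "i < n" "j < n" "N = (%g. q (unit_fun i j g))" by (auto simp: \<N>_def)
  note cl = C.unit_fun_closed[OF ij(1,2)]
  show "EX N':\<N>. ALL h:C0X X. (N h)\<^sup>2 = N' (%y. cnj (h y) * h y)"
   using sq[OF ij(1,2)] ij by (intro bexI[of _ "%g. q (unit_fun j j g)"]) (auto simp: \<N>_def)
  fix h assume h: "h : C0X X"
  show "0 <= N h" using q.q_nonneg[OF cl[OF h]] by (simp add: ij)
  show "N (%y. c * h y) = cmod c * N h" for c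
  proof -
   have "unit_fun i j (%y. c * h y) = alg_scale ?D c (unit_fun i j h)"
    by (intro HOL.ext) (simp add: unit_fun_def mat_fun_simps)
   then show ?thesis using q.q_scale[OF cl[OF h]] by (simp add: ij)
  qed
  fix g assume g: "g : C0X X"
  have "unit_fun i j (%y. g y + h y) = alg_add ?D (unit_fun i j g) (unit_fun i j h)"
   by (intro HOL.ext) (simp add: unit_fun_def mat_fun_simps)
  then show "N (%y. g y + h y) <= N g + N h" using q.q_add[OF cl[OF g] cl[OF h]] by (simp add: ij)
 next
  fix h f assume "h : C0X X" "f : MB"
  then show "(%y. h y * f y) : C0X X" using layer_mult_bounded_B_mult[OF X] MB(1) by blast
 qed (use MB(2) C.f_scale C.f_mult C.f_cnj in auto)
 \<comment> \<open>The diagonal truncations are projections, so their seminorm equals its own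
   square; the off-diagonal ones follow by the C*-identity.\<close>
 have tr: "q (unit_fun i j (trunc X K)) <= 1" if ij: "i < n" "j < n" for i j K
 proof -
  have t: "(%y. cnj (trunc X K y) * trunc X K y) = trunc X K" by (auto simp: trunc_def)
  have le1: "x <= 1" if "x\<^sup>2 = x" "0 <= x" for x :: real using that by (auto simp: power2_eq_square)
  have jj: "q (unit_fun j j (trunc X K)) <= 1"
   using sq[OF ij(2,2) trunc_C0X, of K] q.q_nonneg[OF C.unit_fun_closed[OF ij(2,2) trunc_C0X]] unfolding t
   by (intro le1) simp_all
  then have "(q (unit_fun i j (trunc X K)))\<^sup>2 <= 1\<^sup>2" using sq[OF ij trunc_C0X, of K] unfolding t by simp
  then show ?thesis by (rule power2_le_imp_le) simp
 qed
 have le: "q G <= (real n * real n + 1) * alg_norm ?D G" if G: "G : carrier ?D" for G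
 proof -
  let ?F = "%a. unit_fun (fst a) (snd a) (%y. G y (fst a) (snd a))"
  let ?J = "{..<n} \<times> {..<n}"
  have entry: "q (?F a) <= alg_norm ?D G + e" if a: "a : ?J" and e: "e > 0" for a e
  proof -
   have N: "(%g. q (unit_fun (fst a) (snd a) g)) : \<N>" unfolding \<N>_def using a
    by (intro CollectI exI[of _ "fst a"] exI[of _ "snd a"]) auto
   have p: "alg_norm ?D G + e > 0" using C.mf_norm_nonneg[OF G] e by linarith
   show ?thesis
   proof (rule C0X_functional_bound[OF X fam N _ C.mf_entry[OF G] p])
    show "q (unit_fun (fst a) (snd a) (trunc X K)) <= 1" for K using tr a by auto
    show "cmod (G y (fst a) (snd a)) <= alg_norm ?D G + e" for y
     using C.mf_norm_entry[OF G, of y "fst a" "snd a"] e by linarith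
   qed
  qed
  have entry': "q (?F a) <= alg_norm ?D G" if a: "a : ?J" for a
   by (rule field_le_epsilon) (rule entry[OF a])
  have "q G = q (%y i j. SUM a:?J. ?F a y i j)" using unit_fun_decomp[OF G] by simp
  also have "... <= (SUM a:?J. q (?F a))"
   by (rule conjunct2[OF C.mf_sum[OF q]]) (auto intro: C.unit_fun_closed C.mf_entry[OF G])
  also have "... <= (SUM a:?J. alg_norm ?D G)" by (intro sum_mono entry')
  also have "... <= (real n * real n + 1) * alg_norm ?D G" 
   using C.mf_norm_nonneg[OF G] by (simp add: distrib_right)
  finally show ?thesis .
 qed
 show ?thesis by (rule cstar_seminorm_le_if_bounded[OF C.mf_star_algebra q C.mf_seminorm le F])
qed

section \<open>Approximation of continuous functions\<close>

inductive_set cspan :: "('x => complex) set => ('x => complex) set" for G where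
 gen: "g : G ==> g : cspan G"
| add: "[|f : cspan G; g : cspan G|] ==> (%x. f x + g x) : cspan G"
| scale: "f : cspan G ==> (%x. c * f x) : cspan G"

text \<open>Real and imaginary parts are approximated separately by the real theorem. Closure under
  products and conjugation is asked only up to equality on X, because values of the generators off X
  are irrelevant and may not match.\<close>

theorem complex_Stone_Weierstrass:
 fixes X :: "'x::t2_space set"
 assumes X: "compact X" and cont: "!!g. g : G ==> continuous_on X g"
  and one: "EX g:G. ALL x:X. g x = 1"
  and mult: "!!g h. [|g : G; h : G|] ==> EX k:G. ALL x:X. k x = g x * h x"
  and cnj: "!!g. g : G ==> EX k:G. ALL x:X. k x = cnj (g x)"
  and sep: "!!x y. [|x : X; y : X; x ~= y|] ==> EX g:G. g x ~= g y"
  and f: "continuous_on X f" and e: "e > 0"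
 shows "EX g:cspan G. ALL x:X. cmod (f x - g x) < e"
proof -
 have contS: "continuous_on X g" if "g : cspan G" for g
  using that by induction (simp_all add: cont continuous_on_add continuous_on_mult_left)
 have mult1: "EX k:cspan G. ALL x:X. k x = g x * h x" if h: "h : cspan G" and g: "g : G" for g h
  using h
 proof induction
  case (gen h)
  then show ?case using mult[OF g gen] cspan.gen by blast
 next
  case (add h h')
  then obtain k k' where "k : cspan G" "k' : cspan G" "ALL x:X. k x = g x * h x" "ALL x:X. k' x = g x * h' x" by blast
  then show ?case by (intro bexI[of _ "%x. k x + k' x"]) (auto simp: distrib_left intro: cspan.add)
 next
  case (scale h c)
  then obtain k where "k : cspan G" "ALL x:X. k x = g x * h x" by blast
  then show ?case by (intro bexI[of _ "%x. c * k x"]) (auto intro: cspan.scale)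
 qed
 have multS: "EX k:cspan G. ALL x:X. k x = g x * h x" if g: "g : cspan G" and h: "h : cspan G" for g h
  using g
 proof induction
  case (gen g) then show ?case using mult1[OF h] by blast
 next
  case (add g g')
  then obtain k k' where "k : cspan G" "k' : cspan G" "ALL x:X. k x = g x * h x" "ALL x:X. k' x = g' x * h x" by blast
  then show ?case by (intro bexI[of _ "%x. k x + k' x"]) (auto simp: distrib_right intro: cspan.add)
 next
  case (scale g c)
  then obtain k where "k : cspan G" "ALL x:X. k x = g x * h x" by blast
  then show ?case by (intro bexI[of _ "%x. c * k x"]) (auto intro: cspan.scale)
 qed
 \<comment> \<open>The real functions whose complexification agrees on X with an element of the
   span; this is the algebra handed to the real theorem.\<close>
 define P where "P h \<longleftrightarrow> (EX g:cspan G. ALL x:X. g x = complex_of_real (h x))" for h :: "'x => real"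
 have P_re: "P (%x. Re (g x))" and P_im: "P (%x. Im (g x))" if g: "g : G" for g
 proof -
  obtain k where k: "k : G" "ALL x:X. k x = cnj (g x)" using cnj[OF g] by blast
  have "(%x. (1/2) * g x + (1/2) * k x) : cspan G" by (intro cspan.intros g k)
  moreover have "(1/2) * g x + (1/2) * k x = complex_of_real (Re (g x))" if "x : X" for x
   using k that by (simp add: complex_eq_iff)
  ultimately show "P (%x. Re (g x))" unfolding P_def by (intro bexI[of _ "%x. (1/2) * g x + (1/2) * k x"]) auto
  have "(%x. (-\<i>/2) * g x + (\<i>/2) * k x) : cspan G" by (intro cspan.intros g k)
  moreover have "(-\<i>/2) * g x + (\<i>/2) * k x = complex_of_real (Im (g x))" if "x : X" for x
   using k that by (simp add: complex_eq_iff)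
  ultimately show "P (%x. Im (g x))" unfolding P_def by (intro bexI[of _ "%x. (-\<i>/2) * g x + (\<i>/2) * k x"]) auto
 qed
 have approx: "EX g. P g & (ALL x:X. \<bar>h x - g x\<bar> < d)" if h: "continuous_on X h" and d: "d > 0" for h d
 proof (rule Stone_Weierstrass_HOL[OF X _ _ _ _ _ h d])
  fix c :: real
  obtain u where u: "u : G" "ALL x:X. u x = 1" using one by blast
  then show "P (%x. c)" unfolding P_def
   by (intro bexI[of _ "%x. complex_of_real c * u x"]) (auto intro: cspan.intros)
 next
  fix h assume "P h"
  then obtain g where g: "g : cspan G" "ALL x:X. g x = complex_of_real (h x)" by (auto simp: P_def)
  have "continuous_on X (%x. Re (g x))" by (intro continuous_intros contS g)
  then show "continuous_on X h" using g(2) by (subst continuous_on_cong[of X X h "%x. Re (g x)"]) auto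
 next
  fix h h' assume "P h & P h'"
  then obtain g g' where g: "g : cspan G" "ALL x:X. g x = complex_of_real (h x)" 
   and g': "g' : cspan G" "ALL x:X. g' x = complex_of_real (h' x)" by (auto simp: P_def)
  show "P (%x. h x + h' x)" unfolding P_def
   using g g' by (intro bexI[of _ "%x. g x + g' x"]) (auto intro: cspan.add)
  obtain k where "k : cspan G" "ALL x:X. k x = g x * g' x" using multS[OF g(1) g'(1)] by blast
  then show "P (%x. h x * h' x)" unfolding P_def using g g' by (intro bexI[of _ k]) auto
 next
  fix x y assume "x : X & y : X & x ~= y"
  then obtain g where g: "g : G" "g x ~= g y" using sep by blast
  then have "Re (g x) ~= Re (g y) \<or> Im (g x) ~= Im (g y)" by (simp add: complex_eq_iff)
  then show "EX f. P f & f x ~= f y" using P_re[OF g(1)] P_im[OF g(1)] by blast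
 qed
 have e2: "e / 2 > 0" using e by simp
 have cre: "continuous_on X (%x. Re (f x))" and cim: "continuous_on X (%x. Im (f x))"
  by (intro continuous_intros f)+
 obtain a where a: "P a" "ALL x:X. \<bar>Re (f x) - a x\<bar> < e / 2" using approx[OF cre e2] by blast
 obtain b where b: "P b" "ALL x:X. \<bar>Im (f x) - b x\<bar> < e / 2" using approx[OF cim e2] by blast
 obtain ga where ga: "ga : cspan G" "ALL x:X. ga x = complex_of_real (a x)" using a(1) by (auto simp: P_def)
 obtain gb where gb: "gb : cspan G" "ALL x:X. gb x = complex_of_real (b x)" using b(1) by (auto simp: P_def)
 have "cmod (f x - (ga x + \<i> * gb x)) < e" if x: "x : X" for x
 proof -
  have "cmod (f x - (ga x + \<i> * gb x)) <= \<bar>Re (f x - (ga x + \<i> * gb x))\<bar> + \<bar>Im (f x - (ga x + \<i> * gb x))\<bar>"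
   by (rule cmod_le)
  also have "... = \<bar>Re (f x) - a x\<bar> + \<bar>Im (f x) - b x\<bar>" using ga gb x by simp
  also have "... < e / 2 + e / 2" using a(2) b(2) x by (intro add_strict_mono) auto
  finally show ?thesis by simp
 qed
 then show ?thesis
  by (intro bexI[of _ "%x. ga x + \<i> * gb x"] ballI) (simp, intro cspan.intros ga gb)
qed

text \<open>A discrete Fourier transform replaces the integral over the circle: averaging over the
  m-th roots of unity isolates the coefficient exactly once m exceeds every |l - k|.\<close>

lemma fourier_coefficient_le:
 fixes c :: "int => complex"
 assumes J: "finite J" and le: "!!z. cmod z = 1 ==> cmod (SUM l:J. c l * z powi l) <= B" and k: "k : J"
 shows "cmod (c k) <= B"
proof -
 obtain m where m: "m > 0" "!!l. l : J ==> \<bar>l - k\<bar> < int m"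
 proof
  \<comment> \<open>The sum of all the distances, plus one, exceeds each of them and is
    positive.\<close>
  let ?m = "nat (1 + (SUM l:J. \<bar>l - k\<bar>))"
  have s: "0 <= (SUM l:J. \<bar>l - k\<bar>)" by (intro sum_nonneg) simp
  then have "0 < 1 + (SUM l:J. \<bar>l - k\<bar>)" by linarith
  then show "?m > 0" by simp
  fix l assume "l : J"
  then have "\<bar>l - k\<bar> <= (SUM l:J. \<bar>l - k\<bar>)" using J by (intro member_le_sum) auto
  then show "\<bar>l - k\<bar> < int ?m" using s by simp
 qed
 define \<omega> where "\<omega> = cis (2 * pi / real m)"
 have \<omega>: "cmod \<omega> = 1" "\<omega> ~= 0" by (simp_all add: \<omega>_def)
 have geo: "(\<Sum>t<m. (\<omega> powi (l - k)) ^ t) = (if l = k then of_nat m else 0)" if l: "l : J" for l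
 proof (cases "l = k")
  case False
  have "\<omega> powi (l - k) ~= 1"
  proof
   assume "\<omega> powi (l - k) = 1"
   then have "cos (of_int (l - k) * (2 * pi / real m)) = 1"
    unfolding \<omega>_def cis_power_int by (metis Re_complex_of_real cis.sel(1) of_real_1)
   then obtain j :: int where j: "of_int (l - k) * (2 * pi / real m) = of_int j * 2 * pi"
    using cos_one_2pi_int by blast
   then have "(2 * pi) * real_of_int (l - k) = (2 * pi) * (real_of_int j * real m)"
    using m(1) by (simp only: times_divide_eq_right divide_eq_eq) (simp add: algebra_simps)
   then have "real_of_int (l - k) = real_of_int (j * int m)" by simp
   then have jm: "l - k = j * int m" by (simp only: of_int_eq_iff)
   then have "j ~= 0" using False by auto
   then have "int m <= \<bar>l - k\<bar>" unfolding jm abs_mult using mult_right_mono[of 1 "\<bar>j\<bar>" "int m"] by simp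
   then show False using m(2)[OF l] by simp
  qed
  moreover have "(\<omega> powi (l - k)) ^ m = 1"
  proof -
   have "(\<omega> powi (l - k)) ^ m = (\<omega> ^ m) powi (l - k)"
    by (simp add: power_int_power power_int_power' mult.commute)
   also have "\<omega> ^ m = 1" using m(1) by (simp add: \<omega>_def Complex.DeMoivre)
   finally show ?thesis by simp
  qed
  ultimately show ?thesis using False by (simp add: geometric_sum)
 qed simp
 have "(\<Sum>t<m. \<omega> powi (- (int t * k)) * (SUM l:J. c l * (\<omega> ^ t) powi l))
   = (\<Sum>t<m. SUM l:J. c l * (\<omega> powi (l - k)) ^ t)"
 proof (intro sum.cong refl)
  fix t
  have "\<omega> powi (- (int t * k)) * (c l * (\<omega> ^ t) powi l) = c l * (\<omega> powi (l - k)) ^ t" for l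
  proof -
   have "\<omega> powi (- (int t * k)) * (\<omega> ^ t) powi l = \<omega> powi (- (int t * k) + int t * l)"
    by (subst power_int_add) (simp_all add: \<omega> power_int_power)
   also have "- (int t * k) + int t * l = (l - k) * int t" by (simp add: algebra_simps)
   finally show ?thesis by (simp add: power_int_power' mult_ac)
  qed
  then show "\<omega> powi (- (int t * k)) * (SUM l:J. c l * (\<omega> ^ t) powi l) = (SUM l:J. c l * (\<omega> powi (l - k)) ^ t)"
   by (simp only: sum_distrib_left)
 qed
 also have "... = (SUM l:J. \<Sum>t<m. c l * (\<omega> powi (l - k)) ^ t)" by (rule sum.swap)
 also have "... = (SUM l:J. if l = k then c l * of_nat m else 0)"
  by (intro sum.cong refl) (simp add: sum_distrib_left[symmetric] geo)
 also have "... = c k * of_nat m" using J k by simp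
 finally have e: "(\<Sum>t<m. \<omega> powi (- (int t * k)) * (SUM l:J. c l * (\<omega> ^ t) powi l)) = c k * of_nat m" .
 have "cmod (c k) * real m = cmod (c k * of_nat m)" by (simp add: norm_mult)
 also have "... <= (\<Sum>t<m. cmod (\<omega> powi (- (int t * k)) * (SUM l:J. c l * (\<omega> ^ t) powi l)))"
  unfolding e[symmetric] by (rule norm_sum)
 also have "... <= (\<Sum>t<m. B)"
  by (intro sum_mono) (simp add: norm_mult norm_power_int norm_power \<omega> le)
 finally show ?thesis using m(1) by (simp add: mult.commute)
qed

section \<open>Tensor products with commutative algebras\<close>

lemma cstar_seminorm_max:
 assumes "cstar_seminorm A q" "cstar_seminorm A N"
 shows "cstar_seminorm A (%x. max (q x) (N x))"
 unfolding cstar_seminorm_def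
proof (intro conjI ballI allI)
 note q = assms(1)[unfolded cstar_seminorm_def] and N = assms(2)[unfolded cstar_seminorm_def]
 fix x assume x: "x : carrier A"
 show "0 <= max (q x) (N x)" using q x by (simp add: le_max_iff_disj)
 show "max (q (alg_scale A c x)) (N (alg_scale A c x)) = cmod c * max (q x) (N x)" for c
  using q N x by (simp add: max_mult_distrib_left)
 have nn: "0 <= q x" "0 <= N x" using q N x by auto
 show "max (q (alg_mult A (alg_star A x) x)) (N (alg_mult A (alg_star A x) x)) = (max (q x) (N x))\<^sup>2"
 proof (cases "q x <= N x")
  case True
  then have "(q x)\<^sup>2 <= (N x)\<^sup>2" using nn by (intro power_mono)
  then show ?thesis using q N x True by (simp add: max_def)
 next
  case False
  then have "(N x)\<^sup>2 < (q x)\<^sup>2" using nn by (intro power_strict_mono) auto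
  then show ?thesis using q N x False by (simp add: max_def)
 qed
 fix y assume y: "y : carrier A"
 have nn': "0 <= q y" "0 <= N y" using q N y by auto
 have "q (alg_add A x y) <= q x + q y" "N (alg_add A x y) <= N x + N y" using q N x y by auto
 then show "max (q (alg_add A x y)) (N (alg_add A x y)) <= max (q x) (N x) + max (q y) (N y)" by linarith
 have "q (alg_mult A x y) <= q x * q y" "N (alg_mult A x y) <= N x * N y" using q N x y by auto
 moreover have "q x * q y <= max (q x) (N x) * max (q y) (N y)" "N x * N y <= max (q x) (N x) * max (q y) (N y)"
  using nn nn' by (auto intro!: mult_mono simp: le_max_iff_disj)
 ultimately show "max (q (alg_mult A x y)) (N (alg_mult A x y)) <= max (q x) (N x) * max (q y) (N y)" by linarith
qed

text \<open>\<open>q\<close> may be enlarged to the maximum of \<open>q\<close> and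
  \<open>N\<close>. Congruence modulo the enlarged seminorm implies congruence for \<open>N\<close>,
  so the coefficients of a normal form of t can be estimated by \<open>N t\<close>.\<close>

lemma dominates_if_ge:
 assumes N: "cstar_seminorm P N" and N_rels: "!!y z. (y, z) : R ==> N (alg_diff P y z) = 0"
  and ge: "!!q t. [|cstar_seminorm P q; !!y z. (y, z) : R ==> q (alg_diff P y z) = 0;
   !!t. t : carrier P ==> N t <= q t; t : carrier P|] ==> q t <= N t"
  and q: "cstar_seminorm P q" "!!y z. (y, z) : R ==> q (alg_diff P y z) = 0" and t: "t : carrier P"
 shows "q t <= N t"
proof -
 have "max (q t) (N t) <= N t"
  by (rule ge[OF cstar_seminorm_max[OF q(1) N] _ _ t]) (simp_all add: q(2) N_rels)
 then show ?thesis by simp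
qed

lemma hom_eq_if_norm_zero:
 assumes D: "cstar_algebra D" and h: "star_hom P D \<phi>" and P: "star_algebra P"
  and xy: "x : carrier P" "y : carrier P" "alg_norm D (\<phi> (alg_diff P x y)) <= 0"
 shows "\<phi> x = \<phi> y"
proof -
 interpret D: cstar_algebra D by (rule D)
 interpret DN: seminormed_algebra D "alg_norm D" by (rule cstar_algebra_seminormed[OF D])
 have c: "\<phi> x : carrier D" "\<phi> y : carrier D" using star_homD(1)[OF h] xy by auto
 have e: "\<phi> (alg_diff P x y) = alg_diff D (\<phi> x) (\<phi> y)" by (rule star_hom_diff[OF h P xy(1,2)])
 have "alg_norm D (alg_diff D (\<phi> x) (\<phi> y)) = 0" 
  using xy(3) DN.q_nonneg[OF D.diff_closed[OF c]] unfolding e by simp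
 then have "alg_diff D (\<phi> x) (\<phi> y) = alg_zero D" by (rule D.norm_definite[OF D.diff_closed[OF c]])
 then show ?thesis using D.diff_eq_zero_iff[OF c] by blast
qed

lemma rels_norm_zero:
 assumes D: "cstar_algebra D" and h: "star_hom P D \<phi>" and P: "star_algebra P"
  and "y : carrier P & z : carrier P & \<phi> y = \<phi> z"
 shows "alg_norm D (\<phi> (alg_diff P y z)) = 0"
proof -
 interpret D: cstar_algebra D by (rule D)
 interpret DN: seminormed_algebra D "alg_norm D" by (rule cstar_algebra_seminormed[OF D])
 show ?thesis using assms(4) star_hom_diff[OF h P, of y z] D.diff_self[OF star_homD(1)[OF h], of z] DN.q_zero by simp
qed

locale seminormed_semigroup = star_semigroup S m i
 for S :: "'s set" and m i +
 fixes q :: "('s => complex) => real"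
 assumes q_seminorm: "cstar_seminorm (semigroup_alg S m i) q"
begin

sublocale Q: seminormed_algebra "semigroup_alg S m i" q
 by unfold_locales (rule q_seminorm)

lemma qeq_sum:
 assumes "finite J" "!!j. j : J ==> Q.qeq (x j) (y j)"
 shows "Q.qeq (%u. SUM j:J. x j u) (%u. SUM j:J. y j u)"
 using assms
proof (induction J rule: finite_induct)
 case empty then show ?case using Q.qeq_refl[OF zero_cl] by (simp add: zero_app)
next
 case (insert j J)
 then show ?case using Q.qeq_add[of "x j" "y j" "%u. SUM j:J. x j u" "%u. SUM j:J. y j u"] by (simp add: add_app)
qed

text \<open>\<open>Z k\<close> is linear modulo the null space of \<open>q\<close>, and every basis element is, modulo that null space, a sum
 over these slots.\<close>

lemma collect:
 assumes V: "star_algebra V" and J: "finite J"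
  and Z: "!!k v. [|k : J; v : carrier V|] ==> Z k v : carrier (semigroup_alg S m i)"
  and Z_add: "!!k v v'. [|k : J; v : carrier V; v' : carrier V|]
   ==> Q.qeq (Z k (alg_add V v v')) (alg_add (semigroup_alg S m i) (Z k v) (Z k v'))"
  and Z_scale: "!!k v c. [|k : J; v : carrier V|]
   ==> Q.qeq (Z k (alg_scale V c v)) (alg_scale (semigroup_alg S m i) c (Z k v))"
  and t: "t : carrier (semigroup_alg S m i)"
  and base: "!!s. [|s : S; t s ~= 0|] ==> EX v. (ALL k:J. v k : carrier V) & Q.qeq (delta s) (%u. SUM k:J. Z k (v k) u)"
 shows "EX b. (ALL k:J. b k : carrier V) & Q.qeq t (%u. SUM k:J. Z k (b k) u)"
 using t
proof (induction rule: alg_induct_support)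
 interpret V: star_algebra V by (rule V)
 case zero
 have "Q.qeq (alg_zero P) (Z k (alg_zero V))" if "k : J" for k
  using Z_scale[OF that V.zero_closed, of 0] Z[OF that V.zero_closed]
  by (metis Q.qeq_sym V.scale_zero_right scale_zero_left)
 then have "Q.qeq (%u. SUM k:J. alg_zero P u) (%u. SUM k:J. Z k (alg_zero V) u)" by (intro qeq_sum J)
 then show ?case by (intro exI[of _ "%k. alg_zero V"]) (simp add: zero_app V.zero_closed)
next
 interpret V: star_algebra V by (rule V)
 case (step y c s)
 then obtain b where b: "!!k. k : J ==> b k : carrier V" "Q.qeq y (%u. SUM k:J. Z k (b k) u)" by blast
 obtain v where v: "!!k. k : J ==> v k : carrier V" "Q.qeq (delta s) (%u. SUM k:J. Z k (v k) u)"
  using base[OF step(2,3)] by blast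
 let ?b = "%k. alg_add V (b k) (alg_scale V c (v k))"
 have "Q.qeq (alg_add P (Z k (b k)) (alg_scale P c (Z k (v k)))) (Z k (?b k))" if k: "k : J" for k
 proof -
  have "Q.qeq (Z k (?b k)) (alg_add P (Z k (b k)) (Z k (alg_scale V c (v k))))"
   by (rule Z_add[OF k b(1)[OF k] V.scale_closed[OF v(1)[OF k]]])
  also have "Q.qeq ... (alg_add P (Z k (b k)) (alg_scale P c (Z k (v k))))"
   by (intro Q.qeq_add Q.qeq_refl Z Z_scale k b v)
  finally show ?thesis by (rule Q.qeq_sym)
 qed
 then have 1: "Q.qeq (%u. SUM k:J. alg_add P (Z k (b k)) (alg_scale P c (Z k (v k))) u) (%u. SUM k:J. Z k (?b k) u)"
  by (intro qeq_sum J)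
 have 2: "(%u. SUM k:J. alg_add P (Z k (b k)) (alg_scale P c (Z k (v k))) u)
   = alg_add P (%u. SUM k:J. Z k (b k) u) (alg_scale P c (%u. SUM k:J. Z k (v k) u))"
  by (simp add: add_app scale_app sum.distrib sum_distrib_left)
 have "Q.qeq (alg_add P y (alg_scale P c (delta s))) (%u. SUM k:J. Z k (?b k) u)"
  using Q.qeq_trans[OF Q.qeq_add[OF b(2) Q.qeq_scale[OF v(2), of c]] 1[unfolded 2]] .
 then show ?case using b(1) v(1) by (intro exI[of _ ?b]) (auto simp: V.closed)
qed

lemma single_slot:
 assumes V: "star_algebra V" and J: "finite J"
  and Z: "!!k v. [|k : J; v : carrier V|] ==> Z k v : carrier (semigroup_alg S m i)"
  and Z_scale: "!!k v c. [|k : J; v : carrier V|]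
   ==> Q.qeq (Z k (alg_scale V c v)) (alg_scale (semigroup_alg S m i) c (Z k v))"
  and k0: "k0 : J" and v0: "v0 : carrier V" and x: "Q.qeq x (Z k0 v0)"
 shows "EX v. (ALL k:J. v k : carrier V) & Q.qeq x (%u. SUM k:J. Z k (v k) u)"
proof -
 interpret V: star_algebra V by (rule V)
 let ?v = "%k. if k = k0 then v0 else alg_zero V"
 have z: "Q.qeq (alg_zero P) (Z k (alg_zero V))" if "k : J" for k
  using Z_scale[OF that V.zero_closed, of 0] Z[OF that V.zero_closed]
  by (metis Q.qeq_sym V.scale_zero_right scale_zero_left)
 have "Q.qeq (if k = k0 then x else alg_zero P) (Z k (?v k))" if "k : J" for k
  using z[OF that] x by auto
 then have "Q.qeq (%u. SUM k:J. (if k = k0 then x else alg_zero P) u) (%u. SUM k:J. Z k (?v k) u)"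
  by (intro qeq_sum J)
 moreover have "(%u. SUM k:J. (if k = k0 then x else alg_zero P) u) = x"
 proof
  fix u
  have "(SUM k:J. (if k = k0 then x else alg_zero P) u) = (SUM k:J. if k = k0 then x u else 0)"
   by (intro sum.cong) (auto simp: zero_app)
  then show "(SUM k:J. (if k = k0 then x else alg_zero P) u) = x u" using J k0 by simp
 qed
 ultimately show ?thesis using v0 by (intro exI[of _ ?v]) (auto simp: V.zero_closed)
qed

end

lemma (in star_semigroup) hom_sum:
 assumes h: "star_hom P (mat_fun n C) \<phi>" and C: "fun_alg C" and "finite J" "!!j. j : J ==> y j : carrier P"
 shows "\<phi> (%u. SUM j:J. y j u) = (%x a b. SUM j:J. \<phi> (y j) x a b)"
 using assms(3,4)
proof (induction J rule: finite_induct)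
 case empty
 then show ?case using star_hom_zero[OF h star_algebra_P fun_alg.mf_star_algebra[OF C]] by (simp add: zero_app mat_fun_simps)
next
 case (insert j J)
 then show ?case using star_homD(2)[OF h, of "y j" "%u. SUM j:J. y j u"] alg_sum_closed[of J y]
  by (simp add: add_app mat_fun_simps)
qed

section \<open>C*-seminorms on algebraic tensor products\<close>

locale tensor_pair = A: star_algebra A + B: star_algebra B
 for A :: "('a, 'm) star_alg_scheme" and B :: "('b, 'n) star_alg_scheme"
begin

abbreviation "pair_mult \<equiv> %(a, b) (a', b'). (alg_mult A a a', alg_mult B b b')"
abbreviation "pair_star \<equiv> %(a, b). (alg_star A a, alg_star B b)"

lemma A_alg: "star_algebra A" and B_alg: "star_algebra B"
 by unfold_locales

lemma pair_semigroup: "star_semigroup (carrier A \<times> carrier B) pair_mult pair_star"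
 by (rule star_semigroup_pairs[OF A_alg B_alg])

sublocale P: star_semigroup "carrier A \<times> carrier B" pair_mult pair_star
 rewrites "semigroup_alg (carrier A \<times> carrier B) pair_mult pair_star = pair_alg A B"
 by (rule pair_semigroup) (simp add: pair_alg_def)

end

locale tensor_seminorm = tensor_pair A B
 for A :: "('a, 'm) star_alg_scheme" and B :: "('b, 'n) star_alg_scheme" +
 fixes q :: "('a \<times> 'b => complex) => real"
 assumes q: "cstar_seminorm (pair_alg A B) q"
  and q_rels: "(y, z) : bilinear_rels A B ==> q (alg_diff (pair_alg A B) y z) = 0"
begin

sublocale Q: seminormed_semigroup "carrier A \<times> carrier B" pair_mult pair_star q
 rewrites "semigroup_alg (carrier A \<times> carrier B) pair_mult pair_star = pair_alg A B"
proof -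
 show "semigroup_alg (carrier A \<times> carrier B) pair_mult pair_star = pair_alg A B" by (simp add: pair_alg_def)
 show "seminormed_semigroup (carrier A \<times> carrier B) pair_mult pair_star q"
  using q by (intro seminormed_semigroup.intro pair_semigroup seminormed_semigroup_axioms.intro) (simp add: pair_alg_def)
qed

abbreviation qeq where "qeq \<equiv> Q.Q.qeq"

lemma d_cl: "[|a : carrier A; b : carrier B|] ==> delta (a, b) : carrier (pair_alg A B)"
 by (intro P.delta_cl) simp

lemma qeq_rel:
 assumes "(y, z) : bilinear_rels A B" "y : carrier (pair_alg A B)" "z : carrier (pair_alg A B)" shows "qeq y z"
 using assms q_rels by (simp add: Q.Q.qeq_def)

lemma add_left:
 assumes "a : carrier A" "a' : carrier A" "b : carrier B"
 shows "qeq (delta (alg_add A a a', b)) (alg_add (pair_alg A B) (delta (a, b)) (delta (a', b)))"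
proof (rule qeq_rel)
 show "(delta (alg_add A a a', b), alg_add (pair_alg A B) (delta (a, b)) (delta (a', b))) : bilinear_rels A B"
  unfolding bilinear_rels_def Let_def using assms by blast
qed (use assms in "auto intro!: d_cl P.add_cl A.closed")

lemma add_right:
 assumes "a : carrier A" "b : carrier B" "b' : carrier B"
 shows "qeq (delta (a, alg_add B b b')) (alg_add (pair_alg A B) (delta (a, b)) (delta (a, b')))"
proof (rule qeq_rel)
 show "(delta (a, alg_add B b b'), alg_add (pair_alg A B) (delta (a, b)) (delta (a, b'))) : bilinear_rels A B"
  unfolding bilinear_rels_def Let_def using assms by blast
qed (use assms in "auto intro!: d_cl P.add_cl B.closed")

lemma scale_left:
 assumes "a : carrier A" "b : carrier B"
 shows "qeq (delta (alg_scale A c a, b)) (alg_scale (pair_alg A B) c (delta (a, b)))"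
proof (rule qeq_rel)
 show "(delta (alg_scale A c a, b), alg_scale (pair_alg A B) c (delta (a, b))) : bilinear_rels A B"
  unfolding bilinear_rels_def Let_def using assms by blast
qed (use assms in "auto intro!: d_cl P.scale_cl A.closed")

lemma scale_right:
 assumes "a : carrier A" "b : carrier B"
 shows "qeq (delta (a, alg_scale B c b)) (alg_scale (pair_alg A B) c (delta (a, b)))"
proof (rule qeq_rel)
 show "(delta (a, alg_scale B c b), alg_scale (pair_alg A B) c (delta (a, b))) : bilinear_rels A B"
  unfolding bilinear_rels_def Let_def using assms by blast
qed (use assms in "auto intro!: d_cl P.scale_cl B.closed")

lemma q_square:
 assumes "a : carrier A" "b : carrier B"
 shows "(q (delta (a, b)))\<^sup>2 = q (delta (alg_mult A (alg_star A a) a, alg_mult B (alg_star B b) b))"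
 using Q.Q.q_cstar[OF d_cl[OF assms]] by (simp add: P.delta_star P.delta_mult)

lemma q_add_right:
 assumes "a : carrier A" "b : carrier B" "b' : carrier B"
 shows "q (delta (a, alg_add B b b')) <= q (delta (a, b)) + q (delta (a, b'))"
 using Q.Q.qeq_q[OF add_right[OF assms]] Q.Q.q_add[OF d_cl d_cl, OF assms(1,2,1,3)] by simp

lemma q_scale_right:
 assumes "a : carrier A" "b : carrier B"
 shows "q (delta (a, alg_scale B c b)) = cmod c * q (delta (a, b))"
 using Q.Q.qeq_q[OF scale_right[OF assms]] Q.Q.q_scale[OF d_cl[OF assms]] by simp

text \<open>For a projection e the map a \<mapsto> a \<otimes> e is a *-homomorphism modulo
  bilinearity, so a seminorm on the tensor product restricts to one on the first factor.\<close>

lemma slice_seminorm: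
 assumes e: "e : carrier B" "alg_mult B e e = e" "alg_star B e = e"
 shows "cstar_seminorm A (%a. q (delta (a, e)))"
 unfolding cstar_seminorm_def
proof (intro conjI ballI allI)
 fix a assume a: "a : carrier A"
 note d = d_cl[OF a e(1)]
 show "0 <= q (delta (a, e))" by (rule Q.Q.q_nonneg[OF d])
 show "q (delta (alg_scale A c a, e)) = cmod c * q (delta (a, e))" for c
  using Q.Q.qeq_q[OF scale_left[OF a e(1)]] Q.Q.q_scale[OF d] by simp
 show "q (delta (alg_mult A (alg_star A a) a, e)) = (q (delta (a, e)))\<^sup>2"
  using q_square[OF a e(1)] e by simp
 fix a' assume a': "a' : carrier A"
 note d' = d_cl[OF a' e(1)]
 show "q (delta (alg_add A a a', e)) <= q (delta (a, e)) + q (delta (a', e))"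
  using Q.Q.qeq_q[OF add_left[OF a a' e(1)]] Q.Q.q_add[OF d d'] by simp
 show "q (delta (alg_mult A a a', e)) <= q (delta (a, e)) * q (delta (a', e))"
  using Q.Q.q_mult[OF d d'] e by (simp add: P.delta_mult)
qed

end

lemma cont_alg_star_algebra: "star_algebra (cont_alg X)"
proof unfold_locales
 show "alg_diff (cont_alg X) x x = alg_zero (cont_alg X)" for x :: "'a => complex"
  by (simp add: alg_diff_def cont_alg_simps)
qed (simp_all add: cont_alg_simps cfun_iff continuous_on_add continuous_on_mult continuous_on_cnj continuous_on_mult_left,
 simp_all add: algebra_simps)

lemma cfun_restrict: "continuous_on X f ==> (%x. if x : X then f x else 0) : cfun X"
 by (auto simp: cfun_iff cong: continuous_on_cong)

locale tensor_cont_seminorm = tensor_seminorm A "cont_alg Y" q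
 for A :: "('a, 'm) star_alg_scheme" and Y :: "'y::topological_space set" and q
begin

abbreviation one_Y :: "'y => complex" where "one_Y \<equiv> %y. if y : Y then 1 else 0"

lemma one_Y: "one_Y : cfun Y"
 by (rule cfun_restrict) simp

text \<open>The square of the slice at a is the slice at a* a, so the slices are closed under
  squaring.\<close>

lemma slice_family:
 "multiplier_family {%f. q (delta (a, f)) |a. a : carrier A} (cfun Y) {f. continuous_on Y f}"
proof unfold_locales
 fix N :: "('y => complex) => real" assume "N : {%f. q (delta (a, f)) |a. a : carrier A}"
 then obtain a where a: "a : carrier A" "N = (%f. q (delta (a, f)))" by blast
 show "EX N':{%f. q (delta (a, f)) |a. a : carrier A}. ALL h:cfun Y. (N h)\<^sup>2 = N' (%y. cnj (h y) * h y)"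
  using q_square[OF a(1)] a A.closed
  by (intro bexI[of _ "%f. q (delta (alg_mult A (alg_star A a) a, f))"]) (auto simp: cont_alg_simps)
 fix h assume h: "h : cfun Y"
 show "0 <= N h" unfolding a(2) by (rule Q.Q.q_nonneg[OF d_cl[OF a(1) h]])
 show "N (%y. c * h y) = cmod c * N h" for c
  using q_scale_right[OF a(1) h, of c] by (simp add: a(2) cont_alg_simps)
 fix g assume g: "g : cfun Y"
 show "N (%y. g y + h y) <= N g + N h"
  using q_add_right[OF a(1) g h] by (simp add: a(2) cont_alg_simps)
next
 fix f :: "'y => complex" and \<phi> :: "complex => complex" 
 assume "f : {f. continuous_on Y f}" "continuous_on UNIV \<phi>"
 then show "(%y. \<phi> (f y)) : {f. continuous_on Y f}"
  by (auto intro: continuous_on_compose2[of UNIV \<phi>])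
qed (auto simp: cfun_iff intro!: continuous_intros)

lemma q_slice_le:
 assumes a: "a : carrier A" and f: "f : cfun Y" and c: "c > 0" "!!y. y : Y ==> cmod (f y) <= c"
 shows "q (delta (a, f)) <= c * q (delta (a, one_Y))"
proof -
 interpret M: multiplier_family "{%f. q (delta (a, f)) |a. a : carrier A}" "cfun Y" "{f. continuous_on Y f}"
  by (rule slice_family)
 have "f = (%y. one_Y y * f y)" using f by (auto simp: cfun_iff)
 moreover have "q (delta (a, %y. one_Y y * f y)) <= c * q (delta (a, one_Y))"
  by (rule M.N_mult_le[OF _ one_Y _ c(1)]) (use a f c(2) in "auto simp: cfun_iff split: if_splits")
 ultimately show ?thesis by simp
qed

lemma slice_sum:
 assumes a: "a : carrier A" and "finite J" "!!k. k : J ==> e k : cfun Y"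
 shows "(%y. SUM k:J. c k * e k y) : cfun Y &
  qeq (delta (a, %y. SUM k:J. c k * e k y)) (%u. SUM k:J. c k * delta (a, e k) u)"
 using assms(2,3)
proof (induction J rule: finite_induct)
 case empty
 have "qeq (delta (a, alg_scale (cont_alg Y) 0 one_Y)) (alg_scale (pair_alg A (cont_alg Y)) 0 (delta (a, one_Y)))"
  by (rule scale_right[OF a one_Y])
 then show ?case using B.zero_closed by (simp add: cont_alg_simps P.scale_app)
next
 case (insert k J)
 let ?s = "%y. SUM k:J. c k * e k y" and ?P = "pair_alg A (cont_alg Y)"
 have ek: "e k : cfun Y" "(%y. c k * e k y) : cfun Y" using insert B.scale_closed[of "e k"] by (auto simp: cont_alg_simps)
 have s: "?s : cfun Y" "qeq (delta (a, ?s)) (%u. SUM k:J. c k * delta (a, e k) u)" using insert by auto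
 have "qeq (delta (a, alg_add (cont_alg Y) (%y. c k * e k y) ?s)) (alg_add ?P (delta (a, %y. c k * e k y)) (delta (a, ?s)))"
  by (rule add_right[OF a ek(2) s(1)])
 also have "qeq ... (alg_add ?P (alg_scale ?P (c k) (delta (a, e k))) (%u. SUM k:J. c k * delta (a, e k) u))"
  using scale_right[OF a ek(1), of "c k"] by (intro Q.Q.qeq_add s(2)) (simp add: cont_alg_simps)
 finally show ?case using insert(1,2) B.add_closed[OF ek(2) s(1)] by (simp add: cont_alg_simps P.add_app P.scale_app)
qed

end

text \<open>Finite-dimensional approximations of \<open>C(Y)\<close>: the functions \<open>e m k\<close> with \<open>k \<in> J m d\<close> are, up to zero, a finite
 set of elements of degree at most \<open>d\<close> of a \<open>*\<close>-semigroup, with coordinates bounded by the supremum norm.\<close>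

locale approximating_system =
 fixes Y :: "'y::topological_space set" and e :: "nat => int => 'y => complex" and J :: "nat => nat => int set"
  and cardJ :: "nat => real"
 assumes J_finite: "finite (J m d)" and J_card: "real (card (J m d)) <= cardJ m * (1 + real d)"
  and e_cfun: "k : J m d ==> e m k : cfun Y"
  and e_le: "k : J m d ==> cmod (e m k y) <= 1"
  and e_mult: "[|k : J m d; l : J m d'|] ==> EX j:J m (d + d'). ALL y. e m k y * e m l y = e m j y"
  and e_cnj: "k : J m d ==> EX j:J m d. ALL y. cnj (e m k y) = e m j y"
  and e_coeff: "[|!!y. y : Y ==> cmod (SUM k:J m d. c k * e m k y) <= B; k : J m d|]
   ==> e m k = (%y. 0) \<or> cmod (c k) <= B"
  and e_dense: "[|f : cfun Y; 0 < \<epsilon>|] ==> EX m0. ALL m>=m0. EX c. ALL y:Y. cmod (f y - (SUM k:J m 1. c k * e m k y)) <= \<epsilon>"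

text \<open>\<open>X'\<close> stands for the product of \<open>X\<close> and \<open>Y\<close>, with
  projections \<open>h\<close> and \<open>g\<close>; leaving the identification abstract allows
  either order of the factors and an additional one-point factor. The first tensor factor is
  accessible only through \<open>\<Theta>\<close>.\<close>

locale tensor_model = tensor_pair A "cont_alg Y" + approximating_system Y e J cardJ
 for A :: "('a, 'm) star_alg_scheme" and Y :: "'y::metric_space set" and e J cardJ +
 fixes X :: "'x::metric_space set" and X' :: "'w::metric_space set" and h :: "'w => 'x" and g :: "'w => 'y"
  and n :: nat and \<Theta>
 assumes X: "compact X" and Y: "compact Y" and X': "compact X'"
  and h_cont: "continuous_on X' h" and g_cont: "continuous_on X' g"
  and hg: "bij_betw (%w. (h w, g w)) X' (X \<times> Y)"
  and \<Theta>_hom: "star_hom A (mat_fun n (C0X X)) \<Theta>"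
  and \<Theta>_bij: "bij_betw \<Theta> (carrier A) (carrier (mat_fun n (C0X X)))"
begin

abbreviation "D \<equiv> mat_fun n (C0X X)"
abbreviation "D' \<equiv> mat_fun n (C0X X')"
abbreviation "T \<equiv> pair_alg A (cont_alg Y)"

sublocale C: fun_alg "C0X X" by (rule C0X_fun_alg[OF X])
sublocale C': fun_alg "C0X X'" by (rule C0X_fun_alg[OF X'])

lemma h_in: "w : X' ==> h w : X" and g_in: "w : X' ==> g w : Y"
 using hg by (auto simp: bij_betw_def)

lemma \<Theta>_cl: "a : carrier A ==> \<Theta> a : carrier D"
 by (rule star_homD(1)[OF \<Theta>_hom])

definition tens :: "'a \<times> ('y => complex) => nat \<times> 'w => nat => nat => complex" where
 "tens = (%(a, f) (k, w) i j. if w : X' then \<Theta> a (k, h w) i j * f (g w) else 0)"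

lemma tens_closed:
 assumes a: "a : carrier A" and f: "f : cfun Y" shows "tens (a, f) : carrier D'"
 unfolding mat_fun_carrier
proof (intro conjI allI impI)
 fix i j
 have \<Theta>: "(%y. \<Theta> a y i j) : C0X X" by (rule C.mf_entry[OF \<Theta>_cl[OF a]])
 obtain K where K: "K > 0" "!!y. cmod (f y) <= K" using cfun_bounded[OF Y f] by blast
 show "(%y. tens (a, f) y i j) : C0X X'"
  unfolding C0X_def
 proof (intro CollectI conjI allI impI)
  fix k
  have "continuous_on X' (%w. \<Theta> a (k, h w) i j * f (g w))"
  proof (intro continuous_on_mult)
   show "continuous_on X' (%w. \<Theta> a (k, h w) i j)"
    using \<Theta> h_in by (intro continuous_on_compose2[OF _ h_cont, of X "%x. \<Theta> a (k, x) i j"]) (auto simp: C0X_def cfun_iff)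
   show "continuous_on X' (%w. f (g w))"
    using f g_in by (intro continuous_on_compose2[OF _ g_cont, of Y f]) (auto simp: cfun_iff)
  qed
  from cfun_restrict[OF this] show "(%w. tens (a, f) (k, w) i j) : cfun X'" by (simp add: tens_def)
 next
  fix \<epsilon> :: real assume \<epsilon>: "\<epsilon> > 0"
  then have "\<epsilon> / K > 0" using K by simp
  then obtain N where N: "ALL k>=N. ALL x. cmod (\<Theta> a (k, x) i j) < \<epsilon> / K" using C0X_decay[OF \<Theta>] by blast
  have "cmod (tens (a, f) (k, w) i j) < \<epsilon>" if "k >= N" for k w
  proof (cases "w : X'")
   case True
   have "cmod (\<Theta> a (k, h w) i j * f (g w)) <= cmod (\<Theta> a (k, h w) i j) * K"
    unfolding norm_mult by (intro mult_left_mono K) simp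
   also have "... < \<epsilon>"
   proof -
    have "cmod (\<Theta> a (k, h w) i j) < \<epsilon> / K" using N that by blast
    then show ?thesis using K by (simp add: pos_less_divide_eq)
   qed
   finally show ?thesis using True by (simp add: tens_def)
  qed (use \<epsilon> in "simp add: tens_def")
  then show "EX N. ALL k>=N. ALL w. cmod (tens (a, f) (k, w) i j) < \<epsilon>" by blast
 qed
next
 fix y i j assume "n <= i \<or> n <= j"
 then have "\<Theta> a x i j = 0" for x using \<Theta>_cl[OF a] unfolding mat_fun_carrier by blast
 then show "tens (a, f) y i j = 0" by (cases y) (simp add: tens_def)
qed

lemma tens_hom: "EX \<phi>. star_hom T D' \<phi> & (ALL s:carrier A \<times> cfun Y. \<phi> (delta s) = tens s)"
proof (rule P.hom_extension[OF C'.mf_star_algebra])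
 fix s assume "s : carrier A \<times> cfun Y"
 then obtain a f where s: "s = (a, f)" "a : carrier A" "f : cfun Y" by auto
 show "tens s : carrier D'" unfolding s(1) by (rule tens_closed[OF s(2,3)])
 show "tens (pair_star s) = alg_star D' (tens s)"
  by (intro HOL.ext) (auto simp: tens_def s cont_alg_simps mat_fun_simps star_homD(5)[OF \<Theta>_hom])
 fix s' assume "s' : carrier A \<times> cfun Y"
 then obtain a' f' where s': "s' = (a', f')" "a' : carrier A" "f' : cfun Y" by auto
 show "tens (pair_mult s s') = alg_mult D' (tens s) (tens s')"
  by (intro HOL.ext)
   (auto simp: tens_def s s' cont_alg_simps mat_fun_simps star_homD(4)[OF \<Theta>_hom] sum_distrib_left sum_distrib_right mult_ac)
qed

definition \<phi> where "\<phi> = (SOME \<phi>. star_hom T D' \<phi> & (ALL s:carrier A \<times> cfun Y. \<phi> (delta s) = tens s))"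

lemma \<phi>_hom: "star_hom T D' \<phi>" and \<phi>_delta: "[|a : carrier A; f : cfun Y|] ==> \<phi> (delta (a, f)) = tens (a, f)"
 using someI_ex[OF tens_hom] unfolding \<phi>_def by auto

lemma d_cl: "[|a : carrier A; f : cfun Y|] ==> delta (a, f) : carrier T"
 by (intro P.delta_cl) simp

lemma \<phi>_rels:
 assumes "(y, z) : bilinear_rels A (cont_alg Y)"
 shows "y : carrier T & z : carrier T & \<phi> y = \<phi> z"
proof -
 note H = star_homD(2,3)[OF \<phi>_hom] star_homD(2,3)[OF \<Theta>_hom]
 have 1: "\<phi> (delta (alg_add A a a', b)) = \<phi> (alg_add T (delta (a, b)) (delta (a', b)))"
  if "a : carrier A" "a' : carrier A" "b : cfun Y" for a a' b
  using that by (simp add: H \<phi>_delta A.closed d_cl) (auto simp: tens_def mat_fun_simps H fun_eq_iff algebra_simps)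
 have 2: "\<phi> (delta (a, alg_add (cont_alg Y) b b')) = \<phi> (alg_add T (delta (a, b)) (delta (a, b')))"
  if "a : carrier A" "b : cfun Y" "b' : cfun Y" for a b b'
  using that by (simp add: H \<phi>_delta B.closed d_cl) (auto simp: tens_def mat_fun_simps cont_alg_simps fun_eq_iff algebra_simps)
 have 3: "\<phi> (delta (alg_scale A c a, b)) = \<phi> (alg_scale T c (delta (a, b)))"
  if "a : carrier A" "b : cfun Y" for a b c
  using that by (simp add: H \<phi>_delta A.closed d_cl) (auto simp: tens_def mat_fun_simps H fun_eq_iff algebra_simps)
 have 4: "\<phi> (delta (a, alg_scale (cont_alg Y) c b)) = \<phi> (alg_scale T c (delta (a, b)))"
  if "a : carrier A" "b : cfun Y" for a b c
  using that by (simp add: H \<phi>_delta B.closed d_cl) (auto simp: tens_def mat_fun_simps cont_alg_simps fun_eq_iff algebra_simps)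
 show ?thesis
  using assms unfolding bilinear_rels_def Let_def
  by (elim UnE CollectE exE conjE; simp add: 1 2 3 4 d_cl A.closed B.closed P.cl)
qed

lemma dominated_by_\<phi>:
 assumes q: "cstar_seminorm T q" and q_rels: "!!y z. (y, z) : bilinear_rels A (cont_alg Y) ==> q (alg_diff T y z) = 0"
  and ge: "!!t. t : carrier T ==> alg_norm D' (\<phi> t) <= q t" and t: "t : carrier T"
 shows "q t <= alg_norm D' (\<phi> t)"
proof -
 interpret S: tensor_cont_seminorm A Y q
  by (intro tensor_cont_seminorm.intro tensor_seminorm.intro tensor_pair_axioms tensor_seminorm_axioms.intro q q_rels)
 let ?N = "%t. alg_norm D' (\<phi> t)"
 have N: "cstar_seminorm T ?N" by (rule cstar_seminorm_hom[OF \<phi>_hom P.star_algebra_P C'.mf_seminorm])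
 have \<phi>_qeq: "\<phi> x = \<phi> y" if "S.qeq x y" for x y
 proof (rule hom_eq_if_norm_zero[OF C'.mf_cstar_algebra \<phi>_hom P.star_algebra_P])
  show xy: "x : carrier T" "y : carrier T" by (rule S.Q.Q.qeq_closed[OF that])+
  show "alg_norm D' (\<phi> (alg_diff T x y)) <= 0"
   using ge[OF P.diff_closed[OF xy]] that by (simp add: S.Q.Q.qeq_def)
 qed
 \<comment> \<open>The unit slice is a C*-seminorm on \<open>A\<close>; transported along
   \<open>\<Theta>\<close> it falls under the bound for matrix-valued null sequences.\<close>
 have q1: "q (delta (a, S.one_Y)) <= alg_norm D (\<Theta> a)" if a: "a : carrier A" for a
 proof -
  let ?g = "inv_into (carrier A) \<Theta>"
  have "cstar_seminorm A (%a. q (delta (a, S.one_Y)))"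
   by (rule S.slice_seminorm[OF S.one_Y]) (auto simp: cont_alg_simps)
  from cstar_seminorm_hom[OF star_hom_inv[OF \<Theta>_hom \<Theta>_bij A_alg] C.mf_star_algebra this]
  have "q (delta (?g (\<Theta> a), S.one_Y)) <= alg_norm D (\<Theta> a)"
   using mat_C0X_seminorm_le[OF X] \<Theta>_cl[OF a] by blast
  then show ?thesis using inv_into_f_f[of \<Theta> "carrier A" a] \<Theta>_bij a by (simp add: bij_betw_def)
 qed
 \<comment> \<open>The filtration: second tensor factors lie in the degree-d part of the m-th
   approximating system. The scale m stays fixed while d grows under products.\<close>
 define W where "W m d = {t : carrier T. {s. t s ~= 0} \<subseteq> carrier A \<times> (e m ` J m d)}" for m d
 \<comment> \<open>Modulo \<open>q\<close>, t is a sum over \<open>J m d\<close> of terms b_k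
   \<otimes> e_k. At a fixed point and matrix entry, the values of the
   \<open>\<Theta>\<close>-images of the b_k are the coefficients of a function on Y bounded by
   \<open>?N t\<close>, so \<open>e_coeff\<close> applies.\<close>
 have growth: "q t <= (real n * real n * cardJ m) * (1 + real d) * ?N t" if t: "t : W m d" for t m d
 proof -
  have tT: "t : carrier T" using t by (simp add: W_def)
  note cl = S.d_cl[OF _ e_cfun]
  have "EX b. (ALL k:J m d. b k : carrier A) & S.qeq t (%u. SUM k:J m d. delta (b k, e m k) u)"
  proof (rule S.Q.collect[OF A_alg J_finite, where Z = "%k a. delta (a, e m k)"])
   fix s assume s: "s : carrier A \<times> cfun Y" "t s ~= 0"
   then obtain a k where ak: "a : carrier A" "k : J m d" "s = (a, e m k)" using t unfolding W_def by auto
   show "EX v. (ALL k:J m d. v k : carrier A) & S.qeq (delta s) (%u. SUM k:J m d. delta (v k, e m k) u)"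
    by (rule S.Q.single_slot[OF A_alg J_finite _ _ ak(2,1)])
     (use ak in "auto intro!: cl S.scale_left e_cfun S.Q.Q.qeq_refl")
  qed (auto intro!: cl S.scale_left S.add_left e_cfun tT)
  then obtain b where b: "!!k. k : J m d ==> b k : carrier A"
   "S.qeq t (%u. SUM k:J m d. delta (b k, e m k) u)" by blast
  have \<phi>t: "\<phi> t = (%x i j. SUM k:J m d. tens (b k, e m k) x i j)"
  proof -
   have "\<phi> t = \<phi> (%u. SUM k:J m d. delta (b k, e m k) u)" by (rule \<phi>_qeq[OF b(2)])
   also have "... = (%x i j. SUM k:J m d. \<phi> (delta (b k, e m k)) x i j)"
    by (rule P.hom_sum[OF \<phi>_hom C0X_fun_alg[OF X'] J_finite]) (use b e_cfun in "auto intro!: d_cl")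
   also have "... = (%x i j. SUM k:J m d. tens (b k, e m k) x i j)"
    using b e_cfun by (intro HOL.ext sum.cong) (auto simp: \<phi>_delta)
   finally show ?thesis .
  qed
  have slot: "q (delta (b k, e m k)) <= real n * real n * ?N t" if k: "k : J m d" for k
  proof (cases "e m k = (%y. 0)")
   case True
   have "q (delta (b k, alg_scale (cont_alg Y) 0 (e m k))) = 0"
    using S.q_scale_right[OF b(1)[OF k] e_cfun[OF k], of 0] by simp
   then show ?thesis using True C'.mf_norm_nonneg[OF star_homD(1)[OF \<phi>_hom tT]] by (simp add: cont_alg_simps)
  next
   case False
   have "q (delta (b k, e m k)) <= 1 * q (delta (b k, S.one_Y))"
    by (rule S.q_slice_le[OF b(1)[OF k] e_cfun[OF k]]) (auto intro: e_le[OF k])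
   also have "... <= alg_norm D (\<Theta> (b k))" using q1[OF b(1)[OF k]] by simp
   also have "... <= real n * real n * ?N t"
   proof (rule C.mf_norm_le_entries)
    fix y :: "nat \<times> 'x" and i j assume ij: "i < n" "j < n"
    obtain l x where y: "y = (l, x)" by force
    show "cmod (\<Theta> (b k) y i j) <= ?N t"
    proof (cases "x : X")
     case xX: True
     have "e m k = (%y. 0) \<or> cmod (\<Theta> (b k) (l, x) i j) <= ?N t"
     proof (rule e_coeff[OF _ k, where c = "%k. \<Theta> (b k) (l, x) i j"])
      fix z assume z: "z : Y"
      obtain w where w: "w : X'" "h w = x" "g w = z" 
      proof -
       have "(x, z) : (%w. (h w, g w)) ` X'" using hg xX z by (simp add: bij_betw_def)
       then show ?thesis using that by auto
      qed
      have "(SUM k:J m d. \<Theta> (b k) (l, x) i j * e m k z) = \<phi> t (l, w) i j"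
       using w by (simp add: \<phi>t tens_def)
      then show "cmod (SUM k:J m d. \<Theta> (b k) (l, x) i j * e m k z) <= ?N t"
       using C'.mf_norm_entry[OF star_homD(1)[OF \<phi>_hom tT], of "(l, w)" i j] by simp
     qed
     then show ?thesis using False y by simp
    next
     case False
     have "(%y. \<Theta> (b k) y i j) : C0X X" by (rule C.mf_entry[OF \<Theta>_cl[OF b(1)[OF k]]])
     then have "\<Theta> (b k) y i j = 0" using False y by (simp add: C0X_def cfun_iff)
     then show ?thesis using C'.mf_norm_nonneg[OF star_homD(1)[OF \<phi>_hom tT]] by simp
    qed
   qed
   finally show ?thesis .
  qed
  have "q t = q (%u. SUM k:J m d. delta (b k, e m k) u)" by (rule S.Q.Q.qeq_q[OF b(2)])
  also have "... <= (SUM k:J m d. q (delta (b k, e m k)))"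
   by (rule P.seminorm_sum[OF q J_finite]) (use b e_cfun in "auto intro!: d_cl")
  also have "... <= (SUM k:J m d. real n * real n * ?N t)" by (intro sum_mono slot)
  also have "... = real (card (J m d)) * (real n * real n * ?N t)" by simp
  also have "... <= (cardJ m * (1 + real d)) * (real n * real n * ?N t)"
   using C'.mf_norm_nonneg[OF star_homD(1)[OF \<phi>_hom tT]] by (intro mult_right_mono J_card) simp
  finally show ?thesis by (simp add: mult_ac)
 qed
 have W_le: "q t <= ?N t" if tW: "t : W m d" for t m d
 proof (rule cstar_seminorm_le_if_growth[where W = "W m" and d = d, OF P.star_algebra_P q N])
  show "t : W m d" by (rule tW)
  show "q x <= (real n * real n * cardJ m) * (1 + real d) * ?N x" if "x : W m d" for x d by (rule growth[OF that])
  show "W m d \<subseteq> carrier T" for d by (auto simp: W_def)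
  fix d x assume x: "x : W m d"
  have "{u. alg_star T x u ~= 0} \<subseteq> carrier A \<times> (e m ` J m d)"
  proof
   fix u assume "u : {u. alg_star T x u ~= 0}"
   then obtain s where s: "x s ~= 0" "u = pair_star s" using P.star_support[of x] by auto
   then obtain a k where ak: "a : carrier A" "k : J m d" "s = (a, e m k)" using x unfolding W_def by auto
   obtain j where "j : J m d" "ALL y. cnj (e m k y) = e m j y" using e_cnj[OF ak(2)] by blast
   then show "u : carrier A \<times> (e m ` J m d)" using s ak by (auto simp: cont_alg_simps A.closed)
  qed
  then show "alg_star T x : W m d" using x P.star_cl by (auto simp: W_def)
 next
  fix d d' x x' assume x: "x : W m d" and x': "x' : W m d'"
  have "{u. alg_mult T x x' u ~= 0} \<subseteq> carrier A \<times> (e m ` J m (d + d'))"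
  proof
   fix u assume "u : {u. alg_mult T x x' u ~= 0}"
   then obtain s s' where s: "x s ~= 0" "x' s' ~= 0" "u = pair_mult s s'" using P.mult_support[of x x'] by auto
   obtain a k where ak: "a : carrier A" "k : J m d" "s = (a, e m k)" using x s(1) unfolding W_def by auto
   obtain a' k' where ak': "a' : carrier A" "k' : J m d'" "s' = (a', e m k')" using x' s(2) unfolding W_def by auto
   obtain j where "j : J m (d + d')" "ALL y. e m k y * e m k' y = e m j y" using e_mult[OF ak(2) ak'(2)] by blast
   then show "u : carrier A \<times> (e m ` J m (d + d'))" using s ak ak' by (auto simp: cont_alg_simps A.closed)
  qed
  then show "alg_mult T x x' : W m (d + d')" using x x' P.mult_cl by (auto simp: W_def)
 qed
 \<comment> \<open>Degree 1 suffices for density once the scale m is large. The statement covers all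
   large m because the summands of t need a common scale.\<close>
 have approx: "ALL \<epsilon>>0. EX m0. ALL m>=m0. EX t':W m 1. q (alg_diff T t t') <= \<epsilon>" if "t : carrier T" for t
  using that
 proof (induction rule: P.alg_induct_support)
  case zero
  have "alg_zero T : W m 1" for m using P.zero_cl by (auto simp: W_def P.zero_app)
  moreover have "q (alg_diff T (alg_zero T) (alg_zero T)) = 0" using P.diff_self[OF P.zero_cl] S.Q.Q.q_zero by simp
  ultimately show ?case by (intro allI impI exI bexI[of _ "alg_zero T"]) simp_all
 next
  case (step t c s)
  obtain a f where s: "s = (a, f)" "a : carrier A" "f : cfun Y" using step by auto
  show ?case
  proof (intro allI impI)
   fix \<epsilon> :: real assume \<epsilon>: "\<epsilon> > 0"
   \<comment> \<open>Bounds the effect on \<open>q\<close> of an error in the function f; the added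
     1 keeps \<open>M\<close> positive.\<close>
   define M where "M = cmod c * q (delta (a, S.one_Y)) + 1"
   have M: "M > 0" "cmod c * q (delta (a, S.one_Y)) <= M"
    using S.Q.Q.q_nonneg[OF S.d_cl[OF s(2) S.one_Y]] by (auto simp: M_def add_nonneg_pos)
   define \<delta> where "\<delta> = \<epsilon> / 2 / M"
   have \<delta>: "\<delta> > 0" "\<delta> * M = \<epsilon> / 2" using \<epsilon> M by (simp_all add: \<delta>_def)
   obtain m1 where m1: "ALL m>=m1. EX t':W m 1. q (alg_diff T t t') <= \<epsilon> / 2" using step(4) \<epsilon> half_gt_zero by blast
   obtain m2 where m2: "ALL m>=m2. EX c. ALL y:Y. cmod (f y - (SUM k:J m 1. c k * e m k y)) <= \<delta>"
    using e_dense[OF s(3) \<delta>(1)] by blast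
   show "EX m0. ALL m>=m0. EX t':W m 1. q (alg_diff T (alg_add T t (alg_scale T c (delta s))) t') <= \<epsilon>"
   proof (intro exI allI impI)
    fix m assume m: "m >= max m1 m2"
    then obtain t' where t': "t' : W m 1" "q (alg_diff T t t') <= \<epsilon> / 2" using m1 by auto
    obtain c' where c': "!!y. y : Y ==> cmod (f y - (SUM k:J m 1. c' k * e m k y)) <= \<delta>" using m m2 by (meson max.bounded_iff)
    let ?p = "%y. SUM k:J m 1. c' k * e m k y" and ?u = "%u. SUM k:J m 1. c' k * delta (a, e m k) u"
    have p: "?p : cfun Y" "S.qeq (delta (a, ?p)) ?u"
     using S.slice_sum[OF s(2) J_finite[of m 1], where e = "e m" and c = c'] e_cfun by auto
    have uT: "?u : carrier T" by (rule S.Q.Q.qeq_closed(2)[OF p(2)])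
    have fp: "alg_diff (cont_alg Y) f ?p : cfun Y" by (rule B.diff_closed[OF s(3) p(1)])
    let ?t = "alg_add T t' (alg_scale T c ?u)"
    have t'T: "t' : carrier T" using t'(1) by (simp add: W_def)
    have supp: "{s. ?t s ~= 0} \<subseteq> carrier A \<times> (e m ` J m 1)"
    proof
     fix u assume "u : {s. ?t s ~= 0}"
     then have "t' u ~= 0 \<or> ?u u ~= 0" by (auto simp: P.add_app P.scale_app)
     then show "u : carrier A \<times> (e m ` J m 1)"
     proof
      assume "?u u ~= 0"
      then obtain k where "k : J m 1" "c' k * delta (a, e m k) u ~= 0" by (meson sum.not_neutral_contains_not_neutral)
      then show ?thesis using s(2) by (auto simp: delta_def split: if_splits)
     qed (use t'(1) in "auto simp: W_def")
    qed
    have tW: "?t : W m 1" unfolding W_def using supp P.add_cl[OF t'T P.scale_cl[OF uT]] by blast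
    have da: "delta (a, f) : carrier T" by (rule S.d_cl[OF s(2,3)])
    have "q (alg_diff T (delta (a, f)) ?u) = q (alg_diff T (delta (a, f)) (delta (a, ?p)))"
     using S.Q.Q.qeq_add[OF S.Q.Q.qeq_refl[OF da] S.Q.Q.qeq_scale[OF p(2), of "-1"]] S.Q.Q.qeq_q
     by (simp add: alg_diff_def)
    also have "... = q (delta (a, alg_diff (cont_alg Y) f ?p))"
    proof -
     have "S.qeq (delta (a, alg_diff (cont_alg Y) f ?p)) (alg_add T (delta (a, f)) (delta (a, alg_scale (cont_alg Y) (-1) ?p)))"
      unfolding alg_diff_def by (rule S.add_right[OF s(2,3) B.scale_closed[OF p(1)]])
     also have "S.qeq ... (alg_diff T (delta (a, f)) (delta (a, ?p)))"
      unfolding alg_diff_def by (intro S.Q.Q.qeq_add S.Q.Q.qeq_refl da S.scale_right s p)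
     finally show ?thesis using S.Q.Q.qeq_q by simp
    qed
    also have "... <= \<delta> * q (delta (a, S.one_Y))"
     by (rule S.q_slice_le[OF s(2) fp \<delta>(1)]) (use c' in "simp add: alg_diff_def cont_alg_simps")
    finally have d: "q (alg_diff T (delta (a, f)) ?u) <= \<delta> * q (delta (a, S.one_Y))" .
    have "q (alg_diff T (alg_add T t (alg_scale T c (delta s))) ?t)
      <= q (alg_diff T t t') + q (alg_diff T (alg_scale T c (delta s)) (alg_scale T c ?u))"
     by (rule S.Q.Q.q_add_diff_le) (use step t'T uT da s in "auto intro: P.scale_cl")
    also have "q (alg_diff T (alg_scale T c (delta s)) (alg_scale T c ?u)) = cmod c * q (alg_diff T (delta (a, f)) ?u)"
     unfolding s(1) by (rule S.Q.Q.q_scale_diff[OF da uT])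
    also have "cmod c * q (alg_diff T (delta (a, f)) ?u) <= \<delta> * (cmod c * q (delta (a, S.one_Y)))"
     using mult_left_mono[OF d, of "cmod c"] by (simp add: mult_ac)
    also have "\<delta> * (cmod c * q (delta (a, S.one_Y))) <= \<epsilon> / 2"
     using mult_left_mono[OF M(2), of \<delta>] \<delta> by simp
    finally have "q (alg_diff T (alg_add T t (alg_scale T c (delta s))) ?t) <= \<epsilon>" using t'(2) by linarith
    then show "EX t':W m 1. q (alg_diff T (alg_add T t (alg_scale T c (delta s))) t') <= \<epsilon>" using tW by blast
   qed
  qed
 qed
 interpret NN: seminormed_algebra T ?N by unfold_locales (rule N)
 have "q t <= ?N t + \<epsilon>" if "\<epsilon> > 0" for \<epsilon>
 proof -
  have "\<epsilon> / 2 > 0" using that by simp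
  then obtain m t' where t': "t' : W m 1" "q (alg_diff T t t') <= \<epsilon> / 2" using approx[OF t] by blast
  have t'T: "t' : carrier T" using t'(1) by (simp add: W_def)
  have "q t <= q t' + \<epsilon> / 2" using S.Q.Q.q_le_diff[OF t t'T] t'(2) by linarith
  moreover have "q t' <= ?N t'" by (rule W_le[OF t'(1)])
  moreover have "?N t' <= ?N t + ?N (alg_diff T t' t)" by (rule NN.q_le_diff[OF t'T t])
  moreover have "?N (alg_diff T t' t) <= \<epsilon> / 2"
   using ge[OF P.diff_closed[OF t t'T]] t'(2) NN.q_diff_commute[OF t'T t] by linarith
  ultimately show ?thesis by linarith
 qed
 then show ?thesis by (rule field_le_epsilon)
qed

text \<open>Only finitely many layers have entries of size \<delta> or more. In each of those, each
  entry is approximated by sums of products of a function on X and one on Y.\<close>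

lemma \<phi>_dense:
 assumes F: "F : carrier D'" and \<epsilon>: "0 < \<epsilon>"
 shows "EX t:carrier T. alg_norm D' (alg_diff D' F (\<phi> t)) < \<epsilon>"
proof -
 define G where "G = {%w. a (h w) * f (g w) |a f. a : cfun X & f : cfun Y}"
 have G_I: "(%w. a (h w) * f (g w)) : G" if "a : cfun X" "f : cfun Y" for a f
  unfolding G_def using that by blast
 let ?E = "%k i j p. %(k', w) i' j'. if k' = k & i' = i & j' = j & w : X' then p w else 0 :: complex"
 note H = star_homD(1,2,3)[OF \<phi>_hom]
 \<comment> \<open>A product function supported on one layer and one matrix entry is the image of a
   simple tensor, because \<open>\<Theta>\<close> is onto; linear combinations follow.\<close>
 have elem: "EX t:carrier T. \<phi> t = ?E k i j p" if p: "p : cspan G" and ij: "i < n" "j < n" for p k i j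
  using p
 proof induction
  case (gen p)
  then obtain a f where p: "p = (%w. a (h w) * f (g w))" "a : cfun X" "f : cfun Y" by (auto simp: G_def)
  let ?a = "%(k', x). if k' = k then a x else 0"
  have "?a : C0X X"
   unfolding C0X_def
  proof (intro CollectI conjI allI impI)
   fix k' have "(%x. 0) : cfun X" by (simp add: cfun_iff)
   then show "(%x. ?a (k', x)) : cfun X" using p(2) by (cases "k' = k") simp_all
  next
   fix e :: real assume "e > 0"
   then show "EX K. ALL k'>=K. ALL x. cmod (?a (k', x)) < e" by (intro exI[of _ "Suc k"]) auto
  qed
  then have "unit_fun i j ?a : carrier D" by (rule C.unit_fun_closed[OF ij])
  then have "unit_fun i j ?a : \<Theta> ` carrier A" using \<Theta>_bij by (simp add: bij_betw_def)
  then obtain b where b: "b : carrier A" "\<Theta> b = unit_fun i j ?a" by force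
  have "\<phi> (delta (b, f)) = ?E k i j p"
   unfolding \<phi>_delta[OF b(1) p(3)] by (intro HOL.ext) (auto simp: tens_def b(2) unit_fun_def p(1))
  then show ?case using d_cl[OF b(1) p(3)] by blast
 next
  case (add p p')
  then obtain t t' where t: "t : carrier T" "\<phi> t = ?E k i j p" "t' : carrier T" "\<phi> t' = ?E k i j p'" by blast
  have "\<phi> (alg_add T t t') = ?E k i j (%w. p w + p' w)"
   unfolding H(2)[OF t(1,3)] t by (intro HOL.ext) (auto simp: mat_fun_simps)
  then show ?case using P.add_cl[OF t(1,3)] by blast
 next
  case (scale p c)
  then obtain t where t: "t : carrier T" "\<phi> t = ?E k i j p" by blast
  have "\<phi> (alg_scale T c t) = ?E k i j (%w. c * p w)"
   unfolding H(3)[OF t(1)] t by (intro HOL.ext) (auto simp: mat_fun_simps)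
  then show ?case using P.scale_cl[OF t(1)] by blast
 qed
 define \<delta> where "\<delta> = \<epsilon> / (real n * real n + 1)"
 have pos: "real n * real n + 1 > 0" by (simp add: add_nonneg_pos)
 have \<delta>: "\<delta> > 0" "real n * real n * \<delta> < \<epsilon>"
 proof -
  show "\<delta> > 0" using \<epsilon> pos by (simp add: \<delta>_def)
  moreover have "(real n * real n + 1) * \<delta> = \<epsilon>" using pos by (simp add: \<delta>_def)
  ultimately show "real n * real n * \<delta> < \<epsilon>" by (simp add: distrib_right)
 qed
 have Fe: "(%y. F y i j) : C0X X'" for i j by (rule C'.mf_entry[OF F])
 have approx: "EX p:cspan G. ALL w:X'. cmod (F (k, w) i j - p w) < \<delta>" for k i j
 proof (rule complex_Stone_Weierstrass[OF X' _ _ _ _ _ _ \<delta>(1)])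
  show "continuous_on X' (%w. F (k, w) i j)" using Fe[of i j] by (simp add: C0X_def cfun_iff)
  show "continuous_on X' p" if pG: "p : G" for p
  proof -
   obtain a f where p: "p = (%w. a (h w) * f (g w))" "a : cfun X" "f : cfun Y" using pG by (auto simp: G_def)
   show ?thesis
    unfolding p(1) using p(2,3) h_in g_in
    by (intro continuous_on_mult continuous_on_compose2[OF _ h_cont, of X a] continuous_on_compose2[OF _ g_cont, of Y f])
     (auto simp: cfun_iff)
  qed
  show "EX p:G. ALL w:X'. p w = 1"
  proof (rule bexI)
   let ?p = "%w. (if h w : X then 1 else 0) * (if g w : Y then 1 else 0) :: complex"
   show "ALL w:X'. ?p w = 1" using h_in g_in by simp
   show "?p : G"
    by (rule G_I[of "%x. if x : X then 1 else 0" "%y. if y : Y then 1 else 0"]; intro cfun_restrict continuous_intros)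
  qed
  fix p assume "p : G"
  then obtain a f where p: "p = (%w. a (h w) * f (g w))" "a : cfun X" "f : cfun Y" by (auto simp: G_def)
  have "(%x. cnj (a x)) : cfun X" "(%y. cnj (f y)) : cfun Y"
   using p by (auto simp: cfun_iff intro!: continuous_intros)
  from G_I[OF this] have "(%w. cnj (a (h w)) * cnj (f (g w))) : G" .
  then show "EX k:G. ALL x:X'. k x = cnj (p x)" by (rule rev_bexI) (simp add: p(1))
  fix p' assume "p' : G"
  then obtain a' f' where p': "p' = (%w. a' (h w) * f' (g w))" "a' : cfun X" "f' : cfun Y" by (auto simp: G_def)
  have "(%x. a x * a' x) : cfun X" "(%y. f y * f' y) : cfun Y"
   using p p' by (auto simp: cfun_iff intro!: continuous_intros)
  from G_I[OF this] have "(%w. (a (h w) * a' (h w)) * (f (g w) * f' (g w))) : G" .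
  then show "EX k:G. ALL x:X'. k x = p x * p' x" by (rule rev_bexI) (simp add: p(1) p'(1) mult_ac)
 next
  fix w w' assume w: "w : X'" "w' : X'" "w ~= w'"
  then have ne: "h w ~= h w' \<or> g w ~= g w'" using hg unfolding bij_betw_def inj_on_def by blast
  let ?a = "%x. if x : X then complex_of_real (dist x (h w)) else 0" and ?f = "%y. if y : Y then complex_of_real (dist y (g w)) else 0"
  let ?a1 = "%x. if x : X then 1 else 0 :: complex" and ?f1 = "%y. if y : Y then 1 else 0 :: complex"
  have c: "?a : cfun X" "?f : cfun Y" "?a1 : cfun X" "?f1 : cfun Y"
   by (intro cfun_restrict continuous_intros)+
  have "(%w. ?a (h w) * ?f1 (g w)) : G" "(%w. ?a1 (h w) * ?f (g w)) : G"
   using G_I[OF c(1,4)] G_I[OF c(3,2)] by simp_all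
  then show "EX p:G. p w ~= p w'"
   using ne w h_in g_in by (elim disjE) (rule bexI[rotated], assumption, simp)+
 qed
 obtain p where p: "!!k i j. p k i j : cspan G" "!!k i j w. w : X' ==> cmod (F (k, w) i j - p k i j w) < \<delta>"
  using approx by metis
 have "EX K. ALL k>=K. ALL w. cmod (F (k, w) i j) < \<delta>" for i j by (rule C0X_decay[OF Fe \<delta>(1)])
 then obtain K where K: "!!i j k w. k >= K i j ==> cmod (F (k, w) i j) < \<delta>" by metis
 \<comment> \<open>The sum serves as a common upper bound for the thresholds
   \<open>K i j\<close>.\<close>
 define L where "L = (\<Sum>i<n. \<Sum>j<n. K i j)"
 have L: "K i j <= L" if "i < n" "j < n" for i j
 proof -
  have "K i j <= (\<Sum>j<n. K i j)" using that by (intro member_le_sum) auto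
  also have "... <= L" unfolding L_def using that by (intro member_le_sum[of i "{..<n}" "%i. \<Sum>j<n. K i j"]) auto
  finally show ?thesis .
 qed
 let ?J = "{..<L} \<times> {..<n} \<times> {..<n}"
 have "ALL x:?J. EX t. t : carrier T & \<phi> t = ?E (fst x) (fst (snd x)) (snd (snd x)) (p (fst x) (fst (snd x)) (snd (snd x)))"
  using elem[OF p(1)] by force
 from bchoice[OF this] obtain t where t': "ALL x:?J. t x : carrier T &
   \<phi> (t x) = ?E (fst x) (fst (snd x)) (snd (snd x)) (p (fst x) (fst (snd x)) (snd (snd x)))" ..
 note t = conjunct1[OF bspec[OF t']] conjunct2[OF bspec[OF t']]
 have T: "(%u. SUM x:?J. t x u) : carrier T" by (rule P.alg_sum_closed) (use t(1) in auto)
 have e: "\<phi> (%u. SUM x:?J. t x u) (k, w) i j = (if k < L & w : X' then p k i j w else 0)" if ij: "i < n" "j < n" for k w i j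
 proof -
  have "\<phi> (%u. SUM x:?J. t x u) (k, w) i j = (SUM x:?J. \<phi> (t x) (k, w) i j)"
   using P.hom_sum[OF \<phi>_hom C0X_fun_alg[OF X'], of ?J t] t(1) by simp
  also have "... = (SUM x:?J. if x = (k, i, j) then (if w : X' then p k i j w else 0) else 0)"
   by (intro sum.cong refl) (subst t(2), auto)
  also have "... = (if k < L & w : X' then p k i j w else 0)" using ij by simp
  finally show ?thesis .
 qed
 have "alg_norm D' (alg_diff D' F (\<phi> (%u. SUM x:?J. t x u))) <= real n * real n * \<delta>"
 proof (rule C'.mf_norm_le_entries)
  fix y :: "nat \<times> 'w" and i j assume ij: "i < n" "j < n"
  obtain k w where y: "y = (k, w)" by force
  have "cmod (F (k, w) i j - (if k < L & w : X' then p k i j w else 0)) <= \<delta>"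
  proof (cases "w : X'")
   case True
   show ?thesis
   proof (cases "k < L")
    case k: True then show ?thesis using p(2)[OF True, of k i j] True by simp
   next
    case False
    then have "k >= K i j" using L[OF ij] by linarith
    then show ?thesis using K[of i j k w] False by simp
   qed
  next
   case False
   then have "F (k, w) i j = 0" using Fe[of i j] by (simp add: C0X_def cfun_iff)
   then show ?thesis using False \<delta> by simp
  qed
  then show "cmod (alg_diff D' F (\<phi> (%u. SUM x:?J. t x u)) y i j) <= \<delta>"
   by (simp add: mat_fun_diff y e[OF ij])
 qed
 then show ?thesis using T \<delta>(2) by (intro bexI[OF _ T]) linarith
qed

theorem tensor_iso:
 shows "cstar_algebra (envelope T (bilinear_rels A (cont_alg Y)))"
  and "EX \<psi>. star_hom (envelope T (bilinear_rels A (cont_alg Y))) D' \<psi> &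
   bij_betw \<psi> (carrier (envelope T (bilinear_rels A (cont_alg Y)))) (carrier D')"
proof -
 interpret E: envelope_model T "bilinear_rels A (cont_alg Y)" D' \<phi>
 proof (intro envelope_model.intro P.star_algebra_P C'.mf_cstar_algebra envelope_model_axioms.intro \<phi>_hom \<phi>_rels)
  fix q t assume q: "cstar_seminorm T q" "!!y z. (y, z) : bilinear_rels A (cont_alg Y) ==> q (alg_diff T y z) = 0"
   and t: "t : carrier T"
  show "q t <= alg_norm D' (\<phi> t)"
  proof (rule dominates_if_ge[where P = T and R = "bilinear_rels A (cont_alg Y)" and q = q and N = "%t. alg_norm D' (\<phi> t)"])
   show "cstar_seminorm T (%t. alg_norm D' (\<phi> t))"
    by (rule cstar_seminorm_hom[OF \<phi>_hom P.star_algebra_P C'.mf_seminorm])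
   show "alg_norm D' (\<phi> (alg_diff T y z)) = 0" if "(y, z) : bilinear_rels A (cont_alg Y)" for y z
    by (rule rels_norm_zero[OF C'.mf_cstar_algebra \<phi>_hom P.star_algebra_P \<phi>_rels[OF that]])
  qed (fact q t dominated_by_\<phi>)+
 qed
 show "cstar_algebra (envelope T (bilinear_rels A (cont_alg Y)))" by (rule E.envelope_cstar)
 show "EX \<psi>. star_hom (envelope T (bilinear_rels A (cont_alg Y))) D' \<psi> &
   bij_betw \<psi> (carrier (envelope T (bilinear_rels A (cont_alg Y)))) (carrier D')"
  using E.envelope_ext_bij[OF \<phi>_dense] by blast
qed

end

subsection \<open>The tensor product of matrices and null sequences\<close>

lemma fun_alg_unit: "fun_alg (UNIV :: (unit => complex) set)"
 by unfold_locales auto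

text \<open>Scalar matrices as matrix-valued functions on a one-point type, so that the lemmas on
  \<open>mat_fun\<close> apply to \<open>matrix_alg\<close>.\<close>

definition mat_entries :: "nat => complex Matrix.mat => unit => nat => nat => complex" where
 "mat_entries n M = (%u i j. if i < n & j < n then M $$ (i, j) else 0)"

abbreviation matrices :: "nat => (unit => nat => nat => complex) cstar_alg" where
 "matrices n \<equiv> mat_fun n UNIV"

lemma matrix_alg_simps:
 "carrier (matrix_alg n) = carrier_mat n n" "alg_zero (matrix_alg n) = 0\<^sub>m n n"
 "alg_add (matrix_alg n) M N = M + N" "alg_scale (matrix_alg n) c M = c \<cdot>\<^sub>m M"
 "alg_mult (matrix_alg n) M N = M * N" "alg_star (matrix_alg n) M = mat_adjoint M"
 by (simp_all add: matrix_alg_def)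

lemma mat_adjoint_carrier: "M : carrier_mat n n ==> mat_adjoint M : carrier_mat n n"
 by (auto simp: mat_adjoint_def)

lemma mat_adjoint_index: "[|M : carrier_mat n n; i < n; j < n|] ==> mat_adjoint M $$ (i, j) = cnj (M $$ (j, i))"
 by (auto simp: mat_adjoint_def mat_of_rows_index)

lemma mat_entries_hom: "star_hom (matrix_alg n) (matrices n) (mat_entries n)"
 unfolding star_hom_def matrix_alg_simps mat_fun_simps
proof (intro conjI ballI allI funcsetI)
 fix M N :: "complex Matrix.mat" assume M: "M : carrier_mat n n" and N: "N : carrier_mat n n"
 show "mat_entries n (M + N) = (%y i j. mat_entries n M y i j + mat_entries n N y i j)"
  using M N by (intro HOL.ext) (auto simp: mat_entries_def)
 show "mat_entries n (M * N) = (%y i j. \<Sum>l<n. mat_entries n M y i l * mat_entries n N y l j)"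
  using M N by (intro HOL.ext) (auto simp: mat_entries_def scalar_prod_def lessThan_atLeast0)
next
 fix M :: "complex Matrix.mat" assume M: "M : carrier_mat n n"
 show "mat_entries n M : carrier (matrices n)" by (auto simp: mat_fun_carrier mat_entries_def)
 show "mat_entries n (c \<cdot>\<^sub>m M) = (%y i j. c * mat_entries n M y i j)" for c
  using M by (intro HOL.ext) (auto simp: mat_entries_def)
 show "mat_entries n (mat_adjoint M) = (%y i j. cnj (mat_entries n M y j i))"
  using M by (intro HOL.ext) (auto simp: mat_entries_def mat_adjoint_index)
qed

lemma mat_entries_bij: "bij_betw (mat_entries n) (carrier (matrix_alg n)) (carrier (matrices n))"
proof (rule bij_betwI[where g = "%F. Matrix.mat n n (%(i, j). F () i j)"])
 show "mat_entries n : carrier (matrix_alg n) \<rightarrow> carrier (matrices n)"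
  using star_homD(1)[OF mat_entries_hom] by blast
 show "(%F. Matrix.mat n n (%(i, j). F () i j)) : carrier (matrices n) \<rightarrow> carrier (matrix_alg n)"
  by (simp add: matrix_alg_simps)
 fix M assume "M : carrier (matrix_alg n)"
 then show "Matrix.mat n n (%(i, j). mat_entries n M () i j) = M"
  by (intro eq_matI) (auto simp: matrix_alg_simps mat_entries_def)
next
 fix F assume F: "F : carrier (matrices n)"
 show "mat_entries n (Matrix.mat n n (%(i, j). F () i j)) = F"
 proof (intro HOL.ext)
  fix u i j
  have "F u i j = 0" if "~ (i < n & j < n)" using F that unfolding mat_fun_carrier by (meson not_less)
  then show "mat_entries n (Matrix.mat n n (%(i, j). F () i j)) u i j = F u i j" by (auto simp: mat_entries_def)
 qed
qed

lemma matrix_alg_star_algebra: "star_algebra (matrix_alg n)"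
proof (rule star_algebra_pullback[OF fun_alg.mf_star_algebra[OF fun_alg_unit] mat_entries_hom])
 show "inj_on (mat_entries n) (carrier (matrix_alg n))" using mat_entries_bij by (simp add: bij_betw_def)
 show "mat_entries n (alg_zero (matrix_alg n)) = alg_zero (matrices n)"
  by (intro HOL.ext) (auto simp: mat_entries_def matrix_alg_simps mat_fun_simps)
qed (simp_all add: matrix_alg_simps mat_adjoint_carrier)

lemma c0_alg_simps:
 "carrier c0_alg = {f. f \<longlonglongrightarrow> 0}" "alg_zero c0_alg = (%k. 0)" "alg_add c0_alg f g = (%k. f k + g k)"
 "alg_scale c0_alg c f = (%k. c * f k)" "alg_mult c0_alg f g = (%k. f k * g k)" "alg_star c0_alg f = (%k. cnj (f k))"
 by (simp_all add: c0_alg_def)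

lemma c0_alg_star_algebra: "star_algebra c0_alg"
proof unfold_locales
 show "alg_diff c0_alg x x = alg_zero c0_alg" for x by (simp add: alg_diff_def c0_alg_simps)
 fix f assume "f : carrier c0_alg"
 then have f: "f \<longlonglongrightarrow> 0" by (simp add: c0_alg_simps)
 show "alg_star c0_alg f : carrier c0_alg" using tendsto_cnj[OF f] by (simp add: c0_alg_simps)
 show "alg_scale c0_alg c f : carrier c0_alg" for c using tendsto_mult_right_zero[OF f] by (simp add: c0_alg_simps)
 fix g assume "g : carrier c0_alg"
 then have g: "g \<longlonglongrightarrow> 0" by (simp add: c0_alg_simps)
 show "alg_add c0_alg f g : carrier c0_alg" using tendsto_add_zero[OF f g] by (simp add: c0_alg_simps)
 show "alg_mult c0_alg f g : carrier c0_alg" using tendsto_mult_zero[OF f g] by (simp add: c0_alg_simps)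
qed (simp_all add: c0_alg_simps algebra_simps)

text \<open>The one-point space is realised as {1} inside the circle, since 1 is the value of V^n in
  the crossed product by the finite group; the spaces on both sides of the isomorphism then agree
  literally.\<close>

abbreviation pt :: "complex set" where "pt \<equiv> {1}"

lemma C0X_pt_iff: "g : C0X pt \<longleftrightarrow> (%k. g (k, 1)) \<longlonglongrightarrow> 0 & (ALL k x. x ~= 1 --> g (k, x) = 0)"
proof
 assume g: "g : C0X pt"
 have "(%k. g (k, 1)) \<longlonglongrightarrow> 0"
 proof (rule LIMSEQ_I)
  fix e :: real assume "0 < e"
  from C0X_decay[OF g this] show "EX K. ALL k>=K. cmod (g (k, 1) - 0) < e" by auto
 qed
 then show "(%k. g (k, 1)) \<longlonglongrightarrow> 0 & (ALL k x. x ~= 1 --> g (k, x) = 0)" using g by (auto simp: C0X_def cfun_iff)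
next
 assume g: "(%k. g (k, 1)) \<longlonglongrightarrow> 0 & (ALL k x. x ~= 1 --> g (k, x) = 0)"
 show "g : C0X pt"
  unfolding C0X_def
 proof (intro CollectI conjI allI impI)
  show "(%x. g (k, x)) : cfun pt" for k using g by (auto simp: cfun_iff)
  fix e :: real assume e: "0 < e"
  then obtain K where K: "!!k. k >= K ==> cmod (g (k, 1)) < e" using LIMSEQ_D[OF conjunct1[OF g] e] by auto
  have "cmod (g (k, x)) < e" if "k >= K" for k x using K[OF that] g e by (cases "x = 1") auto
  then show "EX K. ALL k>=K. ALL x. cmod (g (k, x)) < e" by blast
 qed
qed

text \<open>c_0 has no unit, so this tensor product is not an instance of
  \<open>tensor_model\<close>, where the second factor is C(Y). Finite dimension of the matrices
  makes up for it: the n^2 matrix units give exact normal forms, and the map to the model is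
  onto.\<close>

locale matrix_c0 = tensor_pair "matrix_alg n" c0_alg for n :: nat
begin

abbreviation "T \<equiv> pair_alg (matrix_alg n) c0_alg"
abbreviation "R \<equiv> bilinear_rels (matrix_alg n) c0_alg"
abbreviation "D1 \<equiv> mat_fun n (C0X pt)"
abbreviation "G \<equiv> inv_into (carrier (matrix_alg n)) (mat_entries n)"

sublocale C: fun_alg "C0X pt" by (rule C0X_fun_alg) simp
sublocale U: fun_alg "UNIV :: (unit => complex) set" by (rule fun_alg_unit)

lemma G_hom: "star_hom (matrices n) (matrix_alg n) G"
 by (rule star_hom_inv[OF mat_entries_hom mat_entries_bij matrix_alg_star_algebra])

lemma G_inv: "M : carrier (matrix_alg n) ==> G (mat_entries n M) = M"
 and G_inv': "F : carrier (matrices n) ==> mat_entries n (G F) = F"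
 using mat_entries_bij by (auto simp: bij_betw_def f_inv_into_f)

definition tens :: "complex Matrix.mat \<times> (nat => complex) => nat \<times> complex => nat => nat => complex" where
 "tens = (%(M, f) (k, w) i j. if w = 1 then mat_entries n M () i j * f k else 0)"

lemma tens_hom: "EX \<phi>. star_hom T D1 \<phi> & (ALL s:carrier (matrix_alg n) \<times> carrier c0_alg. \<phi> (delta s) = tens s)"
proof (rule P.hom_extension[OF C.mf_star_algebra])
 fix s assume "s : carrier (matrix_alg n) \<times> carrier c0_alg"
 then obtain M f where s: "s = (M, f)" "M : carrier (matrix_alg n)" "f : carrier c0_alg" by auto
 have f: "f \<longlonglongrightarrow> 0" using s(3) by (simp add: c0_alg_simps)
 show "tens s : carrier D1"
  using tendsto_mult_right_zero[OF f] by (auto simp: mat_fun_carrier C0X_pt_iff tens_def s(1)) (auto simp: mat_entries_def)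
 show "tens (pair_star s) = alg_star D1 (tens s)"
  by (intro HOL.ext) (auto simp: tens_def s c0_alg_simps mat_fun_simps star_homD(5)[OF mat_entries_hom])
 fix s' assume "s' : carrier (matrix_alg n) \<times> carrier c0_alg"
 then obtain M' f' where s': "s' = (M', f')" "M' : carrier (matrix_alg n)" "f' : carrier c0_alg" by auto
 show "tens (pair_mult s s') = alg_mult D1 (tens s) (tens s')"
  by (intro HOL.ext)
   (auto simp: tens_def s s' c0_alg_simps mat_fun_simps star_homD(4)[OF mat_entries_hom] sum_distrib_left sum_distrib_right mult_ac)
qed

definition \<phi> where "\<phi> = (SOME \<phi>. star_hom T D1 \<phi> & (ALL s:carrier (matrix_alg n) \<times> carrier c0_alg. \<phi> (delta s) = tens s))"

lemma \<phi>_hom: "star_hom T D1 \<phi>" 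
 and \<phi>_delta: "[|M : carrier (matrix_alg n); f : carrier c0_alg|] ==> \<phi> (delta (M, f)) = tens (M, f)"
 using someI_ex[OF tens_hom] unfolding \<phi>_def by auto

lemma d_cl: "[|M : carrier (matrix_alg n); f : carrier c0_alg|] ==> delta (M, f) : carrier T"
 by (intro P.delta_cl) simp

lemma \<phi>_rels:
 assumes "(y, z) : R" shows "y : carrier T & z : carrier T & \<phi> y = \<phi> z"
proof -
 note H = star_homD(2,3)[OF \<phi>_hom] star_homD(2,3)[OF mat_entries_hom]
 have 1: "\<phi> (delta (alg_add (matrix_alg n) a a', b)) = \<phi> (alg_add T (delta (a, b)) (delta (a', b)))"
  if "a : carrier (matrix_alg n)" "a' : carrier (matrix_alg n)" "b : carrier c0_alg" for a a' b
  using that by (simp add: H \<phi>_delta A.closed d_cl) (auto simp: tens_def mat_fun_simps H fun_eq_iff algebra_simps)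
 have 2: "\<phi> (delta (a, alg_add c0_alg b b')) = \<phi> (alg_add T (delta (a, b)) (delta (a, b')))"
  if "a : carrier (matrix_alg n)" "b : carrier c0_alg" "b' : carrier c0_alg" for a b b'
  using that by (simp add: H \<phi>_delta B.closed d_cl) (auto simp: tens_def mat_fun_simps c0_alg_simps fun_eq_iff algebra_simps)
 have 3: "\<phi> (delta (alg_scale (matrix_alg n) c a, b)) = \<phi> (alg_scale T c (delta (a, b)))"
  if "a : carrier (matrix_alg n)" "b : carrier c0_alg" for a b c
  using that by (simp add: H \<phi>_delta A.closed d_cl) (auto simp: tens_def mat_fun_simps H fun_eq_iff algebra_simps)
 have 4: "\<phi> (delta (a, alg_scale c0_alg c b)) = \<phi> (alg_scale T c (delta (a, b)))"
  if "a : carrier (matrix_alg n)" "b : carrier c0_alg" for a b c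
  using that by (simp add: H \<phi>_delta B.closed d_cl) (auto simp: tens_def mat_fun_simps c0_alg_simps fun_eq_iff algebra_simps)
 show ?thesis
  using assms unfolding bilinear_rels_def Let_def
  by (elim UnE CollectE exE conjE; simp add: 1 2 3 4 d_cl A.closed B.closed P.cl)
qed

definition E :: "nat \<times> nat => complex Matrix.mat" where
 "E a = G (unit_fun (fst a) (snd a) (%_. 1))"

abbreviation "J \<equiv> {..<n} \<times> {..<n}"

lemma unit_cl: "a : J ==> unit_fun (fst a) (snd a) g : carrier (matrices n)"
 by (auto intro: U.unit_fun_closed)

lemma E_cl: "a : J ==> E a : carrier (matrix_alg n)"
 unfolding E_def by (rule star_homD(1)[OF G_hom unit_cl])

lemma E_entries: "a : J ==> mat_entries n (E a) = unit_fun (fst a) (snd a) (%_. 1)"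
 unfolding E_def by (rule G_inv'[OF unit_cl])

lemma E_star_mult: "(i, j) : J ==> alg_mult (matrix_alg n) (alg_star (matrix_alg n) (E (i, j))) (E (i, j)) = E (j, j)"
 using unit_fun_star_mult[of i n UNIV j "%_::unit. 1"] unit_cl[of "(i, j)"] U.mf_closed(5)[of "unit_fun i j (%_. 1)" n]
 by (simp add: E_def star_homD(4,5)[OF G_hom, symmetric])

lemma surjective:
 assumes F: "F : carrier D1" shows "EX t:carrier T. \<phi> t = F"
proof -
 have f: "(%k. F (k, 1) i j) : carrier c0_alg" for i j
  using C.mf_entry[OF F, of i j] by (simp add: C0X_pt_iff c0_alg_simps)
 let ?t = "%u. SUM a:J. delta (E a, %k. F (k, 1) (fst a) (snd a)) u"
 have t: "?t : carrier T" by (rule P.alg_sum_closed) (auto intro!: d_cl E_cl f)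
 have "\<phi> ?t = (%x i j. SUM a:J. \<phi> (delta (E a, %k. F (k, 1) (fst a) (snd a))) x i j)"
  by (rule P.hom_sum[OF \<phi>_hom C0X_fun_alg]) (auto intro!: d_cl E_cl f)
 also have "... = F"
 proof (intro HOL.ext)
  fix x :: "nat \<times> complex" and i j :: nat
  obtain k w where x: "x = (k, w)" by force
  have "(SUM a:J. \<phi> (delta (E a, %k. F (k, 1) (fst a) (snd a))) x i j)
    = (SUM a:J. if a = (i, j) then (if w = 1 then F (k, 1) i j else 0) else 0)"
  proof (intro sum.cong refl)
   fix a assume a: "a : J"
   show "\<phi> (delta (E a, %k. F (k, 1) (fst a) (snd a))) x i j = (if a = (i, j) then (if w = 1 then F (k, 1) i j else 0) else 0)"
    unfolding \<phi>_delta[OF E_cl[OF a] f] by (auto simp: tens_def x E_entries[OF a] unit_fun_def)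
  qed
  also have "... = F x i j"
  proof (cases "(i, j) : J")
   case True
   have "F (k, w) i j = 0" if "w ~= 1" using C.mf_entry[OF F, of i j] that by (simp add: C0X_pt_iff)
   then show ?thesis using True x by auto
  next
   case False
   then have "F x i j = 0" using F unfolding mat_fun_carrier by (metis SigmaI lessThan_iff not_less)
   then show ?thesis using False by auto
  qed
  finally show "(SUM a:J. \<phi> (delta (E a, %k. F (k, 1) (fst a) (snd a))) x i j) = F x i j" .
 qed
 finally show ?thesis using t by blast
qed

text \<open>The coefficients in the expansion by matrix units are entries of the model, so each of
  the n^2 slots is bounded by the model norm; the resulting constant factor is then removed.\<close>

lemma dominated:
 assumes q: "cstar_seminorm T q" and q_rels: "!!y z. (y, z) : R ==> q (alg_diff T y z) = 0"
  and ge: "!!t. t : carrier T ==> alg_norm D1 (\<phi> t) <= q t" and t: "t : carrier T"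
 shows "q t <= alg_norm D1 (\<phi> t)"
proof -
 interpret S: tensor_seminorm "matrix_alg n" c0_alg q
  by (intro tensor_seminorm.intro tensor_pair_axioms tensor_seminorm_axioms.intro q q_rels)
 let ?N = "%t. alg_norm D1 (\<phi> t)" and ?A = "matrix_alg n"
 have N: "cstar_seminorm T ?N" by (rule cstar_seminorm_hom[OF \<phi>_hom P.star_algebra_P C.mf_seminorm])
 have \<phi>_qeq: "\<phi> x = \<phi> y" if "S.qeq x y" for x y
 proof (rule hom_eq_if_norm_zero[OF C.mf_cstar_algebra \<phi>_hom P.star_algebra_P])
  show xy: "x : carrier T" "y : carrier T" by (rule S.Q.Q.qeq_closed[OF that])+
  show "alg_norm D1 (\<phi> (alg_diff T x y)) <= 0"
   using ge[OF P.diff_closed[OF xy]] that by (simp add: S.Q.Q.qeq_def)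
 qed
 define \<N> where "\<N> = {%g. q (delta (a, %k. g (k, 1 :: complex))) |a. a : carrier ?A}"
 have g0: "(%k. g (k, 1)) : carrier c0_alg" if "g : C0X pt" for g
  using that by (simp add: C0X_pt_iff c0_alg_simps)
 have fam: "multiplier_family \<N> (C0X pt) MB"
  if MB: "!!f. f : MB ==> f : layer_mult pt & bounded (range f)" 
   "!!f \<phi>. [|f : MB; continuous_on UNIV \<phi>|] ==> (%y. \<phi> (f y)) : MB" for MB
 proof unfold_locales
  fix N assume "N : \<N>"
  then obtain a where a: "a : carrier ?A" "N = (%g. q (delta (a, %k. g (k, 1))))" by (auto simp: \<N>_def)
  show "EX N':\<N>. ALL h:C0X pt. (N h)\<^sup>2 = N' (%y. cnj (h y) * h y)"
  proof (rule bexI)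
   show "(%g. q (delta (alg_mult ?A (alg_star ?A a) a, %k. g (k, 1 :: complex)))) : \<N>"
    unfolding \<N>_def using a(1) A.closed by blast
   show "ALL h:C0X pt. (N h)\<^sup>2 = q (delta (alg_mult ?A (alg_star ?A a) a, %k. cnj (h (k, 1)) * h (k, 1)))"
    using S.q_square[OF a(1) g0] by (simp add: a(2) c0_alg_simps)
  qed
  fix h assume h: "h : C0X pt"
  show "0 <= N h" unfolding a(2) by (rule S.Q.Q.q_nonneg[OF S.d_cl[OF a(1) g0[OF h]]])
  show "N (%y. c * h y) = cmod c * N h" for c
   using S.q_scale_right[OF a(1) g0[OF h], of c] by (simp add: a(2) c0_alg_simps)
  fix g assume g: "g : C0X pt"
  show "N (%y. g y + h y) <= N g + N h"
   using S.q_add_right[OF a(1) g0[OF g] g0[OF h]] by (simp add: a(2) c0_alg_simps)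
 next
  fix h f assume "h : C0X pt" "f : MB"
  then show "(%y. h y * f y) : C0X pt" by (intro layer_mult_bounded_B_mult MB(1)) simp_all
 qed (use MB(2) C.f_scale C.f_mult C.f_cnj in auto)
 have tr: "q (delta (E a, %k. trunc pt K (k, 1))) <= 1" if a: "a : J" for a K
 proof -
  obtain i j where ij: "a = (i, j)" "i < n" "j < n" using a by auto
  have t: "alg_mult c0_alg (alg_star c0_alg (%k. trunc pt K (k, 1))) (%k. trunc pt K (k, 1)) = (%k. trunc pt K (k, 1))" 
   by (auto simp: trunc_def c0_alg_simps)
  note tc = g0[OF trunc_C0X[of pt K]]
  have le1: "x <= 1" if "x\<^sup>2 = x" "0 <= x" for x :: real using that by (auto simp: power2_eq_square)
  have jj: "q (delta (E (j, j), %k. trunc pt K (k, 1))) <= 1"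
  proof (rule le1)
   show "(q (delta (E (j, j), %k. trunc pt K (k, 1))))\<^sup>2 = q (delta (E (j, j), %k. trunc pt K (k, 1)))"
    using S.q_square[OF E_cl tc, of "(j, j)"] E_star_mult[of j j] ij t by simp
   show "0 <= q (delta (E (j, j), %k. trunc pt K (k, 1)))" using ij by (intro S.Q.Q.q_nonneg S.d_cl E_cl tc) simp
  qed
  then have "(q (delta (E a, %k. trunc pt K (k, 1))))\<^sup>2 <= 1\<^sup>2"
   using S.q_square[OF E_cl tc, of a] E_star_mult[of i j] ij t by simp
  then show ?thesis by (rule power2_le_imp_le) simp
 qed
 have le: "q (delta (E a, f)) <= c" if a: "a : J" and f: "f : carrier c0_alg" and c: "c > 0" "!!k. cmod (f k) <= c" for a f c
 proof -
  define g where "g = (%(k :: nat, w :: complex). if w = 1 then f k else 0 :: complex)"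
  have "q (delta (E a, %k. g (k, 1))) <= c"
  proof (rule C0X_functional_bound[where X = pt and N = "%g. q (delta (E a, %k. g (k, 1)))" and \<N> = \<N> and g = g and c = c])
   show "(%g. q (delta (E a, %k. g (k, 1)))) : \<N>" unfolding \<N>_def using E_cl[OF a] by blast
   show "g : C0X pt" using f by (simp add: g_def C0X_pt_iff c0_alg_simps)
   show "cmod (g y) <= c" for y using c by (cases y) (auto simp: g_def)
   show "q (delta (E a, %k. trunc pt K (k, 1))) <= 1" for K by (rule tr[OF a])
  qed (use fam c(1) in auto)
  then show ?thesis by (simp add: g_def)
 qed
 \<comment> \<open>Expanding M in matrix units, the scalar entries of M are moved across the tensor
   sign to the c_0 side by bilinearity.\<close>
 have slot: "EX v. (ALL a:J. v a : carrier c0_alg) & S.qeq (delta s) (%u. SUM a:J. delta (E a, v a) u)" 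
  if s: "s : carrier ?A \<times> carrier c0_alg" for s
 proof -
  obtain M f where M: "s = (M, f)" "M : carrier ?A" "f : carrier c0_alg" using s by auto
  define m where "m a = mat_entries n M () (fst a) (snd a)" for a
  define H where "H J' = (%y i j. SUM a:J'. unit_fun (fst a) (snd a) (%_. m a) (y::unit) i j)" for J'
  have HJ: "H J = mat_entries n M"
   using unit_fun_decomp[OF star_homD(1)[OF mat_entries_hom M(2)]] by (simp add: H_def m_def)
  have "H J' : carrier (matrices n) & S.qeq (delta (G (H J'), f)) (%u. SUM a:J'. delta (E a, alg_scale c0_alg (m a) f) u)"
   if "finite J'" "J' \<subseteq> J" for J'
   using that
  proof (induction J' rule: finite_induct)
   case empty
   have z: "H {} = alg_scale (matrices n) 0 (H {})" "H {} : carrier (matrices n)" by (simp_all add: H_def mat_fun_simps mat_fun_carrier)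
   have "S.qeq (delta (alg_scale ?A 0 (G (H {})), f)) (alg_scale T 0 (delta (G (H {}), f)))"
    by (rule S.scale_left[OF star_homD(1)[OF G_hom z(2)] M(3)])
   moreover have "alg_scale ?A 0 (G (H {})) = G (H {})" using star_homD(3)[OF G_hom z(2), of 0] z(1) by simp
   ultimately show ?case using z(2) by (simp add: P.scale_app)
  next
   case (insert a J')
   then have a: "a : J" and IH: "H J' : carrier (matrices n)" 
    "S.qeq (delta (G (H J'), f)) (%u. SUM a:J'. delta (E a, alg_scale c0_alg (m a) f) u)" by auto
   let ?u = "unit_fun (fst a) (snd a) (%_. m a)"
   have u: "?u : carrier (matrices n)" by (rule unit_cl[OF a])
   have us: "?u = alg_scale (matrices n) (m a) (unit_fun (fst a) (snd a) (%_. 1))"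
    by (intro HOL.ext) (simp add: unit_fun_def mat_fun_simps)
   have Gu: "G ?u = alg_scale ?A (m a) (E a)" unfolding us E_def by (rule star_homD(3)[OF G_hom unit_cl[OF a]])
   have Hi: "H (insert a J') = alg_add (matrices n) ?u (H J')" using insert(1,2) by (simp add: H_def mat_fun_simps)
   have "G (H (insert a J')) = alg_add ?A (G ?u) (G (H J'))" unfolding Hi by (rule star_homD(2)[OF G_hom u IH(1)])
   then have "S.qeq (delta (G (H (insert a J')), f)) (alg_add T (delta (G ?u, f)) (delta (G (H J'), f)))"
    using S.add_left[OF star_homD(1)[OF G_hom u] star_homD(1)[OF G_hom IH(1)] M(3)] by simp
   also have "S.qeq ... (alg_add T (delta (E a, alg_scale c0_alg (m a) f)) (%u. SUM a:J'. delta (E a, alg_scale c0_alg (m a) f) u))"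
   proof (rule S.Q.Q.qeq_add[OF _ IH(2)])
    have "S.qeq (delta (alg_scale ?A (m a) (E a), f)) (alg_scale T (m a) (delta (E a, f)))" by (rule S.scale_left[OF E_cl[OF a] M(3)])
    also have "S.qeq ... (delta (E a, alg_scale c0_alg (m a) f))" by (rule S.Q.Q.qeq_sym[OF S.scale_right[OF E_cl[OF a] M(3)]])
    finally show "S.qeq (delta (G ?u, f)) (delta (E a, alg_scale c0_alg (m a) f))" unfolding Gu .
   qed
   finally show ?case using insert(1,2) U.mf_closed(2)[OF u IH(1)] unfolding Hi by (simp add: P.add_app)
  qed
  from conjunct2[OF this[of J]] have "S.qeq (delta s) (%u. SUM a:J. delta (E a, alg_scale c0_alg (m a) f) u)"
   unfolding HJ G_inv[OF M(2)] M(1) by simp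
  then show ?thesis using B.scale_closed[OF M(3)] by (intro exI[of _ "%a. alg_scale c0_alg (m a) f"]) auto
 qed
 have le2: "q x <= (real n * real n + 1) * ?N x" if x: "x : carrier T" for x
 proof -
  have "EX b. (ALL a:J. b a : carrier c0_alg) & S.qeq x (%u. SUM a:J. delta (E a, b a) u)"
  proof (rule S.Q.collect[where V = c0_alg and Z = "%a f. delta (E a, f)"])
   show "EX v. (ALL a:J. v a : carrier c0_alg) & S.qeq (delta s) (%u. SUM a:J. delta (E a, v a) u)"
    if "s : carrier ?A \<times> carrier c0_alg" for s by (rule slot[OF that])
  qed (use x in "simp_all only: B_alg S.d_cl E_cl S.add_right S.scale_right finite_lessThan finite_cartesian_product")
  then obtain b where b: "ALL a:J. b a : carrier c0_alg" "S.qeq x (%u. SUM a:J. delta (E a, b a) u)" by (elim exE conjE)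
  have b_cl: "b a : carrier c0_alg" if "a : J" for a using b(1) that by (rule bspec)
  have Nx: "0 <= ?N x" by (rule C.mf_norm_nonneg[OF star_homD(1)[OF \<phi>_hom x]])
  have entry: "cmod (b a k) <= ?N x" if a: "a : J" for a k
  proof -
   have "\<phi> x = (%y i j. SUM a:J. \<phi> (delta (E a, b a)) y i j)"
    unfolding \<phi>_qeq[OF b(2)] by (rule P.hom_sum[OF \<phi>_hom C0X_fun_alg]) (auto intro!: d_cl E_cl b_cl)
   then have "\<phi> x (k, 1) (fst a) (snd a) = (SUM a':J. \<phi> (delta (E a', b a')) (k, 1) (fst a) (snd a))" by simp
   also have "... = (SUM a':J. if a' = a then b a k else 0)"
   proof (intro sum.cong refl)
    fix a' assume a': "a' : J"
    show "\<phi> (delta (E a', b a')) (k, 1) (fst a) (snd a) = (if a' = a then b a k else 0)"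
     unfolding \<phi>_delta[OF E_cl[OF a'] b_cl[OF a']]
     by (cases "a' = a") (auto simp: tens_def E_entries[OF a] E_entries[OF a'] unit_fun_def dest: prod_eqI)
   qed
   also have "... = b a k" using a by simp
   finally show ?thesis using C.mf_norm_entry[OF star_homD(1)[OF \<phi>_hom x], of "(k, 1)" "fst a" "snd a"] by simp
  qed
  have slot_le: "q (delta (E a, b a)) <= ?N x" if a: "a : J" for a
  proof (rule field_le_epsilon)
   fix e :: real assume e: "e > 0"
   show "q (delta (E a, b a)) <= ?N x + e"
   proof (rule le[OF a b_cl[OF a]])
    show "0 < ?N x + e" using Nx e by linarith
    show "cmod (b a k) <= ?N x + e" for k using entry[OF a, of k] e by linarith
   qed
  qed
  have "q x = q (%u. SUM a:J. delta (E a, b a) u)" by (rule S.Q.Q.qeq_q[OF b(2)])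
  also have "... <= (SUM a:J. q (delta (E a, b a)))"
   by (rule P.seminorm_sum[OF q]) (auto intro!: d_cl E_cl b_cl)
  also have "... <= (SUM a:J. ?N x)" by (rule sum_mono[OF slot_le])
  also have "... <= (real n * real n + 1) * ?N x" using Nx by (simp add: distrib_right)
  finally show ?thesis .
 qed
 show ?thesis by (rule cstar_seminorm_le_if_bounded[OF P.star_algebra_P q N le2 t])
qed

theorem matrix_c0_iso:
 shows "cstar_algebra (envelope T R)"
  and "EX \<psi>. star_hom (envelope T R) D1 \<psi> & bij_betw \<psi> (carrier (envelope T R)) (carrier D1)"
proof -
 interpret E: envelope_model T R D1 \<phi>
 proof (intro envelope_model.intro P.star_algebra_P C.mf_cstar_algebra envelope_model_axioms.intro \<phi>_hom \<phi>_rels)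
  fix q t assume q: "cstar_seminorm T q" "!!y z. (y, z) : R ==> q (alg_diff T y z) = 0" and t: "t : carrier T"
  show "q t <= alg_norm D1 (\<phi> t)"
  proof (rule dominates_if_ge[where P = T and R = R and q = q and N = "%t. alg_norm D1 (\<phi> t)"])
   show "cstar_seminorm T (%t. alg_norm D1 (\<phi> t))"
    by (rule cstar_seminorm_hom[OF \<phi>_hom P.star_algebra_P C.mf_seminorm])
   show "alg_norm D1 (\<phi> (alg_diff T y z)) = 0" if "(y, z) : R" for y z
    by (rule rels_norm_zero[OF C.mf_cstar_algebra \<phi>_hom P.star_algebra_P \<phi>_rels[OF that]])
  qed (fact q t dominated)+
 qed
 show "cstar_algebra (envelope T R)" by (rule E.envelope_cstar)
 have "EX x:carrier T. alg_norm D1 (alg_diff D1 y (\<phi> x)) < e" if y: "y : carrier D1" and e: "0 < e" for y e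
 proof -
  obtain x where x: "x : carrier T" "\<phi> x = y" using surjective[OF y] by blast
  show ?thesis using x e star_algebra.diff_self[OF C.mf_star_algebra y] seminormed_algebra.q_zero[OF cstar_algebra_seminormed[OF C.mf_cstar_algebra]] by (intro bexI[OF _ x(1)]) simp
 qed
 then show "EX \<psi>. star_hom (envelope T R) D1 \<psi> & bij_betw \<psi> (carrier (envelope T R)) (carrier D1)"
  using E.envelope_ext_bij by blast
qed

end

subsection \<open>Trigonometric polynomials\<close>

lemma cnj_powi: "cmod z = 1 ==> cnj (z powi k) = z powi (- k)"
proof -
 assume "cmod z = 1"
 then have "z powi k * cnj (z powi k) = 1" using complex_norm_square[of "z powi k"] by (simp add: norm_power_int)
 then show ?thesis using inverse_unique by (metis power_int_minus)
qed

text \<open>The powers z^k with |k| \<le> m d: exponents add under multiplication, and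
  \<open>e_coeff\<close> is the bound for Fourier coefficients. The count 2 m d + 1 is linear in d;
  it is what calls for a growth bound in place of a constant one.\<close>

lemma circle_system:
 "approximating_system (sphere 0 1 :: complex set) (%m k z. if cmod z = 1 then z powi k else 0)
   (%m d. {- int (m * d) .. int (m * d)}) (%m. 2 * real m + 1)"
proof unfold_locales
 fix m d d' :: nat and k l :: int
 show "finite {- int (m * d) .. int (m * d)}" by simp
 show "real (card {- int (m * d) .. int (m * d)}) <= (2 * real m + 1) * (1 + real d)"
  by (simp add: algebra_simps)
 have "continuous_on (sphere 0 1) (%z::complex. z powi k)"
  by (intro continuous_intros) auto
 from cfun_restrict[OF this] show "(%z::complex. if cmod z = 1 then z powi k else 0) : cfun (sphere 0 1)"
  by simp
 show "cmod (if cmod z = 1 then z powi k else 0) <= 1" for z :: complex by (simp add: norm_power_int)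
 assume k: "k : {- int (m * d) .. int (m * d)}"
 show "EX j:{- int (m * d)..int (m * d)}. ALL y. cnj (if cmod y = 1 then y powi k else 0) = (if cmod y = 1 then y powi j else 0)"
 proof (intro bexI[of _ "-k"] allI)
  fix y :: complex
  have "cnj (y powi k) = y powi (-k)" if "cmod y = 1" using that by (rule cnj_powi)
  then show "cnj (if cmod y = 1 then y powi k else 0) = (if cmod y = 1 then y powi (-k) else 0)" by simp
 qed (use k in auto)
 assume l: "l : {- int (m * d') .. int (m * d')}"
 show "EX j:{- int (m * (d + d'))..int (m * (d + d'))}. ALL y. (if cmod y = 1 then y powi k else 0) * (if cmod y = 1 then y powi l else 0)
   = (if cmod y = 1 then y powi j else 0)"
 proof (intro bexI[of _ "k + l"] allI)
  fix y :: complex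
  have "y ~= 0" if "cmod y = 1" using that by auto
  then show "(if cmod y = 1 then y powi k else 0) * (if cmod y = 1 then y powi l else 0) = (if cmod y = 1 then y powi (k + l) else 0)"
   by (simp add: power_int_add)
 qed (use k l in "auto simp: algebra_simps")
next
 fix m d :: nat and k :: int and c :: "int => complex" and B :: real
 assume le: "!!y::complex. y : sphere 0 1 ==> cmod (SUM k:{- int (m * d)..int (m * d)}. c k * (if cmod y = 1 then y powi k else 0)) <= B"
  and k: "k : {- int (m * d)..int (m * d)}"
 have "cmod (c k) <= B"
 proof (rule fourier_coefficient_le[OF _ _ k])
  fix z :: complex assume "cmod z = 1"
  then show "cmod (SUM l:{- int (m * d)..int (m * d)}. c l * z powi l) <= B" using le[of z] by simp
 qed simp
 then show "(%z::complex. if cmod z = 1 then z powi k else 0) = (%y. 0) \<or> cmod (c k) <= B" ..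
next
 fix f :: "complex => complex" and \<epsilon> :: real assume f: "f : cfun (sphere 0 1)" and \<epsilon>: "0 < \<epsilon>"
 let ?G = "range (%k::int. %z::complex. z powi k)"
 have "EX g:cspan ?G. ALL x:sphere 0 1. cmod (f x - g x) < \<epsilon>"
 proof (rule complex_Stone_Weierstrass[OF _ _ _ _ _ _ _ \<epsilon>])
  show "continuous_on (sphere 0 1) g" if "g : ?G" for g
   using that by (auto intro!: continuous_intros)
  show "EX g:?G. ALL x:sphere 0 1. g x = 1" by (rule bexI[OF _ rangeI[of _ 0]]) simp
  show "EX k:?G. ALL x:sphere 0 1. k x = g x * h x" if gh: "g : ?G" "h : ?G" for g h
  proof -
   obtain k l where kl: "g = (%z. z powi k)" "h = (%z. z powi l)" using gh by auto
   have "z powi (k + l) = z powi k * z powi l" if "z : sphere 0 1" for z :: complex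
    using that by (intro power_int_add) auto
   then show ?thesis using kl by (intro bexI[of _ "%z. z powi (k + l)"]) auto
  qed
  show "EX k:?G. ALL x:sphere 0 1. k x = cnj (g x)" if g: "g : ?G" for g
  proof -
   obtain k where k: "g = (%z. z powi k)" using g by auto
   have "z powi (-k) = cnj (z powi k)" if "z : sphere 0 1" for z :: complex using cnj_powi[of z k] that by simp
   then show ?thesis using k by (intro bexI[of _ "%z. z powi (-k)"]) auto
  qed
  show "EX g:?G. g x ~= g y" if "x ~= y" for x y using that by (intro bexI[OF _ rangeI[of _ 1]]) simp
  show "continuous_on (sphere 0 1) f" using f by (simp add: cfun_iff)
 qed simp
 then obtain g where g: "g : cspan ?G" "ALL x:sphere 0 1. cmod (f x - g x) < \<epsilon>" by blast
 have "EX m0. ALL m>=m0. EX c. ALL z:sphere 0 1. g z = (SUM k:{- int m..int m}. c k * z powi k)"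
  using g(1)
 proof induction
  case (gen g)
  then obtain l where l: "g = (%z. z powi l)" by auto
  show ?case
  proof (intro exI allI impI ballI)
   fix m and z :: complex assume "m >= nat \<bar>l\<bar>"
   then have "l : {- int m..int m}" by auto
   then have "(SUM k:{- int m..int m}. if k = l then z powi k else 0) = z powi l" by simp
   moreover have "(SUM k:{- int m..int m}. (if k = l then 1 else 0) * z powi k) = (SUM k:{- int m..int m}. if k = l then z powi k else 0)"
    by (intro sum.cong) auto
   ultimately show "g z = (SUM k:{- int m..int m}. (if k = l then 1 else 0) * z powi k)" using l by simp
  qed
 next
  case (add f g)
  then obtain m1 m2 where m: "ALL m>=m1. EX c. ALL z:sphere 0 1. f z = (SUM k:{- int m..int m}. c k * z powi k)"
   "ALL m>=m2. EX c. ALL z:sphere 0 1. g z = (SUM k:{- int m..int m}. c k * z powi k)" by blast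
  show ?case
  proof (rule exI, intro allI impI)
   fix k assume "k >= max m1 m2"
   then obtain a b where "ALL z:sphere 0 1. f z = (SUM l:{- int k..int k}. a l * z powi l)"
    "ALL z:sphere 0 1. g z = (SUM l:{- int k..int k}. b l * z powi l)" using m by (meson max.bounded_iff)
   then have "ALL z:sphere 0 1. f z + g z = (SUM l:{- int k..int k}. (a l + b l) * z powi l)"
    by (simp add: distrib_right sum.distrib)
   then show "EX c. ALL z:sphere 0 1. f z + g z = (SUM l:{- int k..int k}. c l * z powi l)" by (rule exI[of _ "%l. a l + b l"])
  qed
 next
  case (scale f c)
  then obtain m1 where m: "ALL m>=m1. EX c. ALL z:sphere 0 1. f z = (SUM k:{- int m..int m}. c k * z powi k)" by blast
  show ?case
  proof (rule exI, intro allI impI)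
   fix k assume "k >= m1"
   then obtain a where "ALL z:sphere 0 1. f z = (SUM l:{- int k..int k}. a l * z powi l)" using m by blast
   then have "ALL z:sphere 0 1. c * f z = (SUM l:{- int k..int k}. (c * a l) * z powi l)"
    by (simp add: sum_distrib_left mult.assoc)
   then show "EX d. ALL z:sphere 0 1. c * f z = (SUM l:{- int k..int k}. d l * z powi l)" by (rule exI[of _ "%l. c * a l"])
  qed
 qed
 then obtain m0 where m0: "ALL m>=m0. EX c. ALL z:sphere 0 1. g z = (SUM k:{- int m..int m}. c k * z powi k)" by blast
 show "EX m0. ALL m>=m0. EX c. ALL y:sphere 0 1. cmod (f y - (SUM k:{- int (m * 1)..int (m * 1)}. c k * (if cmod y = 1 then y powi k else 0))) <= \<epsilon>"
 proof (rule exI, intro allI impI)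
  fix m assume "m >= m0"
  then obtain c where "ALL z:sphere 0 1. g z = (SUM k:{- int m..int m}. c k * z powi k)" using m0 by blast
  then show "EX c. ALL y:sphere 0 1. cmod (f y - (SUM k:{- int (m * 1)..int (m * 1)}. c k * (if cmod y = 1 then y powi k else 0))) <= \<epsilon>"
   using g(2) by (intro exI[of _ c]) (auto intro: less_imp_le)
 qed
qed

section \<open>The p-adic integers\<close>

text \<open>The usual metric, whose topology is the discrete one. It turns \<open>nat => int\<close>
  into a metric space for the product topology, as uniform continuity and
  \<open>tensor_model\<close> require.\<close>

instantiation int :: metric_space
begin

definition dist_int :: "int => int => real" where "dist_int m k = \<bar>real_of_int (m - k)\<bar>"

definition uniformity_int :: "(int \<times> int) filter" where
 "uniformity_int = (INF e\<in>{0<..}. principal {(x, y). dist x y < e})"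

instance
proof
 show "uniformity = (INF e\<in>{0<..}. principal {(x :: int, y). dist x y < e})" by (rule uniformity_int_def)
 have "\<forall>\<^sub>F (x', y) in uniformity. x' = x --> y = x" for x :: int
  unfolding uniformity_int_def
 proof (rule eventually_INF1[of 1])
  show "\<forall>\<^sub>F (x', y) in principal {(x, y). dist x y < 1}. x' = x --> y = x"
   unfolding eventually_principal by (auto simp: dist_int_def simp flip: of_int_diff of_int_abs)
 qed simp
 then show "open U \<longleftrightarrow> (ALL x:U. \<forall>\<^sub>F (x', y) in uniformity. x' = x --> y : U)" for U :: "int set"
  by (force simp: open_discrete split_beta elim: eventually_mono)
qed (auto simp: dist_int_def)

end

text \<open>The integers are discrete, so any function of a single coordinate is continuous.\<close>

lemma int_coord_continuous: "continuous_on S (%x :: nat => int. h (x m))"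
 by (rule continuous_on_compose2[of UNIV h])
  (auto intro: continuous_on_subset[OF continuous_on_product_coordinates])

lemma dist_coordinates:
 fixes x y :: "nat => int"
 assumes "0 < e" shows "EX m. ALL x y :: nat => int. (ALL l<=m. x l = y l) --> dist x y < e"
proof -
 obtain K where K: "(1/2 :: real) ^ K < e" using real_arch_pow_inv[OF assms, of "1/2"] by auto
 let ?m = "Max ((from_nat :: nat => nat) ` {..K})"
 have "dist x y < e" if eq: "ALL l<=?m. x l = y l" for x y :: "nat => int"
 proof -
  have "x (from_nat l) = y (from_nat l)" if "l <= K" for l using eq that by simp
  then have "{dist (x (from_nat l)) (y (from_nat l)) |l. l <= K} = {0}" by (auto intro: exI[of _ 0])
  then show ?thesis using dist_fun_le_dist_first_terms[of x y K] K by simp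
 qed
 then show ?thesis by blast
qed

locale padic =
 fixes p :: nat
 assumes p_prime: "prime p"
begin

abbreviation "ZZ \<equiv> carrier (Zp p)"
abbreviation P :: "nat => int" where "P m \<equiv> int p ^ m"

lemma P_pos: "0 < P m" using prime_gt_0_nat[OF p_prime] by simp

lemma P_dvd: "m <= l ==> P m dvd P l" by (rule le_imp_power_dvd)

lemma ZZ_iff: "x : ZZ \<longleftrightarrow> (ALL m. 0 <= x m & x m < P m & x (Suc m) mod P m = x m)"
 by (simp add: Zp_def)

lemma ZZ_bounds: "x : ZZ ==> 0 <= x m" "x : ZZ ==> x m < P m" "x : ZZ ==> x m mod P m = x m"
 by (auto simp: ZZ_iff)

lemma ZZ_mod: assumes x: "x : ZZ" and "m <= l" shows "x l mod P m = x m"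
 using assms(2)
proof (induction rule: dec_induct)
 case base show ?case by (rule ZZ_bounds(3)[OF x])
next
 case (step l)
 have "x (Suc l) mod P m = x (Suc l) mod P l mod P m" using P_dvd[OF step(1)] by (simp add: mod_mod_cancel)
 also have "... = x m" using x step by (simp add: ZZ_iff)
 finally show ?case .
qed

lemma ZZ_eq_mono: "[|x : ZZ; y : ZZ; x l = y l; m <= l|] ==> x m = y m"
 by (metis ZZ_mod)

lemma reduce_ZZ:
 assumes "!!m. f (Suc m) mod P m = f m mod P m" shows "(%m. f m mod P m) : ZZ"
 unfolding ZZ_iff using assms P_pos by (simp add: mod_mod_cancel P_dvd)

lemma Zp_simps: "mult (Zp p) x y = (%m. (x m * y m) mod P m)" "one (Zp p) = (%m. 1 mod P m)" "zero (Zp p) = (%m. 0)"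
 by (simp_all add: Zp_def)

lemma zero_ZZ: "(%m. 0) : ZZ" using P_pos by (simp add: ZZ_iff)

sublocale M: comm_monoid "Zp p"
proof (rule comm_monoidI)
 fix x y z assume x: "x : ZZ" and y: "y : ZZ" and z: "z : ZZ"
 show "x \<otimes>\<^bsub>Zp p\<^esub> y : ZZ"
  unfolding Zp_simps
 proof (rule reduce_ZZ)
  show "x (Suc m) * y (Suc m) mod P m = x m * y m mod P m" for m
   using x y by (metis ZZ_iff mod_mult_eq)
 qed
 show "x \<otimes>\<^bsub>Zp p\<^esub> y \<otimes>\<^bsub>Zp p\<^esub> z = x \<otimes>\<^bsub>Zp p\<^esub> (y \<otimes>\<^bsub>Zp p\<^esub> z)"
  by (simp add: Zp_simps mod_mult_left_eq mod_mult_right_eq mult.assoc)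
 show "x \<otimes>\<^bsub>Zp p\<^esub> y = y \<otimes>\<^bsub>Zp p\<^esub> x" by (simp add: Zp_simps mult.commute)
 show "\<one>\<^bsub>Zp p\<^esub> \<otimes>\<^bsub>Zp p\<^esub> x = x" using ZZ_bounds(3)[OF x] by (simp add: Zp_simps mod_mult_left_eq)
next
 show "\<one>\<^bsub>Zp p\<^esub> : ZZ" unfolding Zp_simps by (rule reduce_ZZ) simp
qed

text \<open>A product of finite sets is compact by Tychonoff, and the compatibility conditions
  between coordinates are closed.\<close>

lemma ZZ_compact: "compact ZZ"
proof -
 have "compactin (product_topology (%_. euclidean) UNIV) (PiE UNIV (%m. {0..<P m}))"
  by (simp add: compactin_PiE finite_imp_compact)
 then have "compact (PiE UNIV (%m. {0..<P m}))" by (simp add: euclidean_product_topology)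
 moreover have "closed (\<Inter>m. {x :: nat => int. x (Suc m) mod P m = x m})"
 proof (intro closed_INT ballI)
  fix m
  have "continuous_on UNIV (%x :: nat => int. x (Suc m) mod P m)" "continuous_on UNIV (%x :: nat => int. x m)"
   by (rule int_coord_continuous)+
  then show "closed {x :: nat => int. x (Suc m) mod P m = x m}" by (rule closed_Collect_eq)
 qed
 ultimately have "compact (PiE UNIV (%m. {0..<P m}) \<inter> (\<Inter>m. {x :: nat => int. x (Suc m) mod P m = x m}))"
  by (rule compact_Int_closed)
 also have "PiE UNIV (%m. {0..<P m}) \<inter> (\<Inter>m. {x :: nat => int. x (Suc m) mod P m = x m}) = ZZ"
  by (auto simp: ZZ_iff PiE_UNIV_domain Pi_iff)
 finally show ?thesis .
qed

text \<open>A coordinate determines all earlier ones, so agreement in a single late coordinate makes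
  two points close.\<close>

lemma ZZ_dist: "0 < e ==> EX m. ALL l>=m. ALL x:ZZ. ALL y:ZZ. x l = y l --> dist x y < e"
proof -
 assume "0 < e"
 then obtain m where m: "!!x y :: nat => int. ALL l<=m. x l = y l ==> dist x y < e" using dist_coordinates by blast
 have "dist x y < e" if "l >= m" "x : ZZ" "y : ZZ" "x l = y l" for l x y
  using that by (intro m) (meson ZZ_eq_mono le_trans)
 then show ?thesis by blast
qed

text \<open>The indicators of residue classes modulo p^m are closed under products once zero is
  included; the index -1, which is no residue, stands for it. Density is uniform continuity, with f
  sampled at one point of each class.\<close>

lemma ZZ_approximating_system:
 "approximating_system ZZ (%m k x. if x : ZZ & x m = k then 1 else 0) (%m d. {-1..<P m}) (%m. real (p ^ m + 1))"
proof unfold_locales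
 fix m d d' :: nat and k l :: int
 have "0 <= (real p ^ m + 1) * real d" by simp
 then show "real (card {-1..<P m}) <= real (p ^ m + 1) * (1 + real d)"
  by (simp add: nat_add_distrib nat_power_eq algebra_simps)
 have "continuous_on ZZ (%x. if x m = k then 1 else 0 :: complex)" by (rule int_coord_continuous)
 from cfun_restrict[OF this] show "(%x. if x : ZZ & x m = k then 1 else 0) : cfun ZZ"
  by (rule back_subst[of "%f. f : cfun ZZ"]) auto
 have no: "~ (x : ZZ & x m = - 1)" for x by (auto dest: ZZ_bounds(1)[of _ m])
 have m1: "-1 : {-1..<P m}" using P_pos[of m] by (simp add: order_less_trans[of _ 0])
 assume k: "k : {-1..<P m}"
 then show "EX j:{-1..<P m}. ALL x. cnj (if x : ZZ & x m = k then 1 else 0) = (if x : ZZ & x m = j then 1 else 0)" 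
  by (intro bexI[OF _ k]) simp
 assume "l : {-1..<P m}"
 show "EX j:{-1..<P m}. ALL x. (if x : ZZ & x m = k then 1 else 0) * (if x : ZZ & x m = l then 1 else 0)
   = (if x : ZZ & x m = j then 1 else 0 :: complex)"
  by (rule bexI[of _ "if k = l then k else -1"]) (use k m1 no in auto)
next
 fix m d and k :: int and c :: "int => complex" and B :: real
 assume le: "!!y. y : ZZ ==> cmod (SUM k:{-1..<P m}. c k * (if y : ZZ & y m = k then 1 else 0)) <= B"
  and k: "k : {-1..<P m}"
 show "(%x. if x : ZZ & x m = k then 1 else 0 :: complex) = (%y. 0) \<or> cmod (c k) <= B"
 proof (cases "0 <= k")
  case True
  let ?y = "%l. k mod P l"
  have y: "?y : ZZ" "?y m = k" using k True by (auto intro: reduce_ZZ)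
  have "(SUM j:{-1..<P m}. c j * (if ?y : ZZ & ?y m = j then 1 else 0)) = (SUM j:{-1..<P m}. if j = k then c k else 0)"
   using y by (intro sum.cong) auto
  then show ?thesis using le[OF y(1)] k by simp
 next
  case False
  then have "~ (x : ZZ & x m = k)" for x by (auto dest: ZZ_bounds(1)[of _ m])
  then have "(%x. if x : ZZ & x m = k then 1 else 0 :: complex) = (%y. 0)" by (intro HOL.ext) auto
  then show ?thesis ..
 qed
next
 fix f :: "(nat => int) => complex" and \<epsilon> :: real assume f: "f : cfun ZZ" and \<epsilon>: "0 < \<epsilon>"
 have "uniformly_continuous_on ZZ f" using f by (intro compact_uniformly_continuous ZZ_compact) (simp add: cfun_iff)
 then obtain \<delta> where \<delta>: "\<delta> > 0" "!!x y. [|x : ZZ; y : ZZ; dist y x < \<delta>|] ==> dist (f y) (f x) < \<epsilon>"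
  using \<epsilon> unfolding uniformly_continuous_on_def by meson
 obtain m0 where m0: "!!l x y. [|l >= m0; x : ZZ; y : ZZ; x l = y l|] ==> dist x y < \<delta>" using ZZ_dist[OF \<delta>(1)] by blast
 show "EX m0. ALL m>=m0. EX c. ALL y:ZZ. cmod (f y - (SUM k:{-1..<P m}. c k * (if y : ZZ & y m = k then 1 else 0))) <= \<epsilon>"
 proof (rule exI[of _ m0], intro allI impI, rule exI[of _ "%k. f (%l. k mod P l)"], rule ballI)
  fix m y assume m: "m >= m0" and y: "y : ZZ"
  let ?y = "%l. y m mod P l"
  have y': "?y : ZZ" by (rule reduce_ZZ) simp
  have "(SUM k:{-1..<P m}. f (%l. k mod P l) * (if y : ZZ & y m = k then 1 else 0)) 
    = (SUM k:{-1..<P m}. if k = y m then f ?y else 0)" using y by (intro sum.cong) auto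
  also have "... = f ?y" using ZZ_bounds[OF y, of m] by simp
  finally show "cmod (f y - (SUM k:{-1..<P m}. f (%l. k mod P l) * (if y : ZZ & y m = k then 1 else 0))) <= \<epsilon>"
   using \<delta>(2)[OF y' y] m0[OF m y y'] ZZ_bounds(3)[OF y, of m] by (simp add: dist_norm less_imp_le)
 qed
qed auto

text \<open>The ball \<open>a + p\<^sup>M \<int>\<^sub>p\<close> is a copy of \<open>\<int>\<^sub>p\<close>.\<close>

definition ball :: "nat => int => (nat => int) => nat => int" where
 "ball M a y = (%m. (a + P M * y m) mod P m)"

text \<open>This is (x - a) / p^M: coordinate M + m of x is known modulo p^(M+m), hence the quotient
  modulo p^m, and \<open>div\<close> discards the remainder a.\<close>

definition unball :: "nat => (nat => int) => nat => int" where
 "unball M x = (%m. x (M + m) div P M)"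

text \<open>Division by p^M commutes with reduction if the modulus before dividing is larger by the
  factor p^M; this is the coherence of the coordinates of \<open>unball\<close>.\<close>

lemma div_P_mod: "x mod (P M * P m) div P M = x div P M mod P m"
proof -
 have "x mod (P M * P m) = P M * (x div P M mod P m) + x mod P M" by (rule zmod_zmult2_eq) (simp add: P_pos less_imp_le)
 then show ?thesis using P_pos[of M] by simp
qed

lemma ball_ZZ: "y : ZZ ==> ball M a y : ZZ"
 unfolding ball_def by (rule reduce_ZZ) (metis ZZ_iff mod_add_right_eq mod_mult_right_eq)

lemma unball_ZZ: assumes "x : ZZ" shows "unball M x : ZZ"
 unfolding ZZ_iff
proof (intro allI conjI)
 fix m
 show "0 <= unball M x m" using ZZ_bounds(1)[OF assms] P_pos by (simp add: unball_def pos_imp_zdiv_nonneg_iff)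
 have "x (M + m) div P M = x (M + m) div P M mod P m"
  using div_P_mod[of "x (M + m)" M m] ZZ_bounds(3)[OF assms, of "M + m"] by (simp add: power_add)
 then show "unball M x m < P m" unfolding unball_def by (metis P_pos pos_mod_bound)
 show "unball M x (Suc m) mod P m = unball M x m"
  using ZZ_mod[OF assms, of "M + m" "M + Suc m"] div_P_mod[of "x (M + Suc m)" M m] by (simp add: unball_def power_add)
qed

lemma ball_coord: "[|0 <= a; a < P M|] ==> ball M a y M = a"
 by (simp add: ball_def)

lemma unball_ball: assumes "y : ZZ" "0 <= a" "a < P M" shows "unball M (ball M a y) = y"
proof
 fix m
 have "(a + P M * y (M + m)) mod (P M * P m) div P M = y (M + m) mod P m"
  unfolding div_P_mod using assms P_pos[of M] by (simp add: div_add1_eq)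
 then show "unball M (ball M a y) m = y m" using ZZ_mod[OF assms(1), of m "M + m"] by (simp add: unball_def ball_def power_add)
qed

lemma ball_unball: assumes "x : ZZ" "x M = a" shows "ball M a (unball M x) = x"
proof
 fix m
 have "x (M + m) mod P M = a" using ZZ_mod[OF assms(1), of M "M + m"] assms(2) by simp
 then have "a + P M * (x (M + m) div P M) = x (M + m)" using mod_mult_div_eq[of "x (M + m)" "P M"] by simp
 then show "ball M a (unball M x) m = x m" using ZZ_mod[OF assms(1), of m "M + m"] by (simp add: ball_def unball_def)
qed

lemma ball_continuous: "continuous_on S (ball M a)"
 unfolding ball_def by (intro continuous_on_coordinatewise_then_product int_coord_continuous)

lemma unball_continuous: "continuous_on S (unball M)"
 unfolding unball_def by (intro continuous_on_coordinatewise_then_product int_coord_continuous)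

end

subsection \<open>A fundamental domain for multiplication by a root of unity\<close>

locale padic_root = padic p for p +
 fixes r :: "nat => int"
 assumes r_unit: "r : Units (Zp p)" and r_root: "root_of_unity p r"
begin

section \<open>The powers of r acting on p-adic integers and on residues\<close>

abbreviation "n \<equiv> ord_Zp p r"

definition u :: "nat => nat => int" where "u i = r [^]\<^bsub>Zp p\<^esub> i"
definition act :: "nat => (nat => int) => nat => int" where "act i x = u i \<otimes>\<^bsub>Zp p\<^esub> x"

lemma ord_props: "0 < n" "u n = \<one>\<^bsub>Zp p\<^esub>" "[|0 < j; j < n|] ==> u j ~= \<one>\<^bsub>Zp p\<^esub>"
proof -
 have "EX m :: nat. 0 < m & r [^]\<^bsub>Zp p\<^esub> m = \<one>\<^bsub>Zp p\<^esub>" using r_root by (auto simp: root_of_unity_def)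
 from LeastI_ex[OF this] show "0 < n" "u n = \<one>\<^bsub>Zp p\<^esub>" by (simp_all add: ord_Zp_def u_def)
 show "u j ~= \<one>\<^bsub>Zp p\<^esub>" if "0 < j" "j < n"
  using not_less_Least[of j "%m. 0 < m & r [^]\<^bsub>Zp p\<^esub> m = \<one>\<^bsub>Zp p\<^esub>"] that by (auto simp: ord_Zp_def u_def)
qed

lemma r_ZZ: "r : ZZ" by (rule M.Units_closed[OF r_unit])
lemma u_ZZ: "u i : ZZ" unfolding u_def by (rule M.nat_pow_closed[OF r_ZZ])
lemma u_add: "u (i + j) = u i \<otimes>\<^bsub>Zp p\<^esub> u j" unfolding u_def by (rule M.nat_pow_mult[OF r_ZZ, symmetric])
lemma u_0: "u 0 = \<one>\<^bsub>Zp p\<^esub>" by (simp add: u_def)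
lemma u_mod: "u (i mod n) = u i"
proof -
 have "u i = u (n * (i div n)) \<otimes>\<^bsub>Zp p\<^esub> u (i mod n)" by (simp flip: u_add)
 moreover have "u (n * k) = \<one>\<^bsub>Zp p\<^esub>" for k
  using M.nat_pow_pow[OF r_ZZ, of n k] ord_props(2) by (simp add: u_def M.nat_pow_one)
 ultimately show ?thesis using u_ZZ by simp
qed

lemma act_ZZ: "x : ZZ ==> act i x : ZZ" unfolding act_def by (intro M.m_closed u_ZZ)
lemma act_act: "x : ZZ ==> act i (act j x) = act (i + j) x" unfolding act_def u_add by (simp add: M.m_assoc u_ZZ)
lemma act_mod: "act (i mod n) x = act i x" by (simp add: act_def u_mod)
lemma act_0: "x : ZZ ==> act 0 x = x" by (simp add: act_def u_0)
lemma act_n: "x : ZZ ==> act n x = x" by (simp add: act_def ord_props)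
lemma act_zero: "act i (%m. 0) = (%m. 0)" by (simp add: act_def Zp_simps)
lemma act_continuous: "continuous_on S (act i)"
 unfolding act_def Zp_simps by (intro continuous_on_coordinatewise_then_product int_coord_continuous)
lemma act_cancel: "[|x : ZZ; i <= n|] ==> act i (act (n - i) x) = x" "[|x : ZZ; i <= n|] ==> act (n - i) (act i x) = x"
 by (simp_all add: act_act act_n)

text \<open>The inverse of r is r^(n-1), so division by r becomes one of the maps
  \<open>act\<close>.\<close>

lemma alpha_eq: "alpha p r f = (%x. if x : ZZ then f (act (n - 1) x) else 0)"
proof -
 have "u (n - 1) \<otimes>\<^bsub>Zp p\<^esub> r = \<one>\<^bsub>Zp p\<^esub>" using ord_props(1,2) u_add[of "n - 1" 1] r_ZZ by (simp add: u_def)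
 then have "inv\<^bsub>Zp p\<^esub> r = u (n - 1)" using M.inv_unique'[OF r_ZZ u_ZZ] by (simp add: M.m_comm r_ZZ u_ZZ)
 then show ?thesis by (auto simp: alpha_def act_def M.m_comm u_ZZ)
qed

text \<open>A level at which the powers of r are already distinct modulo p^N, so that the action on
  residues prime to p is free.\<close>

definition N :: nat where "N = (SOME N. 0 < N & (ALL j. 0 < j & j < n --> u j N ~= 1 mod P N))"

lemma N_props: "0 < N" "[|0 < j; j < n|] ==> u j N ~= 1 mod P N"
proof -
 have "ALL j. EX m. 0 < j & j < n --> u j m ~= 1 mod P m" using ord_props(3) by (auto simp: Zp_simps fun_eq_iff)
 then obtain m where m: "!!j. [|0 < j; j < n|] ==> u j (m j) ~= 1 mod P (m j)" by metis
 \<comment> \<open>Agreement at a level implies agreement at all lower ones, so any level above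
   every \<open>m j\<close> works; \<open>Suc\<close> keeps it positive.\<close>
 let ?N = "Suc (\<Sum>j<n. m j)"
 have "u j ?N ~= 1 mod P ?N" if j: "0 < j" "j < n" for j
 proof
  assume "u j ?N = 1 mod P ?N"
  moreover have "m j <= ?N" using j member_le_sum[of j "{..<n}" m] by simp
  ultimately show False using m[OF j] ZZ_eq_mono[OF u_ZZ M.one_closed, of j ?N "m j"] by (simp add: Zp_simps)
 qed
 then have "EX N. 0 < N & (ALL j. 0 < j & j < n --> u j N ~= 1 mod P N)" by (intro exI[of _ ?N]) simp
 from someI_ex[OF this] show "0 < N" "[|0 < j; j < n|] ==> u j N ~= 1 mod P N" unfolding N_def by auto
qed

definition orb :: "nat => int => int" where "orb i a = u i N * a mod P N"
definition residues :: "int set" where "residues = {a. 0 <= a & a < P N & ~ int p dvd a}"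
definition orbit_reps :: "int set" where "orbit_reps = {a : residues. ALL i. a <= orb i a}"

lemma u_coprime: assumes "0 < m" shows "~ int p dvd u i m"
proof
 assume d: "int p dvd u i m"
 have "u (i + (n - i mod n)) = \<one>\<^bsub>Zp p\<^esub>"
 proof -
  have "(i + (n - i mod n)) mod n = 0"
   using ord_props(1) by (metis mod_add_left_eq add.commute le_add_diff_inverse mod_le_divisor mod_self)
  then show ?thesis using u_mod[of "i + (n - i mod n)"] u_0 by simp
 qed
 then have "u i m * u (n - i mod n) m mod P m = 1 mod P m" by (simp add: u_add Zp_simps fun_eq_iff)
 moreover have "int p dvd P m" using assms by simp
 moreover have "int p dvd u i m * u (n - i mod n) m" using d by simp
 ultimately have "int p dvd 1" by (metis dvd_mod_iff)
 then show False using prime_gt_1_nat[OF p_prime] by simp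
qed

lemma p_prime_int: "prime (int p)" using p_prime by simp

lemma orb_residues: "a : residues ==> orb i a : residues"
proof -
 assume a: "a : residues"
 have "int p dvd P N" using N_props(1) by simp
 then have "int p dvd orb i a \<longleftrightarrow> int p dvd u i N * a" by (simp add: orb_def dvd_mod_iff)
 then show ?thesis using a u_coprime[OF N_props(1), of i] P_pos prime_dvd_mult_iff[OF p_prime_int]
  by (simp add: residues_def orb_def)
qed

lemma orb_orb: "orb i (orb j a) = orb (i + j) a"
 by (simp add: orb_def u_add Zp_simps mod_mult_right_eq mod_mult_left_eq mult.assoc)

lemma orb_mod: "orb (i mod n) a = orb i a" by (simp add: orb_def u_mod)

lemma orb_n: "a : residues ==> orb n a = a" by (simp add: orb_def ord_props(2) Zp_simps residues_def mod_mult_left_eq)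

text \<open>If two exponents gave the same image, p^N would divide (r^j - 1) a with 0 < j < n; as a
  is prime to p, r^j would be 1 modulo p^N, against the choice of \<open>N\<close>.\<close>

lemma orb_free: assumes a: "a : residues" and ij: "i < n" "j < n" and eq: "orb i a = orb j a" shows "i = j"
proof -
 have "i' = j'" if ij: "i' <= j'" "j' < n" and eq: "orb i' a = orb j' a" for i' j'
 proof (rule ccontr)
  assume ne: "i' ~= j'"
  have "orb (n - i') (orb i' a) = orb (n - i') (orb j' a)" using eq by simp
  moreover have "n - i' + j' = j' - i' + n" "n - i' + i' = n" using ij by simp_all
  ultimately have "a = orb (j' - i' + n) a" unfolding orb_orb by (simp only: orb_n[OF a])
  also have "... = orb (j' - i') a" using orb_mod[of "j' - i' + n" a] orb_mod[of "j' - i'" a] by simp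
  finally have "u (j' - i') N * a mod P N = 1 * a mod P N" using a by (simp add: orb_def residues_def)
  moreover have "coprime a (P N)"
   using a prime_imp_coprime[OF p_prime_int, of a] by (simp add: residues_def coprime_commute)
  moreover have "P N dvd (u (j' - i') N - 1) * a" using calculation by (simp add: mod_eq_dvd_iff left_diff_distrib)
  ultimately have "P N dvd u (j' - i') N - 1" by (simp add: coprime_dvd_mult_left_iff coprime_commute)
  then have "u (j' - i') N = 1 mod P N" using ZZ_bounds(3)[OF u_ZZ] by (simp flip: mod_eq_dvd_iff)
  then show False using N_props(2)[of "j' - i'"] ij ne by simp
 qed
 then show ?thesis using ij eq by (metis nle_le)
qed

lemma orbit_rep_ex: assumes b: "b : residues" shows "EX i<n. orb i b : orbit_reps"
proof -
 have f: "finite (range (%i. orb i b))"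
  by (rule finite_subset[of _ "{0..<P N}"]) (use orb_residues[OF b] in "auto simp: residues_def")
 obtain i where i: "Min (range (%i. orb i b)) = orb i b" using Min_in[OF f] by auto
 have "orb i b <= orb j (orb i b)" for j using Min_le[OF f, of "orb (j + i) b"] i by (simp add: orb_orb)
 then have "orb (i mod n) b : orbit_reps" using orb_residues[OF b] by (simp add: orbit_reps_def orb_mod)
 then show ?thesis using ord_props(1) by (intro exI[of _ "i mod n"]) simp
qed

lemma act_coord: "act i x m = u i m * x m mod P m" by (simp add: act_def Zp_simps)

text \<open>If a translate of x lies in the ball about p^e c, then x has valuation exactly e and its
  leading residue is the image of c under r^i. So e and the orbit of c can be recovered from
  x.\<close>

lemma fund_coord:
 assumes x: "x : ZZ" and c: "c : residues" and i: "i < n" and eq: "act (n - i) x (N + e) = P e * c"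
 shows "x (N + e) = P e * orb i c" and "x e = 0" and "x (Suc e) ~= 0"
proof -
 have "x (N + e) = u i (N + e) * (P e * c) mod P (N + e)"
  using act_cancel(1)[OF x, of i] i act_coord[of i "act (n - i) x" "N + e"] eq by simp
 also have "... = P e * ((u i (N + e) * c) mod P N)" by (simp add: power_add mult.left_commute mult.commute[of "P N"] mod_mult_mult1)
 also have "(u i (N + e) * c) mod P N = orb i c"
  using ZZ_mod[OF u_ZZ, of N "N + e" i] by (metis orb_def le_add1 mod_mult_left_eq)
 finally show eq': "x (N + e) = P e * orb i c" .
 show "x e = 0" using ZZ_mod[OF x, of e "N + e"] eq' by simp
 have "x (Suc e) = P e * orb i c mod (P e * int p)" using ZZ_mod[OF x, of "Suc e" "N + e"] eq' N_props(1) by (simp add: mult.commute)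
 then have "x (Suc e) = P e * (orb i c mod int p)" by (simp add: mod_mult_mult1)
 then show "x (Suc e) ~= 0" using orb_residues[OF c, of i] P_pos[of e] by (simp add: residues_def dvd_eq_mod_eq_0)
qed

text \<open>A nonzero x is p^e times a unit, and the unit modulo p^N is r^i c for exactly one orbit
  representative c and one i < n. The balls are p^e c + p^(N+e) Z_p, one for each pair (e, c); each
  e occurs finitely often, so they shrink to 0. The exponent n - i plays the inverse of i.\<close>

theorem fundamental_domain:
 obtains M :: "nat => nat" and a :: "nat => int"
 where "!!k. 0 < a k" "!!k. a k < P (M k)"
  and "!!x. [|x : ZZ; x ~= (%m. 0)|] ==> EX k. EX i<n. act (n - i) x (M k) = a k"
  and "!!x k k' i i'. [|x : ZZ; i < n; i' < n; act (n - i) x (M k) = a k; act (n - i') x (M k') = a k'|] ==> k = k' & i = i'"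
  and "!!m. EX K. ALL k>=K. m <= M k & P m dvd a k"
proof -
 have "finite residues" by (rule finite_subset[of _ "{0..<P N}"]) (auto simp: residues_def)
 then have fin: "finite orbit_reps" by (simp add: orbit_reps_def)
 have "1 < P N" using N_props(1) prime_gt_1_nat[OF p_prime] by (simp add: one_less_power)
 then have "1 : residues" using prime_gt_1_nat[OF p_prime] by (simp add: residues_def)
 from orbit_rep_ex[OF this] have ne: "orbit_reps ~= {}" by auto
 define m0 where "m0 = card orbit_reps"
 have m0: "0 < m0" using fin ne by (simp add: m0_def card_gt_0_iff)
 obtain c where c: "bij_betw c {..<m0} orbit_reps"
  using ex_bij_betw_nat_finite[OF fin] by (auto simp: m0_def lessThan_atLeast0)
 \<comment> \<open>k enumerates the pairs: its quotient by \<open>m0\<close> is the valuation e, its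
   remainder numbers the orbit representative.\<close>
 define M where "M k = N + k div m0" for k
 define a where "a k = P (k div m0) * c (k mod m0)" for k
 have cr: "c (k mod m0) : orbit_reps" for k using c m0 by (auto simp: bij_betw_def)
 then have cres: "c (k mod m0) : residues" for k by (simp add: orbit_reps_def)
 show thesis
 proof (rule that[of a M])
  show "0 < a k" for k
   using cres[of k] P_pos by (auto simp: a_def residues_def intro!: mult_pos_pos) (metis dvd_0_right order_le_less)
  show "a k < P (M k)" for k using cres[of k] P_pos by (simp add: a_def M_def residues_def power_add mult.commute)
  show "EX K. ALL k>=K. m <= M k & P m dvd a k" for m
  proof (intro exI allI impI)
   fix k assume "m * m0 <= k"
   then have "m <= k div m0" using m0 by (simp add: less_eq_div_iff_mult_less_eq)
   then show "m <= M k & P m dvd a k" using P_dvd by (simp add: M_def a_def)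
  qed
 next
  fix x assume x: "x : ZZ" "x ~= (%m. 0)"
  have x0: "x 0 = 0" using ZZ_bounds[OF x(1), of 0] by simp
  have "EX l. x (Suc l) ~= 0" using x x0 by (metis HOL.ext not0_implies_Suc)
  \<comment> \<open>The valuation of x. Coordinate 0 is a residue modulo 1 and hence 0, so the first
    nonzero coordinate has the form \<open>Suc e\<close>.\<close>
  define e where "e = (LEAST l. x (Suc l) ~= 0)"
  have e1: "x (Suc e) ~= 0" unfolding e_def by (rule LeastI_ex) fact
  have e0: "x e = 0" using x0 not_less_Least[of "e - 1" "%l. x (Suc l) ~= 0"] by (cases e) (auto simp: e_def)
  define b where "b = x (N + e) div P e"
  have xb: "x (N + e) = P e * b" using ZZ_mod[OF x(1), of e "N + e"] e0 by (simp add: b_def mult_div_mod_eq dvd_eq_mod_eq_0)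
  have "b : residues"
   unfolding residues_def
  proof (intro CollectI conjI notI)
   have "0 <= P e * b" "P e * b < P e * P N" using ZZ_bounds[OF x(1), of "N + e"] xb by (simp_all add: power_add mult.commute)
   then show "0 <= b" "b < P N" using P_pos[of e] by (auto simp: zero_le_mult_iff)
   assume "int p dvd b"
   then have "P (Suc e) dvd x (N + e)" by (simp add: xb mult.commute)
   then show False using e1 ZZ_mod[OF x(1), of "Suc e" "N + e"] N_props(1) by simp
  qed
  from orbit_rep_ex[OF this] obtain i where i: "i < n" "orb i b : orbit_reps" by blast
  obtain t where t: "t < m0" "c t = orb i b" using c i(2) by (metis bij_betw_imp_surj_on imageE lessThan_iff)
  let ?k = "e * m0 + t"
  have k: "?k div m0 = e" "?k mod m0 = t" using t(1) by simp_all
  have xi: "act i x (M ?k) = a ?k"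
  proof -
   have "act i x (N + e) = u i (N + e) * (P e * b) mod P (N + e)" by (simp add: act_coord xb)
   also have "... = P e * ((u i (N + e) * b) mod P N)" by (simp add: power_add mult.left_commute mult.commute[of "P N"] mod_mult_mult1)
   also have "(u i (N + e) * b) mod P N = orb i b"
    using ZZ_mod[OF u_ZZ, of N "N + e" i] by (metis orb_def le_add1 mod_mult_left_eq)
   finally show ?thesis unfolding M_def a_def k t(2) .
  qed
  \<comment> \<open>The witness should be n - i, which for i = 0 is not below n; there 0 itself
    works, because r^n = 1.\<close>
  show "EX k. EX i<n. act (n - i) x (M k) = a k"
  proof (cases "i = 0")
   case True then show ?thesis using xi ord_props(1) act_0[OF x(1)] act_n[OF x(1)] by (intro exI[of _ ?k] exI[of _ 0]) simp
  next
   case False then show ?thesis using xi i(1) by (intro exI[of _ ?k] exI[of _ "n - i"]) simp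
  qed
 next
  fix x k k' i i'
  assume x: "x : ZZ" and i: "i < n" "i' < n" and k: "act (n - i) x (M k) = a k" and k': "act (n - i') x (M k') = a k'"
  note f = fund_coord[OF x cres i(1) k[unfolded M_def a_def]] and f' = fund_coord[OF x cres i(2) k'[unfolded M_def a_def]]
  have e_le: "e' <= e" if "x (Suc e) ~= 0" "x e' = 0" for e e'
   using that ZZ_mod[OF x, of "Suc e" e'] by (metis mod_0 not_less_eq_eq)
  have e: "k div m0 = k' div m0" using e_le[OF f(3) f'(2)] e_le[OF f'(3) f(2)] by simp
  have o: "orb i (c (k mod m0)) = orb i' (c (k' mod m0))" using f(1) f'(1) P_pos[of "k' div m0"] by (auto simp: e)
  \<comment> \<open>Two representatives in the same orbit are each minimal in it; used in both
    directions this makes them equal.\<close>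
  have le: "a <= a'" if "orb i a = orb i' a'" "a : orbit_reps" "a' : orbit_reps" "i' < n" for a a' i i'
  proof -
   have "a' = orb (n - i') (orb i' a')" using that(3,4) by (simp add: orbit_reps_def orb_orb orb_n)
   also have "... = orb (n - i' + i) a" by (simp add: orb_orb flip: that(1))
   finally have "a' = orb (n - i' + i) a" .
   then show ?thesis using that(2) by (simp add: orbit_reps_def)
  qed
  have cc: "c (k mod m0) = c (k' mod m0)" using le[OF o cr cr i(2)] le[OF o[symmetric] cr cr i(1)] by simp
  then have "k mod m0 = k' mod m0" using c m0 by (auto simp: bij_betw_def inj_on_def)
  then have "k = k'" using e by (metis div_mult_mod_eq)
  moreover have "i = i'" using orb_free[OF cres i, of k] o cc by simp
  ultimately show "k = k' & i = i'" by simp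
 qed
qed

end

section \<open>Crossed products\<close>

text \<open>The flag \<open>b\<close> selects between the crossed product \<open>A'\<^sub>r\<close> by the finite cyclic group (\<open>True\<close>) and \<open>A\<^sub>r\<close> (\<open>False\<close>).\<close>

locale crossed = padic_root p r for p r +
 fixes b :: bool
begin

definition R :: "(free_elem \<times> free_elem) set" where "R = (if b then A'_rels p r else A_rels p r)"
text \<open>The spectrum of the central unitary V^n: the relation V^n = 1 of the finite crossed
  product leaves one point, otherwise the whole circle occurs.\<close>

definition S :: "complex set" where "S = (if b then {1} else sphere 0 1)"
text \<open>The exponents of V that suffice for words of length at most d. With V^n = 1 there are n
  of them; without that relation their number grows linearly in d.\<close>

definition J :: "nat => int set" where "J d = (if b then {0..<int n} else {- int d..int d})"

sublocale W: star_semigroup "lists (gens p \<times> UNIV)" "(@)" flip by (rule star_semigroup_words)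

abbreviation "Ws \<equiv> lists (gens p \<times> UNIV) :: (gen \<times> bool) list set"
abbreviation FA :: "free_elem star_alg" where "FA \<equiv> semigroup_alg Ws (@) flip"
abbreviation M :: "((nat => int) => complex) => gen \<times> bool" where "M f \<equiv> (M_gen f, False)"
abbreviation V :: "gen \<times> bool" where "V \<equiv> (V_gen, False)"
abbreviation V' :: "gen \<times> bool" where "V' \<equiv> (V_gen, True)"

lemma FA_eq: "free_star_alg (gens p) = FA" by (simp add: free_star_alg_def)

definition Vp :: "int => (gen \<times> bool) list" where "Vp j = replicate (nat \<bar>j\<bar>) (V_gen, j < 0)"

abbreviation nf :: "((nat => int) => complex) => int => (gen \<times> bool) list" where "nf f j \<equiv> M f # Vp j"

lemma gens_iff: "V_gen : gens p" "M_gen f : gens p \<longleftrightarrow> f : cfun ZZ" by (auto simp: gens_def)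

lemma Ws_simps [simp]: "[] : Ws" "l # w : Ws \<longleftrightarrow> fst l : gens p & w : Ws" "s @ t : Ws \<longleftrightarrow> s : Ws & t : Ws"
 by (auto simp: in_lists_conv_set; cases l; force)+

lemma Vp_Ws [simp]: "Vp j : Ws" by (auto simp: Vp_def gens_iff in_lists_conv_set)

lemma one_cfun: "one_Zp p : cfun ZZ" unfolding one_Zp_def by (rule cfun_restrict) simp

lemma cfun_act: "f : cfun ZZ ==> (%x. if x : ZZ then f (act i x) else 0) : cfun ZZ"
 by (rule cfun_restrict, rule continuous_on_compose2[OF _ act_continuous]) (auto simp: cfun_iff act_ZZ)

lemma alpha_cfun: "f : cfun ZZ ==> alpha p r f : cfun ZZ" unfolding alpha_eq by (rule cfun_act)

lemma J_card: "finite (J d)" "real (card (J d)) <= (2 + real n) * (1 + real d)"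
proof -
 show "finite (J d)" by (simp add: J_def)
 have "0 <= real n * real d" "2 * real d + 1 <= 2 * (1 + real d)" "0 <= real n" "0 <= real d" by simp_all
 then show "real (card (J d)) <= (2 + real n) * (1 + real d)" by (simp add: J_def algebra_simps)
qed

lemma J_dist: "[|i : J d; j : J d; b; (i - j) mod int n = 0|] ==> i = j"
proof -
 assume "i : J d" "j : J d" b and m: "(i - j) mod int n = 0"
 then have "0 <= i" "i < int n" "0 <= j" "j < int n" unfolding J_def by auto
 moreover have "i mod int n = j mod int n" using m by (simp add: mod_eq_dvd_iff dvd_eq_mod_eq_0)
 ultimately show "i = j" by simp
qed

lemma A_rels_R: "A_rels p r \<subseteq> R" by (auto simp: R_def A_rels_def A'_rels_def Let_def)

end

section \<open>Normal forms of words modulo the relations\<close>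

locale crossed_seminorm = crossed p r b for p r b +
 fixes q :: "free_elem => real"
 assumes q: "cstar_seminorm FA q" and q_rels: "(y, z) : R ==> q (alg_diff FA y z) = 0"
begin

sublocale Q: seminormed_semigroup Ws "(@)" flip q
 by unfold_locales (rule q)

definition weq :: "(gen \<times> bool) list => (gen \<times> bool) list => bool" (infix \<open>\<simeq>\<close> 50) where
 "w \<simeq> w' \<longleftrightarrow> w : Ws & w' : Ws & Q.Q.qeq (delta w) (delta w')"

lemma weq_refl: "w : Ws ==> w \<simeq> w" by (simp add: weq_def Q.Q.qeq_refl W.delta_cl)
lemma weq_sym: "w \<simeq> w' ==> w' \<simeq> w" by (simp add: weq_def Q.Q.qeq_sym)
lemma weq_trans [trans]: "[|s \<simeq> t; t \<simeq> w|] ==> s \<simeq> w" using Q.Q.qeq_trans unfolding weq_def by blast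
lemma weq_append: "[|s \<simeq> s'; t \<simeq> t'|] ==> s @ t \<simeq> s' @ t'"
 using Q.Q.qeq_mult[of "delta s" "delta s'" "delta t" "delta t'"] by (simp add: weq_def W.delta_mult)
lemma weq_left: "[|t \<simeq> t'; s : Ws|] ==> s @ t \<simeq> s @ t'" by (rule weq_append[OF weq_refl])
lemma weq_right: "[|s \<simeq> s'; t : Ws|] ==> s @ t \<simeq> s' @ t" by (rule weq_append[OF _ weq_refl])
lemma weq_q: "s \<simeq> t ==> q (delta s) = q (delta t)" unfolding weq_def using Q.Q.qeq_q by blast

lemma rel_qeq: "[|(y, z) : R; y : carrier FA; z : carrier FA|] ==> Q.Q.qeq y z" by (simp add: Q.Q.qeq_def q_rels)
lemma weq_rel: "[|(delta w, delta w') : R; w : Ws; w' : Ws|] ==> w \<simeq> w'" by (simp add: weq_def rel_qeq W.delta_cl)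

lemmas rels_unfold = A_rels_def A'_rels_def M_rels_def covariance_rels_def Let_def FA_eq free_gen_def free_one_def W.delta_mult
 W.delta_star cont_alg_simps append.simps list.map rev.simps prod.case

lemma cfun_ops:
 "f : cfun ZZ ==> (%x. cnj (f x)) : cfun ZZ" "[|f : cfun ZZ; g : cfun ZZ|] ==> (%x. f x * g x) : cfun ZZ"
 "[|f : cfun ZZ; g : cfun ZZ|] ==> (%x. f x + g x) : cfun ZZ" "f : cfun ZZ ==> (%x. c * f x) : cfun ZZ"
 using fun_alg.f_cnj[OF cfun_fun_alg[OF ZZ_compact]] fun_alg.f_mult[OF cfun_fun_alg[OF ZZ_compact]]
  fun_alg.f_add[OF cfun_fun_alg[OF ZZ_compact]] fun_alg.f_scale[OF cfun_fun_alg[OF ZZ_compact]] by blast+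

lemma M_mult: assumes f: "f : cfun ZZ" and g: "g : cfun ZZ" shows "[M f, M g] \<simeq> [M (%x. f x * g x)]"
proof (rule weq_sym, rule weq_rel[OF subsetD[OF A_rels_R]])
 show "(delta [M (%x. f x * g x)], delta [M f, M g]) : A_rels p r" 
  unfolding rels_unfold using f g by blast
qed (use f g cfun_ops in "auto simp: gens_iff")

lemma M_star: assumes f: "f : cfun ZZ" shows "[(M_gen f, True)] \<simeq> [M (%x. cnj (f x))]"
proof (rule weq_sym, rule weq_rel[OF subsetD[OF A_rels_R]])
 show "(delta [M (%x. cnj (f x))], delta [(M_gen f, True)]) : A_rels p r" 
  unfolding rels_unfold not_False_eq_True using f by blast
qed (use f cfun_ops in "auto simp: gens_iff")

lemma M_one: "[M (one_Zp p)] \<simeq> []"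
proof (rule weq_rel[OF subsetD[OF A_rels_R]])
 show "(delta [M (one_Zp p)], delta []) : A_rels p r" unfolding rels_unfold by blast
qed (auto simp: gens_iff one_cfun)

lemma covariance: assumes f: "f : cfun ZZ" shows "[V, M f, V'] \<simeq> [M (alpha p r f)]"
proof (rule weq_rel[OF subsetD[OF A_rels_R]])
 show "(delta [V, M f, V'], delta [M (alpha p r f)]) : A_rels p r" 
  unfolding rels_unfold not_False_eq_True using f by blast
qed (use f alpha_cfun in "auto simp: gens_iff")

lemma V'V: "[V', V] \<simeq> []"
proof (rule weq_rel[OF subsetD[OF A_rels_R]])
 show "(delta [V', V], delta []) : A_rels p r" unfolding rels_unfold not_False_eq_True by blast
qed (auto simp: gens_iff)

lemma VV': "[V, V'] \<simeq> []"
proof -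
 have a1: "alpha p r (one_Zp p) = one_Zp p" by (auto simp: alpha_eq one_Zp_def act_ZZ)
 have "[V] @ [] @ [V'] \<simeq> [V] @ [M (one_Zp p)] @ [V']"
  by (intro weq_left weq_right weq_sym[OF M_one]) (auto simp: gens_iff)
 also have "[V] @ [M (one_Zp p)] @ [V'] \<simeq> [M (one_Zp p)]" using covariance[OF one_cfun] by (simp add: a1)
 also have "[M (one_Zp p)] \<simeq> []" by (rule M_one)
 finally show ?thesis by simp
qed

lemma V_M: assumes f: "f : cfun ZZ" shows "[V, M f] \<simeq> [M (alpha p r f), V]"
proof -
 have "[V, M f] @ [] \<simeq> [V, M f] @ [V', V]" by (intro weq_left weq_sym[OF V'V]) (auto simp: gens_iff f)
 also have "[V, M f] @ [V', V] \<simeq> [M (alpha p r f)] @ [V]"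
  using weq_right[OF covariance[OF f], of "[V]"] by (simp add: gens_iff)
 finally show ?thesis by simp
qed

lemma V'_M: assumes f: "f : cfun ZZ" shows "EX g:cfun ZZ. [V', M f] \<simeq> [M g, V']"
proof -
 define g where "g = (%x. if x : ZZ then f (act 1 x) else 0)"
 have g: "g : cfun ZZ" unfolding g_def by (rule cfun_act[OF f])
 have "alpha p r g = f"
  using f ord_props(1) act_cancel(1)[of _ 1] by (auto simp: alpha_eq g_def act_ZZ cfun_iff)
 then have "[V'] @ [M f] \<simeq> [V'] @ [V, M g, V']"
  using weq_left[OF weq_sym[OF covariance[OF g]], of "[V']"] by (simp add: gens_iff)
 also have "[V'] @ [V, M g, V'] \<simeq> [] @ [M g, V']" using weq_right[OF V'V, of "[M g, V']"] g by (simp add: gens_iff)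
 finally show ?thesis using g by auto
qed

lemma V_Vp: "V # Vp j \<simeq> Vp (j + 1)"
proof (cases "0 <= j")
 case True
 then have "Vp (j + 1) = V # Vp j" by (simp add: Vp_def nat_add_distrib)
 then show ?thesis by (metis weq_refl Vp_Ws)
next
 case False
 then have "nat \<bar>j\<bar> = Suc (nat \<bar>j + 1\<bar>)" by linarith
 then have "Vp j = V' # Vp (j + 1)" using False by (auto simp: Vp_def)
 then show ?thesis using weq_right[OF VV', of "Vp (j + 1)"] by simp
qed

lemma V'_Vp: "V' # Vp j \<simeq> Vp (j - 1)"
proof (cases "j <= 0")
 case True
 then have "nat \<bar>j - 1\<bar> = Suc (nat \<bar>j\<bar>)" by linarith
 then have "Vp (j - 1) = V' # Vp j" using True by (auto simp: Vp_def)
 then show ?thesis by (metis weq_refl Vp_Ws)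
next
 case False
 then have "nat \<bar>j\<bar> = Suc (nat \<bar>j - 1\<bar>)" by linarith
 then have "Vp j = V # Vp (j - 1)" using False by (auto simp: Vp_def)
 then show ?thesis using weq_right[OF V'V, of "Vp (j - 1)"] by simp
qed

text \<open>Prefixing one letter changes the exponent of V by at most one. This bounds the exponent
  by the word length and yields the linear count of normal forms.\<close>

lemma letter_nf:
 assumes l: "fst l : gens p" and f: "f : cfun ZZ" shows "EX g:cfun ZZ. EX j'. \<bar>j'\<bar> <= \<bar>j\<bar> + 1 & l # nf f j \<simeq> nf g j'"
proof (cases "fst l")
 case (M_gen g)
 then have g: "g : cfun ZZ" using l by (simp add: gens_iff)
 have *: "M g # nf f j \<simeq> nf (%x. g x * f x) j" if "g : cfun ZZ" for g
  using weq_right[OF M_mult[OF that f], of "Vp j"] by simp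
 show ?thesis
 proof (cases "snd l")
  case True
  then have "l = (M_gen g, True)" using M_gen by (cases l) auto
  then have "[l] @ nf f j \<simeq> [M (%x. cnj (g x))] @ nf f j" using weq_right[OF M_star[OF g]] f by (simp add: gens_iff)
  also have "[M (%x. cnj (g x))] @ nf f j \<simeq> nf (%x. cnj (g x) * f x) j" using *[OF cfun_ops(1)[OF g]] by simp
  finally show ?thesis by (intro bexI[OF _ cfun_ops(2)[OF cfun_ops(1)[OF g] f]] exI[of _ j]) simp
 next
  case False
  then have "l = M g" using M_gen by (cases l) auto
  then show ?thesis using *[OF g] by (intro bexI[OF _ cfun_ops(2)[OF g f]] exI[of _ j]) simp
 qed
next
 case V_gen
 show ?thesis
 proof (cases "snd l")
  case True
  then have l: "l = V'" using V_gen by (cases l) auto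
  obtain g where g: "g : cfun ZZ" "[V', M f] \<simeq> [M g, V']" using V'_M[OF f] by blast
  have "[V', M f] @ Vp j \<simeq> [M g, V'] @ Vp j" by (rule weq_right[OF g(2)]) simp
  also have "[M g, V'] @ Vp j \<simeq> [M g] @ Vp (j - 1)" using weq_left[OF V'_Vp, of "[M g]"] g(1) by (simp add: gens_iff)
  finally show ?thesis using l by (intro bexI[OF _ g(1)] exI[of _ "j - 1"]) simp
 next
  case False
  then have l: "l = V" using V_gen by (cases l) auto
  have "[V, M f] @ Vp j \<simeq> [M (alpha p r f), V] @ Vp j" by (rule weq_right[OF V_M[OF f]]) simp
  also have "[M (alpha p r f), V] @ Vp j \<simeq> [M (alpha p r f)] @ Vp (j + 1)"
   using weq_left[OF V_Vp, of "[M (alpha p r f)]"] alpha_cfun[OF f] by (simp add: gens_iff)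
  finally show ?thesis using l by (intro bexI[OF _ alpha_cfun[OF f]] exI[of _ "j + 1"]) simp
 qed
qed

lemma normal_form: "w : Ws ==> EX f:cfun ZZ. EX j. \<bar>j\<bar> <= int (length w) & w \<simeq> nf f j"
proof (induction w)
 case Nil
 then show ?case using weq_sym[OF M_one] one_cfun by (intro bexI[of _ "one_Zp p"] exI[of _ 0]) (simp_all add: Vp_def)
next
 case (Cons l w)
 then obtain f j where f: "f : cfun ZZ" "\<bar>j\<bar> <= int (length w)" "w \<simeq> nf f j" by auto
 have l: "fst l : gens p" using Cons.prems by auto
 obtain g j' where g: "g : cfun ZZ" "\<bar>j'\<bar> <= \<bar>j\<bar> + 1" "l # nf f j \<simeq> nf g j'" using letter_nf[OF l f(1)] by blast
 have "[l] @ w \<simeq> [l] @ nf f j" by (rule weq_left[OF f(3)]) (simp add: l mem_Times_iff)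
 also have "[l] @ nf f j \<simeq> nf g j'" using g(3) by simp
 finally show ?case using g(1,2) f(2) by (intro bexI[OF _ g(1)] exI[of _ j']) simp
qed

lemma Vp_periodic: assumes b shows "Vp (j mod int n) \<simeq> Vp j"
proof -
 have pow: "(alg_mult FA (delta [V]) ^^ k) (delta []) = delta (replicate k V)" for k
  by (induction k) (simp_all add: W.delta_mult)
 have "((alg_mult FA (delta [V]) ^^ n) (delta []), delta []) : R"
  unfolding R_def using assms by (simp add: A'_rels_def Let_def FA_eq free_gen_def free_one_def)
 then have Vn: "replicate n V \<simeq> []" unfolding pow by (rule weq_rel) (auto simp: in_lists_conv_set gens_iff)
 have add: "replicate k V @ Vp j \<simeq> Vp (j + int k)" for k j
 proof (induction k)
  case 0 then show ?case by (simp add: weq_refl)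
 next
  case (Suc k)
  have "[V] @ replicate k V @ Vp j \<simeq> [V] @ Vp (j + int k)" by (rule weq_left[OF Suc]) (simp add: gens_iff)
  also have "[V] @ Vp (j + int k) \<simeq> Vp (j + int k + 1)" using V_Vp by simp
  finally show ?case by (simp add: ac_simps)
 qed
 have step: "Vp j \<simeq> Vp (j + int n)" for j
  using weq_trans[OF weq_sym[OF weq_right[OF Vn, of "Vp j"]] add] by simp
 have up: "Vp j \<simeq> Vp (j + int (n * k))" for j k
 proof (induction k)
  case 0 then show ?case by (simp add: weq_refl)
 next
  case (Suc k) then show ?case using weq_trans[OF Suc step] by (simp add: algebra_simps)
 qed
 show ?thesis
 proof (cases "0 <= j div int n")
  case True
  then have "j mod int n + int (n * nat (j div int n)) = j" by simp
  then show ?thesis using up[of "j mod int n" "nat (j div int n)"] by simp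
 next
  case False
  then have "j + int (n * nat (- (j div int n))) = j mod int n" by (simp add: minus_mult_div_eq_mod[symmetric])
  then show ?thesis using weq_sym[OF up[of j "nat (- (j div int n))"]] by simp
 qed
qed

lemma normal_form_J: assumes "w : Ws" "length w <= d" shows "EX f:cfun ZZ. EX j:J d. w \<simeq> nf f j"
proof -
 obtain f j where f: "f : cfun ZZ" "\<bar>j\<bar> <= int (length w)" "w \<simeq> nf f j" using normal_form[OF assms(1)] by blast
 show ?thesis
 proof (cases b)
  case True
  have "nf f j \<simeq> nf f (j mod int n)"
   using weq_left[OF weq_sym[OF Vp_periodic[OF True]], of "[M f]" j] f(1) by (simp add: gens_iff)
  with f(3) have "w \<simeq> nf f (j mod int n)" by (rule weq_trans)
  moreover have "j mod int n : J d" unfolding J_def using True ord_props(1) by simp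
  ultimately show ?thesis using f(1) by blast
 next
  case False
  have "j : J d" unfolding J_def using False f(2) assms(2) by auto
  then show ?thesis using f by blast
 qed
qed

lemma nf_Ws: "f : cfun ZZ ==> nf f j : Ws" by (simp add: gens_iff)
lemma nf_cl: "f : cfun ZZ ==> delta (nf f j) : carrier FA" by (rule W.delta_cl[OF nf_Ws])

lemma M_add:
 assumes f: "f : cfun ZZ" and g: "g : cfun ZZ"
 shows "Q.Q.qeq (delta [M (%x. f x + g x)]) (alg_add FA (delta [M f]) (delta [M g]))"
proof (rule rel_qeq[OF subsetD[OF A_rels_R]])
 show "(delta [M (%x. f x + g x)], alg_add FA (delta [M f]) (delta [M g])) : A_rels p r"
  unfolding rels_unfold using f g by blast
qed (use f g cfun_ops in "auto simp: gens_iff intro!: W.cl")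

lemma M_scale:
 assumes f: "f : cfun ZZ" shows "Q.Q.qeq (delta [M (%x. c * f x)]) (alg_scale FA c (delta [M f]))"
proof (rule rel_qeq[OF subsetD[OF A_rels_R]])
 show "(delta [M (%x. c * f x)], alg_scale FA c (delta [M f])) : A_rels p r" unfolding rels_unfold using f by blast
qed (use f cfun_ops in "auto simp: gens_iff intro!: W.cl")

lemma nf_delta: "delta (nf f j) = alg_mult FA (delta [M f]) (delta (Vp j))" by (simp add: W.delta_mult)

lemma M_cl: "f : cfun ZZ ==> delta [M f] : carrier FA" by (intro W.delta_cl) (simp add: gens_iff)

text \<open>The words with the same exponent are merged into one coefficient function, since M_f V^j
  is linear in f modulo \<open>q\<close>.\<close>

lemma collect_nf:
 assumes t: "t : carrier FA" and d: "!!w. t w ~= 0 ==> length w <= d"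
 shows "EX c. (ALL j:J d. c j : cfun ZZ) & Q.Q.qeq t (%w. SUM j:J d. delta (nf (c j) j) w)"
proof (rule Q.collect[OF cont_alg_star_algebra J_card(1), where Z = "%j f. delta (nf f j)"])
 note v = W.delta_cl[OF Vp_Ws]
 fix f j assume f: "f : cfun ZZ"
 show "delta (nf f j) : carrier FA" by (rule nf_cl[OF f])
 show sc: "Q.Q.qeq (delta (nf (alg_scale (C_Zp p) c f) j)) (alg_scale FA c (delta (nf f j)))" for c
  using Q.Q.qeq_mult[OF M_scale[OF f] Q.Q.qeq_refl[OF v]] by (simp only: nf_delta cont_alg_simps W.mult_scale_left[OF M_cl[OF f] v])
 fix g assume g: "g : cfun ZZ"
 show "Q.Q.qeq (delta (nf (alg_add (C_Zp p) f g) j)) (alg_add FA (delta (nf f j)) (delta (nf g j)))"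
  using Q.Q.qeq_mult[OF M_add[OF f g] Q.Q.qeq_refl[OF v]]
  by (simp only: nf_delta cont_alg_simps W.mult_add_left[OF M_cl[OF f] M_cl[OF g] v])
next
 fix w assume w: "w : Ws" "t w ~= 0"
 obtain f j where fj: "f : cfun ZZ" "j : J d" "w \<simeq> nf f j" using normal_form_J[OF w(1) d[OF w(2)]] by blast
 show "EX v. (ALL j:J d. v j : cfun ZZ) & Q.Q.qeq (delta w) (%u. SUM j:J d. delta (nf (v j) j) u)"
 proof (rule Q.single_slot[OF cont_alg_star_algebra J_card(1) _ _ fj(2,1)])
  show "Q.Q.qeq (delta w) (delta (nf f j))" using fj(3) by (simp add: weq_def)
  fix f j c assume f: "f : cfun ZZ"
  show "delta (nf f j) : carrier FA" by (rule nf_cl[OF f])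
  show "Q.Q.qeq (delta (nf (alg_scale (C_Zp p) c f) j)) (alg_scale FA c (delta (nf f j)))"
   using Q.Q.qeq_mult[OF M_scale[OF f] Q.Q.qeq_refl[OF W.delta_cl[OF Vp_Ws]]]
   by (simp only: nf_delta cont_alg_simps W.mult_scale_left[OF M_cl[OF f] W.delta_cl[OF Vp_Ws]])
 qed
qed (rule t)

lemma q_one: "q (delta []) <= 1"
proof -
 have "(q (delta []))\<^sup>2 = q (delta [])" using Q.Q.q_cstar[OF W.delta_cl[of "[]"]] by (simp add: W.delta_mult W.delta_star)
 then show ?thesis by (auto simp: power2_eq_square)
qed

lemma q_Vp: "q (delta (Vp j)) <= 1"
proof -
 have V: "q (delta [(V_gen, c)]) <= 1" for c
 proof -
  have "(q (delta [(V_gen, c)]))\<^sup>2 = q (delta [(V_gen, ~ c), (V_gen, c)])"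
   using Q.Q.q_cstar[OF W.delta_cl[of "[(V_gen, c)]"]] by (simp add: W.delta_mult W.delta_star gens_iff)
  also have "... = q (delta [])" using weq_q[OF V'V] weq_q[OF VV'] by (cases c) simp_all
  finally have "(q (delta [(V_gen, c)]))\<^sup>2 <= 1\<^sup>2" using q_one by simp
  then show ?thesis by (rule power2_le_imp_le) simp
 qed
 have "q (delta (replicate k (V_gen, c))) <= 1" for k c
 proof (induction k)
  case 0 then show ?case using q_one by simp
 next
  case (Suc k)
  have cl: "delta [(V_gen, c)] : carrier FA" "delta (replicate k (V_gen, c)) : carrier FA"
   by (auto intro!: W.delta_cl simp: gens_iff in_lists_conv_set)
  have "q (delta (replicate (Suc k) (V_gen, c))) <= q (delta [(V_gen, c)]) * q (delta (replicate k (V_gen, c)))"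
   using Q.Q.q_mult[OF cl] by (simp add: W.delta_mult)
  also have "... <= 1 * 1" by (intro mult_mono V Suc Q.Q.q_nonneg cl) simp
  finally show ?case by simp
 qed
 then show ?thesis by (simp add: Vp_def)
qed

lemma q_nf: assumes f: "f : cfun ZZ" shows "q (delta (nf f j)) <= q (delta [M f])"
proof -
 have "q (delta (nf f j)) <= q (delta [M f]) * q (delta (Vp j))" unfolding nf_delta by (rule Q.Q.q_mult[OF M_cl[OF f] W.delta_cl[OF Vp_Ws]])
 also have "... <= q (delta [M f]) * 1" by (intro mult_left_mono q_Vp Q.Q.q_nonneg[OF M_cl[OF f]])
 finally show ?thesis by simp
qed

text \<open>As M_h* M_h is M of |h|^2, squaring leads from the functional f \<mapsto> q(M_f) back to
  itself; this single functional is already a multiplier family.\<close>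

lemma q_M:
 assumes f: "f : cfun ZZ" and c: "0 < c" "!!x. x : ZZ ==> cmod (f x) <= c" shows "q (delta [M f]) <= c"
proof -
 interpret C: multiplier_family "{%f. q (delta [M f])}" "cfun ZZ" "{f. continuous_on ZZ f}"
 proof unfold_locales
  fix N and h :: "(nat => int) => complex" assume "N : {%f. q (delta [M f])}" and h: "h : cfun ZZ"
  then have N: "N = (%f. q (delta [M f]))" by simp
  show "0 <= N h" unfolding N by (rule Q.Q.q_nonneg[OF M_cl[OF h]])
  show "N (%y. a * h y) = cmod a * N h" for a
   unfolding N by (simp add: Q.Q.qeq_q[OF M_scale[OF h]] Q.Q.q_scale[OF M_cl[OF h]])
  fix g :: "(nat => int) => complex" assume g: "g : cfun ZZ"
  show "N (%y. g y + h y) <= N g + N h"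
   unfolding N by (simp add: Q.Q.qeq_q[OF M_add[OF g h]] Q.Q.q_add[OF M_cl[OF g] M_cl[OF h]])
 next
  fix N assume "N : {%f. q (delta [M f])}"
  then have N: "N = (%f. q (delta [M f]))" by simp
  have "(q (delta [M h]))\<^sup>2 = q (delta [M (%y. cnj (h y) * h y)])" if h: "h : cfun ZZ" for h
  proof -
   have "(q (delta [M h]))\<^sup>2 = q (delta [(M_gen h, True), M h])"
    using Q.Q.q_cstar[OF M_cl[OF h]] by (simp add: W.delta_mult W.delta_star)
   also have "[(M_gen h, True)] @ [M h] \<simeq> [M (%x. cnj (h x))] @ [M h]" by (rule weq_right[OF M_star[OF h]]) (simp add: gens_iff h)
   from weq_q[OF weq_trans[OF this[unfolded append.simps] M_mult[OF cfun_ops(1)[OF h] h]]]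
   have "q (delta [(M_gen h, True), M h]) = q (delta [M (%y. cnj (h y) * h y)])" .
   finally show ?thesis .
  qed
  then show "EX N':{%f. q (delta [M f])}. ALL h:cfun ZZ. (N h)\<^sup>2 = N' (%y. cnj (h y) * h y)" by (simp add: N)
 next
  fix f :: "(nat => int) => complex" and \<phi> :: "complex => complex" assume "f : {f. continuous_on ZZ f}" "continuous_on UNIV \<phi>"
  then show "(%y. \<phi> (f y)) : {f. continuous_on ZZ f}" by (auto intro: continuous_on_compose2[of UNIV \<phi>])
 qed (auto simp: cfun_iff intro!: continuous_intros)
 have "f = (%x. one_Zp p x * f x)" using f by (auto simp: cfun_iff one_Zp_def)
 moreover have "q (delta [M (%x. one_Zp p x * f x)]) <= c * q (delta [M (one_Zp p)])"
  by (rule C.N_mult_le[OF _ one_cfun _ c(1)]) (use f c(2) in "auto simp: cfun_iff one_Zp_def split: if_splits")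
 moreover have "c * q (delta [M (one_Zp p)]) <= c * 1" unfolding weq_q[OF M_one] using c(1) q_one by (intro mult_left_mono) auto
 ultimately show ?thesis by simp
qed

end

context crossed
begin

text \<open>Two admissible seminorms are compared through the coefficient functions at the points of
  X. With X all of Z_p this shows that the matrix model is universal; with X = {0}, used in both
  directions, it identifies the norm of the shift representation with that of the fibre over
  0.\<close>

theorem seminorm_le_if_coefficients:
 assumes q: "crossed_seminorm p r b q" and q': "crossed_seminorm p r b q'"
  and M_le: "!!f c. [|f : cfun ZZ; 0 < c; !!x. x : X ==> cmod (f x) <= c|] ==> q (delta [M f]) <= c & q' (delta [M f]) <= c"
  and coeff: "!!d c j x. [|!!j. j : J d ==> c j : cfun ZZ; j : J d; x : X|]
   ==> cmod (c j x) <= q' (%w. SUM j:J d. delta (nf (c j) j) w)"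
  and t: "t : carrier FA"
 shows "q t <= q' t"
proof -
 interpret q: crossed_seminorm p r b q by (rule q)
 interpret q': crossed_seminorm p r b q' by (rule q')
 \<comment> \<open>Normal forms are taken modulo the maximum, so that one and the same combination
   represents t for both seminorms.\<close>
 interpret m: crossed_seminorm p r b "%t. max (q t) (q' t)"
  by unfold_locales (simp_all add: cstar_seminorm_max q.q q'.q q.q_rels q'.q_rels)
 define A where "A d = {t : carrier FA. ALL w. t w ~= 0 --> length w <= d}" for d
 have growth: "q t <= (2 + real n) * (1 + real d) * q' t" if t: "t : A d" for t d
 proof -
  have tF: "t : carrier FA" and td: "!!w. t w ~= 0 ==> length w <= d" using t by (simp_all add: A_def)
  obtain c where c: "ALL j:J d. c j : cfun ZZ" "m.Q.Q.qeq t (%w. SUM j:J d. delta (nf (c j) j) w)"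
   using m.collect_nf[where t = t and d = d, OF tF] td by blast
  have cc: "c j : cfun ZZ" if "j : J d" for j using c(1) that by (rule bspec)
  let ?s = "%w. SUM j:J d. delta (nf (c j) j) w"
  have s: "?s : carrier FA" and mz: "max (q (alg_diff FA t ?s)) (q' (alg_diff FA t ?s)) = 0"
   using c(2) by (simp_all add: m.Q.Q.qeq_def)
  have "q' (alg_diff FA t ?s) = 0" "q (alg_diff FA t ?s) = 0"
   using mz q'.Q.Q.q_nonneg[OF W.diff_closed[OF tF s]] q.Q.Q.q_nonneg[OF W.diff_closed[OF tF s]] by linarith+
  then have Nt: "q' t = q' ?s" and qt: "q t = q ?s"
   using tF s q'.Q.Q.qeq_q[of t ?s] q.Q.Q.qeq_q[of t ?s] by (simp_all add: q'.Q.Q.qeq_def q.Q.Q.qeq_def)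
  have slot: "q (delta (nf (c j) j)) <= q' t" if j: "j : J d" for j
  proof (rule field_le_epsilon)
   fix e :: real assume e: "0 < e"
   have "q (delta [M (c j)]) <= q' t + e & q' (delta [M (c j)]) <= q' t + e"
   proof (rule M_le[OF cc[OF j]])
    show "0 < q' t + e" using e q'.Q.Q.q_nonneg[OF tF] by linarith
    show "cmod (c j x) <= q' t + e" if "x : X" for x 
    proof -
     have "cmod (c j x) <= q' ?s" by (rule coeff[OF _ j that]) (rule cc)
     then show ?thesis using e unfolding Nt by simp
    qed
   qed
   then show "q (delta (nf (c j) j)) <= q' t + e" using q.q_nf[OF cc[OF j], of j] by linarith
  qed
  have "q ?s <= (SUM j:J d. q (delta (nf (c j) j)))" by (rule W.seminorm_sum[OF q.q J_card(1) q.nf_cl[OF cc]])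
  also have "... <= (SUM j:J d. q' t)" by (rule sum_mono[OF slot])
  also have "... <= (2 + real n) * (1 + real d) * q' t"
   using mult_right_mono[OF J_card(2)[of d] q'.Q.Q.q_nonneg[OF tF]] by simp
  finally show ?thesis unfolding qt .
 qed
 \<comment> \<open>The degree of t is the maximal word length in its support; inserting 0 covers t =
   0.\<close>
 have tA: "t : A (Max (insert 0 (length ` {w. t w ~= 0})))" 
  unfolding A_def using t by (auto simp: W.carrier_iff intro!: Max_ge)
 show ?thesis
 proof (rule cstar_seminorm_le_if_growth[where W = A and C = "2 + real n", OF W.star_algebra_P q.q q'.q])
  show "A d \<subseteq> carrier FA" for d by (auto simp: A_def)
  show "alg_star FA x : A d" if "x : A d" for d x
   unfolding A_def
  proof (intro CollectI conjI allI impI)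
   show "alg_star FA x : carrier FA" using that by (auto simp: A_def intro: W.star_cl)
   fix w assume "alg_star FA x w ~= 0"
   then show "length w <= d" using W.star_support[of x] that by (auto simp: A_def)
  qed
  show "alg_mult FA x y : A (d + e)" if "x : A d" "y : A e" for d e x y
   unfolding A_def
  proof (intro CollectI conjI allI impI)
   show "alg_mult FA x y : carrier FA" using that by (auto simp: A_def intro: W.mult_cl)
   fix w assume "alg_mult FA x y w ~= 0"
   then obtain s t where "w = s @ t" "x s ~= 0" "y t ~= 0" using W.mult_support[of x y] by auto
   then show "length w <= d + e" using that by (auto simp: A_def intro!: add_mono)
  qed
 qed (fact growth tA)+
qed

end

subsection \<open>Covariant families\<close>

context padic_root
begin

definition rot :: "int => (nat => int) => nat => int" where "rot j = act (nat (j mod int n))"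

lemma rot_ZZ: "x : ZZ ==> rot j x : ZZ" unfolding rot_def by (rule act_ZZ)
lemma rot_int: "rot (int i) = act i" by (rule HOL.ext) (simp add: rot_def nat_mod_distrib act_mod)
lemma rot_0: "x : ZZ ==> rot 0 x = x" using rot_int[of 0] by (simp add: act_0)
lemma rot_zero: "rot j (%m. 0) = (%m. 0)" unfolding rot_def by (rule act_zero)
lemma rot_continuous: "continuous_on X (rot j)" unfolding rot_def by (rule act_continuous)
lemma rot_eq: "(i - j) mod int n = 0 ==> rot i x = rot j x"
 by (simp add: rot_def mod_eq_0_iff_dvd flip: mod_eq_dvd_iff)
lemma rot_rot: assumes "x : ZZ" shows "rot i (rot j x) = rot (i + j) x"
proof -
 have "(nat (i mod int n) + nat (j mod int n)) mod n = nat ((i + j) mod int n)"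
  using ord_props(1) by (simp add: nat_add_distrib[symmetric] nat_mod_as_int mod_add_eq)
 then show ?thesis
  using act_mod[of "nat (i mod int n) + nat (j mod int n)" x] by (simp add: rot_def act_act[OF assms])
qed

end

text \<open>\<open>Y f j\<close> is the intended image of M_f V^j, and the assumptions are the
  multiplication table of these elements. They are stated for functions continuous on Z_p, with
  values elsewhere ignored by \<open>Y_cong\<close>, so that the constant 1 can be used
  directly.\<close>

locale covariant_family = crossed p r b + D: star_algebra D for p r b and D :: "('d, 'm) star_alg_scheme" +
 fixes Y :: "((nat => int) => complex) => int => 'd"
 assumes Y_cl: "continuous_on ZZ f ==> Y f j : carrier D"
  and Y_cong: "(!!x. x : ZZ ==> f x = g x) ==> Y f j = Y g j"
  and Y_add: "[|continuous_on ZZ f; continuous_on ZZ g|] ==> Y (%x. f x + g x) j = alg_add D (Y f j) (Y g j)"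
  and Y_scale: "continuous_on ZZ f ==> Y (%x. c * f x) j = alg_scale D c (Y f j)"
  and Y_mult: "[|continuous_on ZZ f; continuous_on ZZ g|]
   ==> alg_mult D (Y f i) (Y g j) = Y (%x. f x * g (rot (- i) x)) (i + j)"
  and Y_star: "continuous_on ZZ f ==> alg_star D (Y f j) = Y (%x. cnj (f (rot j x))) (- j)"
  and Y_one: "y : carrier D ==> alg_mult D (Y (%_. 1) 0) y = y" "y : carrier D ==> alg_mult D y (Y (%_. 1) 0) = y"
  and Y_periodic: "b ==> Y (%_. 1) (int n) = Y (%_. 1) 0"
begin

lemma ex_hom: "EX \<Phi>. star_hom FA D \<Phi> & \<Phi> (delta []) = Y (%_. 1) 0 & \<Phi> (delta [V]) = Y (%_. 1) 1
  & (ALL f:cfun ZZ. \<Phi> (delta [M f]) = Y f 0)"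
proof -
 let ?\<tau> = "%g. case g of M_gen f => Y f 0 | V_gen => Y (%_. 1) 1"
 have "?\<tau> g : carrier D" if "g : gens p" for g using that Y_cl by (cases g) (auto simp: gens_iff cfun_iff)
 then have "EX \<Phi>. star_hom (free_star_alg (gens p)) D \<Phi> & \<Phi> free_one = Y (%_. 1) 0 & (ALL g:gens p. \<Phi> (free_gen g) = ?\<tau> g)"
  by (intro free_hom D.star_algebra_axioms Y_one Y_cl) simp_all
 then obtain \<Phi> where \<Phi>: "star_hom FA D \<Phi>" "\<Phi> (delta []) = Y (%_. 1) 0" "ALL g:gens p. \<Phi> (delta [(g, False)]) = ?\<tau> g"
  unfolding FA_eq free_one_def free_gen_def by blast
 then show ?thesis using \<Phi>(3) by (intro exI[of _ \<Phi>]) (simp add: gens_iff)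
qed

definition \<Phi> :: "free_elem => 'd" where
 "\<Phi> = (SOME \<Phi>. star_hom FA D \<Phi> & \<Phi> (delta []) = Y (%_. 1) 0 & \<Phi> (delta [V]) = Y (%_. 1) 1
  & (ALL f:cfun ZZ. \<Phi> (delta [M f]) = Y f 0))"

lemma \<Phi>_hom: "star_hom FA D \<Phi>" and \<Phi>_one: "\<Phi> (delta []) = Y (%_. 1) 0" and \<Phi>_V: "\<Phi> (delta [V]) = Y (%_. 1) 1"
 and \<Phi>_M: "f : cfun ZZ ==> \<Phi> (delta [M f]) = Y f 0"
 using someI_ex[OF ex_hom] unfolding \<Phi>_def[symmetric] by blast+

lemma d_cl: "w : Ws ==> delta w : carrier FA" by (rule W.delta_cl)

lemma \<Phi>_append: "[|s : Ws; t : Ws|] ==> \<Phi> (delta (s @ t)) = alg_mult D (\<Phi> (delta s)) (\<Phi> (delta t))"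
 using star_homD(4)[OF \<Phi>_hom d_cl d_cl, of s t] by (simp add: W.delta_mult)

lemma \<Phi>_V': "\<Phi> (delta [V']) = Y (%_. 1) (- 1)"
proof -
 have "\<Phi> (delta [V']) = alg_star D (\<Phi> (delta [V]))"
  using star_homD(5)[OF \<Phi>_hom d_cl[of "[V]"]] by (simp add: W.delta_star gens_iff)
 then show ?thesis by (simp add: \<Phi>_V Y_star)
qed

lemma \<Phi>_Vp: "\<Phi> (delta (Vp j)) = Y (%_. 1) j"
proof -
 have "\<Phi> (delta (replicate k (V_gen, c))) = Y (%_. 1) (if c then - int k else int k)" for k c
 proof (induction k)
  case 0 then show ?case by (simp add: \<Phi>_one)
 next
  case (Suc k)
  have "\<Phi> (delta ([(V_gen, c)] @ replicate k (V_gen, c))) = alg_mult D (\<Phi> (delta [(V_gen, c)])) (\<Phi> (delta (replicate k (V_gen, c))))"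
   by (rule \<Phi>_append) (auto simp: gens_iff in_lists_conv_set)
  then show ?case using Suc \<Phi>_V \<Phi>_V' by (cases c) (simp_all add: Y_mult)
 qed
 then show ?thesis by (simp add: Vp_def)
qed

lemma \<Phi>_nf: "f : cfun ZZ ==> \<Phi> (delta (nf f j)) = Y f j"
 using \<Phi>_append[of "[M f]" "Vp j"] Y_mult[of f "%_. 1" 0 j] by (simp add: gens_iff \<Phi>_M \<Phi>_Vp cfun_iff)

lemma \<Phi>_rels: assumes "(y, z) : R" shows "y : carrier FA & z : carrier FA & \<Phi> y = \<Phi> z"
proof -
 interpret C: fun_alg "cfun ZZ" by (rule cfun_fun_alg[OF ZZ_compact])
 have c: "continuous_on ZZ f" if "f : cfun ZZ" for f using that by (simp add: cfun_iff)
 have m: "delta [M f] : carrier FA" if "f : cfun ZZ" for f using that by (intro d_cl) (simp add: gens_iff)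
 have v: "delta [V] : carrier FA" "delta [V'] : carrier FA" by (auto intro!: d_cl simp: gens_iff)
 note H = star_homD(2,3,4,5)[OF \<Phi>_hom]
 have one: "\<Phi> (delta [M (one_Zp p)]) = \<Phi> (delta [])"
  unfolding \<Phi>_M[OF one_cfun] \<Phi>_one by (rule Y_cong) (simp add: one_Zp_def)
 have add: "\<Phi> (delta [M (%x. f x + g x)]) = \<Phi> (alg_add FA (delta [M f]) (delta [M g]))" if "f : cfun ZZ" "g : cfun ZZ" for f g
  using that by (simp add: \<Phi>_M C.f_add H m Y_add c)
 have sc: "\<Phi> (delta [M (%x. a * f x)]) = \<Phi> (alg_scale FA a (delta [M f]))" if "f : cfun ZZ" for f a
  using that by (simp add: \<Phi>_M C.f_scale H m Y_scale c)
 have mu: "\<Phi> (delta [M (%x. f x * g x)]) = \<Phi> (alg_mult FA (delta [M f]) (delta [M g]))" if "f : cfun ZZ" "g : cfun ZZ" for f g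
  unfolding H(3)[OF m[OF that(1)] m[OF that(2)]] using that by (simp add: \<Phi>_M C.f_mult Y_mult c) (intro Y_cong, simp add: rot_0)
 have st: "\<Phi> (delta [M (%x. cnj (f x))]) = \<Phi> (alg_star FA (delta [M f]))" if "f : cfun ZZ" for f
  unfolding H(4)[OF m[OF that]] using that by (simp add: \<Phi>_M C.f_cnj Y_star c) (intro Y_cong, simp add: rot_0)
 \<comment> \<open>Conjugation by V moves the argument by r^(-1), and -1 is congruent to n - 1,
   which matches \<open>alpha_eq\<close>.\<close>
 have co: "\<Phi> (delta ([V] @ [M f] @ [V'])) = \<Phi> (delta [M (alpha p r f)])" if f: "f : cfun ZZ" for f
 proof -
  have fr: "continuous_on ZZ (%x. f (rot (- 1) x))"
   by (rule continuous_on_compose2[OF c[OF f] rot_continuous]) (auto simp: rot_ZZ)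
  have "\<Phi> (delta ([V] @ [M f] @ [V'])) = alg_mult D (Y (%_. 1) 1) (alg_mult D (Y f 0) (Y (%_. 1) (- 1)))"
   using f by (subst \<Phi>_append, simp add: gens_iff, simp add: gens_iff, subst \<Phi>_append) (simp_all add: gens_iff \<Phi>_V \<Phi>_V' \<Phi>_M)
  also have "... = Y (%x. f (rot (- 1) x)) 0" using f by (simp add: Y_mult c)
  also have "... = Y (alpha p r f) 0"
   using ord_props(1) rot_eq[of "-1" "int (n - 1)"] by (intro Y_cong) (simp add: alpha_eq rot_int[symmetric] of_nat_diff)
  finally show ?thesis by (simp add: \<Phi>_M alpha_cfun f)
 qed
 have vv: "\<Phi> (delta ([V'] @ [V])) = \<Phi> (delta [])" "\<Phi> (delta ([V] @ [V'])) = \<Phi> (delta [])"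
  by (subst \<Phi>_append; simp add: gens_iff \<Phi>_V \<Phi>_V' \<Phi>_one Y_mult)+
 have pow: "(alg_mult FA (delta [V]) ^^ k) (delta []) = delta (Vp (int k))" for k
  by (induction k) (simp_all add: W.delta_mult Vp_def nat_add_distrib)
 have A: ?thesis if "(y, z) : A_rels p r"
  using that unfolding A_rels_def M_rels_def covariance_rels_def Let_def FA_eq free_gen_def free_one_def cont_alg_simps
  by (elim UnE CollectE exE conjE insertE emptyE; clarsimp simp: add sc mu st one W.delta_star W.delta_mult)
   (auto simp: m v W.cl d_cl C.f_add C.f_scale C.f_mult C.f_cnj gens_iff one_cfun alpha_cfun
    co[simplified] vv[simplified] mu[unfolded W.delta_mult, simplified] st[unfolded W.delta_star, simplified])
 show ?thesis
 proof (cases "(y, z) : A_rels p r")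
  case False
  then have b: b and "(y, z) : A'_rels p r" using assms by (auto simp: R_def split: if_splits)
  then have "(y, z) = (delta ([V] @ [V']), delta []) \<or> (y, z) = (delta (Vp (int n)), delta [])"
   using False by (auto simp: A_rels_def A'_rels_def Let_def FA_eq free_gen_def free_one_def W.delta_star W.delta_mult pow)
  then show ?thesis using vv(2) Y_periodic[OF b] Vp_Ws[of "int n"]
   by (auto intro!: d_cl simp: \<Phi>_Vp \<Phi>_one gens_iff simp del: Vp_Ws)
 qed (rule A)
qed

lemma crossed_seminorm_\<Phi>:
 assumes "star_hom D E \<theta>" "cstar_algebra E" shows "crossed_seminorm p r b (%t. alg_norm E (\<theta> (\<Phi> t)))"
proof unfold_locales
 have h: "star_hom FA E (%t. \<theta> (\<Phi> t))" using star_hom_comp[OF \<Phi>_hom assms(1)] by (simp add: comp_def)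
 show "cstar_seminorm FA (%t. alg_norm E (\<theta> (\<Phi> t)))"
  by (rule cstar_seminorm_hom[OF h W.star_algebra_P cstar_algebra.norm_seminorm[OF assms(2)]])
 fix y z assume "(y, z) : R"
 from \<Phi>_rels[OF this] show "alg_norm E (\<theta> (\<Phi> (alg_diff FA y z))) = 0"
  by (intro rels_norm_zero[OF assms(2) h W.star_algebra_P]) simp
qed

end

subsection \<open>The matrix-valued functions attached to a crossed product\<close>

context crossed
begin

definition XS :: "((nat => int) \<times> complex) set" where "XS = ZZ \<times> S"
abbreviation "DM \<equiv> mat_fun n (cfun XS)"

lemma S_props: "z : S ==> cmod z = 1" "compact S" "1 : S"
 by (auto simp: S_def split: if_splits)

lemma XS_compact: "compact XS" unfolding XS_def by (intro compact_Times ZZ_compact S_props)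

sublocale CX: fun_alg "cfun XS" by (rule cfun_fun_alg[OF XS_compact])
sublocale CS: fun_alg "cfun S" by (rule cfun_fun_alg[OF S_props(2)])

text \<open>The representation induced from the point x: the basis vectors satisfy e_(k+n) = z e_k,
  V sends e_k to e_(k+1), and M_f multiplies e_i by f(r^i x). Hence V^j e_k is a multiple of e_i
  exactly if n divides k + j - i, the quotient being the power of z.\<close>

definition YM :: "((nat => int) => complex) => int => (nat => int) \<times> complex => nat => nat => complex" where
 "YM f j = (%(x, z) i k. if x : ZZ & z : S & i < n & k < n & (int k + j - int i) mod int n = 0
   then f (act i x) * z powi ((int k + j - int i) div int n) else 0)"

lemma YM_cl: assumes f: "continuous_on ZZ f" shows "YM f j : carrier DM"
 unfolding mat_fun_carrier
proof (intro conjI allI impI)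
 fix i k
 let ?e = "(int k + j - int i) div int n"
 have "continuous_on XS (%w. act i (fst w))"
  by (rule continuous_on_compose2[OF act_continuous[of UNIV]]) (auto intro: continuous_intros)
 then have "continuous_on XS (%w. f (act i (fst w)))"
  by (rule continuous_on_compose2[OF f]) (auto simp: XS_def act_ZZ)
 then have "continuous_on XS (%w. f (act i (fst w)) * snd w powi ?e)"
  by (intro continuous_intros) (auto simp: XS_def dest: S_props(1))
 from cfun_restrict[OF this]
 have *: "(%w. if w : XS then f (act i (fst w)) * snd w powi ?e else 0) : cfun XS" .
 show "(%w. YM f j w i k) : cfun XS"
 proof (cases "i < n & k < n & (int k + j - int i) mod int n = 0")
  case True
  then have "(%w. YM f j w i k) = (%w. if w : XS then f (act i (fst w)) * snd w powi ?e else 0)"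
   by (auto simp: YM_def XS_def)
  then show ?thesis using * by simp
 next
  case False
  then have "(%w. YM f j w i k) = (%w. 0)" by (auto simp: YM_def)
  then show ?thesis using CX.f_zero by simp
 qed
qed (auto simp: YM_def split_beta)

lemma index_unique: "[|l < n; (int l - j) mod int n = 0|] ==> l = nat (j mod int n)"
 by (metis mod_0_imp_dvd mod_eq_dvd_iff mod_less nat_int of_nat_mod)

lemma index_ex: "nat (j mod int n) < n" "(int (nat (j mod int n)) - j) mod int n = 0"
 using ord_props(1) by (simp_all add: nat_less_iff minus_mod_eq_mult_div[symmetric] mod_diff_left_eq)

text \<open>Each row meets a single intermediate index \<open>l0\<close>; the powers of z add up
  correctly once the carry q of the reduction modulo n is tracked.\<close>

lemma YM_mult: "alg_mult DM (YM f a) (YM g c) = YM (%x. f x * g (rot (- a) x)) (a + c)"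
proof (intro HOL.ext)
 fix w :: "(nat => int) \<times> complex" and i k :: nat
 obtain x z where w: "w = (x, z)" by force
 show "alg_mult DM (YM f a) (YM g c) w i k = YM (%x. f x * g (rot (- a) x)) (a + c) w i k"
 proof (cases "x : ZZ & z : S & i < n & k < n")
  case True
  define l0 where "l0 = nat ((int i - a) mod int n)"
  have l0: "l0 < n" "(int l0 - (int i - a)) mod int n = 0" unfolding l0_def by (rule index_ex)+
  have "int n dvd int l0 + a - int i" using l0(2) by (simp add: mod_eq_0_iff_dvd diff_diff_eq2)
  then obtain q where q: "int l0 + a - int i = int n * q" by (rule dvdE)
  define E where "E = int k + (a + c) - int i"
  have k: "int k + c - int l0 = E + int n * (- q)" using q by (simp add: E_def)
  have e1: "(int k + c - int l0) mod int n = E mod int n" unfolding k by (rule mod_mult_self2)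
  have e2: "(int k + c - int l0) div int n = E div int n - q"
   unfolding k using ord_props(1) div_mult_self2[of "int n" E "- q"] by simp
  have z: "z powi q * z powi (E div int n - q) = z powi (E div int n)"
  proof -
   have "z ~= 0" using True S_props(1)[of z] by auto
   then show ?thesis by (simp flip: power_int_add)
  qed
  have "rot (- a) (act i x) = rot (int i - a) x" using rot_rot[of x "- a" "int i"] True by (simp add: rot_int)
  also have "... = act l0 x" using rot_eq[OF l0(2)] by (simp add: rot_int)
  finally have r: "rot (- a) (act i x) = act l0 x" .
  have "alg_mult DM (YM f a) (YM g c) w i k = (\<Sum>l<n. if l = l0 then YM f a w i l0 * YM g c w l0 k else 0)"
   unfolding mat_fun_simps
  proof (intro sum.cong refl)
   fix l assume "l : {..<n}"
   then have "(int l + a - int i) mod int n ~= 0" if "l ~= l0"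
    using that index_unique[of l "int i - a"] unfolding l0_def diff_diff_eq2 by auto
   then have "YM f a w i l = 0" if "l ~= l0" unfolding YM_def w using that by simp
   then show "YM f a w i l * YM g c w l k = (if l = l0 then YM f a w i l0 * YM g c w l0 k else 0)" by simp
  qed
  also have "... = YM f a w i l0 * YM g c w l0 k" using l0(1) by simp
  also have "... = YM (%x. f x * g (rot (- a) x)) (a + c) w i k"
  proof -
   have d: "(int l0 + a - int i) mod int n = 0" "(int l0 + a - int i) div int n = q" using ord_props(1) unfolding q by simp_all
   show ?thesis
    unfolding YM_def w prod.case d e1 e2 E_def[symmetric] r z[symmetric] using True l0(1) by simp
  qed
  finally show ?thesis .
 qed (auto simp: YM_def w mat_fun_simps)
qed

lemma YM_star: "alg_star DM (YM f j) = YM (%x. cnj (f (rot j x))) (- j)"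
proof (intro HOL.ext)
 fix w :: "(nat => int) \<times> complex" and i k :: nat
 obtain x z where w: "w = (x, z)" by force
 define E where "E = int i + j - int k"
 have E': "int k + - j - int i = - E" by (simp add: E_def)
 have m: "(- E) mod int n = 0 \<longleftrightarrow> E mod int n = 0" by (simp add: mod_eq_0_iff_dvd)
 show "alg_star DM (YM f j) w i k = YM (%x. cnj (f (rot j x))) (- j) w i k"
 proof (cases "x : ZZ & z : S & i < n & k < n & E mod int n = 0")
  case True
  have "int n dvd E" using True by (simp add: mod_eq_0_iff_dvd)
  then obtain q where q: "E = int n * q" by (rule dvdE)
  have d: "E div int n = q" "(- E) div int n = - q" using ord_props(1) q by (simp_all flip: mult_minus_right)
  have "rot j (act i x) = rot (j + int i) x" using rot_rot[of x j "int i"] True by (simp add: rot_int)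
  also have "... = act k x" using rot_eq[of "j + int i" "int k" x] True by (simp add: rot_int E_def add.commute)
  finally have r: "rot j (act i x) = act k x" .
  have "alg_star DM (YM f j) w i k = cnj (f (act k x)) * cnj (z powi q)"
   using True by (simp add: mat_fun_simps YM_def w E_def[symmetric] d)
  also have "... = YM (%x. cnj (f (rot j x))) (- j) w i k"
   unfolding YM_def w prod.case E' m d using True S_props(1)[of z] cnj_powi[of z q] by (simp add: r)
  finally show ?thesis .
 next
  case False
  then show ?thesis unfolding mat_fun_simps YM_def w prod.case E' m E_def[symmetric] by auto
 qed
qed

lemma YM_one_entry: "YM (%_. 1) 0 w i k = (if w : XS & i < n & k = i then 1 else 0)"
proof (cases "i < n & k < n & (int k + 0 - int i) mod int n = 0")
 case True
 then have "k = i" using index_unique[of k "int i"] by simp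
 then show ?thesis using True by (cases w) (simp add: YM_def XS_def)
next
 case False
 then show ?thesis by (cases w) (auto simp: YM_def XS_def)
qed

lemma DM_zero: "[|F : carrier DM; ~ (w : XS & i < n & k < n)|] ==> F w i k = 0"
 unfolding mat_fun_carrier cfun_iff by (meson not_less)

sublocale MF: covariant_family p r b DM YM
proof (intro covariant_family.intro crossed_axioms CX.mf_star_algebra covariant_family_axioms.intro)
 fix f g :: "(nat => int) => complex" and i j :: int and c :: complex
 show "YM f j = YM g j" if "!!x. x : ZZ ==> f x = g x" using that by (intro HOL.ext) (auto simp: YM_def act_ZZ)
 show "YM (%x. f x + g x) j = alg_add DM (YM f j) (YM g j)"
  by (intro HOL.ext) (simp add: YM_def mat_fun_simps distrib_right split_beta)
 show "YM (%x. c * f x) j = alg_scale DM c (YM f j)"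
  by (intro HOL.ext) (simp add: YM_def mat_fun_simps split_beta mult.assoc)
 fix F assume F: "F : carrier DM"
 show "alg_mult DM (YM (%_. 1) 0) F = F"
 proof (intro HOL.ext)
  fix w i k
  have "alg_mult DM (YM (%_. 1) 0) F w i k = (\<Sum>l<n. if l = i then (if w : XS then F w i k else 0) else 0)"
   unfolding mat_fun_simps YM_one_entry by (intro sum.cong) auto
  then show "alg_mult DM (YM (%_. 1) 0) F w i k = F w i k" using DM_zero[OF F, of w i k] by auto
 qed
 show "alg_mult DM F (YM (%_. 1) 0) = F"
 proof (intro HOL.ext)
  fix w i k
  have "alg_mult DM F (YM (%_. 1) 0) w i k = (\<Sum>l<n. if l = k then (if w : XS then F w i k else 0) else 0)"
   unfolding mat_fun_simps YM_one_entry by (intro sum.cong) auto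
  then show "alg_mult DM F (YM (%_. 1) 0) w i k = F w i k" using DM_zero[OF F, of w i k] by auto
 qed
next
 assume b
 then have z: "z = 1" if "z : S" for z using that unfolding S_def by simp
 have m: "(int k + int n - int i) mod int n = (int k + 0 - int i) mod int n" for i k 
  using mod_add_self2[of "int k + 0 - int i" "int n"] by (simp add: algebra_simps)
 show "YM (%_. 1) (int n) = YM (%_. 1) 0"
  by (intro HOL.ext) (auto simp: YM_def m dest!: z)
qed (simp_all add: YM_cl YM_mult YM_star)

subsection \<open>The representation by shifts\<close>

text \<open>On the integers k mod 0 = k, so the modulus 0 makes \<open>Idx\<close> all of Z while
  the modulus n makes it the residues; pi_0 and pi_0' are thus handled together.\<close>

definition mm :: int where "mm = (if b then int n else 0)"
definition Idx :: "int set" where "Idx = {k. k mod mm = k}"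

definition shift :: "int => (int => complex) => int => complex" where
 "shift j x = (%i. if x : ell2 Idx & i : Idx then x ((i - j) mod mm) else 0)"

definition YO :: "((nat => int) => complex) => int => (int => complex) => int => complex" where
 "YO f j = (%x i. f (%m. 0) * shift j x i)"

lemma mod_Idx: "k mod mm : Idx" by (simp add: Idx_def)

lemma shift_basis: assumes "k : Idx" shows "shift j (basis_vec k) = basis_vec ((k + j) mod mm)"
proof
 fix i
 have 1: "i = (k + j) mod mm" if "i : Idx" "(i - j) mod mm = k"
  using that(1) unfolding that(2)[symmetric] by (simp add: Idx_def mod_add_left_eq)
 have 2: "((k + j) mod mm - j) mod mm = k" using assms by (simp add: mod_diff_left_eq Idx_def)
 show "shift j (basis_vec k) i = basis_vec ((k + j) mod mm) i"
 proof (cases "i = (k + j) mod mm")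
  case True
  then have "i : Idx" "(i - j) mod mm = k" using 2 mod_Idx by simp_all
  then show ?thesis using True basis_ell2[OF assms] by (simp add: shift_def basis_vec_def)
 next
  case False
  then have "i : Idx ==> (i - j) mod mm ~= k" using 1 by blast
  then show ?thesis using False by (simp add: shift_def basis_vec_def)
 qed
qed

lemma shift_ell2: assumes x: "x : ell2 Idx" shows "shift j x : ell2 Idx" "ell2_norm Idx (shift j x) <= ell2_norm Idx x"
proof -
 have v: "shift j x i = 0" if "i ~: Idx" for i using that by (simp add: shift_def)
 have le: "L2_set (%i. cmod (shift j x i)) A <= ell2_norm Idx x" if A: "finite A" "A \<subseteq> Idx" for A
 proof -
  have "inj_on (%i. (i - j) mod mm) A"
  proof (rule inj_on_inverseI)
   fix i assume "i : A"
   then show "((i - j) mod mm + j) mod mm = i" using A(2) by (auto simp: mod_add_left_eq Idx_def)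
  qed
  then have "L2_set (%i. cmod (shift j x i)) A = L2_set (%i. cmod (x i)) ((%i. (i - j) mod mm) ` A)"
   unfolding L2_set_def using A(2) x by (subst sum.reindex) (auto simp: shift_def intro!: sum.cong)
  also have "... <= ell2_norm Idx x" using A mod_Idx by (intro l2_le_norm x) auto
  finally show ?thesis .
 qed
 show "shift j x : ell2 Idx" by (rule ell2I(1)[OF v ell2_norm_nonneg le])
 show "ell2_norm Idx (shift j x) <= ell2_norm Idx x" by (rule ell2I(2)[OF v ell2_norm_nonneg le])
qed

lemma shift_op: "shift j : bounded_ops Idx"
proof (rule bounded_opsI[where K = 1])
 show "shift j x : ell2 Idx" "ell2_norm Idx (shift j x) <= 1 * ell2_norm Idx x" if "x : ell2 Idx" for x using shift_ell2[OF that] by simp_all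
qed (auto simp: shift_def ell2_add ell2_scale)

lemma YO_cl: "YO f j : bounded_ops Idx" unfolding YO_def by (rule op_scale_closed(1)[OF shift_op])

lemma shift_shift: "x : ell2 Idx ==> shift i (shift j x) = shift (i + j) x"
 by (rule HOL.ext) (simp add: shift_def[of i] shift_ell2, simp add: shift_def mod_Idx mod_diff_left_eq diff_diff_add)

lemma shift_0: "shift 0 = id_op Idx"
 by (intro HOL.ext) (auto simp: shift_def id_op_def ell2_vanish Idx_def)

lemma YO_basis: "k : Idx ==> YO f j (basis_vec k) = (%i. f (%m. 0) * basis_vec ((k + j) mod mm) i)"
 by (simp add: YO_def shift_basis)

lemma YO_star: "alg_star (op_alg Idx) (YO f j) = YO (%x. cnj (f (rot j x))) (- j)"
proof (rule op_eqI[where I = Idx])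
 note adj = op_star(1)[OF YO_cl[of f j], unfolded is_adjoint_def]
 show "alg_star (op_alg Idx) (YO f j) : bounded_ops Idx" using adj by blast
 fix k assume k: "k : Idx"
 show "alg_star (op_alg Idx) (YO f j) (basis_vec k) = YO (%x. cnj (f (rot j x))) (- j) (basis_vec k)"
 proof
  fix i
  show "alg_star (op_alg Idx) (YO f j) (basis_vec k) i = YO (%x. cnj (f (rot j x))) (- j) (basis_vec k) i"
  proof (cases "i : Idx")
   case i: True
   have "ell2_inner Idx (YO f j (basis_vec i)) (basis_vec k) = ell2_inner Idx (basis_vec i) (alg_star (op_alg Idx) (YO f j) (basis_vec k))"
    using adj basis_ell2[OF i] basis_ell2[OF k] by blast
   then have "cnj (alg_star (op_alg Idx) (YO f j) (basis_vec k) i) = YO f j (basis_vec i) k"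
    unfolding inner_basis[OF k] inner_cnj[of Idx "alg_star (op_alg Idx) (YO f j) (basis_vec k)" "basis_vec i"]
    by (simp add: inner_basis[OF i] inner_cnj[of Idx "basis_vec i"])
   moreover have ik: "(i + j) mod mm = k \<longleftrightarrow> i = (k - j) mod mm"
    using i k by (auto simp: mod_diff_left_eq mod_add_left_eq Idx_def)
   have "YO f j (basis_vec i) k = f (%m. 0) * basis_vec ((k - j) mod mm) i"
    unfolding YO_basis[OF i] using ik by (auto simp: basis_vec_def)
   ultimately have "cnj (cnj (alg_star (op_alg Idx) (YO f j) (basis_vec k) i)) = cnj (f (%m. 0) * basis_vec ((k - j) mod mm) i)"
    by simp
   moreover have "cnj (basis_vec l i) = basis_vec l i" for l by (simp add: basis_vec_def)
   ultimately show ?thesis by (simp add: YO_basis[OF k] rot_zero)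
  next
   case False
   then show ?thesis using bounded_op_ell2 adj YO_cl by (metis ell2_vanish)
  qed
 qed
qed (rule YO_cl)

sublocale OP: covariant_family p r b "op_alg Idx" YO
proof (intro covariant_family.intro crossed_axioms op_star_algebra covariant_family_axioms.intro)
 fix f g :: "(nat => int) => complex" and i j :: int and c :: complex
 show "YO f j : carrier (op_alg Idx)" for f by (simp add: op_alg_simps YO_cl)
 show "YO f j = YO g j" if "!!x. x : ZZ ==> f x = g x" using that[OF zero_ZZ] by (simp add: YO_def)
 show "YO (%x. f x + g x) j = alg_add (op_alg Idx) (YO f j) (YO g j)" by (simp add: YO_def op_alg_simps distrib_right)
 show "YO (%x. c * f x) j = alg_scale (op_alg Idx) c (YO f j)" by (simp add: YO_def op_alg_simps mult.assoc)
 show "alg_mult (op_alg Idx) (YO f i) (YO g j) = YO (%x. f x * g (rot (- i) x)) (i + j)"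
 proof
  fix x
  show "alg_mult (op_alg Idx) (YO f i) (YO g j) x = YO (%x. f x * g (rot (- i) x)) (i + j) x"
  proof (cases "x : ell2 Idx")
   case True
   have "shift i (%l. g (%m. 0) * shift j x l) = (%l. g (%m. 0) * shift (i + j) x l)"
    using bounded_opsD(3)[OF shift_op shift_ell2(1)[OF True]] shift_shift[OF True] by simp
   then show ?thesis by (simp add: op_alg_simps YO_def rot_zero mult.assoc)
  next
   case False
   then have "YO g j x = (%i. 0)" "YO (%x. f x * g (rot (- i) x)) (i + j) x = (%i. 0)" by (simp_all add: YO_def shift_def)
   then show ?thesis using bounded_op_zero[OF YO_cl] by (simp add: op_alg_simps)
  qed
 qed
 show "alg_star (op_alg Idx) (YO f j) = YO (%x. cnj (f (rot j x))) (- j)" by (rule YO_star)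
 have id: "YO (%_. 1) 0 = id_op Idx" by (simp add: YO_def shift_0)
 fix T assume "T : carrier (op_alg Idx)"
 then show "alg_mult (op_alg Idx) (YO (%_. 1) 0) T = T" "alg_mult (op_alg Idx) T (YO (%_. 1) 0) = T"
  unfolding id by (simp_all only: id_op op_alg_simps(1))
next
 assume b
 then have "mm = int n" unfolding mm_def by simp
 then have "(i - int n) mod mm = (i - 0) mod mm" for i by simp
 then show "YO (%_. 1) (int n) = YO (%_. 1) 0" by (intro HOL.ext) (simp add: YO_def shift_def)
qed

end

section \<open>Universality of the matrix model and the norm of the fibre over zero\<close>

context crossed
begin

abbreviation "\<phi> \<equiv> MF.\<Phi>"
abbreviation "\<rho> \<equiv> OP.\<Phi>"
abbreviation "nfs d c \<equiv> (%w. SUM j:J d. delta (nf (c j) j) w)"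

lemma nf_closed: "f : cfun ZZ ==> delta (nf f j) : carrier FA"
 by (intro W.delta_cl) (simp add: gens_iff)

lemma \<phi>_sum:
 assumes c: "!!j. j : J d ==> c j : cfun ZZ"
 shows "\<phi> (nfs d c) = (%w i k. SUM j:J d. YM (c j) j w i k)"
proof -
 have "\<phi> (nfs d c) = (%w i k. SUM j:J d. \<phi> (delta (nf (c j) j)) w i k)"
  by (rule W.hom_sum[OF MF.\<Phi>_hom cfun_fun_alg[OF XS_compact] J_card(1) nf_closed[OF c]])
 also have "... = (%w i k. SUM j:J d. YM (c j) j w i k)"
  by (intro HOL.ext sum.cong refl) (simp add: MF.\<Phi>_nf c)
 finally show ?thesis .
qed

text \<open>The functions \<open>c j\<close> are recovered as Fourier coefficients of the first column.\<close>

lemma matrix_coefficient: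
 assumes c: "!!j. j : J d ==> c j : cfun ZZ" and j0: "j0 : J d" and x: "x : ZZ"
  and le: "!!z i. [|z : S; i < n|] ==> cmod (\<phi> (nfs d c) (act (n - i) x, z) i 0) <= B"
 shows "cmod (c j0 x) <= B"
proof -
 have ps: "\<phi> (nfs d c) = (%w i k. SUM j:J d. YM (c j) j w i k)" by (rule \<phi>_sum) (rule c)
 \<comment> \<open>In the first column the exponent j0 occurs exactly in row i = j0 mod n.
   Evaluation at the translate of x by r^(n-i) makes the argument of the coefficient function equal
   to x.\<close>
 define i where "i = nat (j0 mod int n)"
 have i: "i < n" "(int i - j0) mod int n = 0" unfolding i_def by (rule index_ex)+
 then have i': "(j0 - int i) mod int n = 0" by (simp add: mod_eq_0_iff_dvd dvd_diff_commute)
 have e: "\<phi> (nfs d c) (act (n - i) x, z) i 0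
   = (SUM j:J d. if (j - int i) mod int n = 0 then c j x * z powi ((j - int i) div int n) else 0)" if z: "z : S" for z
  unfolding ps using i(1) z x act_cancel(1)[OF x, of i] by (intro sum.cong refl) (simp add: YM_def act_ZZ)
 show ?thesis
 proof (cases b)
  case True
  have "(if (j - int i) mod int n = 0 then c j x * 1 powi ((j - int i) div int n) else 0) = (if j = j0 then c j0 x else 0)"
   if "j : J d" for j
  proof -
   have imp: "j = j0" if m: "(j - int i) mod int n = 0"
   proof (rule J_dist[OF \<open>j : J d\<close> j0 True])
    show "(j - j0) mod int n = 0" using dvd_diff[of "int n" "j - int i" "j0 - int i"] m i' by (simp add: mod_eq_0_iff_dvd)
   qed
   show ?thesis
   proof (cases "j = j0")
    case True then show ?thesis using i' by simp
   next
    case False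
    then have "(j - int i) mod int n ~= 0" by (rule contrapos_nn) (rule imp)
    then show ?thesis by (simp only: False if_False)
   qed
  qed
  then have "\<phi> (nfs d c) (act (n - i) x, 1) i 0 = c j0 x"
   unfolding e[OF S_props(3)] using j0 J_card(1)[of d] by (simp cong: sum.cong)
  then show ?thesis using le[OF S_props(3) i(1)] by simp
 next
  case False
  \<comment> \<open>Row i of the first column is a Laurent polynomial in z; its coefficient at z^l
    belongs to the exponent i + n l.\<close>
  let ?J = "(%l. int i + int n * l) -` J d"
  have fin: "finite ?J" using ord_props(1) by (intro finite_vimageI J_card inj_onI) simp
  define l0 where "l0 = (j0 - int i) div int n"
  have l0: "int i + int n * l0 = j0" using mult_div_mod_eq[of "int n" "j0 - int i"] i' by (simp add: l0_def)
  have "cmod (c (int i + int n * l0) x) <= B"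
  proof (rule fourier_coefficient_le[where c = "%l. c (int i + int n * l) x" and k = l0, OF fin])
   show "l0 : ?J" using l0 j0 by simp
   fix z :: complex assume "cmod z = 1"
   then have z: "z : S" using False unfolding S_def by simp
   have "\<phi> (nfs d c) (act (n - i) x, z) i 0 
     = (SUM j:{j : J d. (j - int i) mod int n = 0}. c j x * z powi ((j - int i) div int n))"
    by (rule trans[OF e[OF z] sum.inter_filter[symmetric, OF J_card(1)]])
   also have "... = (SUM l:?J. c (int i + int n * l) x * z powi l)"
   proof (rule sum.reindex_bij_witness[where i = "%l. int i + int n * l" and j = "%j. (j - int i) div int n"])
    fix j assume j: "j : {j : J d. (j - int i) mod int n = 0}"
    then show "int i + int n * ((j - int i) div int n) = j" using mult_div_mod_eq[of "int n" "j - int i"] by simp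
    then show "(j - int i) div int n : ?J" "c (int i + int n * ((j - int i) div int n)) x * z powi ((j - int i) div int n)
      = c j x * z powi ((j - int i) div int n)" using j by simp_all
   qed (use ord_props(1) in simp_all)
   finally show "cmod (SUM l:?J. c (int i + int n * l) x * z powi l) <= B" using le[OF z i(1)] by simp
  qed
  then show ?thesis unfolding l0 .
 qed
qed

abbreviation "DS \<equiv> mat_fun n (cfun S)"
definition ev0 :: "((nat => int) \<times> complex => nat => nat => complex) => complex => nat => nat => complex" where
 "ev0 F = (%z. F (%m. 0, z))"

lemma ev0_app: "ev0 F z i k = F (%m. 0, z) i k" by (simp add: ev0_def)

lemma ev0_hom: "star_hom DM DS ev0"
proof -
 have "ev0 F : carrier DS" if F: "F : carrier DM" for F
  unfolding mat_fun_carrier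
 proof (intro conjI allI impI)
  fix i k
  have f: "continuous_on XS (%w. F w i k)" "!!w. w ~: XS ==> F w i k = 0" using CX.mf_entry[OF F, of i k] by (auto simp: cfun_iff)
  have "continuous_on S (%z. F (%m. 0, z) i k)"
   by (rule continuous_on_compose2[OF f(1)]) (auto intro!: continuous_intros simp: XS_def zero_ZZ)
  then show "(%z. ev0 F z i k) : cfun S" using f(2) by (auto simp: cfun_iff ev0_def XS_def)
 qed (use F in "auto simp: ev0_def mat_fun_carrier")
 then show ?thesis by (simp add: star_hom_def mat_fun_simps) (simp add: ev0_def)
qed

lemma star_hom_id: "star_hom D D (%x. x)" by (simp add: star_hom_def)

lemma \<phi>_seminorm: "crossed_seminorm p r b (%t. alg_norm DM (\<phi> t))"
 by (rule MF.crossed_seminorm_\<Phi>[OF star_hom_id CX.mf_cstar_algebra])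

lemma ev0_seminorm: "crossed_seminorm p r b (%t. alg_norm DS (ev0 (\<phi> t)))"
 by (rule MF.crossed_seminorm_\<Phi>[OF ev0_hom CS.mf_cstar_algebra])

lemma \<rho>_seminorm: "crossed_seminorm p r b (%t. opnorm Idx (\<rho> t))"
 by (rule OP.crossed_seminorm_\<Phi>[OF star_hom_id op_cstar_algebra])

text \<open>Entries of the model bound the coefficient functions at every point of Z_p, and any
  admissible seminorm bounds M_f by the supremum of |f|; the comparison theorem needs nothing
  else.\<close>

lemma dominated:
 assumes q: "crossed_seminorm p r b q" and t: "t : carrier FA" shows "q t <= alg_norm DM (\<phi> t)"
proof (rule seminorm_le_if_coefficients[OF q \<phi>_seminorm _ _ t, where X = ZZ])
 show "q (delta [M f]) <= c & alg_norm DM (\<phi> (delta [M f])) <= c"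
  if "f : cfun ZZ" "0 < c" "!!x. x : ZZ ==> cmod (f x) <= c" for f c
  using crossed_seminorm.q_M[OF q that] crossed_seminorm.q_M[OF \<phi>_seminorm that] ..
 fix d c j x assume c: "!!j. j : J d ==> c j : cfun ZZ" and j: "j : J d" and x: "x : ZZ"
 have "nfs d c : carrier FA" by (rule W.alg_sum_closed[OF J_card(1) nf_closed[OF c]])
 note le = CX.mf_norm_entry[OF star_homD(1)[OF MF.\<Phi>_hom this]]
 show "cmod (c j x) <= alg_norm DM (\<phi> (nfs d c))"
 proof (rule matrix_coefficient[OF _ j x])
  show "c i : cfun ZZ" if "i : J d" for i using that by (rule c)
 qed (rule le)
qed

text \<open>Both seminorms bound M_f by |f(0)|, and both detect each coefficient at 0: the fibre
  through Fourier coefficients, the shifts through the coordinates of the image of E_0. The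
  comparison theorem then applies in both directions.\<close>

lemma zero_norm_eq:
 assumes t: "t : carrier FA" shows "opnorm Idx (\<rho> t) = alg_norm DS (ev0 (\<phi> t))"
proof -
 have one: "delta [] : carrier FA" by (intro W.delta_cl) simp
 have M_le: "opnorm Idx (\<rho> (delta [M f])) <= c & alg_norm DS (ev0 (\<phi> (delta [M f]))) <= c"
  if f: "f : cfun ZZ" and c: "0 < c" "!!x. x : {%m. 0} ==> cmod (f x) <= c" for f c
 proof
  have f0: "cmod (f (%m. 0)) <= c" using c(2) by simp
  have "\<rho> (delta [M f]) = (%x i. f (%m. 0) * \<rho> (delta []) x i)" using f by (simp add: OP.\<Phi>_M OP.\<Phi>_one YO_def)
  then have "opnorm Idx (\<rho> (delta [M f])) = cmod (f (%m. 0)) * opnorm Idx (\<rho> (delta []))"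
   using op_scale_norm[of "\<rho> (delta [])" Idx "f (%m. 0)"] star_homD(1)[OF OP.\<Phi>_hom one] by (simp add: op_alg_simps)
  also have "... <= c * 1"
   using f0 crossed_seminorm.q_one[OF \<rho>_seminorm] opnorm_nonneg star_homD(1)[OF OP.\<Phi>_hom one] c(1)
   by (intro mult_mono) (auto simp: op_alg_simps)
  finally show "opnorm Idx (\<rho> (delta [M f])) <= c" by simp
  have "ev0 (\<phi> (delta [M f])) = alg_scale DS (f (%m. 0)) (ev0 (\<phi> (delta [])))"
   using f by (intro HOL.ext) (simp add: MF.\<Phi>_M MF.\<Phi>_one ev0_def YM_def mat_fun_simps act_zero)
  then have "alg_norm DS (ev0 (\<phi> (delta [M f]))) = cmod (f (%m. 0)) * alg_norm DS (ev0 (\<phi> (delta [])))"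
   using CS.mf_seminorm star_homD(1)[OF ev0_hom star_homD(1)[OF MF.\<Phi>_hom one]] by (simp add: cstar_seminorm_def)
  also have "... <= c * 1"
   using f0 crossed_seminorm.q_one[OF ev0_seminorm] c(1) CS.mf_norm_nonneg[OF star_homD(1)[OF ev0_hom star_homD(1)[OF MF.\<Phi>_hom one]]]
   by (intro mult_mono) auto
  finally show "alg_norm DS (ev0 (\<phi> (delta [M f]))) <= c" by simp
 qed
 have s_cl: "nfs d c : carrier FA" if "!!j. j : J d ==> c j : cfun ZZ" for d c
  by (rule W.alg_sum_closed[OF J_card(1) nf_closed[OF that]])
 show ?thesis
 proof (rule antisym)
  show "opnorm Idx (\<rho> t) <= alg_norm DS (ev0 (\<phi> t))"
  proof (rule seminorm_le_if_coefficients[OF \<rho>_seminorm ev0_seminorm M_le _ t])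
   fix d c j and x :: "nat => int" assume c: "!!j. j : J d ==> c j : cfun ZZ" and j: "j : J d" and x: "x : {%m. 0}"
   have scl: "nfs d c : carrier FA" by (rule s_cl) (rule c)
   have le: "cmod (\<phi> (nfs d c) (%m. 0, z) i k) <= alg_norm DS (ev0 (\<phi> (nfs d c)))" for z i k
    using CS.mf_norm_entry[OF star_homD(1)[OF ev0_hom star_homD(1)[OF MF.\<Phi>_hom scl]], of z i k] unfolding ev0_app .
   have x0: "x = (%m. 0)" using x by (rule singletonD)
   show "cmod (c j x) <= alg_norm DS (ev0 (\<phi> (nfs d c)))"
    unfolding x0
   proof (rule matrix_coefficient[where c = c and d = d, OF _ j zero_ZZ])
    show "cmod (\<phi> (nfs d c) (act (n - i) (%m. 0), z) i 0) <= alg_norm DS (ev0 (\<phi> (nfs d c)))" for z i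
     unfolding act_zero by (rule le)
   qed (rule c)
  qed assumption
  show "alg_norm DS (ev0 (\<phi> t)) <= opnorm Idx (\<rho> t)"
  proof (rule seminorm_le_if_coefficients[OF ev0_seminorm \<rho>_seminorm _ _ t, where X = "{%m. 0}"])
   show "alg_norm DS (ev0 (\<phi> (delta [M f]))) <= c & opnorm Idx (\<rho> (delta [M f])) <= c"
    if "f : cfun ZZ" "0 < c" "!!x. x : {%m. 0} ==> cmod (f x) <= c" for f c using M_le[OF that] by simp
   fix d c j and x :: "nat => int" assume c: "!!j. j : J d ==> c j : cfun ZZ" and j: "j : J d" and x: "x : {%m. 0}"
   have add: "\<rho> (%w. SUM j:A. delta (nf (c j) j) w) y l = (SUM j:A. \<rho> (delta (nf (c j) j)) y l)" if "finite A" "A \<subseteq> J d" for A y l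
    using that
   proof (induction A rule: finite_induct)
    case empty
    then show ?case using star_hom_zero[OF OP.\<Phi>_hom W.star_algebra_P op_star_algebra] by (simp add: W.zero_app op_alg_simps)
   next
    case (insert a A)
    have "(%w. SUM j:A. delta (nf (c j) j) w) : carrier FA" using insert by (intro W.alg_sum_closed nf_closed c) auto
    then show ?case
     using insert star_homD(2)[OF OP.\<Phi>_hom nf_closed[OF c], of a "%w. SUM j:A. delta (nf (c j) j) w" a] by (simp add: W.add_app op_alg_simps)
   qed
   have scl: "nfs d c : carrier FA" by (rule s_cl) (rule c)
   have Z: "0 : Idx" by (simp add: Idx_def)
   have bv: "basis_vec k l = (if l = k then 1 else 0)" for k l :: int by (simp add: basis_vec_def)
   \<comment> \<open>Different exponents in \<open>J d\<close> move E_0 to different basis vectors,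
     so no two coefficients overlap.\<close>
   have jm: "j mod mm = j' mod mm \<longleftrightarrow> j' = j" if "j' : J d" for j'
   proof (cases b)
    case True
    then have m: "mm = int n" unfolding mm_def by simp
    show ?thesis
    proof
     assume "j mod mm = j' mod mm"
     then show "j' = j" by (intro J_dist[OF that j True]) (simp add: m mod_eq_0_iff_dvd flip: mod_eq_dvd_iff)
    qed simp
   next
    case False then show ?thesis unfolding mm_def by auto
   qed
   have "\<rho> (nfs d c) (basis_vec 0) (j mod mm) = (SUM j':J d. if j' = j then c j (%m. 0) else 0)"
    unfolding add[OF J_card(1) order_refl] using jm
    by (intro sum.cong refl) (simp add: OP.\<Phi>_nf c YO_basis[OF Z] bv)
   then have "\<rho> (nfs d c) (basis_vec 0) (j mod mm) = c j x" using j J_card(1)[of d] x by simp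
   then show "cmod (c j x) <= opnorm Idx (\<rho> (nfs d c))"
    using coeff_le_opnorm[OF _ Z, of "\<rho> (nfs d c)" "j mod mm"] star_homD(1)[OF OP.\<Phi>_hom scl] by (simp add: op_alg_simps)
  qed
 qed
qed

subsection \<open>The crossed product as an algebra of matrix-valued functions\<close>

sublocale AA: envelope_model FA R DM \<phi>
proof (intro envelope_model.intro W.star_algebra_P CX.mf_cstar_algebra envelope_model_axioms.intro MF.\<Phi>_hom MF.\<Phi>_rels)
 fix q t assume "cstar_seminorm FA q" "!!y z. (y, z) : R ==> q (alg_diff FA y z) = 0" and t: "t : carrier FA"
 then have "crossed_seminorm p r b q" by unfold_locales
 then show "q t <= alg_norm DM (\<phi> t)" by (rule dominated[OF _ t])
qed

abbreviation "\<A> \<equiv> envelope FA R"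
abbreviation "\<psi> \<equiv> AA.env.ext"

text \<open>Replacing x by r^k x renumbers the basis of the induced representation by k, with a
  factor z on wrapping past n. A covariant function is therefore determined by its first column, on
  which the condition imposes nothing.\<close>

definition covariant :: "((nat => int) \<times> complex => nat => nat => complex) => bool" where
 "covariant F \<longleftrightarrow> (ALL x:ZZ. ALL z:S. ALL i<n. ALL k<n.
   F (x, z) i k = (if k <= i then F (act k x, z) (i - k) 0 else z * F (act k x, z) (n + i - k) 0))"

definition KK where "KK = {F : carrier DM. covariant F}"

lemma covariantD: "[|covariant F; x : ZZ; z : S; i < n; k < n|]
 ==> F (x, z) i k = (if k <= i then F (act k x, z) (i - k) 0 else z * F (act k x, z) (n + i - k) 0)"
 unfolding covariant_def by blast

lemma covariant_YM: "covariant (YM f j)"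
 unfolding covariant_def
proof (intro ballI allI impI)
 fix x z i k assume x: "x : ZZ" and z: "z : S" and i: "i < n" and k: "k < n"
 show "YM f j (x, z) i k = (if k <= i then YM f j (act k x, z) (i - k) 0 else z * YM f j (act k x, z) (n + i - k) 0)"
 proof (cases "k <= i")
  case True
  then have e: "int 0 + j - int (i - k) = int k + j - int i" "i - k + k = i" by simp_all
  show ?thesis using True x z i k act_act[OF x, of "i - k" k] unfolding YM_def prod.case e(1) by (simp add: act_ZZ)
 next
  case False
  define E where "E = int k + j - int i"
  have e: "int 0 + j - int (n + i - k) = E + int n * (- 1)" using k by (simp add: E_def)
  have m: "(E + int n * (- 1)) mod int n = E mod int n" by (rule mod_mult_self2)
  have d: "(E + int n * (- 1)) div int n = E div int n - 1" using ord_props(1) div_mult_self2[of "int n" E "-1"] by simp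
  have a: "act (n + i - k) (act k x) = act i x"
   using act_act[OF x, of "n + i - k" k] act_mod[of "n + i" x] act_mod[of i x] k by simp
  have "z ~= 0" using S_props(1)[OF z] by auto
  then have zz: "z * z powi (E div int n - 1) = z powi (E div int n)" by (simp add: power_int_diff)
  have lt: "n + i - k < n" using False k by linarith
  show ?thesis
   unfolding YM_def prod.case e m d a E_def[symmetric] using False x z i k lt by (simp add: act_ZZ zz[symmetric])
 qed
qed

lemma covariant_add: "[|covariant F; covariant G|] ==> covariant (%w i k. F w i k + G w i k)"
 and covariant_scale: "covariant F ==> covariant (%w i k. c * F w i k)"
 unfolding covariant_def by (auto simp: distrib_left)

lemma covariant_\<phi>: assumes t: "t : carrier FA" shows "covariant (\<phi> t)"
proof -
 interpret q: crossed_seminorm p r b "%t. alg_norm DM (\<phi> t)" by (rule \<phi>_seminorm)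
 have "length w <= Max (insert 0 (length ` {w. t w ~= 0}))" if "t w ~= 0" for w
  using t that by (auto simp: W.carrier_iff intro!: Max_ge)
 then have "EX c. (ALL j:J (Max (insert 0 (length ` {w. t w ~= 0}))). c j : cfun ZZ)
   & q.Q.Q.qeq t (nfs (Max (insert 0 (length ` {w. t w ~= 0}))) c)" by (rule q.collect_nf[OF t])
 then obtain d c where c: "ALL j:J d. c j : cfun ZZ" "q.Q.Q.qeq t (nfs d c)" by blast
 have cc: "c j : cfun ZZ" if "j : J d" for j using c(1) that by (rule bspec)
 have "\<phi> t = \<phi> (nfs d c)"
 proof (rule hom_eq_if_norm_zero[OF CX.mf_cstar_algebra MF.\<Phi>_hom W.star_algebra_P t])
  show "nfs d c : carrier FA" "alg_norm DM (\<phi> (alg_diff FA t (nfs d c))) <= 0" using c(2) by (simp_all add: q.Q.Q.qeq_def)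
 qed
 also have "... = (%w i k. SUM j:J d. YM (c j) j w i k)" by (rule \<phi>_sum) (rule cc)
 finally have t: "\<phi> t = (%w i k. SUM j:J d. YM (c j) j w i k)" .
 have "covariant (%w i k. SUM j:A. YM (c j) j w i k)" if "finite A" for A
  using that
 proof (induction A rule: finite_induct)
  case empty then show ?case by (simp add: covariant_def)
 next
  case (insert a A) then show ?case using covariant_add[OF covariant_YM insert.IH] by simp
 qed
 then show ?thesis unfolding t using J_card(1) .
qed

text \<open>A normal form with exponent m + n l fills only row m of the first column, with z^l times
  a function that can be prescribed up to a translation. The rows are filled one at a time.\<close>

lemma column_approx:
 assumes h: "!!i. i < n ==> h i : cspan {%w. f (fst w) * snd w powi l |f l. f : cfun ZZ}" and m: "m <= n"
 shows "EX t:carrier FA. ALL w:XS. ALL i<n. \<phi> t w i 0 = (if i < m then h i w else 0)"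
 using m
proof (induction m)
 case 0
 show ?case using star_hom_zero[OF MF.\<Phi>_hom W.star_algebra_P CX.mf_star_algebra]
  by (intro bexI[OF _ W.zero_cl]) (simp add: mat_fun_simps)
next
 case (Suc m)
 then obtain t where t: "t : carrier FA" "ALL w:XS. ALL i<n. \<phi> t w i 0 = (if i < m then h i w else 0)" by auto
 have m: "m < n" using Suc by simp
 have "EX s:carrier FA. ALL w:XS. ALL i<n. \<phi> s w i 0 = (if i = m then g w else 0)"
  if "g : cspan {%w. f (fst w) * snd w powi l |f l. f : cfun ZZ}" for g
  using that
 proof induction
  case (gen g)
  then obtain f l where f: "f : cfun ZZ" "g = (%w. f (fst w) * snd w powi l)" by blast
  let ?f = "%x. if x : ZZ then f (act (n - m) x) else 0"
  let ?j = "int m + int n * l"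
  have e: "YM ?f ?j w i 0 = (if i = m then g w else 0)" if w: "w : XS" and i: "i < n" for w i
  proof -
   obtain x z where xz: "w = (x, z)" "x : ZZ" "z : S" using w by (auto simp: XS_def)
   have "(int 0 + ?j - int i) mod int n = (int m - int i) mod int n"
    using mod_mult_self2[of "int m - int i" "int n" l] by (simp add: algebra_simps)
   moreover have "(int m - int i) mod int n = 0 \<longleftrightarrow> i = m" using index_unique[of m "int i"] m i by auto
   moreover have "(int 0 + ?j - int m) div int n = l" using ord_props(1) by simp
   ultimately show ?thesis using xz f(2) m act_cancel(2)[OF xz(2), of m] by (auto simp: YM_def act_ZZ)
  qed
  show ?case
   by (rule bexI[OF _ nf_closed[OF cfun_act[OF f(1)], of "n - m" ?j]]) (use e in "simp add: MF.\<Phi>_nf[OF cfun_act[OF f(1)]]")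
 next
  case (add f g)
  then obtain s t where "s : carrier FA" "t : carrier FA" "ALL w:XS. ALL i<n. \<phi> s w i 0 = (if i = m then f w else 0)"
   "ALL w:XS. ALL i<n. \<phi> t w i 0 = (if i = m then g w else 0)" by blast
  then show ?case by (intro bexI[of _ "alg_add FA s t"]) (simp_all add: star_homD(2)[OF MF.\<Phi>_hom] mat_fun_simps W.add_cl)
 next
  case (scale f c)
  then obtain s where "s : carrier FA" "ALL w:XS. ALL i<n. \<phi> s w i 0 = (if i = m then f w else 0)" by blast
  then show ?case by (intro bexI[of _ "alg_scale FA c s"]) (simp_all add: star_homD(3)[OF MF.\<Phi>_hom] mat_fun_simps W.scale_cl)
 qed
 from this[OF h[OF m]] obtain s where s: "s : carrier FA" "ALL w:XS. ALL i<n. \<phi> s w i 0 = (if i = m then h m w else 0)" by blast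
 show ?case
  by (rule bexI[OF _ W.add_cl[OF t(1) s(1)]]) (use s t in "auto simp: star_homD(2)[OF MF.\<Phi>_hom] mat_fun_simps")
qed

text \<open>By covariance only the first column has to be approximated; the other columns inherit
  the error because |z| = 1.\<close>

lemma \<phi>_dense:
 assumes F: "F : KK" and e: "0 < e" shows "EX t:carrier FA. alg_norm DM (alg_diff DM F (\<phi> t)) < e"
proof -
 let ?G = "{%w. f (fst w) * snd w powi l |f l. f : cfun ZZ}"
 have GI: "(%w. f (fst w) * snd w powi l) : ?G" if "f : cfun ZZ" for f l using that by blast
 have FD: "F : carrier DM" and Fc: "covariant F" using F by (simp_all add: KK_def)
 define \<delta> where "\<delta> = e / (real n * real n + 1)"
 have \<delta>: "0 < \<delta>" "real n * real n * \<delta> < e" using e by (auto simp: \<delta>_def field_simps add_pos_nonneg)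
 have "EX g:cspan ?G. ALL w:XS. cmod (F w i 0 - g w) < \<delta>" for i
 proof (rule complex_Stone_Weierstrass[OF XS_compact _ _ _ _ _ _ \<delta>(1)])
  show "continuous_on XS (%w. F w i 0)" using CX.mf_entry[OF FD] by (simp add: cfun_iff)
  fix g assume "g : ?G"
  then obtain f l where g: "f : cfun ZZ" "g = (%w. f (fst w) * snd w powi l)" by blast
  have "continuous_on XS (%w. f (fst w))"
   by (rule continuous_on_compose2[of ZZ f]) (use g(1) in "auto simp: cfun_iff XS_def intro!: continuous_on_fst continuous_on_id")
  then show "continuous_on XS g" unfolding g(2) by (intro continuous_intros) (auto simp: XS_def dest: S_props(1))
  show "EX k:?G. ALL w:XS. k w = cnj (g w)"
  proof (rule bexI)
   show "(%w. cnj (f (fst w)) * snd w powi (- l)) : ?G" by (rule GI[OF fun_alg.f_cnj[OF cfun_fun_alg[OF ZZ_compact] g(1)]])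
   show "ALL w:XS. cnj (f (fst w)) * snd w powi (- l) = cnj (g w)"
    unfolding g(2) complex_cnj_mult using cnj_powi[of _ l] S_props(1) by (auto simp: XS_def simp del: complex_cnj_power_int)
  qed
  fix g' assume "g' : ?G"
  then obtain f' l' where g': "f' : cfun ZZ" "g' = (%w. f' (fst w) * snd w powi l')" by blast
  show "EX k:?G. ALL w:XS. k w = g w * g' w"
  proof (rule bexI)
   show "(%w. (f (fst w) * f' (fst w)) * snd w powi (l + l')) : ?G"
    by (rule GI[OF fun_alg.f_mult[OF cfun_fun_alg[OF ZZ_compact] g(1) g'(1)]])
   have "snd w powi (l + l') = snd w powi l * snd w powi l'" if "w : XS" for w
    using that S_props(1)[of "snd w"] by (intro power_int_add) (auto simp: XS_def)
   then show "ALL w:XS. (f (fst w) * f' (fst w)) * snd w powi (l + l') = g w * g' w" by (simp add: g g')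
  qed
 next
  show "EX g:?G. ALL w:XS. g w = 1"
   by (rule bexI[OF _ GI[OF one_cfun, of 0]]) (auto simp: one_Zp_def XS_def)
  fix w w' assume w: "w : XS" "w' : XS" "w ~= w'"
  show "EX g:?G. g w ~= g w'"
  proof (cases "fst w = fst w'")
   case True
   then have "one_Zp p (fst w) * snd w powi 1 ~= one_Zp p (fst w') * snd w' powi 1"
    using w by (auto simp: one_Zp_def XS_def)
   then show ?thesis by (rule bexI[OF _ GI[OF one_cfun]])
  next
   case False
   then obtain m where m: "fst w m ~= fst w' m" by (meson HOL.ext)
   let ?f = "%x. if x : ZZ then complex_of_int (x m) else 0"
   have "?f : cfun ZZ" by (rule cfun_restrict[OF int_coord_continuous])
   then have G: "(%w. ?f (fst w) * snd w powi 0) : ?G" by (rule GI)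
   have "?f (fst w) * snd w powi 0 ~= ?f (fst w') * snd w' powi 0" using w m by (auto simp: XS_def)
   then show ?thesis by (rule bexI[OF _ G])
  qed
 qed
 then have "ALL i. EX g. g : cspan ?G & (ALL w:XS. cmod (F w i 0 - g w) < \<delta>)" by blast
 from choice[OF this] obtain h where h: "ALL i. h i : cspan ?G & (ALL w:XS. cmod (F w i 0 - h i w) < \<delta>)" ..
 obtain t where t: "t : carrier FA" "ALL w:XS. ALL i<n. \<phi> t w i 0 = (if i < n then h i w else 0)"
  using column_approx[of h n] h by blast
 have col: "cmod (F w i 0 - \<phi> t w i 0) <= \<delta>" if "w : XS" "i < n" for w i
  using h t(2) that by (simp add: less_imp_le)
 have "cmod (alg_diff DM F (\<phi> t) w i k) <= \<delta>" if ik: "i < n" "k < n" for w i k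
 proof (cases "w : XS")
  case True
  then obtain x z where w: "w = (x, z)" "x : ZZ" "z : S" by (auto simp: XS_def)
  have a: "(act k x, z) : XS" using w by (simp add: XS_def act_ZZ)
  have d: "covariant (%w i k. F w i k + (-1) * \<phi> t w i k)" by (rule covariant_add[OF Fc covariant_scale[OF covariant_\<phi>[OF t(1)]]])
  show ?thesis
   using covariantD[OF d w(2,3) ik] col[OF a, of "i - k"] col[OF a, of "n + i - k"] ik S_props(1)[OF w(3)]
   by (auto simp: mat_fun_diff w(1) norm_mult simp flip: right_diff_distrib)
 next
  case False
  then show ?thesis using DM_zero[OF FD] DM_zero[OF star_homD(1)[OF MF.\<Phi>_hom t(1)]] \<delta>(1) by (simp add: mat_fun_diff)
 qed
 then have "alg_norm DM (alg_diff DM F (\<phi> t)) <= real n * real n * \<delta>" by (rule CX.mf_norm_le_entries)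
 then show ?thesis using \<delta>(2) t(1) by (intro bexI[OF _ t(1)]) simp
qed

lemma tends_entry:
 assumes "AA.env.DN.tends s F" shows "(%m. s m w i k) \<longlonglongrightarrow> F w i k"
proof (rule LIM_zero_cancel, rule Lim_null_comparison)
 show "(%m. alg_norm DM (alg_diff DM (s m) F)) \<longlonglongrightarrow> 0" using assms by (simp add: AA.env.DN.tends_def)
 have "alg_diff DM (s m) F : carrier DM" for m
  using assms by (intro star_algebra.diff_closed[OF CX.mf_star_algebra]) (simp_all add: AA.env.DN.tends_def)
 from CX.mf_norm_entry[OF this, of _ w i k] have "cmod (s m w i k - F w i k) <= alg_norm DM (alg_diff DM (s m) F)" for m
  by (simp add: mat_fun_diff)
 then show "\<forall>\<^sub>F m in sequentially. cmod (s m w i k - F w i k) <= alg_norm DM (alg_diff DM (s m) F)" by simp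
qed

lemma \<A>_eq: "\<A> = completion FA (max_seminorm FA R)" by (simp add: envelope_def)

lemma \<psi>_hom: "star_hom \<A> DM \<psi>" unfolding \<A>_eq by (rule AA.env.ext_hom)
lemma \<A>_cstar: "cstar_algebra \<A>" by (rule AA.envelope_cstar)
lemma \<psi>_inj: "inj_on \<psi> (carrier \<A>)" unfolding \<A>_eq by (rule AA.env.ext_inj)
lemma \<psi>_norm: "a : carrier \<A> ==> alg_norm \<A> a = alg_norm DM (\<psi> a)" unfolding \<A>_eq by (rule AA.env.ext_isometric)

lemma rep_cl: "a : carrier \<A> ==> seq_rep a m : carrier FA"
 using AA.env.rep_class(1)[of a] by (simp add: \<A>_eq cauchy_seqs_def)

text \<open>Covariance passes to limits, since norm convergence implies convergence of every entry;
  density gives the other inclusion.\<close>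

lemma \<psi>_image: "\<psi> ` carrier \<A> = KK"
proof
 show "KK \<subseteq> \<psi> ` carrier \<A>" unfolding \<A>_eq AA.env.ext_range using \<phi>_dense by (auto simp: KK_def)
 show "\<psi> ` carrier \<A> \<subseteq> KK"
 proof (rule image_subsetI)
  fix a assume a: "a : carrier \<A>"
  have T: "AA.env.DN.tends (%m. \<phi> (seq_rep a m)) (\<psi> a)" using AA.env.ext_tends_rep a by (simp add: \<A>_eq)
  note lim = tends_entry[OF T]
  have "covariant (\<psi> a)"
   unfolding covariant_def
  proof (intro ballI allI impI)
   fix x z i k assume x: "x : ZZ" and z: "z : S" and i: "i < n" and k: "k < n"
   have eq: "\<phi> (seq_rep a m) (x, z) i k = (if k <= i then \<phi> (seq_rep a m) (act k x, z) (i - k) 0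
     else z * \<phi> (seq_rep a m) (act k x, z) (n + i - k) 0)" for m
    by (rule covariantD[OF covariant_\<phi>[OF rep_cl[OF a]] x z i k])
   have "(%m. \<phi> (seq_rep a m) (x, z) i k) \<longlonglongrightarrow> (if k <= i then \<psi> a (act k x, z) (i - k) 0 else z * \<psi> a (act k x, z) (n + i - k) 0)"
    unfolding eq using lim by (cases "k <= i") (auto intro: tendsto_mult_left)
   then show "\<psi> a (x, z) i k = (if k <= i then \<psi> a (act k x, z) (i - k) 0 else z * \<psi> a (act k x, z) (n + i - k) 0)"
    by (rule LIMSEQ_unique[OF lim])
  qed
  then show "\<psi> a : KK" using star_homD(1)[OF \<psi>_hom a] by (simp add: KK_def)
 qed
qed

end

subsection \<open>The representation at zero and its kernel\<close>

context crossed
begin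

lemma hom_eq_on_generators:
 assumes D: "star_algebra D" and \<sigma>: "star_hom FA D \<sigma>" and \<tau>: "star_hom FA D \<tau>"
  and one: "\<sigma> (delta []) = \<tau> (delta [])" and gen: "!!g. g : gens p ==> \<sigma> (delta [(g, False)]) = \<tau> (delta [(g, False)])"
  and t: "t : carrier FA"
 shows "\<sigma> t = \<tau> t"
proof -
 have w: "\<sigma> (delta w) = \<tau> (delta w)" if "w : Ws" for w
  using that
 proof (induction w)
  case Nil show ?case by (rule one)
 next
  case (Cons l w)
  obtain g c where l: "l = (g, c)" by force
  have lw: "fst l : gens p" "w : Ws" using Cons.hyps by (auto simp: mem_Times_iff)
  then have g: "g : gens p" "[(g, False)] : Ws" "[l] : Ws" and w: "w : Ws" using l by (simp_all only: Ws_simps fst_conv)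
  have "\<sigma> (delta [l]) = \<tau> (delta [l])"
  proof (cases c)
   case True
   then have "delta [l] = alg_star FA (delta [(g, False)])" by (simp add: W.delta_star l)
   then show ?thesis using star_homD(5)[OF \<sigma> W.delta_cl[OF g(2)]] star_homD(5)[OF \<tau> W.delta_cl[OF g(2)]] gen[OF g(1)] by simp
  next
   case False then show ?thesis using gen[OF g(1)] l by simp
  qed
  moreover have "delta (l # w) = alg_mult FA (delta [l]) (delta w)" by (simp add: W.delta_mult)
  ultimately show ?case
   using star_homD(4)[OF \<sigma> W.delta_cl[OF g(3)] W.delta_cl[OF w]] star_homD(4)[OF \<tau> W.delta_cl[OF g(3)] W.delta_cl[OF w]]
    Cons.IH by simp
 qed
 show ?thesis
  using t
 proof (induction rule: W.alg_induct_support)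
  case zero
  show ?case using star_hom_zero[OF \<sigma> W.star_algebra_P D] star_hom_zero[OF \<tau> W.star_algebra_P D] by simp
 next
  case (step y c s)
  note d = W.delta_cl[OF step(2)]
  show ?case
   using star_homD(2)[OF \<sigma> step(1) W.scale_cl[OF d]] star_homD(2)[OF \<tau> step(1) W.scale_cl[OF d]]
    star_homD(3)[OF \<sigma> d] star_homD(3)[OF \<tau> d] w[OF step(2)] step(4) by simp
 qed
qed

definition cst :: "free_elem => (nat => free_elem) set" where "cst t = seq_class FA (max_seminorm FA R) (%n. t)"

lemma cst_cl: "t : carrier FA ==> cst t : carrier \<A>"
 unfolding \<A>_eq cst_def by (rule AA.env.class_closed[OF AA.env.cauchy_const])

lemma \<psi>_cst: "t : carrier FA ==> \<psi> (cst t) = \<phi> t" unfolding cst_def by (rule AA.env.ext_const)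

lemma \<A>_star: "star_algebra \<A>" using \<A>_cstar by (simp add: cstar_algebra_def)

lemma \<A>_eqI: "[|\<psi> x = \<psi> y; x : carrier \<A>; y : carrier \<A>|] ==> x = y"
 by (rule inj_onD[OF \<psi>_inj])

lemma cst_hom: "star_hom FA \<A> cst"
proof -
 note cl = star_algebra.closed[OF \<A>_star]
 show ?thesis
  unfolding star_hom_def
  by (intro conjI ballI allI funcsetI cst_cl; (assumption | rule \<A>_eqI);
   simp add: \<psi>_cst star_homD(2-5)[OF \<psi>_hom] star_homD(2-5)[OF MF.\<Phi>_hom] W.cl cst_cl cl)
qed

sublocale PI: completion_hom FA "max_seminorm FA R" "op_alg Idx" \<rho>
proof (intro completion_hom.intro completion_hom_axioms.intro AA.env.seminormed_algebra_axioms op_cstar_algebra OP.\<Phi>_hom)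
 show "opnorm Idx (\<rho> x) <= max_seminorm FA R x" if "x : carrier FA" for x
  using dominated[OF \<rho>_seminorm that] AA.max_seminorm_eq[OF that] by simp
qed

abbreviation "\<pi> \<equiv> restrict PI.ext (carrier \<A>)"

text \<open>The conditions that define pi_0 and pi_0', on the common index set \<open>Idx\<close>.
  Existence and uniqueness below give meaning to the definite descriptions.\<close>

definition is_pi :: "((nat => free_elem) set => (int => complex) => int => complex) => bool" where
 "is_pi \<pi>' \<longleftrightarrow> representation \<A> Idx \<pi>' & (ALL k:Idx. \<pi>' (cst (delta [V])) (basis_vec k) = basis_vec ((k + 1) mod mm)) &
   (ALL f:cfun ZZ. ALL k:Idx. \<pi>' (cst (delta [M f])) (basis_vec k) = (%i. f (%m. 0) * basis_vec k i))"

lemma gen_cl: "delta [V] : carrier FA" "f : cfun ZZ ==> delta [M f] : carrier FA" "delta [] : carrier FA"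
 by (auto intro!: W.delta_cl simp: gens_iff)

lemma \<rho>_basis:
 assumes k: "k : Idx"
 shows "\<rho> (delta [V]) (basis_vec k) = basis_vec ((k + 1) mod mm)"
  and "f : cfun ZZ ==> \<rho> (delta [M f]) (basis_vec k) = (%i. f (%m. 0) * basis_vec k i)"
proof -
 have "k mod mm = k" using k by (simp only: Idx_def mem_Collect_eq)
 then show "\<rho> (delta [V]) (basis_vec k) = basis_vec ((k + 1) mod mm)"
  "f : cfun ZZ ==> \<rho> (delta [M f]) (basis_vec k) = (%i. f (%m. 0) * basis_vec k i)"
  by (simp_all add: OP.\<Phi>_V OP.\<Phi>_M YO_basis[OF k])
qed

lemma PI_hom: "star_hom \<A> (op_alg Idx) PI.ext" unfolding \<A>_eq by (rule PI.ext_hom)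

lemma PI_cst: "t : carrier FA ==> PI.ext (cst t) = \<rho> t" unfolding cst_def by (rule PI.ext_const)

lemma is_pi_\<pi>: "is_pi \<pi>"
proof -
 have "star_hom \<A> (op_alg Idx) \<pi>" using PI_hom star_algebra.closed[OF \<A>_star] by (auto simp: star_hom_def)
 moreover have "ALL a:carrier \<A>. opnorm Idx (\<pi> a) <= alg_norm \<A> a" using PI.ext_contractive by (simp add: \<A>_eq)
 ultimately show ?thesis by (simp add: is_pi_def representation_def PI_cst gen_cl cst_cl \<rho>_basis)
qed

text \<open>Operators are determined by their values on basis vectors, homomorphisms of the free
  algebra by unit and generators, and contractive maps by a dense subalgebra.\<close>

lemma is_pi_unique: assumes "is_pi \<pi>'" shows "\<pi>' = \<pi>"
proof (rule extensionalityI[where A = "carrier \<A>"])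
 have hom: "star_hom \<A> (op_alg Idx) \<pi>'" and contr: "!!a. a : carrier \<A> ==> opnorm Idx (\<pi>' a) <= alg_norm \<A> a"
  and V: "!!k. k : Idx ==> \<pi>' (cst (delta [V])) (basis_vec k) = basis_vec ((k + 1) mod mm)"
  and Mf: "!!f k. [|f : cfun ZZ; k : Idx|] ==> \<pi>' (cst (delta [M f])) (basis_vec k) = (%i. f (%m. 0) * basis_vec k i)"
  and ext: "\<pi>' : extensional (carrier \<A>)" using assms by (auto simp: is_pi_def representation_def)
 show "\<pi>' : extensional (carrier \<A>)" by (rule ext)
 show "\<pi> : extensional (carrier \<A>)" by (rule restrict_extensional)
 have \<sigma>: "star_hom FA (op_alg Idx) (%t. \<pi>' (cst t))" using star_hom_comp[OF cst_hom hom] by (simp add: comp_def)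
 have op: "\<pi>' (cst t) : bounded_ops Idx" "\<rho> t : bounded_ops Idx" if "t : carrier FA" for t
  using star_homD(1)[OF \<sigma> that] star_homD(1)[OF OP.\<Phi>_hom that] by (simp_all add: op_alg_simps)
 have gM: "\<pi>' (cst (delta [M f])) = \<rho> (delta [M f])" if f: "f : cfun ZZ" for f
  by (rule op_eqI[OF op[OF gen_cl(2)[OF f]]]) (simp add: Mf f \<rho>_basis)
 have gV: "\<pi>' (cst (delta [V])) = \<rho> (delta [V])"
  by (rule op_eqI[OF op[OF gen_cl(1)]]) (simp add: V \<rho>_basis)
 have eq: "\<pi>' (cst t) = \<rho> t" if t: "t : carrier FA" for t
 proof (rule hom_eq_on_generators[OF op_star_algebra \<sigma> OP.\<Phi>_hom _ _ t])
  \<comment> \<open>The image of the unit is not prescribed; the relation that M of the constant 1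
    is the unit supplies it.\<close>
  have "(delta [M (one_Zp p)], delta []) : R"
   using A_rels_R by (auto simp: A_rels_def M_rels_def Let_def free_gen_def free_one_def)
  note r = MF.\<Phi>_rels[OF this] OP.\<Phi>_rels[OF this]
  have "cst (delta [M (one_Zp p)]) = cst (delta [])"
   by (rule \<A>_eqI) (use r(1) in "simp_all add: \<psi>_cst cst_cl")
  moreover have "\<rho> (delta [M (one_Zp p)]) = \<rho> (delta [])" using r(2) by blast
  ultimately show "\<pi>' (cst (delta [])) = \<rho> (delta [])" using gM[OF one_cfun] by simp
  show "\<pi>' (cst (delta [(g, False)])) = \<rho> (delta [(g, False)])" if "g : gens p" for g
   using that gM gV by (cases g) (simp_all add: gens_iff)
 qed
 fix a assume a: "a : carrier \<A>"
 let ?s = "seq_rep a"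
 have s: "?s m : carrier FA" for m by (rule rep_cl[OF a])
 have T: "AA.env.DN.tends (%m. \<phi> (?s m)) (\<psi> a)" using AA.env.ext_tends_rep a by (simp add: \<A>_eq)
 have "PI.DN.tends (%m. \<rho> (?s m)) (\<pi>' a)"
  unfolding PI.DN.tends_def
 proof (intro conjI allI)
  show "\<rho> (?s m) : carrier (op_alg Idx)" for m by (rule star_homD(1)[OF OP.\<Phi>_hom s])
  show "\<pi>' a : carrier (op_alg Idx)" by (rule star_homD(1)[OF hom a])
  show "(%m. opnorm Idx (alg_diff (op_alg Idx) (\<rho> (?s m)) (\<pi>' a))) \<longlonglongrightarrow> 0"
  proof (rule Lim_null_comparison)
   show "(%m. alg_norm DM (alg_diff DM (\<phi> (?s m)) (\<psi> a))) \<longlonglongrightarrow> 0" using T by (simp add: AA.env.DN.tends_def)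
   have "norm (opnorm Idx (alg_diff (op_alg Idx) (\<rho> (?s m)) (\<pi>' a))) <= alg_norm DM (alg_diff DM (\<phi> (?s m)) (\<psi> a))" for m
   proof -
    have d: "alg_diff \<A> (cst (?s m)) a : carrier \<A>" by (rule star_algebra.diff_closed[OF \<A>_star cst_cl[OF s] a])
    have "alg_diff (op_alg Idx) (\<rho> (?s m)) (\<pi>' a) = \<pi>' (alg_diff \<A> (cst (?s m)) a)"
     using star_hom_diff[OF hom \<A>_star cst_cl[OF s] a] by (simp add: eq s)
    moreover have "\<psi> (alg_diff \<A> (cst (?s m)) a) = alg_diff DM (\<phi> (?s m)) (\<psi> a)"
     using star_hom_diff[OF \<psi>_hom \<A>_star cst_cl[OF s] a] by (simp add: \<psi>_cst s)
    moreover have "0 <= opnorm Idx (\<pi>' (alg_diff \<A> (cst (?s m)) a))"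
     using star_homD(1)[OF hom d] by (intro opnorm_nonneg) (simp add: op_alg_simps)
    ultimately show ?thesis using contr[OF d] \<psi>_norm[OF d] by simp
   qed
   then show "\<forall>\<^sub>F m in sequentially. norm (opnorm Idx (alg_diff (op_alg Idx) (\<rho> (?s m)) (\<pi>' a)))
     <= alg_norm DM (alg_diff DM (\<phi> (?s m)) (\<psi> a))" by simp
  qed
 qed
 then have "\<pi>' a = PI.ext a" using PI.ext_tends_rep a by (intro PI.tends_unique) (simp_all add: \<A>_eq)
 then show "\<pi>' a = \<pi> a" using a by simp
qed

lemma ev0_norm: "F : carrier DM ==> alg_norm DS (ev0 F) <= alg_norm DM F"
 by (rule CS.mf_norm_le) (simp add: ev0_def CX.mf_norm_ge)

text \<open>The norms of the shift representation and of the fibre over 0 agree on the free algebra,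
  hence on limits; so the two images vanish together.\<close>

lemma \<pi>_kernel: assumes a: "a : carrier \<A>" shows "\<pi> a = alg_zero (op_alg Idx) \<longleftrightarrow> ev0 (\<psi> a) = alg_zero DS"
proof -
 let ?s = "seq_rep a"
 interpret S: seminormed_algebra DS "alg_norm DS" by (rule cstar_algebra_seminormed[OF CS.mf_cstar_algebra])
 have s: "?s m : carrier FA" for m by (rule rep_cl[OF a])
 have T: "AA.env.DN.tends (%m. \<phi> (?s m)) (\<psi> a)" using AA.env.ext_tends_rep a by (simp add: \<A>_eq)
 note \<psi>a = star_homD(1)[OF \<psi>_hom a] and \<phi>s = star_homD(1)[OF MF.\<Phi>_hom s]
 have "S.tends (%m. ev0 (\<phi> (?s m))) (ev0 (\<psi> a))"
  unfolding S.tends_def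
 proof (intro conjI allI star_homD(1)[OF ev0_hom] \<psi>a \<phi>s)
  show "(%m. alg_norm DS (alg_diff DS (ev0 (\<phi> (?s m))) (ev0 (\<psi> a)))) \<longlonglongrightarrow> 0"
  proof (rule Lim_null_comparison)
   show "(%m. alg_norm DM (alg_diff DM (\<phi> (?s m)) (\<psi> a))) \<longlonglongrightarrow> 0" using T by (simp add: AA.env.DN.tends_def)
   have "norm (alg_norm DS (alg_diff DS (ev0 (\<phi> (?s m))) (ev0 (\<psi> a)))) <= alg_norm DM (alg_diff DM (\<phi> (?s m)) (\<psi> a))" for m
   proof -
    have d: "alg_diff DM (\<phi> (?s m)) (\<psi> a) : carrier DM" by (rule star_algebra.diff_closed[OF CX.mf_star_algebra \<phi>s \<psi>a])
    show ?thesis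
     using ev0_norm[OF d] S.q_nonneg[OF star_homD(1)[OF ev0_hom d]]
     unfolding star_hom_diff[OF ev0_hom CX.mf_star_algebra \<phi>s \<psi>a] by simp
   qed
   then show "\<forall>\<^sub>F m in sequentially. norm (alg_norm DS (alg_diff DS (ev0 (\<phi> (?s m))) (ev0 (\<psi> a))))
     <= alg_norm DM (alg_diff DM (\<phi> (?s m)) (\<psi> a))" by simp
  qed
 qed
 from S.tends_q[OF this] have 1: "(%m. opnorm Idx (\<rho> (?s m))) \<longlonglongrightarrow> alg_norm DS (ev0 (\<psi> a))" by (simp add: zero_norm_eq[OF s])
 have "PI.DN.tends (%m. \<rho> (?s m)) (PI.ext a)" using PI.ext_tends_rep a by (simp add: \<A>_eq)
 from LIMSEQ_unique[OF PI.DN.tends_q[OF this] 1] have n: "opnorm Idx (PI.ext a) = alg_norm DS (ev0 (\<psi> a))" .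
 have "PI.ext a = alg_zero (op_alg Idx) \<longleftrightarrow> opnorm Idx (PI.ext a) = 0"
  using cstar_algebra.norm_definite[OF op_cstar_algebra star_homD(1)[OF PI_hom a]] PI.DN.q_zero by auto
 moreover have "ev0 (\<psi> a) = alg_zero DS \<longleftrightarrow> alg_norm DS (ev0 (\<psi> a)) = 0"
  using cstar_algebra.norm_definite[OF CS.mf_cstar_algebra star_homD(1)[OF ev0_hom \<psi>a]] S.q_zero by auto
 ultimately show ?thesis using a n by simp
qed

definition "II = kernel_alg \<A> (op_alg Idx) \<pi>"

lemma II_carrier: "a : carrier II \<longleftrightarrow> a : carrier \<A> & (ALL z i k. \<psi> a (%m. 0, z) i k = 0)"
 using \<pi>_kernel[of a] by (auto simp: II_def kernel_alg_def ev0_def mat_fun_simps fun_eq_iff)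

lemma II_simps: "alg_add II = alg_add \<A>" "alg_scale II = alg_scale \<A>" "alg_mult II = alg_mult \<A>" "alg_star II = alg_star \<A>"
 "alg_zero II = alg_zero \<A>" "alg_norm II = alg_norm \<A>"
 by (simp_all add: II_def kernel_alg_def)

text \<open>Vanishing at x = 0 is a closed condition, since every matrix entry is dominated by the
  norm.\<close>

lemma II_cstar: "cstar_algebra II"
proof -
 note cl = star_algebra.closed[OF \<A>_star]
 have zero: "\<psi> (alg_zero \<A>) = alg_zero DM" by (rule star_hom_zero[OF \<psi>_hom \<A>_star CX.mf_star_algebra])
 have id: "star_hom II \<A> (%a. a)" by (auto simp: star_hom_def II_simps II_carrier)
 have sa: "star_algebra II"
 proof (rule star_algebra_pullback[OF \<A>_star id])
 qed (auto simp: II_simps II_carrier cl zero star_homD(2-5)[OF \<psi>_hom] mat_fun_simps)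
 show ?thesis
 proof (rule cstar_algebra_pullback[OF \<A>_cstar sa id])
  fix y assume y: "y : carrier \<A>" and near: "!!e. 0 < e ==> EX x:carrier II. alg_norm \<A> (alg_diff \<A> y x) < e"
  have "\<psi> y (%m. 0, z) i k = 0" for z i k
  proof (rule ccontr)
   assume "\<psi> y (%m. 0, z) i k ~= 0"
   then have "0 < cmod (\<psi> y (%m. 0, z) i k)" by simp
   from near[OF this] obtain x where x: "x : carrier II" "alg_norm \<A> (alg_diff \<A> y x) < cmod (\<psi> y (%m. 0, z) i k)" ..
   have xA: "x : carrier \<A>" and x0: "\<psi> x (%m. 0, z) i k = 0" using x(1) by (simp_all add: II_carrier)
   have d: "alg_diff \<A> y x : carrier \<A>" by (rule star_algebra.diff_closed[OF \<A>_star y xA])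
   have "cmod (\<psi> (alg_diff \<A> y x) (%m. 0, z) i k) <= alg_norm \<A> (alg_diff \<A> y x)"
    unfolding \<psi>_norm[OF d] by (rule CX.mf_norm_entry[OF star_homD(1)[OF \<psi>_hom d]])
   then show False using x(2) x0 by (simp add: star_hom_diff[OF \<psi>_hom \<A>_star y xA] mat_fun_diff)
  qed
  then show "y : (%a. a) ` carrier II" using y by (simp add: II_carrier)
 qed (auto simp: II_simps)
qed

subsection \<open>The kernel as an algebra of matrix-valued functions\<close>

text \<open>The orbit of a nonzero point meets the balls exactly once and stabilisers are trivial,
  so covariance does not constrain the values on the balls. Vanishing at 0 becomes decay in the
  index of the ball.\<close>

theorem kernel_iso: "EX \<Theta>. star_hom II (mat_fun n (C0X XS)) \<Theta> & bij_betw \<Theta> (carrier II) (carrier (mat_fun n (C0X XS)))"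
proof -
 obtain mk :: "nat => nat" and ak :: "nat => int" where ak: "!!k. 0 < ak k" "!!k. ak k < P (mk k)"
  and ex: "!!x. [|x : ZZ; x ~= (%m. 0)|] ==> EX k. EX i<n. act (n - i) x (mk k) = ak k"
  and un: "!!x k k' i i'. [|x : ZZ; i < n; i' < n; act (n - i) x (mk k) = ak k; act (n - i') x (mk k') = ak k'|] ==> k = k' & i = i'"
  and lim: "!!m. EX K. ALL k>=K. m <= mk k & P m dvd ak k" by (rule fundamental_domain) blast
 interpret C0: fun_alg "C0X XS" by (rule C0X_fun_alg[OF XS_compact])
 let ?D = "mat_fun n (C0X XS)"
 define fund where "fund k = ball (mk k) (ak k)" for k
 have fund_ZZ: "fund k y : ZZ" if "y : ZZ" for k y unfolding fund_def by (rule ball_ZZ[OF that])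
 have fund_coord: "fund k y (mk k) = ak k" for k y unfolding fund_def using ak[of k] by (intro ball_coord) simp_all
 \<comment> \<open>The full matrix at a point of a ball is kept: it encodes the first columns at all
   n translates of that point.\<close>
 define T :: "_ => nat \<times> (nat => int) \<times> complex => nat => nat => complex" where
  "T F = (%(k, y, z) i j. if y : ZZ & z : S then F (fund k y, z) i j else 0)" for F
 have T_cl: "T F : carrier ?D" if F: "F : carrier DM" and F0: "!!z i j. F (%m. 0, z) i j = 0" for F
  unfolding mat_fun_carrier
 proof (intro conjI allI impI)
  fix i j
  have Fc: "continuous_on XS (%w. F w i j)" using CX.mf_entry[OF F] by (simp add: cfun_iff)
  show "(%w. T F w i j) : C0X XS"
   unfolding C0X_def
  proof (intro CollectI conjI allI impI)
   fix k
   have "continuous_on XS (%w. (fund k (fst w), snd w))"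
    unfolding fund_def
    by (intro continuous_on_Pair continuous_on_snd continuous_on_id continuous_on_compose2[OF ball_continuous[of UNIV] continuous_on_fst])
     auto
   then have "continuous_on XS (%w. F (fund k (fst w), snd w) i j)"
    by (rule continuous_on_compose2[OF Fc]) (auto simp: XS_def fund_ZZ)
   from cfun_restrict[OF this] show "(%w. T F (k, w) i j) : cfun XS"
    by (rule back_subst[of "%f. f : cfun XS"]) (auto simp: T_def XS_def)
  next
   fix e :: real assume e: "0 < e"
   have "uniformly_continuous_on XS (%w. F w i j)" by (rule compact_uniformly_continuous[OF Fc XS_compact])
   then obtain \<delta> where \<delta>: "0 < \<delta>" "!!w w'. [|w : XS; w' : XS; dist w' w < \<delta>|] ==> dist (F w' i j) (F w i j) < e"
    using e unfolding uniformly_continuous_on_def by meson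
   \<comment> \<open>Agreement with 0 modulo p^m puts a point within \<delta> of 0, and all points
     of the balls of large index have this property.\<close>
   obtain m where m: "!!x y. [|x : ZZ; y : ZZ; x m = y m|] ==> dist x y < \<delta>" using ZZ_dist[OF \<delta>(1)] by blast
   obtain K where K: "!!k. k >= K ==> m <= mk k & P m dvd ak k" using lim by blast
   have "cmod (T F (k, y, z) i j) < e" if k: "k >= K" for k y z
   proof (cases "y : ZZ & z : S")
    case True
    have "P m dvd ak k + P (mk k) * y m" using K[OF k] P_dvd[of m "mk k"] by simp
    then have "fund k y m = 0" by (simp add: fund_def ball_def)
    then have "dist (fund k y) (%m. 0) < \<delta>" using m[OF fund_ZZ zero_ZZ] True by simp
    then have "dist (F (fund k y, z) i j) (F (%m. 0, z) i j) < e"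
     using True by (intro \<delta>(2)) (auto simp: XS_def zero_ZZ fund_ZZ dist_Pair_Pair)
    then show ?thesis using True F0 by (simp add: T_def)
   qed (use e in "auto simp: T_def")
   then show "EX K. ALL k>=K. ALL w. cmod (T F (k, w) i j) < e" by auto
  qed
 qed (use F in "auto simp: T_def mat_fun_carrier")
 define \<Theta> where "\<Theta> a = T (\<psi> a)" for a
 have hom: "star_hom II ?D \<Theta>"
 proof -
  have "\<Theta> a : carrier ?D" if "a : carrier II" for a
   unfolding \<Theta>_def using that star_homD(1)[OF \<psi>_hom] by (intro T_cl) (simp_all add: II_carrier)
  moreover have "T (alg_add DM F G) = alg_add ?D (T F) (T G)" "T (alg_scale DM c F) = alg_scale ?D c (T F)"
   "T (alg_mult DM F G) = alg_mult ?D (T F) (T G)" "T (alg_star DM F) = alg_star ?D (T F)" for F G c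
   by (intro HOL.ext; auto simp: T_def mat_fun_simps split_beta)+
  ultimately show ?thesis by (simp add: star_hom_def \<Theta>_def II_simps II_carrier star_homD(2-5)[OF \<psi>_hom])
 qed
 have inj: "inj_on \<Theta> (carrier II)"
 proof (rule inj_onI)
  fix a a' assume a: "a : carrier II" "a' : carrier II" and eq: "\<Theta> a = \<Theta> a'"
  let ?F = "\<psi> a" and ?G = "\<psi> a'"
  have aA: "a : carrier \<A>" "a' : carrier \<A>" using a by (simp_all add: II_carrier)
  have Fc: "covariant ?F" "covariant ?G" and FD: "?F : carrier DM" "?G : carrier DM"
   using \<psi>_image aA by (auto simp: KK_def)
  have col: "?F (x, z) j 0 = ?G (x, z) j 0" if x: "x : ZZ" and z: "z : S" and j: "j < n" for x z j
  proof (cases "x = (%m. 0)")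
   case True then show ?thesis using a by (simp add: II_carrier)
  next
   case False
   then obtain k i where i: "i < n" "act (n - i) x (mk k) = ak k" using ex[OF x] by blast
   let ?y = "act (n - i) x"
   have y: "?y : ZZ" "act i ?y = x" using x i(1) act_cancel(1)[OF x, of i] by (simp_all add: act_ZZ)
   have "fund k (unball (mk k) ?y) = ?y" unfolding fund_def by (rule ball_unball[OF y(1) i(2)])
   moreover have "\<Theta> a (k, unball (mk k) ?y, z) = \<Theta> a' (k, unball (mk k) ?y, z)" using eq by simp
   ultimately have e: "?F (?y, z) = ?G (?y, z)" using z unball_ZZ[OF y(1)] by (simp add: \<Theta>_def T_def)
   \<comment> \<open>x is the translate of \<open>?y\<close> by r^i, so its first column is column i
     at \<open>?y\<close>: entry j sits in row j + i, or, on overflow, in row j + i - n with a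
     factor z.\<close>
   show ?thesis
   proof (cases "j + i < n")
    case True
    show ?thesis using covariantD[OF Fc(1) y(1) z True i(1)] covariantD[OF Fc(2) y(1) z True i(1)] e y(2) by simp
   next
    case False
    then have l: "j + i - n < n" "~ i <= j + i - n" "n + (j + i - n) - i = j" using j i(1) by linarith+
    have "z ~= 0" using S_props(1)[OF z] by auto
    then show ?thesis using covariantD[OF Fc(1) y(1) z l(1) i(1)] covariantD[OF Fc(2) y(1) z l(1) i(1)] l(2,3) e y(2) by simp
   qed
  qed
  have "?F w i k = ?G w i k" for w i k
  proof (cases "w : XS & i < n & k < n")
   case True
   then obtain x z where w: "w = (x, z)" "x : ZZ" "z : S" and ik: "i < n" "k < n" by (auto simp: XS_def)
   show ?thesis
    using covariantD[OF Fc(1) w(2,3) ik] covariantD[OF Fc(2) w(2,3) ik] ik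
     col[OF act_ZZ[OF w(2), of k] w(3), of "i - k"] col[OF act_ZZ[OF w(2), of k] w(3), of "n + i - k"] w(1) by auto
  next
   case False then show ?thesis using DM_zero[OF FD(1) False] DM_zero[OF FD(2) False] by simp
  qed
  then have "?F = ?G" by (intro HOL.ext)
  then show "a = a'" using aA by (rule \<A>_eqI)
 qed
 have surj: "H : \<Theta> ` carrier II" if H: "H : carrier ?D" for H
 proof -
  have Hk: "continuous_on XS (%w. H (k, w) i j)" "!!w. w ~: XS ==> H (k, w) i j = 0" for k i j
   using C0.mf_entry[OF H, of i j] by (auto simp: C0X_def cfun_iff)
  \<comment> \<open>The first column that H prescribes at a point x whose translate lies in ball k,
    by inverting the covariance rule; \<open>cnj z\<close> is the inverse of z.\<close>
  define h where "h k i j x z = (if j + i < n then H (k, unball (mk k) (act (n - i) x), z) (j + i) i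
   else cnj z * H (k, unball (mk k) (act (n - i) x), z) (j + i - n) i)" for k i j x z
  \<comment> \<open>A ball is determined by one coordinate and hence open and closed, so cutting off
    outside the translated ball preserves continuity.\<close>
  define g where "g k i j w = (if act (n - i) (fst w) (mk k) = ak k then 1 else 0) * h k i j (fst w) (snd w)" for k i j w
  have g_cont: "continuous_on XS (g k i j)" for k i j
  proof -
   have u: "continuous_on XS (%w. act (n - i) (fst w))"
    by (rule continuous_on_compose2[OF act_continuous[of UNIV] continuous_on_fst[OF continuous_on_id]]) auto
   have "continuous_on XS (%w. (unball (mk k) (act (n - i) (fst w)), snd w))"
    by (intro continuous_on_Pair continuous_on_snd continuous_on_id continuous_on_compose2[OF unball_continuous[of UNIV] u]) auto
   then have H': "continuous_on XS (%w. H (k, unball (mk k) (act (n - i) (fst w)), snd w) l i)" for l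
    by (rule continuous_on_compose2[OF Hk(1)]) (auto simp: XS_def unball_ZZ act_ZZ)
   have "continuous_on XS (%w. h k i j (fst w) (snd w))"
    unfolding h_def
    by (cases "j + i < n") (simp_all add: H' continuous_on_mult continuous_on_cnj continuous_on_snd continuous_on_id)
   moreover have "continuous_on XS (%w. if act (n - i) (fst w) (mk k) = ak k then 1 else 0 :: complex)"
    by (rule continuous_on_compose2[OF int_coord_continuous[of UNIV "%l. if l = ak k then 1 else 0" "mk k"] u]) simp
   ultimately show ?thesis unfolding g_def by (intro continuous_on_mult)
  qed
  \<comment> \<open>Locates a nonzero point: the index of its ball and the power of r that carries
    the ball to the point.\<close>
  define \<kappa> where "\<kappa> x = (SOME ki. snd ki < n & act (n - snd ki) x (mk (fst ki)) = ak (fst ki))" for x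
  define col where "col j w = (if fst w ~= (%m. 0) then g (fst (\<kappa> (fst w))) (snd (\<kappa> (fst w))) j w else 0)" for j w
  have \<kappa>: "snd (\<kappa> x) < n & act (n - snd (\<kappa> x)) x (mk (fst (\<kappa> x))) = ak (fst (\<kappa> x))"
   if "x : ZZ" "x ~= (%m. 0)" for x
  proof -
   have "EX ki. snd ki < n & act (n - snd ki) x (mk (fst ki)) = ak (fst ki)" using ex[OF that] by auto
   then show ?thesis unfolding \<kappa>_def by (rule someI_ex)
  qed
  have g0: "g k i j (%m. 0, z) = 0" for k i j z using ak(1)[of k] by (simp add: g_def act_zero)
  have g_other: "g k i j (x, z) = 0" if x: "x : ZZ" "x ~= (%m. 0)" and i: "i < n" and ne: "~ (k = fst (\<kappa> x) & i = snd (\<kappa> x))" for k i j x z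
   using un[OF x(1) i _ _ conjunct2[OF \<kappa>[OF x]]] \<kappa>[OF x] ne by (auto simp: g_def)
  have col_eq: "col j (x, z) = h k i j x z"
   if x: "x : ZZ" and i: "i < n" and eq: "act (n - i) x (mk k) = ak k" for j x z k i
  proof -
   have "x ~= (%m. 0)" using eq ak(1)[of k] act_zero[of "n - i"] by (metis less_irrefl)
   moreover have "k = fst (\<kappa> x) & i = snd (\<kappa> x)" using un[OF x i _ eq] \<kappa>[OF x calculation] by blast
   ultimately show ?thesis using eq by (simp add: col_def g_def)
  qed
  \<comment> \<open>The column is a uniform limit of finite sums of the continuous pieces g, the
    remainder being small by the decay of H. This settles continuity at 0, where the balls
    accumulate.\<close>
  have col_cont: "continuous_on XS (col j)" if j: "j < n" for j
  proof (rule continuous_on_if_uniformly_approx)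
   fix e :: real assume e: "0 < e"
   have "ALL c. EX K. ALL k>=K. ALL w. cmod (H (k, w) (fst c) (snd c)) < e"
    using C0X_decay[OF C0.mf_entry[OF H] e] by blast
   from choice[OF this] obtain K where K: "!!c k w. k >= K c ==> cmod (H (k, w) (fst c) (snd c)) < e" by blast
   define K0 where "K0 = (SUM c:{..<n} \<times> {..<n}. K c)"
   have KK: "cmod (H (k, w) i l) < e" if "k >= K0" "i < n" "l < n" for k w i l
    using K[of "(i, l)" k w] member_le_sum[of "(i, l)" "{..<n} \<times> {..<n}" K] that by (auto simp: K0_def)
   have "cmod (col j w - (\<Sum>k<K0. \<Sum>i<n. g k i j w)) <= e" if w: "w : XS" for w
   proof -
    obtain x z where xz: "w = (x, z)" "x : ZZ" "z : S" using w by (auto simp: XS_def)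
    show ?thesis
    proof (cases "x = (%m. 0)")
     case True then show ?thesis using e by (simp add: xz(1) col_def g0)
    next
     case False
     let ?k = "fst (\<kappa> x)" and ?i = "snd (\<kappa> x)"
     note kx = \<kappa>[OF xz(2) False]
     have "(\<Sum>i<n. g k i j w) = (if k = ?k then g ?k ?i j w else 0)" for k
     proof -
      have "(\<Sum>i<n. g k i j w) = (\<Sum>i<n. if i = ?i then (if k = ?k then g ?k ?i j w else 0) else 0)"
       using g_other[OF xz(2) False] by (intro sum.cong) (auto simp: xz(1))
      then show ?thesis using kx by simp
     qed
     then have sum: "(\<Sum>k<K0. \<Sum>i<n. g k i j w) = (if ?k < K0 then g ?k ?i j w else 0)" by simp
     have "cmod (h ?k ?i j x z) <= e" if k: "K0 <= ?k"
      using KK[OF k, of "j + ?i" ?i] KK[OF k, of "j + ?i - n" ?i] kx j S_props(1)[OF xz(3)]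
      by (auto simp: h_def norm_mult less_imp_le)
     then show ?thesis unfolding sum using False kx e by (auto simp: col_def xz(1) g_def)
    qed
   qed
   moreover have "continuous_on XS (%w. \<Sum>k<K0. \<Sum>i<n. g k i j w)" by (intro continuous_on_sum g_cont)
   ultimately show "EX f. continuous_on XS f & (ALL w:XS. cmod (col j w - f w) <= e)" by blast
  qed
  \<comment> \<open>The remaining columns are forced by covariance.\<close>
  define F where "F = (%w i k. if w : XS & i < n & k < n
   then (if k <= i then col (i - k) (act k (fst w), snd w) else snd w * col (n + i - k) (act k (fst w), snd w)) else 0)"
  have FD: "F : carrier DM"
   unfolding mat_fun_carrier
  proof (intro conjI allI impI)
   fix i k
   have "continuous_on XS (%w. act k (fst w))"
    by (rule continuous_on_compose2[OF act_continuous[of UNIV] continuous_on_fst[OF continuous_on_id]]) auto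
   then have "continuous_on XS (%w. (act k (fst w), snd w))"
    by (intro continuous_on_Pair continuous_on_snd continuous_on_id)
   then have c: "continuous_on XS (%w. col j (act k (fst w), snd w))" if "j < n" for j
    by (rule continuous_on_compose2[OF col_cont[OF that]]) (auto simp: XS_def act_ZZ)
   have "continuous_on XS (%w. if k <= i then col (i - k) (act k (fst w), snd w) else snd w * col (n + i - k) (act k (fst w), snd w))"
    if "i < n" "k < n"
    using that c[of "i - k"] c[of "n + i - k"]
    by (cases "k <= i") (simp_all add: continuous_on_mult continuous_on_snd continuous_on_id)
   from cfun_restrict[OF this] CX.f_zero show "(%w. F w i k) : cfun XS"
    unfolding F_def by (cases "i < n & k < n") auto
  qed (auto simp: F_def)
  have "covariant F"
   unfolding covariant_def
  proof (intro ballI allI impI)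
   fix x z i k assume x: "x : ZZ" and z: "z : S" and i: "i < n" and k: "k < n"
   then have "n + i - k < n" if "~ k <= i" using that by linarith
   then show "F (x, z) i k = (if k <= i then F (act k x, z) (i - k) 0 else z * F (act k x, z) (n + i - k) 0)"
    using x z i k by (simp add: F_def XS_def act_ZZ act_0 less_imp_diff_less)
  qed
  then have "F : \<psi> ` carrier \<A>" using FD by (simp add: \<psi>_image KK_def)
  then obtain a where a: "a : carrier \<A>" "\<psi> a = F" by blast
  have "F (%m. 0, z) i k = 0" for z i k by (simp add: F_def act_zero col_def)
  then have aI: "a : carrier II" using a by (simp add: II_carrier)
  have "T F (k, y, z) i j = H (k, y, z) i j" for k y z i j
  proof (cases "y : ZZ & z : S & i < n & j < n")
   case True
   then have y: "y : ZZ" and z: "z : S" and i: "i < n" and j: "j < n" by simp_all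
   let ?x = "act j (fund k y)"
   have x: "?x : ZZ" "act (n - j) ?x = fund k y" using act_cancel(2)[OF fund_ZZ[OF y], of j k] j y by (simp_all add: act_ZZ fund_ZZ)
   have ub: "unball (mk k) (fund k y) = y" unfolding fund_def using ak[of k] by (intro unball_ball[OF y]) simp_all
   have c: "col l (?x, z) = h k j l ?x z" for l by (rule col_eq[OF x(1) j]) (simp add: x(2) fund_coord)
   have zz: "z * cnj z = 1" using S_props(1)[OF z] complex_norm_square[of z] by simp
   have "F (fund k y, z) i j = H (k, y, z) i j"
   proof (cases "j <= i")
    case True
    then show ?thesis using y z i j by (simp add: F_def XS_def fund_ZZ c h_def x(2) ub)
   next
    case False
    then have "n + i - j + j = n + i" using j by linarith
    then show ?thesis using False y z i j zz by (simp add: F_def XS_def fund_ZZ c h_def x(2) ub mult.assoc[symmetric])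
   qed
   then show ?thesis using y z by (simp add: T_def)
  next
   case False
   have "H (k, y, z) i j = 0"
   proof (cases "y : ZZ & z : S")
    case True
    then have "n <= i \<or> n <= j" using False by linarith
    then show ?thesis using H unfolding mat_fun_carrier by blast
   next
    case False then show ?thesis by (intro Hk(2)) (simp add: XS_def)
   qed
   moreover have "T F (k, y, z) i j = 0" using False by (auto simp: T_def F_def)
   ultimately show ?thesis by simp
  qed
  then have "\<Theta> a = H" unfolding \<Theta>_def a(2) by (intro HOL.ext) auto
  then show ?thesis using aI by blast
 qed
 have "\<Theta> ` carrier II = carrier ?D" using surj star_homD(1)[OF hom] by blast
 then show ?thesis using hom inj by (auto simp: bij_betw_def)
qed

section \<open>Identification with the ideals of the statement\<close>

lemma cst_gen: "cst (delta [(g, False)]) = universal_gen (gens p) R g"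
 by (simp add: universal_gen_def to_envelope_def FA_eq free_gen_def cst_def)

lemma the_pi: "(THE \<pi>. is_pi \<pi>) = \<pi>" by (rule the_equality[where P = is_pi, OF is_pi_\<pi> is_pi_unique])

end

context padic_root
begin

lemma I'_alg_eq: "I'_alg p r = crossed.II p r True"
proof -
 interpret crossed p r True by unfold_locales
 have R: "R = A'_rels p r" and mm: "mm = int n" by (simp_all add: R_def mm_def)
 have Idx: "Idx = {0..<int n}" using ord_props(1) by (auto simp: Idx_def mm) (metis pos_mod_sign pos_mod_bound of_nat_0_less_iff)+
 have A: "A'_alg p r = \<A>" by (simp add: A'_alg_def universal_cstar_def FA_eq R)
 have "pi0' p r = (THE \<pi>. is_pi \<pi>)"
  by (simp only: pi0'_def is_pi_def cst_gen Let_def A R mm Idx Zp_simps(3))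
 then have "pi0' p r = \<pi>" unfolding the_pi .
 then show ?thesis by (simp add: I'_alg_def II_def A Idx)
qed

lemma I_alg_eq: "I_alg p r = crossed.II p r False"
proof -
 interpret crossed p r False by unfold_locales
 have R: "R = A_rels p r" and mm: "mm = 0" by (simp_all add: R_def mm_def)
 have Idx: "Idx = UNIV" by (simp add: Idx_def mm)
 have A: "A_alg p r = \<A>" by (simp add: A_alg_def universal_cstar_def FA_eq R)
 have "pi0 p r = (THE \<pi>. is_pi \<pi>)"
  by (simp add: pi0_def is_pi_def cst_gen Let_def A R mm Idx Zp_simps(3))
 then have "pi0 p r = \<pi>" unfolding the_pi .
 then show ?thesis by (simp add: I_alg_def II_def A Idx)
qed

text \<open>Each of the four algebras is identified with matrices over null sequences of functions,
  on Z_p times a point or on Z_p times the circle; both isomorphisms compose two identifications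
  with the same model.\<close>

theorem ideal_isomorphisms:
 "I'_alg p r \<cong>\<^sub>C matrix_alg n \<otimes>\<^sub>C c0_alg \<otimes>\<^sub>C C_Zp p & I_alg p r \<cong>\<^sub>C I'_alg p r \<otimes>\<^sub>C C_S1"
proof
 interpret F: crossed p r True by unfold_locales
 interpret G: crossed p r False by unfold_locales
 have SF: "F.XS = ZZ \<times> pt" and SG: "G.XS = ZZ \<times> sphere (0 :: complex) 1" by (simp_all add: F.XS_def F.S_def G.XS_def G.S_def)
 obtain \<Theta>' where \<Theta>': "star_hom (I'_alg p r) (mat_fun n (C0X (ZZ \<times> pt))) \<Theta>'"
  "bij_betw \<Theta>' (carrier (I'_alg p r)) (carrier (mat_fun n (C0X (ZZ \<times> pt))))"
  using F.kernel_iso unfolding I'_alg_eq SF by blast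
 obtain \<Theta> where \<Theta>: "star_hom (I_alg p r) (mat_fun n (C0X (ZZ \<times> sphere (0 :: complex) 1))) \<Theta>"
  "bij_betw \<Theta> (carrier (I_alg p r)) (carrier (mat_fun n (C0X (ZZ \<times> sphere (0 :: complex) 1))))"
  using G.kernel_iso unfolding I_alg_eq SG by blast
 have cI': "cstar_algebra (I'_alg p r)" and cI: "cstar_algebra (I_alg p r)"
  unfolding I'_alg_eq I_alg_eq by (rule F.II_cstar G.II_cstar)+
 interpret T1: matrix_c0 n
  by (intro matrix_c0.intro tensor_pair.intro matrix_alg_star_algebra c0_alg_star_algebra)
 have T1: "cstar_algebra (matrix_alg n \<otimes>\<^sub>C c0_alg)" unfolding cstar_tensor_def by (rule T1.matrix_c0_iso(1))
 obtain \<Theta>1 where \<Theta>1: "star_hom (matrix_alg n \<otimes>\<^sub>C c0_alg) (mat_fun n (C0X pt)) \<Theta>1"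
  "bij_betw \<Theta>1 (carrier (matrix_alg n \<otimes>\<^sub>C c0_alg)) (carrier (mat_fun n (C0X pt)))"
  using T1.matrix_c0_iso(2) unfolding cstar_tensor_def by blast
 \<comment> \<open>c_0 already supplies the layers over a point; the second factor adds the
   coordinate in Z_p, so the projections are \<open>snd\<close> and \<open>fst\<close>.\<close>
 interpret T2: tensor_model "matrix_alg n \<otimes>\<^sub>C c0_alg" ZZ "%m k x. if x : ZZ & x m = k then 1 else 0"
  "%m d. {-1..<P m}" "%m. real (p ^ m + 1)" pt "ZZ \<times> pt" snd fst n \<Theta>1
 proof (intro tensor_model.intro tensor_pair.intro cont_alg_star_algebra ZZ_approximating_system tensor_model_axioms.intro
   ZZ_compact compact_Times \<Theta>1)
  show "star_algebra (matrix_alg n \<otimes>\<^sub>C c0_alg)" using T1 by (simp add: cstar_algebra_def)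
  show "bij_betw (%w. (snd w, fst w)) (ZZ \<times> pt) (pt \<times> ZZ)" by (auto simp: bij_betw_def inj_on_def image_iff)
 qed (auto intro!: continuous_on_fst continuous_on_snd continuous_on_id)
 obtain \<psi>2 where \<psi>2: "star_hom (matrix_alg n \<otimes>\<^sub>C c0_alg \<otimes>\<^sub>C C_Zp p) (mat_fun n (C0X (ZZ \<times> pt))) \<psi>2"
  "bij_betw \<psi>2 (carrier (matrix_alg n \<otimes>\<^sub>C c0_alg \<otimes>\<^sub>C C_Zp p)) (carrier (mat_fun n (C0X (ZZ \<times> pt))))"
  using T2.tensor_iso(2) unfolding cstar_tensor_def[of "matrix_alg n \<otimes>\<^sub>C c0_alg"] by blast
 show "I'_alg p r \<cong>\<^sub>C matrix_alg n \<otimes>\<^sub>C c0_alg \<otimes>\<^sub>C C_Zp p"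
 proof (rule cstar_isomorphic_via[OF cI' _ _ \<Theta>' \<psi>2])
  show "cstar_algebra (matrix_alg n \<otimes>\<^sub>C c0_alg \<otimes>\<^sub>C C_Zp p)"
   unfolding cstar_tensor_def[of "matrix_alg n \<otimes>\<^sub>C c0_alg"] by (rule T2.tensor_iso(1))
  show "star_algebra (mat_fun n (C0X (ZZ \<times> pt)))" by (rule T2.C'.mf_star_algebra)
 qed
 \<comment> \<open>The first factor is the ideal I' in its model over Z_p times a point. The product
   with the circle omits that point, and the first projection restores it as the constant 1.\<close>
 interpret T3: tensor_model "I'_alg p r" "sphere 0 1 :: complex set" "%m k z. if cmod z = 1 then z powi k else 0"
  "%m d. {- int (m * d) .. int (m * d)}" "%m. 2 * real m + 1" "ZZ \<times> pt" "ZZ \<times> sphere (0 :: complex) 1" "%w. (fst w, 1)" snd n \<Theta>'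
 proof (intro tensor_model.intro tensor_pair.intro cont_alg_star_algebra circle_system tensor_model_axioms.intro
   ZZ_compact compact_Times compact_sphere \<Theta>')
  show "star_algebra (I'_alg p r)" using cI' by (simp add: cstar_algebra_def)
  show "bij_betw (%w. ((fst w, 1), snd w)) (ZZ \<times> sphere (0 :: complex) 1) ((ZZ \<times> pt) \<times> sphere 0 1)"
   by (auto simp: bij_betw_def inj_on_def image_iff)
 qed (auto intro!: continuous_on_fst continuous_on_snd continuous_on_id continuous_on_Pair continuous_on_const)
 obtain \<psi>3 where \<psi>3: "star_hom (I'_alg p r \<otimes>\<^sub>C C_S1) (mat_fun n (C0X (ZZ \<times> sphere (0 :: complex) 1))) \<psi>3"
  "bij_betw \<psi>3 (carrier (I'_alg p r \<otimes>\<^sub>C C_S1)) (carrier (mat_fun n (C0X (ZZ \<times> sphere (0 :: complex) 1))))"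
  using T3.tensor_iso(2) unfolding cstar_tensor_def by blast
 show "I_alg p r \<cong>\<^sub>C I'_alg p r \<otimes>\<^sub>C C_S1"
 proof (rule cstar_isomorphic_via[OF cI _ _ \<Theta> \<psi>3])
  show "cstar_algebra (I'_alg p r \<otimes>\<^sub>C C_S1)" unfolding cstar_tensor_def by (rule T3.tensor_iso(1))
  show "star_algebra (mat_fun n (C0X (ZZ \<times> sphere (0 :: complex) 1)))" by (rule T3.C'.mf_star_algebra)
 qed
qed

end

theorem proposition6p3:
  fixes p :: nat and r :: "nat \<Rightarrow> int"
  assumes "prime p" and "odd p"
    and "r \<in> Units (Zp p)" and "r \<noteq> \<one>\<^bsub>Zp p\<^esub>" and "root_of_unity p r"
  shows "I'_alg p r \<cong>\<^sub>C matrix_alg (ord_Zp p r) \<otimes>\<^sub>C c0_alg \<otimes>\<^sub>C C_Zp p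
    \<and> I_alg p r \<cong>\<^sub>C I'_alg p r \<otimes>\<^sub>C C_S1"
proof -
  interpret padic_root p r by unfold_locales (use assms in auto)
  show ?thesis by (rule ideal_isomorphisms)
qed

end
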